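(* Let $n\ge 5$, $N\ge 2$ and let $F:\mathbb{R}^n\times\big(\mathbb{R}^N\otimes\mathbb{S}(n)\big)\to\mathbb{R}^N$ be a Carathéodory map which satisfies the K-Condition on $\Omega=\mathbb{R}^n$ and $F(\cdot,\mathbf{0})=0$. Then there is a constant $C>0$ depending only on $F$, $n$ and $N$ such that the following hold. (i) For any $f\in L^2(\mathbb{R}^n)^N$, the system $$F(\cdot,D^2u)=f\quad\text{a.e. on }\mathbb{R}^n$$ has a unique global strong a.e. solution $u$ in the space $W^{2,2}_\ast(\mathbb{R}^n)^N$, and this solution satisfies $$\|u\|_{L^{2^{**}}(\mathbb{R}^n)}+\|Du\|_{L^{2^{*}}(\mathbb{R}^n)}+\|D^2u\|_{L^{2}(\mathbb{R}^n)}\le C\|f\|_{L^2(\mathbb{R}^n)}.$$ (ii) For any two maps $w,v\in W^{2,2}_\ast(\mathbb{R}^n)^N$, $$\|w-v\|_{W^{2,2}_\ast(\mathbb{R}^n)}\le C\,\big\|F(\cdot,D^2w)-F(\cdot,D^2v)\big\|_{L^2(\mathbb{R}^n)}.$$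
   Context: Notation. $\mathbb{S}(n)$ is the space of symmetric real $n\times n$ matrices; elements of $\mathbb{R}^N\otimes\mathbb{S}(n)$ are arrays $\mathbf{X}=(\mathbf{X}_{\alpha ij})$, $1\le\alpha\le N$, $1\le i,j\le n$, symmetric in $i,j$. All norms $|\cdot|$ are Euclidean, e.g. $|\mathbf{X}|^2=\mathbf{X}_{\alpha ij}\mathbf{X}_{\alpha ij}$; repeated indices are summed. $D^2u=(D^2_{ij}u_\alpha)$ is the (weak) Hessian of $u$. Carathéodory map: $x\mapsto F(x,\mathbf{X})$ is measurable for every $\mathbf{X}$ and $\mathbf{X}\mapsto F(x,\mathbf{X})$ is continuous for a.e. $x$. $\mathbb{S}(N\times n)$ is the set of real tensors $\mathbf{A}=(\mathbf{A}_{\alpha\beta ij})$ with $1\le\alpha,\beta\le N$, $1\le i,j\le n$ and $\mathbf{A}_{\alpha\beta ij}=\mathbf{A}_{\beta\alpha ji}$. For $\mathbf{Z}\in\mathbb{R}^N\otimes\mathbb{S}(n)$, $\mathbf{A}:\mathbf{Z}\in\mathbb{R}^N$ is the vector with components $(\mathbf{A}:\mathbf{Z})_\alpha=\mathbf{A}_{\alpha\beta ij}\mathbf{Z}_{\beta ij}$. The ellipticity constant is $$\nu(\mathbf{A}):=\min\{\mathbf{A}_{\alpha\beta ij}\eta_\alpha a_i\eta_\beta a_j:\ \eta\in\mathbb{R}^N,\ a\in\mathbb{R}^n,\ |\eta|=|a|=1\},$$ and $\mathbf{A}$ is called rank-one positive if $\nu(\mathbf{A})>0$. K-Condition on an open set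 $\Omega\subseteq\mathbb{R}^n$: there exist a rank-one positive $\mathbf{A}\in\mathbb{S}(N\times n)$, a function $\alpha\in L^\infty(\Omega)$ with $\alpha>0$ a.e. on $\Omega$ and $1/\alpha\in L^\infty(\Omega)$, and constants $\beta,\gamma>0$ with $\beta+\gamma<1$ such that $$\Big|\mathbf{A}:\mathbf{Z}-\alpha(x)\big(F(x,\mathbf{X}+\mathbf{Z})-F(x,\mathbf{X})\big)\Big|^2\le\beta\,\nu(\mathbf{A})^2|\mathbf{Z}|^2+\gamma\,|\mathbf{A}:\mathbf{Z}|^2$$ for all $\mathbf{X},\mathbf{Z}\in\mathbb{R}^N\otimes\mathbb{S}(n)$ and a.e. $x\in\Omega$. Function space: with $2^*=\frac{2n}{n-2}$ and $2^{**}=\frac{2n}{n-4}$, $$W^{2,2}_\ast(\mathbb{R}^n)^N:=\big\{u\in L^{2^{**}}(\mathbb{R}^n)^N\ \big|\ Du\in L^{2^*}(\mathbb{R}^n)^{Nn},\ D^2u\in L^2(\mathbb{R}^n)^{Nn^2}\big\}$$ (weak derivatives), with norm $\|u\|_{W^{2,2}_\ast(\mathbb{R}^n)}:=\|u\|_{L^{2^{**}}(\mathbb{R}^n)}+\|Du\|_{L^{2^*}(\mathbb{R}^n)}+\|D^2u\|_{L^2(\mathbb{R}^n)}$. *)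

theory Defs
  imports "HOL-Analysis.Analysis"
begin

section \<open>Tensors and ellipticity\<close>

(* An element X of R^N (x) S(n) is rendered as X :: real^'n^'n^'N with components
   X $ \<alpha> $ i $ j; the library norm of this type is exactly the Euclidean norm of the array. *)

definition sym_tensors :: "(real^'n^'n^'N) set" where
  "sym_tensors = {X. \<forall>\<alpha> i j. X $ \<alpha> $ i $ j = X $ \<alpha> $ j $ i}"

(* Fourth-order tensors A with components A $ \<alpha> $ \<beta> $ i $ j; note that both index pairs
   are swapped simultaneously. *)

definition sym_tensors4 :: "(real^'n^'n^'N^'N) set" where
  "sym_tensors4 = {A. \<forall>\<alpha> \<beta> i j. A $ \<alpha> $ \<beta> $ i $ j = A $ \<beta> $ \<alpha> $ j $ i}"

definition contract :: "real^'n^'n^'N^'N \<Rightarrow> real^'n^'n^'N \<Rightarrow> real^'N" where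
  "contract A Z = (\<chi> \<alpha>. \<Sum>\<beta>\<in>UNIV. \<Sum>i\<in>UNIV. \<Sum>j\<in>UNIV. A $ \<alpha> $ \<beta> $ i $ j * Z $ \<beta> $ i $ j)"

definition rank_one_form :: "real^'n^'n^'N^'N \<Rightarrow> real^'N \<Rightarrow> real^'n \<Rightarrow> real" where
  "rank_one_form A \<eta> a =
     (\<Sum>\<alpha>\<in>UNIV. \<Sum>\<beta>\<in>UNIV. \<Sum>i\<in>UNIV. \<Sum>j\<in>UNIV.
        A $ \<alpha> $ \<beta> $ i $ j * \<eta> $ \<alpha> * a $ i * \<eta> $ \<beta> * a $ j)"

(* The infimum is a minimum, see ellipticity_attained. *)

definition ellipticity :: "real^'n^'n^'N^'N \<Rightarrow> real" where
  "ellipticity A = Inf {rank_one_form A \<eta> a | \<eta> a. norm \<eta> = 1 \<and> norm a = 1}"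

definition rank_one_positive :: "real^'n^'n^'N^'N \<Rightarrow> bool" where
  "rank_one_positive A \<longleftrightarrow> ellipticity A > 0"

lemma ellipticity_attained:
  fixes A :: "real^'n^'n^'N^'N"
  obtains \<eta> a where "norm \<eta> = 1" "norm a = 1" "ellipticity A = rank_one_form A \<eta> a"
    "\<And>\<eta>' a'. norm \<eta>' = 1 \<Longrightarrow> norm a' = 1 \<Longrightarrow> rank_one_form A \<eta> a \<le> rank_one_form A \<eta>' a'"
proof -
  let ?S = "sphere (0::real^'N) 1 \<times> sphere (0::real^'n) 1"
  have "compact ?S" by (intro compact_Times compact_sphere)
  moreover have "(axis undefined 1, axis undefined 1) \<in> ?S" by simp
  then have "?S \<noteq> {}" by blast
  moreover have "continuous_on ?S (\<lambda>p. rank_one_form A (fst p) (snd p))"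
    unfolding rank_one_form_def by (intro continuous_intros)
  ultimately obtain p where p: "p \<in> ?S"
    "\<And>q. q \<in> ?S \<Longrightarrow> rank_one_form A (fst p) (snd p) \<le> rank_one_form A (fst q) (snd q)"
    using continuous_attains_inf[of ?S "\<lambda>p. rank_one_form A (fst p) (snd p)"] by blast
  have n: "norm (fst p) = 1" "norm (snd p) = 1" using p(1) by (auto simp: mem_Times_iff)
  have le: "rank_one_form A (fst p) (snd p) \<le> rank_one_form A \<eta>' a'"
    if "norm \<eta>' = 1" "norm a' = 1" for \<eta>' a' using p(2)[of "(\<eta>', a')"] that by simp
  have "ellipticity A = rank_one_form A (fst p) (snd p)"
    unfolding ellipticity_def by (rule cInf_eq_minimum) (use n le in auto)
  with n le that show ?thesis by blast
qed


section \<open>Caratheodory maps and the K-Condition\<close>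

(* Maps F(x,X) are only ever constrained on symmetric X. Measurable means Lebesgue measurable. *)

definition caratheodory :: "(real^'n \<Rightarrow> real^'n^'n^'N \<Rightarrow> real^'N) \<Rightarrow> bool" where
  "caratheodory F \<longleftrightarrow>
     (\<forall>X\<in>sym_tensors. (\<lambda>x. F x X) \<in> borel_measurable lebesgue) \<and>
     (AE x in lebesgue. continuous_on sym_tensors (F x))"

definition Linf_on :: "(real^'n) set \<Rightarrow> (real^'n \<Rightarrow> real) set" where
  "Linf_on \<Omega> = {g. g \<in> borel_measurable (lebesgue_on \<Omega>) \<and>
                   (\<exists>M. AE x in lebesgue_on \<Omega>. \<bar>g x\<bar> \<le> M)}"

definition K_condition ::
  "(real^'n) set \<Rightarrow> (real^'n \<Rightarrow> real^'n^'n^'N \<Rightarrow> real^'N) \<Rightarrow> bool" where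
  "K_condition \<Omega> F \<longleftrightarrow>
     (\<exists>A \<alpha> \<beta> \<gamma>.
        A \<in> sym_tensors4 \<and> rank_one_positive A \<and>
        \<alpha> \<in> Linf_on \<Omega> \<and> (AE x in lebesgue_on \<Omega>. \<alpha> x > 0) \<and> (\<lambda>x. 1 / \<alpha> x) \<in> Linf_on \<Omega> \<and>
        \<beta> > 0 \<and> \<gamma> > 0 \<and> \<beta> + \<gamma> < 1 \<and>
        (\<forall>X\<in>sym_tensors. \<forall>Z\<in>sym_tensors. AE x in lebesgue_on \<Omega>.
           (norm (contract A Z - \<alpha> x *\<^sub>R (F x (X + Z) - F x X)))\<^sup>2
             \<le> \<beta> * (ellipticity A)\<^sup>2 * (norm Z)\<^sup>2 + \<gamma> * (norm (contract A Z))\<^sup>2))"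


section \<open>Lebesgue spaces\<close>

definition Lp :: "real \<Rightarrow> (real^'n \<Rightarrow> 'b::euclidean_space) set" where
  "Lp p = {g. g \<in> borel_measurable lebesgue \<and> integrable lebesgue (\<lambda>x. norm (g x) powr p)}"

definition Lp_norm :: "real \<Rightarrow> (real^'n \<Rightarrow> 'b::euclidean_space) \<Rightarrow> real" where
  "Lp_norm p g = (\<integral>x. norm (g x) powr p \<partial>lebesgue) powr (1 / p)"


section \<open>Weak derivatives\<close>

definition partial_deriv :: "'n \<Rightarrow> (real^'n \<Rightarrow> real) \<Rightarrow> real^'n \<Rightarrow> real" where
  "partial_deriv i \<phi> x = frechet_derivative \<phi> (at x) (axis i 1)"

primrec partial_derivs :: "'n list \<Rightarrow> (real^'n \<Rightarrow> real) \<Rightarrow> real^'n \<Rightarrow> real" where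
  "partial_derivs [] \<phi> = \<phi>"
| "partial_derivs (i # is) \<phi> = partial_deriv i (partial_derivs is \<phi>)"

(* Frechet differentiability of all iterated partial derivatives makes all of them
   continuous, hence is the same as being C^\<infinity>. *)

definition smooth :: "(real^'n \<Rightarrow> real) \<Rightarrow> bool" where
  "smooth \<phi> \<longleftrightarrow> (\<forall>is x. partial_derivs is \<phi> differentiable (at x))"

definition test_functions :: "(real^'n \<Rightarrow> real) set" where
  "test_functions = {\<phi>. smooth \<phi> \<and> compact (closure {x. \<phi> x \<noteq> 0})}"

definition L1_loc :: "(real^'n \<Rightarrow> real) set" where
  "L1_loc = {g. \<forall>K. compact K \<longrightarrow> set_integrable lebesgue K g}"

definition has_weak_deriv ::
  "'n list \<Rightarrow> (real^'n \<Rightarrow> real) \<Rightarrow> (real^'n \<Rightarrow> real) \<Rightarrow> bool" where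
  "has_weak_deriv is u g \<longleftrightarrow>
     u \<in> L1_loc \<and> g \<in> L1_loc \<and>
     (\<forall>\<phi>\<in>test_functions.
        (\<integral>x. u x * partial_derivs is \<phi> x \<partial>lebesgue) =
        (-1) ^ length is * (\<integral>x. g x * \<phi> x \<partial>lebesgue))"

definition has_weak_gradient :: "(real^'n \<Rightarrow> real^'N) \<Rightarrow> (real^'n \<Rightarrow> real^'n^'N) \<Rightarrow> bool" where
  "has_weak_gradient u G \<longleftrightarrow>
     (\<forall>\<alpha> i. has_weak_deriv [i] (\<lambda>x. u x $ \<alpha>) (\<lambda>x. G x $ \<alpha> $ i))"

definition has_weak_hessian :: "(real^'n \<Rightarrow> real^'N) \<Rightarrow> (real^'n \<Rightarrow> real^'n^'n^'N) \<Rightarrow> bool" where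
  "has_weak_hessian u H \<longleftrightarrow>
     (\<forall>\<alpha> i j. has_weak_deriv [i, j] (\<lambda>x. u x $ \<alpha>) (\<lambda>x. H x $ \<alpha> $ i $ j))"

(* Weak derivatives are unique up to null sets, and the Hessian is symmetric a.e.; the
   following pick a representative and are only meaningful if a weak derivative exists. *)

definition weak_gradient :: "(real^'n \<Rightarrow> real^'N) \<Rightarrow> real^'n \<Rightarrow> real^'n^'N" where
  "weak_gradient u = (SOME G. has_weak_gradient u G)"

definition weak_hessian :: "(real^'n \<Rightarrow> real^'N) \<Rightarrow> real^'n \<Rightarrow> real^'n^'n^'N" where
  "weak_hessian u = (SOME H. has_weak_hessian u H)"


section \<open>The function space and strong solutions\<close>

(* 2^* and 2^** for the dimension CARD('n) of the domain of the functions involved. *)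

definition crit_exp1 :: "nat \<Rightarrow> real" where
  "crit_exp1 n = 2 * real n / (real n - 2)"

definition crit_exp2 :: "nat \<Rightarrow> real" where
  "crit_exp2 n = 2 * real n / (real n - 4)"

definition W22_star :: "(real^'n \<Rightarrow> real^'N) set" where
  "W22_star = {u. u \<in> Lp (crit_exp2 CARD('n)) \<and>
     (\<exists>G. has_weak_gradient u G) \<and> weak_gradient u \<in> Lp (crit_exp1 CARD('n)) \<and>
     (\<exists>H. has_weak_hessian u H) \<and> weak_hessian u \<in> Lp 2}"

definition W22_star_norm :: "(real^'n \<Rightarrow> real^'N) \<Rightarrow> real" where
  "W22_star_norm u =
     Lp_norm (crit_exp2 CARD('n)) u + Lp_norm (crit_exp1 CARD('n)) (weak_gradient u)
       + Lp_norm 2 (weak_hessian u)"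

definition strong_solution ::
  "(real^'n \<Rightarrow> real^'n^'n^'N \<Rightarrow> real^'N) \<Rightarrow> (real^'n \<Rightarrow> real^'N) \<Rightarrow> (real^'n \<Rightarrow> real^'N) \<Rightarrow> bool" where
  "strong_solution F f u \<longleftrightarrow> (AE x in lebesgue. F x (weak_hessian u x) = f x)"

end

theory Submission
  imports Defs "HOL-Probability.Probability" "HOL-Real_Asymp.Real_Asymp"
begin

text \<open>
  The linear system A : D^2 u = f is solved first. For a square integrable right-hand side g the
  equation Laplace u = g is solved by the potential u = - (1/2) * (time integral of the heat
  semigroup applied to g). Truncating the time integral to compact subsets of the open half line
  makes every kernel integrable; the truncated Hessians converge in mean square because the heat
  kernel is a cosine transform, which also shows that the Hessian of u has the same norm as g and
  that A : D^2 u, tested against g, is at least nu(A) times the squared norm of g. The bounds on u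
  and Du are the Hardy-Littlewood-Sobolev inequality for Riesz potentials written through the heat
  semigroup. Every element of the function space is such a potential, since the difference is
  harmonic and integrable to a power larger than one, hence vanishes. Therefore
  nu(A) |D^2 u| <= |A : D^2 u| in mean square norm, and g |-> A : D^2 u is inverted by a Banach
  fixed point iteration.

  The K-Condition then makes h |-> h - alpha (F(x, D^2 u) - f), where A : D^2 u = h, a contraction
  with constant sqrt (beta + gamma), whose fixed point solves the nonlinear system; the same
  estimate yields the stability inequality and with it uniqueness and the a priori bound.
\<close>

section \<open>Square integrable functions\<close>

text \<open>Rank-one positivity gives no pointwise lower bound of |A : Z| by |Z|, since Z \<mapsto>
  A : Z maps into only N dimensions and has a kernel. The bound exists for Hessians after
  integration, and it fits the K-Condition: the term \<beta> \<nu>(A)^2 |Z|^2 is absorbed by \<beta>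
  |A : Z|^2, the total becomes (\<beta> + \<gamma>) |A : D^2 u|^2, and the root of \<beta> +
  \<gamma> is the contraction constant. Testing with the Laplacian is what brings in rank-one
  tensors: on the frequency side D^2 becomes a tensor square of one vector, so A acts only through
  its values on such tensors. Both iterations run over right-hand sides instead of u, because there
  the norm is the plain mean square norm. A Riesz potential of order 2a maps L^2 into L^q with q =
  2n / (n - 4a) when 4a < n. The value a = 1 serves u, a = 1/2 serves Du, and a = 1 is admissible
  exactly for n \<ge> 5. The exceptional set in the K-Condition may depend on X and Z, whereas
  Hessians vary with x; it is first made uniform by separability and by continuity of F in
  X.\<close>

definition L2 :: "'a measure \<Rightarrow> ('a \<Rightarrow> 'b::euclidean_space) set" where
  "L2 M = {g. g \<in> borel_measurable M \<and> integrable M (\<lambda>x. (norm (g x))^2)}"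

definition l2n :: "'a measure \<Rightarrow> ('a \<Rightarrow> 'b::euclidean_space) \<Rightarrow> real" where
  "l2n M g = sqrt (\<integral>x. (norm (g x))^2 \<partial>M)"

lemma L2_meas: "g \<in> L2 M \<Longrightarrow> g \<in> borel_measurable M"
  and L2_int: "g \<in> L2 M \<Longrightarrow> integrable M (\<lambda>x. (norm (g x))^2)"
  by (auto simp: L2_def)

lemma L2I: "g \<in> borel_measurable M \<Longrightarrow> integrable M (\<lambda>x. (norm (g x))^2) \<Longrightarrow> g \<in> L2 M"
  by (auto simp: L2_def)

lemma L2_dominated:
  fixes f :: "'a \<Rightarrow> 'b::euclidean_space" and g :: "'a \<Rightarrow> 'c::euclidean_space"
  assumes g: "g \<in> L2 M" and f: "f \<in> borel_measurable M"
    and le: "AE x in M. norm (f x) \<le> C * norm (g x)"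
  shows "f \<in> L2 M"
proof (rule L2I[OF f], rule Bochner_Integration.integrable_bound)
  show "integrable M (\<lambda>x. C^2 * (norm (g x))^2)" using L2_int[OF g] by simp
  show "(\<lambda>x. (norm (f x))^2) \<in> borel_measurable M" using f by measurable
  show "AE x in M. norm ((norm (f x))^2) \<le> norm (C^2 * (norm (g x))^2)"
    using le
  proof eventually_elim
    case (elim x)
    then have "(norm (f x))^2 \<le> (C * norm (g x))^2" by (intro power_mono) auto
    then show ?case by (simp add: power_mult_distrib)
  qed
qed

lemma norm_add_sq_le: "(norm (a + b :: 'b::euclidean_space))^2 \<le> 2 * (norm a)^2 + 2 * (norm b)^2"
proof -
  have "(norm (a + b))^2 \<le> (norm a + norm b)^2" by (intro power_mono norm_triangle_ineq) auto
  also have "\<dots> \<le> 2 * (norm a)^2 + 2 * (norm b)^2"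
    using zero_le_power2[of "norm a - norm b"] by (simp add: power2_eq_square algebra_simps)
  finally show ?thesis .
qed

lemma L2_add: "f \<in> L2 M \<Longrightarrow> g \<in> L2 M \<Longrightarrow> (\<lambda>x. f x + g x) \<in> L2 M"
proof -
  assume f: "f \<in> L2 M" and g: "g \<in> L2 M"
  note [measurable] = L2_meas[OF f] L2_meas[OF g]
  show ?thesis
  proof (rule L2I, measurable, rule Bochner_Integration.integrable_bound)
    show "integrable M (\<lambda>x. 2 * (norm (f x))^2 + 2 * (norm (g x))^2)"
      using L2_int[OF f] L2_int[OF g] by simp
    show "AE x in M. norm ((norm (f x + g x))^2) \<le> norm (2 * (norm (f x))^2 + 2 * (norm (g x))^2)"
      using norm_add_sq_le by (auto simp: abs_of_nonneg)
  qed measurable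
qed

lemma L2_scaleR: "f \<in> L2 M \<Longrightarrow> (\<lambda>x. c *\<^sub>R f x) \<in> L2 M"
  by (rule L2_dominated[where g=f and C="\<bar>c\<bar>"]) (auto intro: borel_measurable_scaleR L2_meas)

lemma L2_uminus: "f \<in> L2 M \<Longrightarrow> (\<lambda>x. - f x) \<in> L2 M"
  using L2_scaleR[of f M "-1"] by simp

lemma L2_diff: "f \<in> L2 M \<Longrightarrow> g \<in> L2 M \<Longrightarrow> (\<lambda>x. f x - g x) \<in> L2 M"
  using L2_add[OF _ L2_uminus, of f M g] by simp

lemma L2_zero: "(\<lambda>x. 0) \<in> L2 M"
  by (auto simp: L2_def)

lemma L2_sum: "finite I \<Longrightarrow> (\<And>i. i \<in> I \<Longrightarrow> f i \<in> L2 M) \<Longrightarrow> (\<lambda>x. \<Sum>i\<in>I. f i x) \<in> L2 M"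
  by (induction I rule: finite_induct) (auto intro: L2_zero L2_add)

lemma L2_mult_integrable:
  fixes f g :: "'a \<Rightarrow> 'b::euclidean_space"
  assumes f: "f \<in> L2 M" and g: "g \<in> L2 M"
  shows "integrable M (\<lambda>x. norm (f x) * norm (g x))" and "integrable M (\<lambda>x. f x \<bullet> g x)"
proof -
  note [measurable] = L2_meas[OF f] L2_meas[OF g]
  have le: "norm (f x) * norm (g x) \<le> (norm (f x))^2 + (norm (g x))^2" for x
  proof -
    have "2 * (norm (f x) * norm (g x)) \<le> (norm (f x))^2 + (norm (g x))^2"
      using zero_le_power2[of "norm (f x) - norm (g x)"] by (simp add: power2_eq_square algebra_simps)
    moreover have "0 \<le> norm (f x) * norm (g x)" by simp
    ultimately show ?thesis by linarith
  qed
  have i: "integrable M (\<lambda>x. (norm (f x))^2 + (norm (g x))^2)"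
    using L2_int[OF f] L2_int[OF g] by simp
  show "integrable M (\<lambda>x. norm (f x) * norm (g x))"
    by (rule Bochner_Integration.integrable_bound[OF i]) (use le in \<open>auto simp: abs_of_nonneg\<close>)
  show "integrable M (\<lambda>x. f x \<bullet> g x)"
  proof (rule Bochner_Integration.integrable_bound[OF i])
    show "AE x in M. norm (f x \<bullet> g x) \<le> norm ((norm (f x))^2 + (norm (g x))^2)"
    proof (rule AE_I2)
      fix x
      show "norm (f x \<bullet> g x) \<le> norm ((norm (f x))^2 + (norm (g x))^2)"
        using le[of x] Cauchy_Schwarz_ineq2[of "f x" "g x"] by simp
    qed
  qed measurable
qed

lemma l2n_nonneg: "0 \<le> l2n M f"
  unfolding l2n_def by simp

lemma l2n_sq: "(l2n M f)^2 = (\<integral>x. (norm (f x))^2 \<partial>M)"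
  unfolding l2n_def by simp

lemma l2n_eq_0_AE:
  assumes "f \<in> L2 M" "l2n M f = 0"
  shows "AE x in M. f x = 0"
proof -
  have "(\<integral>x. (norm (f x))^2 \<partial>M) = 0" using assms(2) unfolding l2n_def by simp
  then have "AE x in M. (norm (f x))^2 = 0"
    using integral_nonneg_eq_0_iff_AE[OF L2_int[OF assms(1)]] by simp
  then show ?thesis by simp
qed

lemma l2n_cong_AE:
  assumes "f \<in> borel_measurable M" "g \<in> borel_measurable M" "AE x in M. norm (f x) = norm (g x)"
  shows "l2n M f = l2n M g"
  unfolding l2n_def using assms by (intro arg_cong[where f=sqrt] integral_cong_AE) auto

lemma l2n_Cauchy_Schwarz:
  fixes f g :: "'a \<Rightarrow> 'b::euclidean_space"
  assumes f: "f \<in> L2 M" and g: "g \<in> L2 M"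
  shows "(\<integral>x. norm (f x) * norm (g x) \<partial>M) \<le> l2n M f * l2n M g"
proof (cases "l2n M f = 0 \<or> l2n M g = 0")
  case True
  then have "AE x in M. norm (f x) * norm (g x) = 0"
    using l2n_eq_0_AE[OF f] l2n_eq_0_AE[OF g] by auto
  then have "(\<integral>x. norm (f x) * norm (g x) \<partial>M) = 0" by (rule integral_eq_zero_AE)
  with True show ?thesis by auto
next
  case False
  define a where "a = l2n M f"
  define b where "b = l2n M g"
  have ab: "a > 0" "b > 0" using False l2n_nonneg[of M f] l2n_nonneg[of M g] by (auto simp: a_def b_def)
  \<comment> \<open>Young's inequality with weights chosen so that, a and b being the two norms, the
    integral of the right-hand side is exactly a * b.\<close>
  have "(\<integral>x. norm (f x) * norm (g x) \<partial>M) \<le> (\<integral>x. b / (2*a) * (norm (f x))^2 + a / (2*b) * (norm (g x))^2 \<partial>M)"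
  proof (rule integral_mono)
    fix x
    have "0 \<le> (b * norm (f x) - a * norm (g x))^2" by simp
    then have "2 * a * b * (norm (f x) * norm (g x)) \<le> b^2 * (norm (f x))^2 + a^2 * (norm (g x))^2"
      by (simp add: power2_eq_square algebra_simps)
    also have "\<dots> = 2 * a * b * (b / (2*a) * (norm (f x))^2 + a / (2*b) * (norm (g x))^2)"
      using ab by (simp add: power2_eq_square field_simps)
    finally have "2 * a * b * (norm (f x) * norm (g x)) \<le> 2 * a * b * (b / (2*a) * (norm (f x))^2 + a / (2*b) * (norm (g x))^2)" .
    then show "norm (f x) * norm (g x) \<le> b / (2*a) * (norm (f x))^2 + a / (2*b) * (norm (g x))^2"
      using ab by (subst (asm) mult_le_cancel_left_pos) auto
  qed (use L2_mult_integrable[OF f g] L2_int[OF f] L2_int[OF g] in auto)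
  also have "\<dots> = b / (2*a) * a^2 + a / (2*b) * b^2"
    using L2_int[OF f] L2_int[OF g] by (simp add: a_def b_def l2n_sq)
  also have "\<dots> = a * b" using ab by (simp add: power2_eq_square field_simps)
  finally show ?thesis by (simp add: a_def b_def)
qed

lemma l2n_inner_le:
  fixes f g :: "'a \<Rightarrow> 'b::euclidean_space"
  assumes f: "f \<in> L2 M" and g: "g \<in> L2 M"
  shows "\<bar>\<integral>x. f x \<bullet> g x \<partial>M\<bar> \<le> l2n M f * l2n M g"
proof -
  have "\<bar>\<integral>x. f x \<bullet> g x \<partial>M\<bar> \<le> (\<integral>x. \<bar>f x \<bullet> g x\<bar> \<partial>M)" by (rule integral_abs_bound)
  also have "\<dots> \<le> (\<integral>x. norm (f x) * norm (g x) \<partial>M)"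
    using L2_mult_integrable[OF f g] Cauchy_Schwarz_ineq2 by (intro integral_mono) auto
  also note l2n_Cauchy_Schwarz[OF f g]
  finally show ?thesis .
qed

lemma l2n_triangle:
  fixes f g :: "'a \<Rightarrow> 'b::euclidean_space"
  assumes f: "f \<in> L2 M" and g: "g \<in> L2 M"
  shows "l2n M (\<lambda>x. f x + g x) \<le> l2n M f + l2n M g"
proof -
  have "(l2n M (\<lambda>x. f x + g x))^2 \<le> (\<integral>x. (norm (f x))^2 + 2 * (norm (f x) * norm (g x)) + (norm (g x))^2 \<partial>M)"
    unfolding l2n_sq
  proof (rule integral_mono)
    fix x
    have "(norm (f x + g x))^2 \<le> (norm (f x) + norm (g x))^2" by (intro power_mono norm_triangle_ineq) auto
    then show "(norm (f x + g x))^2 \<le> (norm (f x))^2 + 2 * (norm (f x) * norm (g x)) + (norm (g x))^2"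
      by (simp add: power2_eq_square algebra_simps)
  qed (use L2_mult_integrable[OF f g] L2_int[OF f] L2_int[OF g] L2_int[OF L2_add[OF f g]] in auto)
  also have "\<dots> = (l2n M f)^2 + 2 * (\<integral>x. norm (f x) * norm (g x) \<partial>M) + (l2n M g)^2"
    using L2_mult_integrable[OF f g] L2_int[OF f] L2_int[OF g] by (simp add: l2n_sq)
  also have "\<dots> \<le> (l2n M f + l2n M g)^2"
    using l2n_Cauchy_Schwarz[OF f g] by (simp add: power2_eq_square algebra_simps)
  finally show ?thesis by (rule power2_le_imp_le) (simp add: l2n_nonneg)
qed

lemma l2n_scaleR: "l2n M (\<lambda>x. c *\<^sub>R f x) = \<bar>c\<bar> * l2n M f"
  unfolding l2n_def by (simp add: power_mult_distrib real_sqrt_mult)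

lemma l2n_minus_commute: "l2n M (\<lambda>x. f x - g x) = l2n M (\<lambda>x. g x - f x)"
  unfolding l2n_def by (simp add: norm_minus_commute)

lemma l2n_triangle_diff:
  fixes f g h :: "'a \<Rightarrow> 'b::euclidean_space"
  assumes "f \<in> L2 M" "g \<in> L2 M" "h \<in> L2 M"
  shows "l2n M (\<lambda>x. f x - h x) \<le> l2n M (\<lambda>x. f x - g x) + l2n M (\<lambda>x. g x - h x)"
  using l2n_triangle[OF L2_diff[OF assms(1,2)] L2_diff[OF assms(2,3)]] by simp

lemma l2n_mono_AE:
  fixes f :: "'a \<Rightarrow> 'b::euclidean_space" and g :: "'a \<Rightarrow> 'c::euclidean_space"
  assumes f: "f \<in> L2 M" and g: "g \<in> L2 M" and le: "AE x in M. norm (f x) \<le> norm (g x)"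
  shows "l2n M f \<le> l2n M g"
  unfolding l2n_def
proof (intro real_sqrt_le_mono integral_mono_AE L2_int f g)
  show "AE x in M. (norm (f x))^2 \<le> (norm (g x))^2"
    using le by eventually_elim (auto intro: power_mono)
qed

text \<open>Riesz-Fischer: along a subsequence with geometrically small increments the increments
  are summable at almost every point, which produces a pointwise limit. Fatou's lemma then makes it
  a limit in norm of the whole sequence.\<close>

lemma L2_complete:
  fixes g :: "nat \<Rightarrow> 'a \<Rightarrow> 'b::euclidean_space"
  assumes g: "\<And>n. g n \<in> L2 M"
    and cau: "\<And>e. e > 0 \<Longrightarrow> \<exists>N. \<forall>m\<ge>N. \<forall>n\<ge>N. l2n M (\<lambda>x. g m x - g n x) < e"
  obtains h where "h \<in> L2 M" "(\<lambda>n. l2n M (\<lambda>x. g n x - h x)) \<longlonglongrightarrow> 0"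
proof -
  note [measurable] = L2_meas[OF g]
  have "\<forall>k. \<exists>N. \<forall>m\<ge>N. \<forall>n\<ge>N. l2n M (\<lambda>x. g m x - g n x) < (1/4)^k"
    using cau by simp
  then obtain N where N: "\<And>k m n. m \<ge> N k \<Longrightarrow> n \<ge> N k \<Longrightarrow> l2n M (\<lambda>x. g m x - g n x) < (1/4)^k"
    by metis
  \<comment> \<open>Summing the thresholds makes \<open>r\<close> nondecreasing and at least
    \<open>N k\<close>; the extra summand \<open>k\<close> gives \<open>r j \<ge> j\<close>, which
    Fatou's lemma uses below.\<close>
  define r where "r k = k + (\<Sum>j\<le>k. N j)" for k
  have rN: "r k \<ge> N k" for k
  proof -
    have "N k \<le> (\<Sum>j\<le>k. N j)" by (rule member_le_sum) auto
    then show ?thesis by (simp add: r_def)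
  qed
  have rS: "r k \<le> r (Suc k)" for k by (simp add: r_def)
  define d where "d k x = g (r (Suc k)) x - g (r k) x" for k x
  have dL: "d k \<in> L2 M" for k unfolding d_def by (intro L2_diff g)
  have dm[measurable]: "d k \<in> borel_measurable M" for k by (rule L2_meas[OF dL])
  \<comment> \<open>Squared increments decay like 16^-k, so the weight 4^k still leaves a convergent
    series of integrals. Finiteness of the weighted series at x bounds the increment there by a
    multiple of 2^-k.\<close>
  have dn: "(\<integral>x. (norm (d k x))^2 \<partial>M) \<le> (1/16)^k" for k
  proof -
    have "l2n M (d k) \<le> (1/4)^k" unfolding d_def
      using N[of k "r (Suc k)" "r k"] rN[of k] rS[of k] by simp
    then have "(l2n M (d k))^2 \<le> ((1/4)^k)^2" using l2n_nonneg by (rule power_mono)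
    also have "((1/4::real)^k)^2 = (1/16)^k" by (simp add: power2_eq_square flip: power_mult_distrib)
    finally show ?thesis by (simp add: l2n_sq)
  qed
  have "(\<integral>\<^sup>+x. (\<Sum>k. ennreal (4^k * (norm (d k x))^2)) \<partial>M) = (\<Sum>k. (\<integral>\<^sup>+x. ennreal (4^k * (norm (d k x))^2) \<partial>M))"
    by (rule nn_integral_suminf) measurable
  also have "\<dots> = (\<Sum>k. ennreal (4^k * (\<integral>x. (norm (d k x))^2 \<partial>M)))"
  proof (intro suminf_cong)
    fix k
    have "(\<integral>\<^sup>+x. ennreal (4^k * (norm (d k x))^2) \<partial>M) = ennreal (\<integral>x. 4^k * (norm (d k x))^2 \<partial>M)"
      using L2_int[OF dL] by (intro nn_integral_eq_integral) auto
    then show "(\<integral>\<^sup>+x. ennreal (4^k * (norm (d k x))^2) \<partial>M) = ennreal (4^k * (\<integral>x. (norm (d k x))^2 \<partial>M))" by simp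
  qed
  also have "\<dots> \<le> (\<Sum>k. ennreal ((1/4)^k))"
  proof (intro suminf_le ennreal_leI)
    fix k :: nat
    have "4^k * (\<integral>x. (norm (d k x))^2 \<partial>M) \<le> 4^k * (1/16)^k" using dn by (intro mult_left_mono) auto
    also have "\<dots> = (1/4)^k" by (simp flip: power_mult_distrib)
    finally show "4^k * (\<integral>x. (norm (d k x))^2 \<partial>M) \<le> (1/4)^k" .
  qed auto
  also have "\<dots> = ennreal (\<Sum>k. (1/4)^k)" by (intro suminf_ennreal2) (auto intro: summable_geometric)
  finally have "(\<integral>\<^sup>+x. (\<Sum>k. ennreal (4^k * (norm (d k x))^2)) \<partial>M) \<noteq> \<infinity>" by (auto simp: top_unique)
  then have "AE x in M. (\<Sum>k. ennreal (4^k * (norm (d k x))^2)) \<noteq> \<infinity>"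
    by (intro nn_integral_PInf_AE) auto
  then have conv: "AE x in M. convergent (\<lambda>k. g (r k) x)"
  proof eventually_elim
    case (elim x)
    then have sm: "summable (\<lambda>k. 4^k * (norm (d k x))^2)" by (intro summable_suminf_not_top) (auto simp: top_unique)
    then have "Bseq (\<lambda>k. 4^k * (norm (d k x))^2)" by (intro convergent_imp_Bseq) (auto simp: convergent_def dest: summable_LIMSEQ_zero)
    then obtain K where K: "K > 0" "\<And>k. norm (4^k * (norm (d k x))^2) \<le> K" by (auto elim: BseqE)
    have "norm (d k x) \<le> sqrt K * (1/2)^k" for k
    proof -
      have "(2^k * norm (d k x))^2 \<le> (sqrt K)^2" using K(2)[of k] K(1)
        by (simp add: power_mult_distrib abs_mult) (simp add: power2_eq_square flip: power_mult_distrib)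
      then have "2^k * norm (d k x) \<le> sqrt K" by (rule power2_le_imp_le) (use K(1) in simp)
      then show ?thesis by (simp add: field_simps power_divide)
    qed
    moreover have "summable (\<lambda>k. sqrt K * (1/2::real)^k)" by (intro summable_mult summable_geometric) auto
    ultimately have "summable (\<lambda>k. d k x)"
      by (intro summable_comparison_test[of "\<lambda>k. d k x" "\<lambda>k. sqrt K * (1/2)^k"] exI[of _ 0] allI impI)
    then have "convergent (\<lambda>n. \<Sum>k<n. d k x)" by (simp add: summable_iff_convergent)
    moreover have "(\<Sum>k<n. d k x) = g (r n) x - g (r 0) x" for n
      unfolding d_def by (rule sum_lessThan_telescope)
    ultimately have "convergent (\<lambda>n. g (r n) x - g (r 0) x)" by simp
    then show ?case by (simp add: convergent_diff_const_right_iff)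
  qed
  define h where "h x = lim (\<lambda>k. g (r k) x)" for x
  have hm[measurable]: "h \<in> borel_measurable M" unfolding h_def by measurable
  have lim: "AE x in M. (\<lambda>k. g (r k) x) \<longlonglongrightarrow> h x"
    using conv by eventually_elim (simp add: h_def convergent_LIMSEQ_iff)
  have est: "(\<integral>\<^sup>+x. ennreal ((norm (g m x - h x))^2) \<partial>M) \<le> ennreal (((1/4)^k)^2)" if m: "m \<ge> N k" for m k
  proof -
    have "AE x in M. ennreal ((norm (g m x - h x))^2) = liminf (\<lambda>j. ennreal ((norm (g m x - g (r j) x))^2))"
      using lim
    proof eventually_elim
      case (elim x)
      have "(\<lambda>j. ennreal ((norm (g m x - g (r j) x))^2)) \<longlonglongrightarrow> ennreal ((norm (g m x - h x))^2)"
        by (intro tendsto_ennrealI tendsto_intros elim)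
      then show ?case using lim_imp_Liminf[OF trivial_limit_sequentially] by metis
    qed
    then have "(\<integral>\<^sup>+x. ennreal ((norm (g m x - h x))^2) \<partial>M) = (\<integral>\<^sup>+x. liminf (\<lambda>j. ennreal ((norm (g m x - g (r j) x))^2)) \<partial>M)"
      by (rule nn_integral_cong_AE)
    also have "\<dots> \<le> liminf (\<lambda>j. \<integral>\<^sup>+x. ennreal ((norm (g m x - g (r j) x))^2) \<partial>M)"
      by (rule nn_integral_liminf) measurable
    also have "\<dots> \<le> ennreal (((1/4)^k)^2)"
    proof (rule Liminf_le)
      show "\<forall>\<^sub>F j in sequentially. (\<integral>\<^sup>+x. ennreal ((norm (g m x - g (r j) x))^2) \<partial>M) \<le> ennreal (((1/4)^k)^2)"
        using eventually_ge_at_top[of "N k"]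
      proof eventually_elim
        case (elim j)
        have "r j \<ge> j" by (simp add: r_def)
        then have "l2n M (\<lambda>x. g m x - g (r j) x) \<le> (1/4)^k" using N[of k m "r j"] m elim by simp
        then have "(l2n M (\<lambda>x. g m x - g (r j) x))^2 \<le> ((1/4)^k)^2" using l2n_nonneg by (rule power_mono)
        then show ?case
          using L2_int[OF L2_diff[OF g g, of m "r j"]] by (subst nn_integral_eq_integral) (auto simp: l2n_sq intro!: ennreal_leI)
      qed
    qed auto
    finally show ?thesis .
  qed
  have gh: "(\<lambda>x. g m x - h x) \<in> L2 M" if "m \<ge> N k" for m k
  proof (rule L2I)
    show "integrable M (\<lambda>x. (norm (g m x - h x))^2)"
    proof (rule integrableI_bounded)
      show "(\<integral>\<^sup>+ x. ennreal (norm ((norm (g m x - h x))^2)) \<partial>M) < \<infinity>"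
        using est[OF that] by (simp add: order_le_less_trans[OF _ ennreal_less_top])
    qed measurable
  qed measurable
  have hL: "h \<in> L2 M" using L2_diff[OF g[of "N 0"] gh[of 0 "N 0"]] by simp
  have le: "l2n M (\<lambda>x. g m x - h x) \<le> (1/4)^k" if "m \<ge> N k" for m k
  proof -
    have "ennreal (\<integral>x. (norm (g m x - h x))^2 \<partial>M) \<le> ennreal (((1/4)^k)^2)"
      using est[OF that] L2_int[OF gh[OF that]] by (subst (asm) nn_integral_eq_integral) auto
    then have "(l2n M (\<lambda>x. g m x - h x))^2 \<le> ((1/4)^k)^2" by (simp add: l2n_sq)
    then show ?thesis by (rule power2_le_imp_le) simp
  qed
  have "(\<lambda>n. l2n M (\<lambda>x. g n x - h x)) \<longlonglongrightarrow> 0"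
  proof (rule LIMSEQ_I)
    fix e :: real assume "0 < e"
    then obtain k where k: "(1/4::real)^k < e" using real_arch_pow_inv[of e "1/4"] by auto
    show "\<exists>no. \<forall>n\<ge>no. norm (l2n M (\<lambda>x. g n x - h x) - 0) < e"
    proof (intro exI[of _ "N k"] allI impI)
      fix n assume "n \<ge> N k"
      from le[OF this] k have "l2n M (\<lambda>x. g n x - h x) < e" by linarith
      then show "norm (l2n M (\<lambda>x. g n x - h x) - 0) < e" using l2n_nonneg[of M "\<lambda>x. g n x - h x"] by simp
    qed
  qed
  with hL that show thesis by blast
qed

text \<open>Banach's iteration carried out on functions. No quotient by null sets is formed: applied
  to functions that agree almost everywhere, \<open>con\<close> already forces their images to agree
  almost everywhere.\<close>

lemma L2_fixed_point:
  fixes \<Phi> :: "('a \<Rightarrow> 'b::euclidean_space) \<Rightarrow> 'a \<Rightarrow> 'b"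
  assumes \<Phi>: "\<And>f. f \<in> L2 M \<Longrightarrow> \<Phi> f \<in> L2 M"
    and con: "\<And>f g. f \<in> L2 M \<Longrightarrow> g \<in> L2 M \<Longrightarrow> l2n M (\<lambda>x. \<Phi> f x - \<Phi> g x) \<le> \<kappa> * l2n M (\<lambda>x. f x - g x)"
    and \<kappa>: "0 \<le> \<kappa>" "\<kappa> < 1"
  obtains h where "h \<in> L2 M" "AE x in M. \<Phi> h x = h x"
proof -
  define g where "g n = (\<Phi> ^^ n) (\<lambda>x. 0)" for n
  have g: "g n \<in> L2 M" for n by (induction n) (auto simp: g_def L2_zero \<Phi>)
  have gS: "g (Suc n) = \<Phi> (g n)" for n by (simp add: g_def)
  define c where "c = l2n M (\<lambda>x. g 1 x - g 0 x)"
  have c: "c \<ge> 0" by (simp add: c_def l2n_nonneg)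
  have step: "l2n M (\<lambda>x. g (Suc n) x - g n x) \<le> \<kappa>^n * c" for n
  proof (induction n)
    case 0 then show ?case by (simp add: c_def)
  next
    case (Suc n)
    have "l2n M (\<lambda>x. g (Suc (Suc n)) x - g (Suc n) x) \<le> \<kappa> * l2n M (\<lambda>x. g (Suc n) x - g n x)"
      using con[OF g g, of "Suc n" n] by (simp add: gS)
    also have "\<dots> \<le> \<kappa> * (\<kappa>^n * c)" using Suc \<kappa> by (intro mult_left_mono)
    finally show ?case by (simp add: mult_ac)
  qed
  have far: "l2n M (\<lambda>x. g (n + k) x - g n x) \<le> \<kappa>^n * c / (1 - \<kappa>)" for n k
  proof -
    have "l2n M (\<lambda>x. g (n + k) x - g n x) \<le> (\<Sum>j<k. \<kappa>^(n+j) * c)"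
    proof (induction k)
      case 0 then show ?case by (simp add: l2n_def)
    next
      case (Suc k)
      have "l2n M (\<lambda>x. g (n + Suc k) x - g n x) \<le> l2n M (\<lambda>x. g (Suc (n + k)) x - g (n+k) x) + l2n M (\<lambda>x. g (n+k) x - g n x)"
        using l2n_triangle_diff[where f="g (Suc (n+k))" and g="g (n+k)" and h="g n", OF g g g] by simp
      with step[of "n+k"] Suc show ?case by simp
    qed
    also have "\<dots> = \<kappa>^n * c * (\<Sum>j<k. \<kappa>^j)" by (simp add: power_add sum_distrib_left mult_ac)
    also have "(\<Sum>j<k. \<kappa>^j) \<le> 1 / (1 - \<kappa>)"
      using \<kappa> by (simp add: sum_gp_strict divide_right_mono)
    then have "\<kappa>^n * c * (\<Sum>j<k. \<kappa>^j) \<le> \<kappa>^n * c * (1 / (1 - \<kappa>))" using c \<kappa> by (intro mult_left_mono) auto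
    finally show ?thesis by simp
  qed
  have t0: "(\<lambda>n. \<kappa>^n * c / (1 - \<kappa>)) \<longlonglongrightarrow> 0 * c / (1 - \<kappa>)"
    using \<kappa> by (intro tendsto_intros LIMSEQ_realpow_zero) auto
  have cau: "\<exists>N. \<forall>m\<ge>N. \<forall>n\<ge>N. l2n M (\<lambda>x. g m x - g n x) < e" if e: "e > 0" for e
  proof -
    from t0 e have "\<forall>\<^sub>F n in sequentially. \<kappa>^n * c / (1 - \<kappa>) < e / 2"
      by (intro order_tendstoD) auto
    then obtain N where N: "\<And>n. n \<ge> N \<Longrightarrow> \<kappa>^n * c / (1 - \<kappa>) < e / 2" by (auto simp: eventually_sequentially)
    have s: "l2n M (\<lambda>x. g m x - g N x) < e/2" if "m \<ge> N" for m
    proof -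
      have "l2n M (\<lambda>x. g m x - g N x) \<le> \<kappa>^N * c / (1 - \<kappa>)" using far[of N "m - N"] that by simp
      then show ?thesis using N[of N] by linarith
    qed
    show ?thesis
    proof (intro exI[of _ N] allI impI)
      fix m n assume "m \<ge> N" "n \<ge> N"
      then have "l2n M (\<lambda>x. g m x - g N x) < e/2" "l2n M (\<lambda>x. g N x - g n x) < e/2"
        using s l2n_minus_commute[of M "g N" "g n"] by auto
      then show "l2n M (\<lambda>x. g m x - g n x) < e"
        using l2n_triangle_diff[where f="g m" and g="g N" and h="g n", OF g g g] by simp
    qed
  qed
  obtain h where h: "h \<in> L2 M" and lim: "(\<lambda>n. l2n M (\<lambda>x. g n x - h x)) \<longlonglongrightarrow> 0"
    using L2_complete[of g M, OF g cau] by auto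
  have "l2n M (\<lambda>x. \<Phi> h x - h x) \<le> \<kappa> * l2n M (\<lambda>x. g n x - h x) + l2n M (\<lambda>x. g (Suc n) x - h x)" for n
    using l2n_triangle_diff[OF \<Phi>[OF h] g[of "Suc n"] h] con[OF h g[of n]] l2n_minus_commute[of M h "g n"]
    by (simp add: gS)
  moreover have "(\<lambda>n. \<kappa> * l2n M (\<lambda>x. g n x - h x) + l2n M (\<lambda>x. g (Suc n) x - h x)) \<longlonglongrightarrow> \<kappa> * 0 + 0"
    by (intro tendsto_intros lim LIMSEQ_Suc)
  ultimately have "l2n M (\<lambda>x. \<Phi> h x - h x) \<le> 0" by (intro LIMSEQ_le_const[where X="\<lambda>n. \<kappa> * l2n M (\<lambda>x. g n x - h x) + l2n M (\<lambda>x. g (Suc n) x - h x)"]) auto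
  then have "l2n M (\<lambda>x. \<Phi> h x - h x) = 0" using l2n_nonneg by (intro antisym)
  from l2n_eq_0_AE[OF L2_diff[OF \<Phi>[OF h] h] this] have "AE x in M. \<Phi> h x = h x" by simp
  with h that show thesis by blast
qed

section \<open>The heat kernel and its derivatives\<close>

lemma distr_lborel_reflect: "distr lborel borel (\<lambda>x::'a::euclidean_space. t - x) = lborel"
  using lborel_affine[of "-1" t] by (simp add: density_1)

lemma distr_lborel_shift: "distr lborel borel (\<lambda>x::'a::euclidean_space. x + t) = lborel"
proof -
  have "(\<lambda>x::'a. x + t) = (+) t" by (simp add: fun_eq_iff add.commute)
  then show ?thesis using lborel_distr_plus[of t] by simp
qed

lemma distr_lborel_shift': "distr lborel borel (\<lambda>x::'a::euclidean_space. x - t) = lborel"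
  using distr_lborel_shift[of "-t"] by simp

lemma nn_integral_reflect:
  fixes t :: "'a::euclidean_space"
  assumes [measurable]: "f \<in> borel_measurable borel"
  shows "(\<integral>\<^sup>+x. f (t - x) \<partial>lborel) = (\<integral>\<^sup>+x. f x \<partial>lborel)"
  by (subst (2) distr_lborel_reflect[of t, symmetric]) (simp add: nn_integral_distr)

lemma nn_integral_shift:
  fixes t :: "'a::euclidean_space"
  assumes [measurable]: "f \<in> borel_measurable borel"
  shows "(\<integral>\<^sup>+x. f (x - t) \<partial>lborel) = (\<integral>\<^sup>+x. f x \<partial>lborel)"
  by (subst (2) distr_lborel_shift'[of t, symmetric]) (simp add: nn_integral_distr)

lemma
  fixes t :: "'a::euclidean_space" and f :: "'a \<Rightarrow> 'b::{banach, second_countable_topology}"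
  assumes i: "integrable lborel f"
  shows integrable_reflect: "integrable lborel (\<lambda>x. f (t - x))"
    and integrable_shift: "integrable lborel (\<lambda>x. f (x + t))"
    and integrable_shift': "integrable lborel (\<lambda>x. f (x - t))"
    and integral_reflect: "(LBINT x. f (t - x)) = (LBINT x. f x)"
    and integral_shift: "(LBINT x. f (x + t)) = (LBINT x. f x)"
    and integral_shift': "(LBINT x. f (x - t)) = (LBINT x. f x)"
proof -
  have [measurable]: "f \<in> borel_measurable borel" using borel_measurable_integrable[OF i] by simp
  show "integrable lborel (\<lambda>x. f (t - x))"
    using i by (subst (asm) distr_lborel_reflect[of t, symmetric]) (simp add: integrable_distr_eq)
  show "integrable lborel (\<lambda>x. f (x + t))"
    using i by (subst (asm) distr_lborel_shift[of t, symmetric]) (simp add: integrable_distr_eq)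
  show "integrable lborel (\<lambda>x. f (x - t))"
    using i by (subst (asm) distr_lborel_shift'[of t, symmetric]) (simp add: integrable_distr_eq)
  show "(LBINT x. f (t - x)) = (LBINT x. f x)"
    by (subst (2) distr_lborel_reflect[of t, symmetric]) (simp add: integral_distr)
  show "(LBINT x. f (x + t)) = (LBINT x. f x)"
    by (subst (2) distr_lborel_shift[of t, symmetric]) (simp add: integral_distr)
  show "(LBINT x. f (x - t)) = (LBINT x. f x)"
    by (subst (2) distr_lborel_shift'[of t, symmetric]) (simp add: integral_distr)
qed

lemma integrable_lborel_times:
  fixes f :: "'a::euclidean_space \<Rightarrow> real" and g :: "'b::euclidean_space \<Rightarrow> real"
  assumes f: "integrable lborel f" and g: "integrable lborel g"
  shows "integrable (lborel \<Otimes>\<^sub>M lborel) (\<lambda>(x, y). f x * g y)"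
proof (rule lborel_pair.Fubini_integrable)
  have [measurable]: "f \<in> borel_measurable borel" "g \<in> borel_measurable borel"
    using borel_measurable_integrable[OF f] borel_measurable_integrable[OF g] by auto
  show "(\<lambda>(x, y). f x * g y) \<in> borel_measurable (lborel \<Otimes>\<^sub>M lborel)" by measurable
  show "integrable lborel (\<lambda>x. LBINT y. norm (case (x, y) of (x, y) \<Rightarrow> f x * g y))"
    using f by (simp add: abs_mult)
  show "AE x in lborel. integrable lborel (\<lambda>y. case (x, y) of (x, y) \<Rightarrow> f x * g y)"
    using g by simp
qed

text \<open>Integrating the derivative along the segment from x to x + v gives f (x + v) - f x,
  whose integral vanishes by translation invariance. Exchanging the integrals and using translation
  invariance again returns the integral of f'. Integrability thus takes the place of any decay at
  infinity.\<close>

lemma integral_directional_derivative_eq_0: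
  fixes f f' :: "'a::euclidean_space \<Rightarrow> real" and v :: 'a
  assumes d: "\<And>x. ((\<lambda>t. f (x + t *\<^sub>R v)) has_real_derivative f' x) (at 0)"
    and c: "continuous_on UNIV f'"
    and i: "integrable lborel f" "integrable lborel f'"
  shows "(LBINT x. f' x) = 0"
proof -
  have [measurable]: "f' \<in> borel_measurable borel" using borel_measurable_continuous_onI[OF c] .
  have d': "((\<lambda>t. f (x + t *\<^sub>R v)) has_real_derivative f' (x + s *\<^sub>R v)) (at s)" for x s
  proof -
    have "((\<lambda>t. f (x + (t + s) *\<^sub>R v)) has_real_derivative f' (x + s *\<^sub>R v)) (at 0)"
      using d[of "x + s *\<^sub>R v"] by (simp add: algebra_simps)
    then show ?thesis using DERIV_shift[of "\<lambda>t. f (x + t *\<^sub>R v)" _ 0 s] by simp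
  qed
  have ftc: "(LBINT t. f' (x + t *\<^sub>R v) * indicator {0..1} t) = f (x + v) - f x" for x
  proof -
    have "isCont f' y" for y using c by (simp add: continuous_on_eq_continuous_at)
    then have "isCont (\<lambda>t. f' (x + t *\<^sub>R v)) t" for t
      by (intro isCont_o2[where g=f' and f="\<lambda>t. x + t *\<^sub>R v"] continuous_add continuous_scaleR continuous_const continuous_ident)
    then show ?thesis
      using integral_FTC_Icc_real[of 0 1 "\<lambda>t. f (x + t *\<^sub>R v)" "\<lambda>t. f' (x + t *\<^sub>R v)"] d' by simp
  qed
  have I: "integrable (lborel \<Otimes>\<^sub>M lborel) (\<lambda>(t::real, x). f' (x + t *\<^sub>R v) * indicator {0..1} t)"
  proof (rule lborel_pair.Fubini_integrable)
    show "integrable lborel (\<lambda>t. LBINT x. norm (case (t, x) of (t, x) \<Rightarrow> f' (x + t *\<^sub>R v) * indicator {0..1::real} t))"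
    proof -
      have "(LBINT x. norm (case (t, x) of (t, x) \<Rightarrow> f' (x + t *\<^sub>R v) * indicator {0..1::real} t)) = (LBINT x. \<bar>f' x\<bar>) * indicator {0..1} t" for t
        using integral_shift[of "\<lambda>x. \<bar>f' x\<bar>" "t *\<^sub>R v"] i by (simp add: abs_mult)
      then show ?thesis by simp
    qed
    show "AE t in lborel. integrable lborel (\<lambda>x. case (t, x) of (t, x) \<Rightarrow> f' (x + t *\<^sub>R v) * indicator {0..1::real} t)"
      using integrable_shift[OF i(2)] by simp
  qed measurable
  have "0 = (LBINT x. f (x + v) - f x)"
    using integral_shift[OF i(1)] integrable_shift[OF i(1)] i(1) by simp
  also have "\<dots> = (LBINT x. (LBINT t. f' (x + t *\<^sub>R v) * indicator {0..1} t))" by (simp add: ftc)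
  also have "\<dots> = (LBINT t. (LBINT x. f' (x + t *\<^sub>R v) * indicator {0..1::real} t))"
    by (rule lborel_pair.Fubini_integral[OF I])
  also have "\<dots> = (LBINT t. (LBINT x. f' x) * indicator {0..1::real} t)"
    using integral_shift[OF i(2)] by simp
  also have "\<dots> = (LBINT x. f' x)" by simp
  finally show ?thesis by simp
qed

text \<open>Time is scaled so that the heat equation reads du/ds = (Laplace u) / 2; this makes the kernel a normal density
  of variance s. The functions gk1, gk2 and gk3 are its derivatives along i, along i and j, and along i, j and j.\<close>

definition gk :: "real \<Rightarrow> real^'n \<Rightarrow> real" where
  "gk s z = (2 * pi * s) powr (- (real CARD('n) / 2)) * exp (- (norm z)\<^sup>2 / (2 * s))"

definition gk1 :: "'n \<Rightarrow> real \<Rightarrow> real^'n \<Rightarrow> real" where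
  "gk1 i s z = - (z $ i / s) * gk s z"

definition gk2 :: "'n \<Rightarrow> 'n \<Rightarrow> real \<Rightarrow> real^'n \<Rightarrow> real" where
  "gk2 i j s z = (z $ i * z $ j / s^2 - (if i = j then 1 / s else 0)) * gk s z"

definition gk3 :: "'n \<Rightarrow> 'n \<Rightarrow> real \<Rightarrow> real^'n \<Rightarrow> real" where
  "gk3 i j s z = (z $ i / s^2 + (if i = j then 2 * z $ i / s^2 else 0) - z $ i * (z $ j)^2 / s^3) * gk s z"

lemma measurable_vec_nth[measurable (raw)]:
  "g \<in> borel_measurable M \<Longrightarrow> (\<lambda>x. g x $ i :: real) \<in> borel_measurable M"
  using borel_measurable_continuous_on[of "\<lambda>v. v $ i" g M] by (simp add: continuous_on_component)

lemma measurable_gk[measurable (raw)]: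
  assumes [measurable]: "f \<in> borel_measurable M" "g \<in> borel_measurable M"
  shows "(\<lambda>x. gk (f x) (g x)) \<in> borel_measurable M"
  unfolding gk_def by measurable

lemma measurable_gk1[measurable (raw)]:
  assumes [measurable]: "f \<in> borel_measurable M" "g \<in> borel_measurable M"
  shows "(\<lambda>x. gk1 i (f x) (g x)) \<in> borel_measurable M"
  unfolding gk1_def by measurable

lemma measurable_gk2[measurable (raw)]:
  assumes [measurable]: "f \<in> borel_measurable M" "g \<in> borel_measurable M"
  shows "(\<lambda>x. gk2 i j (f x) (g x)) \<in> borel_measurable M"
  unfolding gk2_def by measurable

section \<open>Mass, derivatives and Gaussian majorants of the heat kernel\<close>

lemma gk_nonneg: "0 \<le> gk s z"
  by (simp add: gk_def)

lemma gk_le: "0 < s \<Longrightarrow> gk s (z::real^'n) \<le> (2 * pi * s) powr (- (real CARD('n) / 2))"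
  unfolding gk_def by (intro mult_left_le) auto

lemma gk_eq_prod:
  assumes s: "0 < s"
  shows "gk s (z::real^'n) = (\<Prod>b\<in>Basis. normal_density 0 (sqrt s) (z \<bullet> b))"
proof -
  have "(\<Prod>b\<in>Basis. normal_density 0 (sqrt s) (z \<bullet> b)) = (1 / sqrt (2 * pi * s)) ^ CARD('n) * (\<Prod>b\<in>Basis. exp (- (z \<bullet> b)\<^sup>2 / (2 * s)))"
    using s by (simp add: normal_density_def prod_dividef power_divide)
  also have "(\<Prod>b\<in>Basis. exp (- (z \<bullet> b)\<^sup>2 / (2 * s))) = exp (\<Sum>b\<in>Basis. - (z \<bullet> b)\<^sup>2 / (2 * s))"
    by (simp add: exp_sum)
  also have "(\<Sum>b\<in>Basis. - (z \<bullet> b)\<^sup>2 / (2 * s)) = - (norm z)\<^sup>2 / (2 * s)"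
    by (simp add: norm_eq_sqrt_inner euclidean_inner[of z z] sum_negf sum_divide_distrib power2_eq_square sum_nonneg)
  also have "(1 / sqrt (2 * pi * s)) ^ CARD('n) = (2 * pi * s) powr (- (real CARD('n) / 2))"
    using s by (simp add: powr_minus powr_half_sqrt[symmetric] powr_realpow[symmetric] powr_powr field_simps)
  finally show ?thesis by (simp add: gk_def)
qed

lemma nn_integral_gk:
  assumes s: "0 < s"
  shows "(\<integral>\<^sup>+z. ennreal (gk s (z::real^'n)) \<partial>lborel) = 1"
proof -
  have "(\<integral>\<^sup>+z. ennreal (gk s (z::real^'n)) \<partial>lborel)
      = (\<integral>\<^sup>+z. (\<Prod>b\<in>Basis. ennreal (normal_density 0 (sqrt s) (z \<bullet> b))) \<partial>(lborel :: (real^'n) measure))"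
    by (simp add: gk_eq_prod[OF s] prod_ennreal normal_density_nonneg)
  also have "\<dots> = (\<Prod>b\<in>(Basis::(real^'n) set). \<integral>\<^sup>+x. ennreal (normal_density 0 (sqrt s) x) \<partial>lborel)"
    by (rule nn_integral_lborel_prod) auto
  also have "(\<integral>\<^sup>+x. ennreal (normal_density 0 (sqrt s) x) \<partial>lborel) = 1"
    using s by (subst nn_integral_eq_integral) (auto simp: integrable_normal_density integral_normal_density)
  finally show ?thesis by simp
qed

lemma integrable_gk: "0 < s \<Longrightarrow> integrable lborel (gk s :: real^'n \<Rightarrow> real)"
  by (rule integrableI_nonneg) (auto simp: gk_nonneg nn_integral_gk intro!: borel_measurable_continuous_onI continuous_intros measurable_gk)

lemma integral_gk: "0 < s \<Longrightarrow> (LBINT z. gk s (z::real^'n)) = 1"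
  using nn_integral_eq_integral[OF integrable_gk, of s] by (simp add: nn_integral_gk gk_nonneg)

lemma component_shift: "(x + t *\<^sub>R axis i 1) $ j = x $ j + (if i = j then t else (0::real))"
  by (auto simp: axis_def)

lemma norm_shift_axis: "(norm (x + t *\<^sub>R axis i (1::real) :: real^'n))^2 = (norm x)^2 + 2 * t * x $ i + t^2"
  unfolding power2_norm_eq_inner
  by (simp add: inner_add_left inner_add_right inner_axis inner_commute[of "axis i 1" x] algebra_simps power2_eq_square)

lemma gk_deriv:
  assumes s: "0 < s"
  shows "((\<lambda>t. gk s (x + t *\<^sub>R axis i 1)) has_real_derivative gk1 i s x) (at 0)"
  unfolding gk_def norm_shift_axis gk1_def using s
  by (auto intro!: derivative_eq_intros simp: field_simps)

lemma gk1_deriv: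
  assumes s: "0 < s"
  shows "((\<lambda>t. gk1 i s (x + t *\<^sub>R axis j 1)) has_real_derivative gk2 i j s x) (at 0)"
  unfolding gk1_def component_shift using s
  by (auto intro!: derivative_eq_intros gk_deriv simp: gk1_def gk2_def field_simps power2_eq_square)

lemma gk2_deriv1:
  assumes s: "0 < s"
  shows "((\<lambda>t. gk2 j j s (x + t *\<^sub>R axis i 1)) has_real_derivative gk3 i j s x) (at 0)"
  unfolding gk2_def component_shift using s
  by (auto intro!: derivative_eq_intros gk_deriv simp: gk1_def gk3_def field_simps power2_eq_square power3_eq_cube)

lemma gk2_deriv2:
  assumes s: "0 < s"
  shows "((\<lambda>t. gk2 i j s (x + t *\<^sub>R axis j 1)) has_real_derivative gk3 i j s x) (at 0)"
  unfolding gk2_def component_shift using s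
  by (auto intro!: derivative_eq_intros gk_deriv simp: gk1_def gk3_def field_simps power2_eq_square power3_eq_cube)

lemma gk_time_deriv:
  assumes s: "0 < s"
  shows "((\<lambda>s. gk s (x::real^'n)) has_real_derivative (\<Sum>i\<in>UNIV. gk2 i i s x) / 2) (at s)"
proof -
  have n: "(\<Sum>i\<in>UNIV. (x $ i)^2) = (norm x)^2"
    by (simp add: norm_vec_def L2_set_def sum_nonneg)
  have "(\<Sum>i\<in>UNIV. gk2 i i s x) = (\<Sum>i\<in>UNIV. ((x $ i)^2 / s^2 - 1 / s)) * gk s x"
    unfolding sum_distrib_right by (rule sum.cong) (auto simp: gk2_def power2_eq_square)
  also have "(\<Sum>i\<in>UNIV. ((x $ i)^2 / s^2 - 1 / s)) = (norm x)^2 / s^2 - real CARD('n) / s"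
    by (simp add: sum_subtractf n[symmetric] sum_divide_distrib)
  finally have "(\<Sum>i\<in>UNIV. gk2 i i s x) = ((norm x)^2 / s^2 - real CARD('n) / s) * gk s x" .
  moreover have "((\<lambda>s. gk s x) has_real_derivative (- (real CARD('n) / 2) / s + (norm x)^2 / (2 * s^2)) * gk s x) (at s)"
  proof -
    define c where "c = - (real CARD('n) / 2)"
    have "((\<lambda>s. (2 * pi * s) powr c) has_real_derivative (2 * pi * s) powr c * (c / s)) (at s)"
      using DERIV_powr[of "\<lambda>s. 2 * pi * s" "2 * pi" s "\<lambda>_. c" 0] s by (auto intro!: derivative_eq_intros)
    moreover have "((\<lambda>s. exp (- (norm x)\<^sup>2 / (2 * s))) has_real_derivative exp (- (norm x)\<^sup>2 / (2 * s)) * ((norm x)^2 / (2 * s^2))) (at s)"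
      using s by (auto intro!: derivative_eq_intros simp: power2_eq_square)
    ultimately show ?thesis unfolding gk_def c_def[symmetric]
      by (rule DERIV_cong[OF DERIV_mult]) (simp add: c_def algebra_simps)
  qed
  ultimately show ?thesis by (elim DERIV_cong) (simp add: algebra_simps diff_divide_distrib)
qed

lemma continuous_on_gk: "0 < s \<Longrightarrow> continuous_on UNIV (gk s)"
  and continuous_on_gk1: "0 < s \<Longrightarrow> continuous_on UNIV (gk1 i s)"
  and continuous_on_gk2: "0 < s \<Longrightarrow> continuous_on UNIV (gk2 i j s)"
  and continuous_on_gk3: "0 < s \<Longrightarrow> continuous_on UNIV (gk3 i j s)"
  unfolding gk_def[abs_def] gk1_def[abs_def] gk2_def[abs_def] gk3_def[abs_def]
  by (cases "i = j"; auto intro!: continuous_intros)+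

text \<open>Half of the exponent is split off. The factor exp (- |z|^2 / (4 s)) swallows the
  polynomials that differentiation produces, and what remains is again a heat kernel of mass 1, at
  the doubled time.\<close>

lemma gk_double: "0 < s \<Longrightarrow> gk s (z::real^'n) = 2 powr (real CARD('n) / 2) * exp (- (norm z)\<^sup>2 / (4 * s)) * gk (2 * s) z"
proof -
  assume s: "0 < s"
  have "(2 * pi * (2 * s)) powr (- (real CARD('n) / 2)) = 2 powr (- (real CARD('n) / 2)) * (2 * pi * s) powr (- (real CARD('n) / 2))"
    using s by (subst powr_mult[symmetric]) (auto simp: mult_ac)
  moreover have "exp (- (norm z)\<^sup>2 / (2 * s)) = exp (- (norm z)\<^sup>2 / (4 * s)) * exp (- (norm z)\<^sup>2 / (2 * (2 * s)))"
    unfolding exp_add[symmetric] using s by (simp add: field_simps)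
  ultimately show ?thesis by (simp add: gk_def powr_minus)
qed

lemma gk_double_le: "0 < s \<Longrightarrow> gk s (z::real^'n) \<le> 2 powr (real CARD('n) / 2) * gk (2 * s) z"
proof -
  assume s: "0 < s"
  have "exp (- (norm z)\<^sup>2 / (4 * s)) * gk (2 * s) z \<le> 1 * gk (2 * s) z"
    using s by (intro mult_right_mono gk_nonneg) auto
  then show ?thesis by (subst gk_double[OF s]) (simp add: mult.assoc)
qed

text \<open>The power s^(-1/2) matters, not the constant: it decides that the gradient is controlled
  by the Riesz potential with a = 1/2.\<close>

lemma gk1_bound:
  assumes s: "0 < s"
  shows "\<bar>gk1 i s (z::real^'n)\<bar> \<le> 2 * 2 powr (real CARD('n) / 2) * s powr (- (1/2)) * gk (2 * s) z"
proof -
  define t where "t = norm z / sqrt s"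
  have t: "t \<ge> 0" "t^2 = (norm z)^2 / s" using s by (auto simp: t_def power_divide)
  have "t \<le> 2 * exp (t^2 / 4)"
  proof -
    have "0 \<le> (t - 1)^2" by simp
    then have "t \<le> 2 * (1 + t^2 / 4)" by (simp add: power2_eq_square algebra_simps)
    also have "\<dots> \<le> 2 * exp (t^2 / 4)" by (rule mult_left_mono[OF exp_ge_add_one_self]) simp
    finally show ?thesis .
  qed
  then have e: "t * exp (- (norm z)\<^sup>2 / (4 * s)) \<le> 2"
    using t s by (simp add: exp_minus field_simps)
  have "\<bar>gk1 i s z\<bar> \<le> norm z / s * gk s z"
    unfolding gk1_def using s component_le_norm_cart[of z i] by (auto simp: abs_mult gk_nonneg intro!: mult_right_mono divide_right_mono)
  also have "norm z / s = s powr (- (1/2)) * t"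
    using s by (simp add: t_def powr_minus powr_half_sqrt field_simps)
  also have "s powr (- (1/2)) * t * gk s z = 2 powr (real CARD('n) / 2) * s powr (- (1/2)) * gk (2 * s) z * (t * exp (- (norm z)\<^sup>2 / (4 * s)))"
    by (subst gk_double[OF s]) simp
  also have "\<dots> \<le> 2 powr (real CARD('n) / 2) * s powr (- (1/2)) * gk (2 * s) z * 2"
    by (intro mult_left_mono e) (auto simp: gk_nonneg)
  finally show ?thesis by (simp add: mult_ac)
qed

text \<open>Here the constant may depend on s in any way. This is enough for \<open>gk3\<close>,
  which appears only in integrations by parts at fixed times.\<close>

lemma gk_poly_bound:
  assumes s: "0 < s"
  obtains C where "0 \<le> C" "\<And>z::real^'n. (norm z) ^ k * gk s z \<le> C * gk (2 * s) z"
proof -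
  define C where "C = (1 + fact k * (4 * s)^k) * 2 powr (real CARD('n) / 2)"
  have C: "0 \<le> C" using s by (simp add: C_def)
  have "(norm z) ^ k * gk s z \<le> C * gk (2 * s) z" for z :: "real^'n"
  proof -
    define a where "a = (norm z)^2 / (4 * s)"
    have a: "a \<ge> 0" using s by (simp add: a_def)
    have "(norm z) ^ k \<le> 1 + ((norm z)^2) ^ k"
    proof (cases "norm z \<le> 1")
      case True then have "(norm z)^k \<le> 1" by (intro power_le_one) auto
      then show ?thesis by (simp add: add_increasing2)
    next
      case False
      then have "norm z \<le> (norm z)^2" using mult_left_mono[of 1 "norm z" "norm z"] by (simp add: power2_eq_square)
      then have "(norm z) ^ k \<le> ((norm z)^2) ^ k" by (intro power_mono) auto
      then show ?thesis by simp
    qed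
    also have "(norm z)^2 = 4 * s * a" using s by (simp add: a_def)
    finally have 1: "(norm z) ^ k \<le> 1 + (4 * s)^k * a^k" by (simp add: power_mult_distrib)
    have "a ^ k / fact k \<le> exp a"
    proof -
      have "a ^ k / fact k = (\<Sum>n\<in>{k}. a ^ n /\<^sub>R fact n)" by (simp add: field_simps)
      also have "\<dots> \<le> exp a" unfolding exp_def using a by (intro sum_le_suminf summable_exp_generic) auto
      finally show ?thesis .
    qed
    then have 2: "a^k \<le> fact k * exp a" by (simp add: field_simps)
    have "1 + (4 * s)^k * a^k \<le> exp a + (4 * s)^k * (fact k * exp a)"
      using 2 a s by (intro add_mono mult_left_mono) auto
    with 1 have "(norm z)^k \<le> (1 + fact k * (4 * s)^k) * exp a" by (simp add: algebra_simps)
    then have "(norm z)^k * gk s z \<le> (1 + fact k * (4 * s)^k) * exp a * gk s z"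
      using gk_nonneg by (intro mult_right_mono)
    also have "\<dots> = C * gk (2 * s) z"
      unfolding C_def by (subst gk_double[OF s]) (simp add: a_def exp_minus field_simps)
    finally show ?thesis .
  qed
  with C that show thesis by blast
qed

lemma gk2_bound:
  assumes s: "0 < s"
  shows "\<bar>gk2 i j s (z::real^'n)\<bar> \<le> 5 * 2 powr (real CARD('n) / 2) / s * gk (2 * s) z"
proof -
  define a where "a = (norm z)^2 / (4 * s)"
  have a: "a \<ge> 0" using s by (simp add: a_def)
  have "a \<le> exp a" using exp_ge_add_one_self[of a] by linarith
  then have e: "(4 * a + 1) * exp (- a) \<le> 5" using a by (simp add: exp_minus field_simps) (smt (verit) one_le_exp_iff)
  have "\<bar>z $ i * z $ j / s^2 - (if i = j then 1 / s else 0)\<bar> \<le> \<bar>z $ i * z $ j\<bar> / s^2 + 1 / s"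
    using s by (auto intro!: order_trans[OF abs_triangle_ineq4] simp: abs_mult)
  also have "\<bar>z $ i * z $ j\<bar> \<le> norm z * norm z"
    unfolding abs_mult by (intro mult_mono component_le_norm_cart) auto
  also have "norm z * norm z / s^2 + 1 / s = (4 * a + 1) / s"
    using s by (simp add: a_def power2_eq_square field_simps)
  finally have "\<bar>z $ i * z $ j / s^2 - (if i = j then 1 / s else 0)\<bar> \<le> (4 * a + 1) / s" using s by (simp add: divide_right_mono)
  then have "\<bar>gk2 i j s z\<bar> \<le> (4 * a + 1) / s * gk s z"
    unfolding gk2_def abs_mult abs_of_nonneg[OF gk_nonneg] by (rule mult_right_mono[OF _ gk_nonneg])
  also have "\<dots> = 2 powr (real CARD('n) / 2) / s * gk (2 * s) z * ((4 * a + 1) * exp (- a))"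
    by (subst gk_double[OF s]) (simp add: a_def)
  also have "\<dots> \<le> 2 powr (real CARD('n) / 2) / s * gk (2 * s) z * 5"
    using s by (intro mult_left_mono e) (auto simp: gk_nonneg)
  finally show ?thesis by (simp add: mult_ac)
qed

text \<open>The class of kernels at one fixed time that may be integrated by parts. The majorant
  sits at time \<open>2 * s\<close> because \<open>gk_double\<close> leaves the kernel there after
  absorbing the polynomial factors.\<close>

definition gdom :: "real \<Rightarrow> (real^'n \<Rightarrow> real) \<Rightarrow> bool" where
  "gdom s h \<longleftrightarrow> continuous_on UNIV h \<and> (\<exists>C\<ge>0. \<forall>z. \<bar>h z\<bar> \<le> C * gk (2 * s) z)"

lemma gdom_gk: "0 < s \<Longrightarrow> gdom s (gk s :: real^'n \<Rightarrow> real)"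
  unfolding gdom_def using gk_double_le[of s] by (auto simp: continuous_on_gk gk_nonneg intro!: exI[of _ "2 powr (real CARD('n) / 2)"])

lemma gdom_gk1: "0 < s \<Longrightarrow> gdom s (gk1 i s :: real^'n \<Rightarrow> real)"
  unfolding gdom_def using gk1_bound[of s]
  by (auto simp: continuous_on_gk1 intro!: exI[of _ "2 * 2 powr (real CARD('n) / 2) * s powr (- (1/2))"])

lemma gdom_gk2: "0 < s \<Longrightarrow> gdom s (gk2 i j s :: real^'n \<Rightarrow> real)"
  unfolding gdom_def using gk2_bound[of s]
  by (auto simp: continuous_on_gk2 intro!: exI[of _ "5 * 2 powr (real CARD('n) / 2) / s"])

lemma gdom_gk3:
  assumes s: "0 < s" shows "gdom s (gk3 i j s :: real^'n \<Rightarrow> real)"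
proof -
  obtain C1 where C1: "0 \<le> C1" "\<And>z::real^'n. (norm z) ^ 1 * gk s z \<le> C1 * gk (2 * s) z"
    using gk_poly_bound[OF s, of 1] by metis
  obtain C3 where C3: "0 \<le> C3" "\<And>z::real^'n. (norm z) ^ 3 * gk s z \<le> C3 * gk (2 * s) z"
    using gk_poly_bound[OF s, of 3] by metis
  have "\<bar>gk3 i j s z\<bar> \<le> (3 / s^2 * C1 + C3 / s^3) * gk (2 * s) z" for z :: "real^'n"
  proof -
    have "\<bar>z $ i / s^2 + (if i = j then 2 * z $ i / s^2 else 0) - z $ i * (z $ j)^2 / s^3\<bar>
        \<le> \<bar>z $ i / s^2\<bar> + \<bar>2 * z $ i / s^2\<bar> + \<bar>z $ i * (z $ j)^2 / s^3\<bar>"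
    proof -
      define a b c where "a = z $ i / s^2" and "b = 2 * z $ i / s^2" and "c = z $ i * (z $ j)^2 / s^3"
      show ?thesis unfolding a_def[symmetric] b_def[symmetric] c_def[symmetric] by (cases "i = j") auto
    qed
    also have "\<dots> = 3 / s^2 * \<bar>z $ i\<bar> + \<bar>z $ i\<bar> * \<bar>z $ j\<bar>^2 / s^3"
      using s by (simp add: abs_mult field_simps)
    also have "\<dots> \<le> 3 / s^2 * norm z + norm z * (norm z)^2 / s^3"
      using s by (intro add_mono mult_left_mono divide_right_mono mult_mono power_mono component_le_norm_cart) auto
    also have "\<dots> = 3 / s^2 * (norm z)^1 + (norm z)^3 / s^3" by (simp add: power2_eq_square power3_eq_cube)
    finally have "\<bar>gk3 i j s z\<bar> \<le> (3 / s^2 * (norm z)^1 + (norm z)^3 / s^3) * gk s z"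
      unfolding gk3_def abs_mult abs_of_nonneg[OF gk_nonneg] by (rule mult_right_mono[OF _ gk_nonneg])
    also have "\<dots> = 3 / s^2 * ((norm z)^1 * gk s z) + (norm z)^3 * gk s z / s^3" by (simp add: algebra_simps)
    also have "\<dots> \<le> 3 / s^2 * (C1 * gk (2 * s) z) + C3 * gk (2 * s) z / s^3"
      using s by (intro add_mono mult_left_mono divide_right_mono C1 C3) auto
    finally show ?thesis by (simp add: algebra_simps)
  qed
  then show ?thesis unfolding gdom_def using C1(1) C3(1) s by (auto simp: continuous_on_gk3 intro!: exI[of _ "3 / s^2 * C1 + C3 / s^3"])
qed

lemma gdom_measurable: "gdom s h \<Longrightarrow> h \<in> borel_measurable borel"
  by (auto simp: gdom_def intro: borel_measurable_continuous_onI)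

lemma gdom_integrable:
  assumes s: "0 < s" and h: "gdom s (h :: real^'n \<Rightarrow> real)"
  shows "integrable lborel h"
proof -
  obtain C where C: "C \<ge> 0" "\<And>z. \<bar>h z\<bar> \<le> C * gk (2 * s) z" using h by (auto simp: gdom_def)
  show ?thesis
    by (rule Bochner_Integration.integrable_bound[of _ "\<lambda>z. C * gk (2 * s) z"])
       (use C s gdom_measurable[OF h] in \<open>auto simp: integrable_gk abs_mult gk_nonneg\<close>)
qed

lemma gdom_bounded:
  assumes s: "0 < s" and h: "gdom s (h :: real^'n \<Rightarrow> real)"
  obtains K where "\<And>z. \<bar>h z\<bar> \<le> K"
proof -
  obtain C where C: "C \<ge> 0" "\<And>z. \<bar>h z\<bar> \<le> C * gk (2 * s) z" using h by (auto simp: gdom_def)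
  have "\<bar>h z\<bar> \<le> C * (2 * pi * (2 * s)) powr (- (real CARD('n) / 2))" for z
    using C(2)[of z] mult_left_mono[OF gk_le[of "2 * s" z] C(1)] s by auto
  with that show thesis by blast
qed

lemma gdom_mult_integrable:
  assumes s: "0 < s" "0 < t" and h: "gdom s (h :: real^'n \<Rightarrow> real)" and k: "gdom t k"
  shows "integrable lborel (\<lambda>x. h (x - y) * k (x - y'))"
proof -
  obtain K where K: "\<And>z. \<bar>h z\<bar> \<le> K" using gdom_bounded[OF s(1) h] by metis
  have [measurable]: "h \<in> borel_measurable borel" "k \<in> borel_measurable borel"
    using gdom_measurable h k by auto
  show ?thesis
  proof (rule Bochner_Integration.integrable_bound)
    show "integrable lborel (\<lambda>x. K * k (x - y'))"
      using integrable_shift'[OF gdom_integrable[OF s(2) k]] by simp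
    show "AE x in lborel. norm (h (x - y) * k (x - y')) \<le> norm (K * k (x - y'))"
      using K order_trans[OF abs_ge_zero K] by (auto simp: abs_mult intro!: mult_right_mono)
  qed measurable
qed

text \<open>Moving one derivative off the first factor turns either side into minus the integral of
  \<open>gk1 i s\<close> against \<open>gk3 i j t\<close>, because \<open>gk3 i j\<close> is at once
  the j-derivative of \<open>gk2 i j\<close> and the i-derivative of \<open>gk2 j j\<close>. Summed
  over i and j, this is the identity between the norms of the Hessian and of the Laplacian.\<close>

lemma gk2_gk2_integral:
  assumes s: "0 < s" "0 < t"
  shows "(LBINT x. gk2 i j s (x - y) * gk2 i j t (x - y'))
       = (\<integral>x. gk2 i i s (x - y) * gk2 j j t (x - y') \<partial>(lborel :: (real^'n) measure))"
proof -
  note I = gdom_mult_integrable[OF s] and G = gdom_gk1[OF s(1)] gdom_gk2[OF s(1)] gdom_gk2[OF s(2)] gdom_gk3[OF s(2)]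
  have sh: "x + t *\<^sub>R axis i 1 - y = (x - y) + t *\<^sub>R axis i 1" for x y :: "real^'n" and t i by simp
  have c: "continuous_on UNIV (\<lambda>x. h (x - z))" if "continuous_on UNIV h" for h :: "real^'n \<Rightarrow> real" and z
    using continuous_on_compose2[OF that continuous_on_diff[OF continuous_on_id continuous_on_const]] by auto
  have "(LBINT x. gk2 i j s (x - y) * gk2 i j t (x - y') + gk3 i j t (x - y') * gk1 i s (x - y)) = 0"
  proof (rule integral_directional_derivative_eq_0[where f="\<lambda>x. gk1 i s (x - y) * gk2 i j t (x - y')" and v="axis j 1"])
    show "((\<lambda>ta. gk1 i s (x + ta *\<^sub>R axis j 1 - y) * gk2 i j t (x + ta *\<^sub>R axis j 1 - y')) has_real_derivative
          gk2 i j s (x - y) * gk2 i j t (x - y') + gk3 i j t (x - y') * gk1 i s (x - y)) (at 0)" for x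
      unfolding sh using DERIV_mult[OF gk1_deriv[OF s(1), of i "x - y" j] gk2_deriv2[OF s(2), of i j "x - y'"]] by simp
    show "integrable lborel (\<lambda>x. gk2 i j s (x - y) * gk2 i j t (x - y') + gk3 i j t (x - y') * gk1 i s (x - y))"
      using I[OF G(2,3), of i j y i j y'] I[OF G(1,4), of i y i j y'] by (simp add: mult.commute)
  qed (auto intro!: I G continuous_intros c continuous_on_gk1 continuous_on_gk2 continuous_on_gk3 s)
  moreover have "(LBINT x. gk2 i i s (x - y) * gk2 j j t (x - y') + gk3 i j t (x - y') * gk1 i s (x - y)) = 0"
  proof (rule integral_directional_derivative_eq_0[where f="\<lambda>x. gk1 i s (x - y) * gk2 j j t (x - y')" and v="axis i 1"])
    show "((\<lambda>ta. gk1 i s (x + ta *\<^sub>R axis i 1 - y) * gk2 j j t (x + ta *\<^sub>R axis i 1 - y')) has_real_derivative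
          gk2 i i s (x - y) * gk2 j j t (x - y') + gk3 i j t (x - y') * gk1 i s (x - y)) (at 0)" for x
      unfolding sh using DERIV_mult[OF gk1_deriv[OF s(1), of i "x - y" i] gk2_deriv1[OF s(2), of j "x - y'" i]] by simp
    show "integrable lborel (\<lambda>x. gk2 i i s (x - y) * gk2 j j t (x - y') + gk3 i j t (x - y') * gk1 i s (x - y))"
      using I[OF G(2,3), of i i y j j y'] I[OF G(1,4), of i y i j y'] by (simp add: mult.commute)
  qed (auto intro!: I G continuous_intros c continuous_on_gk1 continuous_on_gk2 continuous_on_gk3 s)
  moreover have "integrable lborel (\<lambda>x. gk3 i j t (x - y') * gk1 i s (x - y))"
    using I[OF G(1,4), of i y i j y'] by (simp add: mult.commute)
  ultimately show ?thesis using I[OF G(2,3), of i j y i j y'] I[OF G(2,3), of i i y j j y'] by simp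
qed

section \<open>Riesz potentials\<close>

lemma nn_integral_powr_small:
  assumes "0 < a" "0 < T"
  shows "(\<integral>\<^sup>+s. ennreal (indicator {0<..T} s * s powr (a - 1)) \<partial>lborel) = ennreal (T powr a / a)"
proof -
  have "((\<lambda>s. s powr (a - 1)) has_integral (T powr a / a)) {0..T}"
    using has_integral_powr_from_0[of "a - 1" T] assms by simp
  moreover have "(\<lambda>s. s powr (a - 1) * indicator {0..T} s) = (\<lambda>s. if s \<in> {0..T} then s powr (a - 1) else 0)"
    by (auto simp: fun_eq_iff)
  ultimately have "((\<lambda>s. s powr (a - 1) * indicator {0..T} s) has_integral (T powr a / a)) UNIV"
    by (simp only: has_integral_restrict_UNIV)
  then have "(\<integral>\<^sup>+s. ennreal (s powr (a - 1) * indicator {0..T} s) \<partial>lborel) = ennreal (T powr a / a)"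
    by (intro nn_integral_has_integral_lborel) auto
  also have "(\<lambda>s. ennreal (s powr (a - 1) * indicator {0..T} s)) = (\<lambda>s. ennreal (indicator {0<..T} s * s powr (a - 1)))"
    by (auto simp: fun_eq_iff indicator_def)
  finally show ?thesis .
qed

lemma nn_integral_powr_large:
  assumes "b < 0" "0 < T"
  shows "(\<integral>\<^sup>+s. ennreal (indicator {T..} s * s powr (b - 1)) \<partial>lborel) = ennreal (T powr b / (- b))"
proof -
  have "((\<lambda>s. s powr (b - 1)) has_integral (T powr b / (- b))) {T..}"
    using has_integral_powr_to_inf[of "b - 1" T] assms by simp
  moreover have "(\<lambda>s. s powr (b - 1) * indicator {T..} s) = (\<lambda>s. if s \<in> {T..} then s powr (b - 1) else 0)"
    by (auto simp: fun_eq_iff)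
  ultimately have "((\<lambda>s. s powr (b - 1) * indicator {T..} s) has_integral (T powr b / (- b))) UNIV"
    by (simp only: has_integral_restrict_UNIV)
  then have "(\<integral>\<^sup>+s. ennreal (s powr (b - 1) * indicator {T..} s) \<partial>lborel) = ennreal (T powr b / (- b))"
    by (intro nn_integral_has_integral_lborel) auto
  then show ?thesis by (simp add: mult.commute)
qed

text \<open>The doubled time is that of the majorants of \<open>gk\<close> and \<open>gk1\<close>,
  so one operator controls the potentials for both u and its gradient. Values in
  \<open>ennreal\<close> allow every exchange of integrals before anything is known to be
  finite.\<close>

definition heat :: "real \<Rightarrow> (real^'n \<Rightarrow> real) \<Rightarrow> real^'n \<Rightarrow> ennreal" where
  "heat s f x = (\<integral>\<^sup>+y. ennreal (gk (2 * s) (x - y)) * ennreal (f y) \<partial>lborel)"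

text \<open>Up to a constant factor this is the Riesz potential of order 2a.\<close>

definition riesz :: "real \<Rightarrow> (real^'n \<Rightarrow> real) \<Rightarrow> real^'n \<Rightarrow> ennreal" where
  "riesz a f x = (\<integral>\<^sup>+s. ennreal (indicator {0<..} s * s powr (a - 1)) * heat s f x \<partial>lborel)"

lemma measurable_heat[measurable (raw)]:
  assumes [measurable]: "f \<in> borel_measurable borel" "g \<in> borel_measurable M" "h \<in> borel_measurable M"
  shows "(\<lambda>p. heat (g p) f (h p)) \<in> borel_measurable M"
  unfolding heat_def by measurable

lemma measurable_riesz[measurable]:
  assumes [measurable]: "f \<in> borel_measurable borel"
  shows "riesz a f \<in> borel_measurable borel"
proof -
  have "(\<lambda>x. \<integral>\<^sup>+s. ennreal (indicator {0<..} s * s powr (a - 1)) * heat s f x \<partial>lborel) \<in> borel_measurable borel"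
    by measurable
  then show ?thesis by (simp add: riesz_def[abs_def])
qed

lemma nn_integral_gk_reflect: "0 < s \<Longrightarrow> (\<integral>\<^sup>+y. ennreal (gk (2 * s) (x - y)) \<partial>lborel) = 1"
  using nn_integral_reflect[of "\<lambda>z. ennreal (gk (2 * s) z)" x] nn_integral_gk[of "2 * s"] by simp

lemma nn_integral_gk_shift: "0 < s \<Longrightarrow> (\<integral>\<^sup>+x. ennreal (gk (2 * s) (x - y)) \<partial>lborel) = 1"
  using nn_integral_shift[of "\<lambda>z. ennreal (gk (2 * s) z)" y] nn_integral_gk[of "2 * s"] by simp

lemma heat_le_trunc:
  assumes [measurable]: "f \<in> borel_measurable borel" and f: "\<And>y. 0 \<le> f y" and s: "0 < s" and h: "0 \<le> h"
  shows "heat s f x \<le> ennreal h + heat s (\<lambda>y. f y * indicator {y. h < f y} y) x"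
proof -
  have "heat s f x \<le> (\<integral>\<^sup>+y. ennreal h * ennreal (gk (2 * s) (x - y)) + ennreal (gk (2 * s) (x - y)) * ennreal (f y * indicator {y. h < f y} y) \<partial>lborel)"
    unfolding heat_def
  proof (rule nn_integral_mono)
    fix y
    have "ennreal (f y) \<le> ennreal h + ennreal (f y * indicator {y. h < f y} y)"
      using f[of y] h by (auto simp: indicator_def not_less ennreal_leI)
    then have "ennreal (gk (2 * s) (x - y)) * ennreal (f y) \<le> ennreal (gk (2 * s) (x - y)) * (ennreal h + ennreal (f y * indicator {y. h < f y} y))"
      by (intro mult_left_mono) auto
    then show "ennreal (gk (2 * s) (x - y)) * ennreal (f y) \<le> ennreal h * ennreal (gk (2 * s) (x - y)) + ennreal (gk (2 * s) (x - y)) * ennreal (f y * indicator {y. h < f y} y)"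
      by (simp add: distrib_left mult.commute)
  qed
  also have "\<dots> = ennreal h + heat s (\<lambda>y. f y * indicator {y. h < f y} y) x"
    unfolding heat_def by (subst nn_integral_add) (auto simp: nn_integral_cmult nn_integral_gk_reflect[OF s])
  finally show ?thesis .
qed

text \<open>The kernel has mass 1 and supremum of order s^-d, so its mean square norm is of order
  s^(-d/2); this is Cauchy-Schwarz, in the form of Young's inequality with a tuned weight.\<close>

lemma heat_le_decay:
  fixes f :: "real^'n \<Rightarrow> real"
  assumes [measurable]: "f \<in> borel_measurable borel" and f: "\<And>y. 0 \<le> f y" and s: "0 < s"
    and B: "0 < B" "(\<integral>\<^sup>+y. ennreal ((f y)^2) \<partial>lborel) \<le> ennreal B"
  defines "d \<equiv> real CARD('n) / 2" and "c \<equiv> (4 * pi) powr (- (real CARD('n) / 2))"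
  shows "heat s f x \<le> ennreal ((c + 1) / 2 * sqrt B * s powr (- (d / 2)))"
proof -
  \<comment> \<open>Weight for Young's inequality: with this choice e * s^-d and B / e are both
    equal to sqrt B * s^(-d/2).\<close>
  define e where "e = sqrt B * s powr (d / 2)"
  have e: "e > 0" using B s by (simp add: e_def)
  have c: "c > 0" by (simp add: c_def)
  have gc: "gk (2 * s) z \<le> c * s powr (- d)" for z :: "real^'n"
    using gk_le[of "2 * s" z] s by (simp add: c_def d_def powr_mult[symmetric] mult_ac)
  have "heat s f x \<le> (\<integral>\<^sup>+y. ennreal (e / 2 * c * s powr (- d)) * ennreal (gk (2 * s) (x - y)) + ennreal (1 / (2 * e)) * ennreal ((f y)^2) \<partial>lborel)"
    unfolding heat_def
  proof (rule nn_integral_mono)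
    fix y
    define k where "k = gk (2 * s) (x - y)"
    have k: "k \<ge> 0" by (simp add: k_def gk_nonneg)
    have "0 \<le> (e * k - f y)^2" by simp
    then have "2 * e * (k * f y) \<le> e^2 * (k * k) + (f y)^2" by (simp add: power2_eq_square algebra_simps)
    also have "\<dots> \<le> e^2 * (k * (c * s powr (- d))) + (f y)^2"
      using gc[of "x - y"] k by (intro add_right_mono mult_left_mono) (auto simp: k_def)
    also have "\<dots> = 2 * e * (e / 2 * c * s powr (- d) * k + 1 / (2 * e) * (f y)^2)"
      using e by (simp add: field_simps power2_eq_square)
    finally have "k * f y \<le> e / 2 * c * s powr (- d) * k + 1 / (2 * e) * (f y)^2"
      using e by (subst (asm) mult_le_cancel_left_pos) auto
    then have "ennreal (k * f y) \<le> ennreal (e / 2 * c * s powr (- d) * k + 1 / (2 * e) * (f y)^2)" by (rule ennreal_leI)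
    also have "\<dots> = ennreal (e / 2 * c * s powr (- d)) * ennreal k + ennreal (1 / (2 * e)) * ennreal ((f y)^2)"
      using e c k by (subst ennreal_plus) (auto simp: ennreal_mult'[symmetric] intro!: mult_nonneg_nonneg)
    finally show "ennreal (gk (2 * s) (x - y)) * ennreal (f y) \<le> ennreal (e / 2 * c * s powr (- d)) * ennreal (gk (2 * s) (x - y)) + ennreal (1 / (2 * e)) * ennreal ((f y)^2)"
      using k f[of y] by (simp add: ennreal_mult'[symmetric] k_def)
  qed
  also have "\<dots> = ennreal (e / 2 * c * s powr (- d)) + ennreal (1 / (2 * e)) * (\<integral>\<^sup>+y. ennreal ((f y)^2) \<partial>lborel)"
    by (subst nn_integral_add) (auto simp: nn_integral_cmult nn_integral_gk_reflect[OF s])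
  also have "\<dots> \<le> ennreal (e / 2 * c * s powr (- d)) + ennreal (1 / (2 * e)) * ennreal B"
    by (intro add_left_mono mult_left_mono B) auto
  also have "\<dots> = ennreal (e / 2 * c * s powr (- d) + 1 / (2 * e) * B)"
    using e c B by (simp add: ennreal_mult'[symmetric] ennreal_plus[symmetric] del: ennreal_plus)
  also have "e / 2 * c * s powr (- d) + 1 / (2 * e) * B = (c + 1) / 2 * sqrt B * s powr (- (d / 2))"
  proof -
    have 1: "s powr (d/2) * s powr (- d) = s powr (- (d / 2))" by (simp add: powr_add[symmetric])
    have 2: "e / 2 * c * s powr (- d) = c / 2 * sqrt B * s powr (- (d / 2))"
      using 1 by (simp add: e_def)
    have "1 / (2 * e) * B = sqrt B / 2 * s powr (- (d/2))"
      using B s by (simp add: e_def powr_minus field_simps)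
    with 2 show ?thesis by (simp add: field_simps)
  qed
  finally show ?thesis .
qed

lemma nn_integral_heat:
  assumes [measurable]: "f \<in> borel_measurable borel" and s: "0 < s"
  shows "(\<integral>\<^sup>+x. heat s f x \<partial>lborel) = (\<integral>\<^sup>+y. ennreal (f y) \<partial>lborel)"
proof -
  have "(\<integral>\<^sup>+x. heat s f x \<partial>lborel) = (\<integral>\<^sup>+y. (\<integral>\<^sup>+x. ennreal (gk (2 * s) (x - y)) * ennreal (f y) \<partial>lborel) \<partial>lborel)"
    unfolding heat_def by (rule lborel_pair.Fubini') measurable
  also have "\<dots> = (\<integral>\<^sup>+y. ennreal (f y) \<partial>lborel)"
    by (simp add: nn_integral_multc nn_integral_gk_shift[OF s])
  finally show ?thesis .
qed

text \<open>The time integral is split at T, and for times below T the function f is split at height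
  h. The low part of f and the large times together contribute at most the level K * h * T^a, so
  that exceeding twice this level forces the contribution \<open>S\<close> of the high part to
  exceed the level itself. Markov's inequality then applies to \<open>S\<close>, whose integral is
  T^a / a times that of the high part.\<close>

lemma riesz_distribution:
  fixes f :: "real^'n \<Rightarrow> real"
  assumes [measurable]: "f \<in> borel_measurable borel" and f: "\<And>y. 0 \<le> f y"
    and a: "0 < a" "4 * a < real CARD('n)"
    and B: "0 < B" "(\<integral>\<^sup>+y. ennreal ((f y)^2) \<partial>lborel) \<le> ennreal B" and h: "0 < h"
  defines "d \<equiv> real CARD('n) / 2" and "c \<equiv> (4 * pi) powr (- (real CARD('n) / 2))"
  defines "K \<equiv> 1 / a + (c + 1) / 2 / (d / 2 - a)" and "T \<equiv> (B / h^2) powr (1 / d)"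
  shows "emeasure lborel {x. ennreal (2 * (K * h * T powr a)) < riesz a f x}
      \<le> ennreal (1 / h) * (\<integral>\<^sup>+y. ennreal (f y * indicator {y. h < f y} y) \<partial>lborel)"
proof -
  define fh where "fh y = f y * indicator {y. h < f y} y" for y
  have [measurable]: "fh \<in> borel_measurable borel" unfolding fh_def[abs_def] by measurable
  define lam where "lam = K * h * T powr a"
  define S where "S x = (\<integral>\<^sup>+s. ennreal (indicator {0<..T} s * s powr (a - 1)) * heat s fh x \<partial>lborel)" for x
  have [measurable]: "S \<in> borel_measurable borel" unfolding S_def[abs_def] by measurable
  have T: "T > 0" using B h by (simp add: T_def)
  have d: "d / 2 - a > 0" "d > 0" using a by (auto simp: d_def)
  have c: "c > 0" by (simp add: c_def)
  have K: "K > 0" using a c d by (simp add: K_def add_pos_pos)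
  have lam: "lam > 0" using K h T by (simp add: lam_def)
  \<comment> \<open>Up to a constant, \<open>T\<close> is the time at which the decay estimate has
    fallen to the height h; hence both discarded contributions are multiples of h * T^a.\<close>
  have hT: "sqrt B * T powr (- (d / 2)) = h"
  proof -
    have "T powr (- (d/2)) = (B / h^2) powr (- (1 / 2))" using d by (simp add: T_def powr_powr)
    also have "\<dots> = 1 / sqrt (B / h^2)" using B h by (simp add: powr_minus powr_half_sqrt field_simps)
    finally show ?thesis using B h by (simp add: real_sqrt_divide)
  qed
  have le: "riesz a f x \<le> ennreal lam + S x" for x
  proof -
    have "riesz a f x \<le> (\<integral>\<^sup>+s. ennreal h * ennreal (indicator {0<..T} s * s powr (a - 1))
         + (ennreal (indicator {0<..T} s * s powr (a - 1)) * heat s fh x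
         + ennreal ((c + 1) / 2 * sqrt B) * ennreal (indicator {T..} s * s powr ((a - d / 2) - 1))) \<partial>lborel)"
      unfolding riesz_def
    proof (rule nn_integral_mono)
      fix s :: real
      consider "s \<le> 0" | "0 < s" "s \<le> T" | "T < s" by linarith
      then show "ennreal (indicator {0<..} s * s powr (a - 1)) * heat s f x \<le> ennreal h * ennreal (indicator {0<..T} s * s powr (a - 1))
         + (ennreal (indicator {0<..T} s * s powr (a - 1)) * heat s fh x
         + ennreal ((c + 1) / 2 * sqrt B) * ennreal (indicator {T..} s * s powr ((a - d / 2) - 1)))"
      proof cases
        case 1 then show ?thesis by simp
      next
        case 2
        have "heat s f x \<le> ennreal h + heat s fh x"
          unfolding fh_def using 2 f h by (intro heat_le_trunc) auto
        then have "ennreal (s powr (a - 1)) * heat s f x \<le> ennreal (s powr (a - 1)) * (ennreal h + heat s fh x)"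
          by (rule mult_left_mono) simp
        then have "ennreal (s powr (a - 1)) * heat s f x \<le> ennreal h * ennreal (s powr (a - 1)) + ennreal (s powr (a - 1)) * heat s fh x"
          by (simp add: distrib_left mult.commute)
        then show ?thesis using 2 by (simp add: add.assoc[symmetric] add_increasing2)
      next
        case 3
        then have s: "s > 0" using T by simp
        have "heat s f x \<le> ennreal ((c + 1) / 2 * sqrt B * s powr (- (d / 2)))"
          unfolding c_def d_def using f s B by (intro heat_le_decay) auto
        then have "ennreal (s powr (a - 1)) * heat s f x \<le> ennreal (s powr (a - 1)) * ennreal ((c + 1) / 2 * sqrt B * s powr (- (d / 2)))"
          by (rule mult_left_mono) simp
        also have "\<dots> = ennreal ((c + 1) / 2 * sqrt B * (s powr (a - 1) * s powr (- (d / 2))))"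
          by (simp add: ennreal_mult'[symmetric] mult_ac)
        also have "s powr (a - 1) * s powr (- (d / 2)) = s powr ((a - d / 2) - 1)"
          by (simp add: powr_add[symmetric] algebra_simps)
        also have "ennreal ((c + 1) / 2 * sqrt B * s powr ((a - d / 2) - 1)) = ennreal ((c + 1) / 2 * sqrt B) * ennreal (s powr ((a - d / 2) - 1))"
          using c B by (intro ennreal_mult) auto
        finally show ?thesis using 3 s by simp
      qed
    qed
    also have "\<dots> = ennreal h * ennreal (T powr a / a) + (S x + ennreal ((c + 1) / 2 * sqrt B) * ennreal (T powr (a - d / 2) / (- (a - d / 2))))"
      using nn_integral_powr_small[OF a(1) T] nn_integral_powr_large[of "a - d/2" T] d T
      by (subst nn_integral_add, measurable, subst nn_integral_add, measurable) (simp add: nn_integral_cmult S_def)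
    also have "\<dots> = ennreal (h * (T powr a / a)) + ennreal ((c + 1) / 2 * sqrt B * (T powr (a - d / 2) / (d / 2 - a))) + S x"
      using h a c B d by (simp add: ennreal_mult'[symmetric] add_ac)
    also have "ennreal (h * (T powr a / a)) + ennreal ((c + 1) / 2 * sqrt B * (T powr (a - d / 2) / (d / 2 - a)))
       = ennreal (h * (T powr a / a) + (c + 1) / 2 * sqrt B * (T powr (a - d / 2) / (d / 2 - a)))"
      using h a c B d by (intro ennreal_plus[symmetric]) auto
    also have "(c + 1) / 2 * sqrt B * (T powr (a - d / 2) / (d / 2 - a)) = (c + 1) / 2 * (sqrt B * T powr (- (d/2))) * T powr a / (d / 2 - a)"
    proof -
      have "T powr (a - d / 2) = T powr (- (d / 2)) * T powr a" by (simp add: powr_add[symmetric])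
      then show ?thesis by (simp add: mult.assoc)
    qed
    also have "h * (T powr a / a) + (c + 1) / 2 * (sqrt B * T powr (- (d/2))) * T powr a / (d / 2 - a) = lam"
      unfolding hT lam_def K_def by (simp add: algebra_simps)
    finally show ?thesis .
  qed
  have "{x. ennreal (2 * lam) < riesz a f x} \<subseteq> {x\<in>UNIV. 1 \<le> ennreal (1 / lam) * S x}"
  proof safe
    fix x assume *: "ennreal (2 * lam) < riesz a f x"
    have "ennreal lam \<le> S x"
    proof (rule ccontr)
      assume "\<not> ennreal lam \<le> S x"
      then have "ennreal lam + S x \<le> ennreal lam + ennreal lam" by (intro add_left_mono) auto
      with le[of x] * lam show False by (simp add: ennreal_plus[symmetric] del: ennreal_plus)
    qed
    then have "ennreal (1 / lam) * ennreal lam \<le> ennreal (1 / lam) * S x" by (rule mult_left_mono) simp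
    then show "1 \<le> ennreal (1 / lam) * S x" using lam by (simp add: ennreal_mult'[symmetric])
  qed auto
  then have "emeasure lborel {x. ennreal (2 * lam) < riesz a f x} \<le> emeasure lborel {x\<in>UNIV. 1 \<le> ennreal (1 / lam) * S x}"
    by (intro emeasure_mono) measurable
  also have "\<dots> \<le> ennreal (1 / lam) * (\<integral>\<^sup>+x. S x * indicator UNIV x \<partial>lborel)"
    by (rule nn_integral_Markov_inequality) auto
  also have "(\<integral>\<^sup>+x. S x * indicator UNIV x \<partial>lborel) = (\<integral>\<^sup>+s. (\<integral>\<^sup>+x. ennreal (indicator {0<..T} s * s powr (a - 1)) * heat s fh x \<partial>lborel) \<partial>lborel)"
    unfolding S_def by (simp, rule lborel_pair.Fubini') measurable
  also have "\<dots> = (\<integral>\<^sup>+s. ennreal (indicator {0<..T} s * s powr (a - 1)) * (\<integral>\<^sup>+y. ennreal (fh y) \<partial>lborel) \<partial>lborel)"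
  proof (intro nn_integral_cong)
    fix s :: real
    show "(\<integral>\<^sup>+x. ennreal (indicator {0<..T} s * s powr (a - 1)) * heat s fh x \<partial>lborel) = ennreal (indicator {0<..T} s * s powr (a - 1)) * (\<integral>\<^sup>+y. ennreal (fh y) \<partial>lborel)"
      by (cases "0 < s") (simp_all add: nn_integral_cmult nn_integral_heat)
  qed
  also have "\<dots> = ennreal (T powr a / a) * (\<integral>\<^sup>+y. ennreal (fh y) \<partial>lborel)"
    using nn_integral_powr_small[OF a(1) T] by (simp add: nn_integral_multc)
  also have "ennreal (1 / lam) * (ennreal (T powr a / a) * (\<integral>\<^sup>+y. ennreal (fh y) \<partial>lborel)) = ennreal (1 / lam * (T powr a / a)) * (\<integral>\<^sup>+y. ennreal (fh y) \<partial>lborel)"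
    using lam a by (subst ennreal_mult) (auto simp: mult.assoc)
  also have "\<dots> \<le> ennreal (1 / h) * (\<integral>\<^sup>+y. ennreal (fh y) \<partial>lborel)"
  proof (intro mult_right_mono ennreal_leI)
    \<comment> \<open>The summand 1 / a of \<open>K\<close> cancels the 1 / a that the time integral
      over small times produces.\<close>
    have "a * K \<ge> 1" using a c d by (simp add: K_def distrib_left)
    moreover have "1 / lam * (T powr a / a) = 1 / (a * K * h)" using T a K h by (simp add: lam_def field_simps)
    ultimately show "1 / lam * (T powr a / a) \<le> 1 / h" using h a K by (simp add: field_simps)
  qed simp
  finally show ?thesis by (simp add: lam_def fh_def)
qed

lemma nn_integral_two_id: "0 \<le> r \<Longrightarrow> (\<integral>\<^sup>+h. ennreal (2 * h) * indicator {0<..<r} h \<partial>lborel) = ennreal (r^2)"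
proof -
  assume r: "0 \<le> r"
  have "AE h in lborel. ennreal (2 * h) * indicator {0<..<r} h = ennreal (2 * h) * indicator {0..r} h"
    using AE_lborel_singleton[of r] AE_lborel_singleton[of 0] by eventually_elim (auto simp: indicator_def)
  then have "(\<integral>\<^sup>+h. ennreal (2 * h) * indicator {0<..<r} h \<partial>lborel) = (\<integral>\<^sup>+h. ennreal (2 * h) * indicator {0..r} h \<partial>lborel)"
    by (rule nn_integral_cong_AE)
  also have "\<dots> = ennreal (r^2 - 0^2)"
    using r by (intro nn_integral_FTC_Icc[where F="\<lambda>h. h^2", simplified]) (auto intro!: derivative_eq_intros)
  finally show ?thesis by simp
qed

text \<open>Layer-cake integration of the distribution estimate. Substituting the level belonging to
  the height h, the integral of v^q becomes m times the integral of 2 h times the measure of {v^q >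
  m h^2}; the estimate replaces this measure by the integral of f over {f > h} divided by h, and a
  second exchange of integrals gives 2 m times the integral of f^2. Because f is cut at the same h,
  this gives the strong bound without a separate interpolation step.\<close>

theorem riesz_Lq_bound:
  fixes f :: "real^'n \<Rightarrow> real"
  assumes fm[measurable]: "f \<in> borel_measurable borel" and f: "\<And>y. 0 \<le> f y"
    and a: "0 < a" "4 * a < real CARD('n)"
    and B: "0 < B" "(\<integral>\<^sup>+y. ennreal ((f y)^2) \<partial>lborel) \<le> ennreal B"
  defines "d \<equiv> real CARD('n) / 2" and "c \<equiv> (4 * pi) powr (- (real CARD('n) / 2))"
  defines "K \<equiv> 1 / a + (c + 1) / 2 / (d / 2 - a)" and "q \<equiv> 2 * real CARD('n) / (real CARD('n) - 4 * a)"
  shows "AE x in lborel. riesz a f x < \<infinity>"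
    and "(\<integral>\<^sup>+x. ennreal (enn2real (riesz a f x) powr q) \<partial>lborel) \<le> ennreal (2 * (2 * K) powr q * B powr (q / 2))"
proof -
  define T where "T h = (B / h^2) powr (1 / d)" for h
  define fh where "fh h y = (if h < f y then f y else 0)" for h y
  have fh_eq: "f y * indicator {y. h < f y} y = fh h y" for h y by (simp add: fh_def)
  have [measurable (raw)]: "(\<lambda>p. fh (F p) (G p)) \<in> borel_measurable N"
    if [measurable]: "F \<in> borel_measurable N" "G \<in> borel_measurable N" for F G and N :: "'z measure"
    unfolding fh_def by measurable
  have d: "d / 2 - a > 0" "d > 0" using a by (auto simp: d_def)
  have c: "c > 0" by (simp add: c_def)
  have K: "K > 0" using a c d by (simp add: K_def add_pos_pos)
  have q: "q > 0" "a * q / d = q / 2 - 1" using a by (auto simp: q_def d_def field_simps)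
  have dist: "emeasure lborel {x. ennreal (2 * (K * h * T h powr a)) < riesz a f x}
      \<le> ennreal (1 / h) * (\<integral>\<^sup>+y. ennreal (fh h y) \<partial>lborel)" if "0 < h" for h
    using riesz_distribution[OF fm f a B that] by (simp add: K_def d_def c_def T_def fh_eq)
  show "AE x in lborel. riesz a f x < \<infinity>"
  proof -
    \<comment> \<open>The infinite set lies above every level, and f is at most f^2 / h where f > h.
      So its measure is at most B / h^2 for every h.\<close>
    have le: "emeasure lborel {x. riesz a f x = \<infinity>} \<le> ennreal (B / h^2)" if h: "0 < h" for h
    proof -
      have "emeasure lborel {x. riesz a f x = \<infinity>} \<le> emeasure lborel {x. ennreal (2 * (K * h * T h powr a)) < riesz a f x}"
        by (intro emeasure_mono) (auto simp: less_top)
      also note dist[OF h]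
      also have "ennreal (1 / h) * (\<integral>\<^sup>+y. ennreal (fh h y) \<partial>lborel) \<le> ennreal (1 / h) * (\<integral>\<^sup>+y. ennreal (1 / h) * ennreal ((f y)^2) \<partial>lborel)"
      proof (intro mult_left_mono nn_integral_mono)
        fix y
        have "fh h y \<le> 1 / h * (f y)^2" using h f[of y] by (auto simp: fh_def indicator_def field_simps power2_eq_square)
        then show "ennreal (fh h y) \<le> ennreal (1 / h) * ennreal ((f y)^2)" using h by (simp add: ennreal_mult'[symmetric] ennreal_leI)
      qed simp
      also have "\<dots> = ennreal (1 / h) * (ennreal (1 / h) * (\<integral>\<^sup>+y. ennreal ((f y)^2) \<partial>lborel))"
        by (simp add: nn_integral_cmult)
      also have "\<dots> \<le> ennreal (1 / h) * (ennreal (1 / h) * ennreal B)" by (intro mult_left_mono B) auto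
      also have "\<dots> = ennreal (B / h^2)" using h B by (simp add: ennreal_mult'[symmetric] power2_eq_square)
      finally show ?thesis .
    qed
    have lim: "(\<lambda>n. ennreal (B / (real (Suc n))^2)) \<longlonglongrightarrow> ennreal 0"
      by (intro tendsto_ennrealI) real_asymp
    have "emeasure lborel {x. riesz a f x = \<infinity>} \<le> ennreal 0"
      by (rule LIMSEQ_le_const[OF lim]) (intro exI[of _ 0] allI impI le, simp)
    then have "emeasure lborel {x. riesz a f x = \<infinity>} = 0" by simp
    then show ?thesis
      by (intro AE_I[where N="{x. riesz a f x = \<infinity>}"]) (auto simp: not_less top_unique)
  qed
  define v where "v x = enn2real (riesz a f x)" for x
  have [measurable]: "v \<in> borel_measurable borel" unfolding v_def[abs_def] by measurable
  have v: "v x \<ge> 0" for x by (simp add: v_def)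
  define m where "m = (2 * K) powr q * B powr (q / 2 - 1)"
  have m: "m > 0" using K B by (simp add: m_def)
  \<comment> \<open>This fixes q: the level is proportional to h^(1 - 2 a / d), and its q-th power
    is proportional to h^2 exactly when q = 2 n / (n - 4 a).\<close>
  have mh: "m * h^2 = (2 * (K * h * T h powr a)) powr q" if h: "h > 0" for h
  proof -
    have "T h powr a = (B / h^2) powr (a / d)" by (simp add: T_def powr_powr)
    then have "(2 * (K * h * T h powr a)) powr q = (2 * K) powr q * h powr q * (B / h^2) powr (a * q / d)"
      using K h B by (simp add: powr_mult powr_powr mult_ac)
    also have "(B / h^2) powr (a * q / d) = B powr (q / 2 - 1) * (h^2) powr (- (q / 2 - 1))"
    proof -
      have "(B / h^2) powr p = B powr p * (h^2) powr (- p)" for p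
        using B h by (simp add: powr_divide powr_minus_divide)
      then show ?thesis unfolding q(2) .
    qed
    also have "(h^2) powr (- (q / 2 - 1)) = h powr (2 - q)"
      using h by (simp add: powr_powr powr_numeral[symmetric] del: powr_numeral)
    finally have "(2 * (K * h * T h powr a)) powr q = m * (h powr q * h powr (2 - q))" by (simp add: m_def)
    also have "h powr q * h powr (2 - q) = h^2" using h by (simp add: powr_add[symmetric])
    finally show ?thesis by simp
  qed
  have sub: "{x. m * h^2 < v x powr q} \<subseteq> {x. ennreal (2 * (K * h * T h powr a)) < riesz a f x}" if h: "h > 0" for h
  proof safe
    fix x assume "m * h^2 < v x powr q"
    then have *: "(2 * (K * h * T h powr a)) powr q < v x powr q" by (simp add: mh[OF h])
    have l0: "0 < 2 * (K * h * T h powr a)" using K h B by (simp add: T_def)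
    have lt: "2 * (K * h * T h powr a) < v x"
      using * l0 q v[of x] by (metis not_le powr_mono2 less_imp_le)
    have "riesz a f x \<noteq> \<infinity>" using lt l0 by (auto simp: v_def)
    then have "riesz a f x = ennreal (v x)" by (simp add: v_def less_top)
    with lt l0 show "ennreal (2 * (K * h * T h powr a)) < riesz a f x" by (simp add: ennreal_lessI)
  qed
  have "(\<integral>\<^sup>+x. ennreal (v x powr q) \<partial>lborel) = (\<integral>\<^sup>+x. ennreal m * (\<integral>\<^sup>+h. ennreal (2 * h) * (if 0 < h \<and> m * h^2 < v x powr q then 1 else 0) \<partial>lborel) \<partial>lborel)"
  proof (rule nn_integral_cong)
    fix x
    define r where "r = sqrt (v x powr q / m)"
    have r: "r \<ge> 0" "r^2 = v x powr q / m" using m by (auto simp: r_def)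
    have "(if 0 < h \<and> m * h^2 < v x powr q then 1 else 0) = (indicator {0<..<r} h :: ennreal)" for h
    proof -
      have "h < r \<longleftrightarrow> m * h^2 < v x powr q" if "0 < h"
      proof -
        have "h < r \<longleftrightarrow> h^2 < r^2" using that r by (meson power2_less_imp_less power_strict_mono less_imp_le pos2)
        then show ?thesis using r m by (simp add: field_simps)
      qed
      then show ?thesis by (auto simp: indicator_def)
    qed
    then have "(\<integral>\<^sup>+h. ennreal (2 * h) * (if 0 < h \<and> m * h^2 < v x powr q then 1 else 0) \<partial>lborel) = ennreal (r^2)"
      using nn_integral_two_id[OF r(1)] by simp
    then show "ennreal (v x powr q) = ennreal m * (\<integral>\<^sup>+h. ennreal (2 * h) * (if 0 < h \<and> m * h^2 < v x powr q then 1 else 0) \<partial>lborel)"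
      using m r by (simp add: ennreal_mult'[symmetric])
  qed
  also have "\<dots> = ennreal m * (\<integral>\<^sup>+x. (\<integral>\<^sup>+h. ennreal (2 * h) * (if 0 < h \<and> m * h^2 < v x powr q then 1 else 0) \<partial>lborel) \<partial>lborel)"
    by (rule nn_integral_cmult) measurable
  also have "(\<integral>\<^sup>+x. (\<integral>\<^sup>+h. ennreal (2 * h) * (if 0 < h \<and> m * h^2 < v x powr q then 1 else 0) \<partial>lborel) \<partial>lborel)
     = (\<integral>\<^sup>+h. (\<integral>\<^sup>+x. ennreal (2 * h) * (if 0 < h \<and> m * h^2 < v x powr q then 1 else 0) \<partial>lborel) \<partial>lborel)"
    by (rule lborel_pair.Fubini') measurable
  also have "\<dots> \<le> (\<integral>\<^sup>+h. 2 * (\<integral>\<^sup>+y. (if 0 < h then ennreal (fh h y) else 0) \<partial>lborel) \<partial>lborel)"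
  proof (rule nn_integral_mono)
    fix h :: real
    show "(\<integral>\<^sup>+x. ennreal (2 * h) * (if 0 < h \<and> m * h^2 < v x powr q then 1 else 0) \<partial>lborel) \<le> 2 * (\<integral>\<^sup>+y. (if 0 < h then ennreal (fh h y) else 0) \<partial>lborel)"
    proof (cases "0 < h")
      case False then show ?thesis by simp
    next
      case True
      have "(\<integral>\<^sup>+x. ennreal (2 * h) * (if 0 < h \<and> m * h^2 < v x powr q then 1 else 0) \<partial>lborel)
         = (\<integral>\<^sup>+x. ennreal (2 * h) * indicator {x. m * h^2 < v x powr q} x \<partial>lborel)"
        using True by (intro nn_integral_cong) (auto simp: indicator_def)
      also have "\<dots> = ennreal (2 * h) * emeasure lborel {x. m * h^2 < v x powr q}"
        by (simp add: nn_integral_cmult)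
      also have "\<dots> \<le> ennreal (2 * h) * (ennreal (1 / h) * (\<integral>\<^sup>+y. ennreal (fh h y) \<partial>lborel))"
        by (intro mult_left_mono order_trans[OF emeasure_mono[OF sub[OF True]] dist[OF True]]) auto
      also have "\<dots> = ennreal (2 * h * (1 / h)) * (\<integral>\<^sup>+y. ennreal (fh h y) \<partial>lborel)"
      proof -
        have "ennreal (2 * h) * ennreal (1 / h) = ennreal (2 * h * (1 / h))" using True by (intro ennreal_mult[symmetric]) auto
        then show ?thesis by (simp only: mult.assoc[symmetric])
      qed
      also have "2 * h * (1 / h) = 2" using True by simp
      finally show ?thesis using True by simp
    qed
  qed
  also have "\<dots> = 2 * (\<integral>\<^sup>+h. (\<integral>\<^sup>+y. (if 0 < h then ennreal (fh h y) else 0) \<partial>lborel) \<partial>lborel)"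
    by (rule nn_integral_cmult) measurable
  also have "(\<integral>\<^sup>+h. (\<integral>\<^sup>+y. (if 0 < h then ennreal (fh h y) else 0) \<partial>lborel) \<partial>lborel) = (\<integral>\<^sup>+y. (\<integral>\<^sup>+h. (if 0 < h then ennreal (fh h y) else 0) \<partial>lborel) \<partial>lborel)"
    by (rule lborel_pair.Fubini') measurable
  also have "\<dots> = (\<integral>\<^sup>+y. ennreal ((f y)^2) \<partial>lborel)"
  proof (rule nn_integral_cong)
    fix y
    have "(\<integral>\<^sup>+h. (if 0 < h then ennreal (fh h y) else 0) \<partial>lborel) = (\<integral>\<^sup>+h. ennreal (f y) * indicator {0<..<f y} h \<partial>lborel)"
      by (intro nn_integral_cong) (auto simp: fh_def indicator_def)
    also have "\<dots> = ennreal (f y) * ennreal (f y)" using f[of y] by (simp add: nn_integral_cmult)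
    finally show "(\<integral>\<^sup>+h. (if 0 < h then ennreal (fh h y) else 0) \<partial>lborel) = ennreal ((f y)^2)"
      using f[of y] by (simp add: ennreal_mult'[symmetric] power2_eq_square)
  qed
  also have "ennreal m * (2 * (\<integral>\<^sup>+y. ennreal ((f y)^2) \<partial>lborel)) \<le> ennreal m * (2 * ennreal B)"
    by (intro mult_left_mono B) auto
  also have "\<dots> = ennreal (m * (2 * B))" using m B by (simp add: ennreal_mult)
  also have "m * (2 * B) = 2 * (2 * K) powr q * B powr (q / 2)"
    using B by (simp add: m_def powr_diff)
  finally show "(\<integral>\<^sup>+x. ennreal (enn2real (riesz a f x) powr q) \<partial>lborel) \<le> ennreal (2 * (2 * K) powr q * B powr (q / 2))"
    by (simp add: v_def mult_left_mono)
qed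

section \<open>Test functions\<close>

text \<open>\<open>psi 0\<close> is the standard smooth function that is flat at 0. The denominators
  t^m are carried along because they close the family under differentiation.\<close>

definition psi :: "nat \<Rightarrow> real \<Rightarrow> real" where
  "psi m t = (if t > 0 then exp (- 1 / t) / t ^ m else 0)"

lemma psi_nonneg: "0 \<le> psi m t" by (simp add: psi_def)

lemma psi_pos: "0 < t \<Longrightarrow> 0 < psi m t" by (simp add: psi_def)

lemma power_div_fact_le_exp: "0 \<le> (a::real) \<Longrightarrow> a ^ k / fact k \<le> exp a"
proof -
  assume a: "0 \<le> a"
  have "a ^ k / fact k = (\<Sum>n\<in>{k}. a ^ n /\<^sub>R fact n)" by (simp add: field_simps)
  also have "\<dots> \<le> exp a" unfolding exp_def using a by (intro sum_le_suminf summable_exp_generic) auto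
  finally show ?thesis .
qed

text \<open>A single term of the exponential series at 1 / t dominates any power of 1 / t. The free
  exponent k gives the vanishing derivative at 0 (k = 2) and boundedness (k = 0).\<close>

lemma psi_le: "psi m t \<le> fact (m + k) * \<bar>t\<bar> ^ k"
proof (cases "t > 0")
  case True
  have "(1 / t) ^ (m + k) / fact (m + k) \<le> exp (1 / t)"
    by (rule power_div_fact_le_exp) (use True in simp)
  then have "exp (- 1 / t) * (1 / t) ^ (m + k) \<le> fact (m + k)"
    by (simp add: exp_minus divide_le_eq mult.commute le_divide_eq inverse_eq_divide)
  then have "exp (- 1 / t) / t ^ m * (1 / t) ^ k \<le> fact (m + k)"
    by (simp add: power_add power_divide)
  then show ?thesis using True by (simp add: psi_def power_divide field_simps)
qed (simp add: psi_def)

lemma psi_deriv: "(psi m has_real_derivative (psi (m + 2) t - real m * psi (m + 1) t)) (at t)"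
proof -
  consider "t > 0" | "t < 0" | "t = 0" by linarith
  then show ?thesis
  proof cases
    case 1
    have "((\<lambda>t. exp (- 1 / t) / t ^ m) has_real_derivative (psi (m + 2) t - real m * psi (m + 1) t)) (at t)"
    proof (cases m)
      case 0
      then show ?thesis using 1
        by (auto intro!: derivative_eq_intros simp: psi_def field_simps power2_eq_square)
    next
      case (Suc k)
      have "((\<lambda>t. exp (- 1 / t) / t ^ Suc k) has_real_derivative
          (exp (- 1 / t) * (1 / t^2) * t ^ Suc k - exp (- 1 / t) * (real (Suc k) * t ^ k)) / (t ^ Suc k * t ^ Suc k)) (at t)"
        using 1 by (auto intro!: derivative_eq_intros simp del: power_Suc simp: power2_eq_square)
      also have "(exp (- 1 / t) * (1 / t^2) * t ^ Suc k - exp (- 1 / t) * (real (Suc k) * t ^ k)) / (t ^ Suc k * t ^ Suc k)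
          = psi (m + 2) t - real m * psi (m + 1) t"
        using 1 by (simp add: psi_def Suc diff_divide_distrib power2_eq_square)
      finally show ?thesis by (simp add: Suc)
    qed
    then show ?thesis
      by (rule has_field_derivative_transform_within_open[where S="{0<..}"]) (use 1 in \<open>auto simp: psi_def\<close>)
  next
    case 2
    have "((\<lambda>t. 0) has_real_derivative (psi (m + 2) t - real m * psi (m + 1) t)) (at t)"
      using 2 by (simp add: psi_def)
    then show ?thesis
      by (rule has_field_derivative_transform_within_open[where S="{..<0}"]) (use 2 in \<open>auto simp: psi_def\<close>)
  next
    case 3
    have "((\<lambda>h. (psi m (0 + h) - psi m 0) / h) \<longlongrightarrow> 0) (at 0)"
    proof (rule Lim_null_comparison)
      show "\<forall>\<^sub>F h in at 0. norm ((psi m (0 + h) - psi m 0) / h) \<le> fact (m + 2) * \<bar>h\<bar>"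
        unfolding eventually_at_filter
      proof (intro always_eventually allI impI)
        fix h :: real assume "h \<noteq> 0"
        have "psi m h \<le> fact (m + 2) * \<bar>h\<bar> ^ 2" by (rule psi_le)
        then have "psi m h / \<bar>h\<bar> \<le> fact (m + 2) * \<bar>h\<bar>" using \<open>h \<noteq> 0\<close> by (simp add: divide_le_eq power2_eq_square)
        then show "norm ((psi m (0 + h) - psi m 0) / h) \<le> fact (m + 2) * \<bar>h\<bar>"
          using psi_nonneg[of m h] by (simp add: psi_def[of m 0])
      qed
      have "((\<lambda>h::real. fact (m + 2) * \<bar>h\<bar>) \<longlongrightarrow> fact (m + 2) * \<bar>0\<bar>) (at 0)"
        by (intro tendsto_intros)
      then show "((\<lambda>h::real. fact (m + 2) * \<bar>h\<bar>) \<longlongrightarrow> 0) (at 0)" by simp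
    qed
    then show ?thesis using 3 by (simp add: DERIV_def psi_def)
  qed
qed

lemma continuous_psi: "continuous_on S (psi m)"
  by (meson psi_deriv DERIV_isCont continuous_at_imp_continuous_on)

lemma continuous_on_psi [continuous_intros]: "continuous_on S f \<Longrightarrow> continuous_on S (\<lambda>x. psi m (f x))"
  using continuous_on_compose2[OF continuous_psi[of UNIV m]] by auto

lemma measurable_psi[measurable]: "psi m \<in> borel_measurable borel"
  by (intro borel_measurable_continuous_onI continuous_psi)

lemma psi_bounded: "t \<le> 1 \<Longrightarrow> \<bar>psi m t\<bar> \<le> fact m"
  using psi_le[of m t 0] psi_nonneg[of m t] by simp

text \<open>Closure under partial derivatives gives smoothness of all members by induction on the number of derivatives.\<close>

inductive_set nice :: "(real^'n \<Rightarrow> real) set" where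
  nice_const: "(\<lambda>x. c) \<in> nice"
| nice_coord: "(\<lambda>x. x $ i) \<in> nice"
| nice_add: "f \<in> nice \<Longrightarrow> g \<in> nice \<Longrightarrow> (\<lambda>x. f x + g x) \<in> nice"
| nice_mult: "f \<in> nice \<Longrightarrow> g \<in> nice \<Longrightarrow> (\<lambda>x. f x * g x) \<in> nice"
| nice_psi: "f \<in> nice \<Longrightarrow> (\<lambda>x. psi m (f x)) \<in> nice"

lemma nice_deriv:
  "f \<in> nice \<Longrightarrow> \<exists>D. (\<forall>x. (f has_derivative D x) (at x)) \<and> (\<forall>i. (\<lambda>x. D x (axis i 1)) \<in> nice)"
proof (induction rule: nice.induct)
  case (nice_const c)
  show ?case by (rule exI[of _ "\<lambda>x h. 0"]) (auto intro: nice.intros)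
next
  case (nice_coord i)
  show ?case
    by (rule exI[of _ "\<lambda>x h. h $ i"]) (auto intro: nice.intros bounded_linear.has_derivative[OF bounded_linear_vec_nth] has_derivative_ident)
next
  case (nice_add f g)
  then obtain Df Dg where "\<forall>x. (f has_derivative Df x) (at x)" "\<forall>i. (\<lambda>x. Df x (axis i 1)) \<in> nice"
    "\<forall>x. (g has_derivative Dg x) (at x)" "\<forall>i. (\<lambda>x. Dg x (axis i 1)) \<in> nice" by blast
  then show ?case
    by (intro exI[of _ "\<lambda>x h. Df x h + Dg x h"]) (auto intro: nice.intros has_derivative_add)
next
  case (nice_mult f g)
  then obtain Df Dg where "\<forall>x. (f has_derivative Df x) (at x)" "\<forall>i. (\<lambda>x. Df x (axis i 1)) \<in> nice"
    "\<forall>x. (g has_derivative Dg x) (at x)" "\<forall>i. (\<lambda>x. Dg x (axis i 1)) \<in> nice" by blast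
  with nice_mult(1,2) show ?case
    by (intro exI[of _ "\<lambda>x h. f x * Dg x h + Df x h * g x"])
      (auto intro!: nice.nice_add nice.nice_mult has_derivative_mult)
next
  case (nice_psi f m)
  then obtain Df where D: "\<forall>x. (f has_derivative Df x) (at x)" "\<forall>i. (\<lambda>x. Df x (axis i 1)) \<in> nice" by blast
  have "((\<lambda>x. psi m (f x)) has_derivative (\<lambda>h. Df x h * (psi (m + 2) (f x) + (- real m) * psi (m + 1) (f x)))) (at x)" for x
    using DERIV_compose_FDERIV[where g=f and g'="Df x" and f="psi m" and s=UNIV and x=x, OF psi_deriv[of m "f x"]] D(1) by simp
  moreover have "(\<lambda>x. Df x (axis i 1) * (psi (m + 2) (f x) + (- real m) * psi (m + 1) (f x))) \<in> nice" for i
    using D(2) nice_psi(1) by (intro nice.intros) auto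
  ultimately show ?case
    by (intro exI[of _ "\<lambda>x h. Df x h * (psi (m + 2) (f x) + (- real m) * psi (m + 1) (f x))"]) auto
qed

lemma nice_differentiable: "f \<in> nice \<Longrightarrow> f differentiable (at x)"
  using nice_deriv[of f] unfolding differentiable_def by blast

lemma nice_partial_deriv: "f \<in> nice \<Longrightarrow> partial_deriv i f \<in> nice"
proof -
  assume "f \<in> nice"
  then obtain D where D: "\<forall>x. (f has_derivative D x) (at x)" "\<forall>i. (\<lambda>x. D x (axis i 1)) \<in> nice"
    using nice_deriv by blast
  have "partial_deriv i f = (\<lambda>x. D x (axis i 1))"
    unfolding partial_deriv_def using frechet_derivative_at[OF D(1)[rule_format]] by metis
  with D(2) show ?thesis by simp
qed

lemma nice_smooth: "f \<in> nice \<Longrightarrow> smooth f"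
proof -
  assume f: "f \<in> nice"
  have "partial_derivs is f \<in> nice" for "is"
    by (induction "is") (auto simp: f nice_partial_deriv)
  then show ?thesis by (auto simp: smooth_def nice_differentiable)
qed

lemma nice_sum: "finite I \<Longrightarrow> (\<And>i. i \<in> I \<Longrightarrow> f i \<in> nice) \<Longrightarrow> (\<lambda>x. \<Sum>i\<in>I. f i x) \<in> nice"
  by (induction I rule: finite_induct) (auto intro: nice.intros)

lemma nice_prod: "finite I \<Longrightarrow> (\<And>i. i \<in> I \<Longrightarrow> f i \<in> nice) \<Longrightarrow> (\<lambda>x. \<Prod>i\<in>I. f i x) \<in> nice"
  by (induction I rule: finite_induct) (auto intro: nice.intros)

lemma nice_testI:
  assumes "f \<in> nice" "compact K" "\<And>x. x \<notin> K \<Longrightarrow> f x = 0"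
  shows "f \<in> test_functions"
proof -
  have "closure {x. f x \<noteq> 0} \<subseteq> K"
    using assms(3) compact_imp_closed[OF assms(2)] by (intro closure_minimal) auto
  then have "compact (closure {x. f x \<noteq> 0})"
    using compact_Int_closed[OF assms(2) closed_closure[of "{x. f x \<noteq> 0}"]] by (simp add: Int_absorb1)
  with nice_smooth[OF assms(1)] show ?thesis by (simp add: test_functions_def)
qed

section \<open>Support and boundedness of test functions, and their pairing with locally integrable
  functions\<close>

lemma test_differentiable: "\<phi> \<in> test_functions \<Longrightarrow> partial_derivs is \<phi> differentiable (at x)"
  by (auto simp: test_functions_def smooth_def)

lemma test_continuous: "\<phi> \<in> test_functions \<Longrightarrow> continuous_on S (partial_derivs is \<phi>)"
  by (intro continuous_at_imp_continuous_on ballI differentiable_imp_continuous_within test_differentiable)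

lemma test_measurable: "\<phi> \<in> test_functions \<Longrightarrow> partial_derivs is \<phi> \<in> borel_measurable borel"
  by (intro borel_measurable_continuous_onI test_continuous)

lemma differentiable_directional:
  assumes "f differentiable (at x)"
  shows "((\<lambda>t. f (x + t *\<^sub>R v)) has_real_derivative frechet_derivative f (at x) v) (at 0)"
proof -
  have "(f has_derivative frechet_derivative f (at x)) (at (x + 0 *\<^sub>R v))"
    using frechet_derivative_works[of f "at x"] assms by simp
  then have "((\<lambda>t. f (x + t *\<^sub>R v)) has_derivative (\<lambda>t. frechet_derivative f (at x) (t *\<^sub>R v))) (at 0)"
    by (rule has_derivative_compose[rotated]) (auto intro!: derivative_eq_intros)
  moreover have "linear (frechet_derivative f (at x))" using linear_frechet_derivative[OF assms] .
  ultimately show ?thesis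
    by (simp add: has_field_derivative_def linear_scale mult_commute_abs)
qed

lemma test_directional:
  assumes "\<phi> \<in> test_functions"
  shows "((\<lambda>t. partial_derivs is \<phi> (x + t *\<^sub>R axis i 1)) has_real_derivative partial_derivs (i # is) \<phi> x) (at 0)"
  using differentiable_directional[OF test_differentiable[OF assms]] by (simp add: partial_deriv_def)

lemma test_support:
  assumes "x \<notin> closure {x. \<phi> x \<noteq> 0}"
  shows "partial_derivs is \<phi> x = 0"
  using assms
proof (induction "is" arbitrary: x)
  case Nil
  then show ?case using closure_subset[of "{x. \<phi> x \<noteq> 0}"] by auto
next
  case (Cons i "is")
  let ?U = "- closure {x. \<phi> x \<noteq> 0}"
  have "((\<lambda>_. 0) has_derivative (\<lambda>_. 0)) (at x)" by simp
  then have "(partial_derivs is \<phi> has_derivative (\<lambda>_. 0)) (at x)"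
    by (rule has_derivative_transform_within_open[of _ _ _ _ ?U]) (use Cons in auto)
  then show ?case using frechet_derivative_at[of "partial_derivs is \<phi>" "\<lambda>_. 0" x]
    by (simp add: partial_deriv_def) metis
qed

lemma test_bounded:
  assumes "\<phi> \<in> test_functions"
  obtains M where "0 \<le> M" "\<And>x. \<bar>partial_derivs is \<phi> x\<bar> \<le> M * indicator (closure {x. \<phi> x \<noteq> 0}) x"
proof -
  let ?K = "closure {x. \<phi> x \<noteq> 0}"
  have "compact ?K" using assms by (simp add: test_functions_def)
  then have "bounded (partial_derivs is \<phi> ` ?K)"
    by (intro compact_imp_bounded compact_continuous_image test_continuous assms)
  then obtain M where "M > 0" "\<forall>y\<in>partial_derivs is \<phi> ` ?K. norm y \<le> M" by (auto simp: bounded_pos)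
  then show ?thesis using test_support[of _ \<phi> "is"]
    by (intro that[of M]) (auto simp: indicator_def)
qed

lemma test_compact: "\<phi> \<in> test_functions \<Longrightarrow> compact (closure {x. \<phi> x \<noteq> 0})"
  by (simp add: test_functions_def)

lemma L1_loc_integrable_mult:
  assumes z: "z \<in> L1_loc" and K: "compact K" and g: "g \<in> borel_measurable lebesgue"
    and le: "\<And>x. \<bar>g x\<bar> \<le> M * indicator K x"
  shows "integrable lebesgue (\<lambda>x. z x * g x)"
proof -
  have i: "integrable lebesgue (\<lambda>x. indicator K x * z x)"
    using z K by (auto simp: L1_loc_def set_integrable_def)
  have eq: "z x * g x = indicator K x * z x * g x" for x
    using le[of x] by (auto simp: indicator_def)
  show ?thesis
  proof (rule Bochner_Integration.integrable_bound)
    show "integrable lebesgue (\<lambda>x. M * (indicator K x * z x))" using i by simp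
    show "(\<lambda>x. z x * g x) \<in> borel_measurable lebesgue"
      unfolding eq by (intro borel_measurable_times g borel_measurable_integrable[OF i])
    show "AE x in lebesgue. norm (z x * g x) \<le> norm (M * (indicator K x * z x))"
    proof (rule AE_I2)
      fix x
      have "\<bar>g x\<bar> \<le> \<bar>M\<bar> * indicator K x" using le[of x] by (auto simp: indicator_def)
      then have "\<bar>z x\<bar> * \<bar>g x\<bar> \<le> \<bar>z x\<bar> * (\<bar>M\<bar> * indicator K x)" by (rule mult_left_mono) simp
      then show "norm (z x * g x) \<le> norm (M * (indicator K x * z x))" by (simp add: abs_mult mult_ac)
    qed
  qed
qed

lemma borel_imp_lebesgue: "g \<in> borel_measurable borel \<Longrightarrow> g \<in> borel_measurable lebesgue"
  by (rule measurable_completion) simp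

lemma L1_loc_test_integrable:
  assumes z: "z \<in> L1_loc" and \<phi>: "\<phi> \<in> test_functions"
  shows "integrable lebesgue (\<lambda>x. z x * partial_derivs is \<phi> x)"
proof -
  obtain M where "\<And>x. \<bar>partial_derivs is \<phi> x\<bar> \<le> M * indicator (closure {x. \<phi> x \<noteq> 0}) x"
    using test_bounded[OF \<phi>] by metis
  then show ?thesis
    by (intro L1_loc_integrable_mult[OF z test_compact[OF \<phi>]] borel_imp_lebesgue test_measurable \<phi>)
qed

text \<open>Indicators of open boxes are bounded pointwise limits of explicit test functions, so
  every box integral of z vanishes. Lebesgue's differentiation theorem over small cubes then gives z
  = 0 almost everywhere.\<close>

lemma fundamental_lemma:
  fixes z :: "real^'n \<Rightarrow> real"
  assumes z: "z \<in> L1_loc" and zero: "\<And>\<phi>. \<phi> \<in> test_functions \<Longrightarrow> (\<integral>x. z x * \<phi> x \<partial>lebesgue) = 0"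
  shows "AE x in lebesgue. z x = 0"
proof -
  have boxint: "integral (cbox a b) z = 0" if ab: "\<And>i. a $ i < b $ i" for a b :: "real^'n"
  proof -
    \<comment> \<open>Each quadratic factor is positive exactly when its coordinate lies strictly
      between the faces of the box, since the two linear factors cannot both be negative. As k
      grows, \<open>psi 0\<close> of k + 1 times a positive number tends to 1.\<close>
    define \<phi> where "\<phi> k x = (\<Prod>i\<in>UNIV. psi 0 (real (Suc k) * ((x $ i + (- (a $ i))) * (b $ i + (-1) * x $ i))))" for k :: nat and x :: "real^'n"
    have nice: "\<phi> k \<in> nice" for k
      unfolding \<phi>_def[abs_def] by (intro nice_prod nice.intros) auto
    have out: "\<phi> k x = 0" if nb: "x \<notin> box a b" for k x
    proof -
      obtain i where "\<not> (a $ i < x $ i \<and> x $ i < b $ i)" using nb mem_box_cart[of x a b] by blast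
      then have "(x $ i + (- (a $ i))) * (b $ i + (-1) * x $ i) \<le> 0"
        using ab[of i] unfolding mult_le_0_iff by linarith
      then have "psi 0 (real (Suc k) * ((x $ i + (- (a $ i))) * (b $ i + (-1) * x $ i))) = 0"
        using mult_nonneg_nonpos[of "real (Suc k)"] unfolding psi_def by (simp del: of_nat_Suc add: not_less[symmetric])
      then show ?thesis unfolding \<phi>_def by (intro prod_zero) auto
    qed
    have test: "\<phi> k \<in> test_functions" for k
      by (rule nice_testI[OF nice, of "cbox a b"]) (use out box_subset_cbox[of a b] in auto)
    have bd: "\<bar>\<phi> k x\<bar> \<le> 1" for k x
      unfolding \<phi>_def abs_prod by (intro prod_le_1) (auto simp: psi_def)
    have lim: "(\<lambda>k. z x * \<phi> k x) \<longlonglongrightarrow> z x * indicator (box a b) x" for x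
    proof (cases "x \<in> box a b")
      case True
      have "(\<lambda>k. psi 0 (real (Suc k) * ((x $ i + (- (a $ i))) * (b $ i + (-1) * x $ i)))) \<longlonglongrightarrow> 1" for i
      proof -
        define p where "p = (x $ i + (- (a $ i))) * (b $ i + (-1) * x $ i)"
        have p: "p > 0" using True unfolding p_def by (auto simp: mem_box_cart)
        have "(\<lambda>k. exp (- 1 / (real (Suc k) * p))) \<longlonglongrightarrow> 1" using p by real_asymp
        moreover have "psi 0 (real (Suc k) * p) = exp (- 1 / (real (Suc k) * p))" for k
          using p by (simp add: psi_def)
        ultimately show ?thesis by (simp add: p_def)
      qed
      then have "(\<lambda>k. \<phi> k x) \<longlonglongrightarrow> (\<Prod>i\<in>(UNIV::'n set). 1)" unfolding \<phi>_def by (intro tendsto_prod)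
      then show ?thesis using True by (intro tendsto_intros) auto
    qed (simp add: out)
    have i: "integrable lebesgue (\<lambda>x. indicator (cbox a b) x * z x)"
      using z by (auto simp: L1_loc_def set_integrable_def)
    have zm: "(\<lambda>x. z x * \<phi> k x) \<in> borel_measurable lebesgue" for k
      using borel_measurable_integrable[OF L1_loc_test_integrable[OF z test, of "[]"]] by simp
    have "(\<lambda>k. \<integral>x. z x * \<phi> k x \<partial>lebesgue) \<longlonglongrightarrow> (\<integral>x. z x * indicator (box a b) x \<partial>lebesgue)"
    proof (rule integral_dominated_convergence[where w="\<lambda>x. \<bar>indicator (cbox a b) x * z x\<bar>"])
      show "(\<lambda>x. z x * indicator (box a b) x) \<in> borel_measurable lebesgue"
        using zm lim by (rule borel_measurable_LIMSEQ_metric)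
      show "AE x in lebesgue. norm (z x * \<phi> k x) \<le> \<bar>indicator (cbox a b) x * z x\<bar>" for k
      proof (rule AE_I2)
        fix x
        show "norm (z x * \<phi> k x) \<le> \<bar>indicator (cbox a b) x * z x\<bar>"
        proof (cases "x \<in> box a b")
          case True
          then have "x \<in> cbox a b" using box_subset_cbox[of a b] by blast
          then show ?thesis using bd[of k x] by (simp add: abs_mult mult_left_le)
        qed (simp add: out)
      qed
    qed (use i zm lim in auto)
    then have "(\<integral>x. z x * indicator (box a b) x \<partial>lebesgue) = 0"
      using zero[OF test] by (simp add: LIMSEQ_const_iff)
    moreover have si: "set_integrable lebesgue (box a b) z"
    proof (rule set_integrable_subset)
      show "set_integrable lebesgue (cbox a b) z" using z by (auto simp: L1_loc_def)
    qed (auto simp: box_subset_cbox)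
    ultimately have "integral (box a b) z = 0"
      using set_lebesgue_integral_eq_integral(2)[OF si] by (simp add: set_lebesgue_integral_def mult.commute)
    then show ?thesis by (simp add: integral_open_interval)
  qed
  have "z integrable_on cbox a b" for a b
    using z set_lebesgue_integral_eq_integral(1)[of "cbox a b" z] by (auto simp: L1_loc_def)
  then obtain N where N: "negligible N" "\<And>x e. \<lbrakk>x \<notin> N; 0 < e\<rbrakk> \<Longrightarrow>
               \<exists>d>0. \<forall>h. 0 < h \<and> h < d \<longrightarrow> norm (integral (cbox x (x + h *\<^sub>R One)) z /\<^sub>R h ^ DIM(real^'n) - z x) < e"
    using integrable_ccontinuous_explicit[of z] by metis
  have "z x = 0" if xN: "x \<notin> N" for x
  proof (rule ccontr)
    assume "z x \<noteq> 0"
    then obtain d where d: "d > 0" "\<And>h. 0 < h \<and> h < d \<Longrightarrow> norm (integral (cbox x (x + h *\<^sub>R One)) z /\<^sub>R h ^ DIM(real^'n) - z x) < \<bar>z x\<bar>"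
      using N(2)[OF xN, of "\<bar>z x\<bar>"] by auto
    have "(One :: real^'n) $ i = 1" for i
    proof -
      have ax: "(axis i 1 :: real^'n) \<in> Basis" by (auto simp: Basis_vec_def)
      have "One \<bullet> (axis i 1 :: real^'n) = 1" unfolding inner_sum_left by (simp add: inner_Basis ax cong: sum.cong)
      then show ?thesis by (simp add: inner_axis)
    qed
    then have "integral (cbox x (x + (d/2) *\<^sub>R One)) z = 0" using d(1) by (intro boxint) simp
    with d(1) d(2)[of "d/2"] show False by simp
  qed
  then show ?thesis using N(1) by (intro AE_I'[of N]) (auto simp: negligible_iff_null_sets)
qed

section \<open>Cosine transforms of the heat kernel\<close>

lemma abs_cos_diff_le: "\<bar>cos u - cos v\<bar> \<le> \<bar>u - v\<bar>" for u v :: real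
proof -
  have "\<bar>cos u - cos v\<bar> = 2 * (\<bar>sin ((u + v) / 2)\<bar> * \<bar>sin ((v - u) / 2)\<bar>)"
    by (simp add: cos_diff_cos abs_mult)
  also have "\<dots> \<le> 2 * (1 * \<bar>(v - u) / 2\<bar>)"
    by (intro mult_left_mono mult_mono abs_sin_x_le_abs_x) auto
  finally show ?thesis by simp
qed

lemma gdom_times_bounded:
  fixes h :: "real^'n \<Rightarrow> real"
  assumes s: "0 < s" and h: "gdom s h" and b: "b \<in> borel_measurable borel" "\<And>x. \<bar>b x\<bar> \<le> 1"
  shows "integrable lborel (\<lambda>x. h x * b x)"
proof (rule Bochner_Integration.integrable_bound[OF gdom_integrable[OF s h]])
  show "AE x in lborel. norm (h x * b x) \<le> norm (h x)"
    using b(2) by (auto simp: abs_mult mult_left_le)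
qed (use b gdom_measurable[OF h] in auto)

lemma measurable_inner_const[measurable (raw)]:
  fixes f :: "'a \<Rightarrow> real^'n"
  shows "f \<in> borel_measurable M \<Longrightarrow> (\<lambda>x. f x \<bullet> z) \<in> borel_measurable M"
  by simp

lemma component_gk: "0 < \<tau> \<Longrightarrow> x $ i * gk \<tau> x = - \<tau> * gk1 i \<tau> x"
  by (simp add: gk1_def)

text \<open>Integration by parts in x turns derivatives of the kernel into factors of the frequency
  z. Real sines and cosines suffice because the kernel is even.\<close>

lemma gk_cos_identities:
  fixes z :: "real^'n"
  assumes t: "0 < \<tau>"
  shows "(LBINT x. gk1 i \<tau> x * sin (x \<bullet> z)) = - (z $ i) * (LBINT x. gk \<tau> x * cos (x \<bullet> z))"
    and "(LBINT x. gk2 i j \<tau> x * cos (x \<bullet> z)) = - (z $ i) * (z $ j) * (LBINT x. gk \<tau> x * cos (x \<bullet> z))"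
proof -
  have mb: "(\<lambda>x. sin (x \<bullet> z)) \<in> borel_measurable borel" "(\<lambda>x. cos (x \<bullet> z)) \<in> borel_measurable borel"
    by measurable
  note I = gdom_times_bounded[OF t]
  have ic: "integrable lborel (\<lambda>x. gk \<tau> x * cos (x \<bullet> z))" by (intro I gdom_gk t mb) auto
  have i1: "integrable lborel (\<lambda>x. gk1 i \<tau> x * sin (x \<bullet> z))" for i by (intro I gdom_gk1 t mb) auto
  have i2: "integrable lborel (\<lambda>x. gk1 i \<tau> x * cos (x \<bullet> z))" for i by (intro I gdom_gk1 t mb) auto
  have i3: "integrable lborel (\<lambda>x. gk2 i j \<tau> x * cos (x \<bullet> z))" by (intro I gdom_gk2 t mb) auto
  have i4: "integrable lborel (\<lambda>x. gk \<tau> x * sin (x \<bullet> z))" by (intro I gdom_gk t mb) auto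
  have lin: "((\<lambda>t. (x + t *\<^sub>R axis i 1) \<bullet> z) has_real_derivative z $ i) (at 0)" for x i
    unfolding inner_add_left inner_scaleR_left by (auto intro!: derivative_eq_intros simp: inner_axis inner_commute[of "axis i 1" z])
  have A: "(LBINT x. gk1 i \<tau> x * sin (x \<bullet> z) + z $ i * (gk \<tau> x * cos (x \<bullet> z))) = 0" for i
  proof (rule integral_directional_derivative_eq_0[where f="\<lambda>x. gk \<tau> x * sin (x \<bullet> z)" and v="axis i 1"])
    show "((\<lambda>t. gk \<tau> (x + t *\<^sub>R axis i 1) * sin ((x + t *\<^sub>R axis i 1) \<bullet> z)) has_real_derivative
          gk1 i \<tau> x * sin (x \<bullet> z) + z $ i * (gk \<tau> x * cos (x \<bullet> z))) (at 0)" for x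
      by (rule DERIV_cong[OF DERIV_mult[OF gk_deriv[OF t] DERIV_fun_sin[OF lin]]]) (simp add: algebra_simps)
    show "continuous_on UNIV (\<lambda>x. gk1 i \<tau> x * sin (x \<bullet> z) + z $ i * (gk \<tau> x * cos (x \<bullet> z)))"
      by (intro continuous_intros continuous_on_gk1[OF t] continuous_on_gk[OF t])
  qed (use i4 i1 ic in auto)
  show 1: "(LBINT x. gk1 i \<tau> x * sin (x \<bullet> z)) = - (z $ i) * (LBINT x. gk \<tau> x * cos (x \<bullet> z))" for i
  proof -
    have "(LBINT x. gk1 i \<tau> x * sin (x \<bullet> z)) + z $ i * (LBINT x. gk \<tau> x * cos (x \<bullet> z)) = 0"
      using A[of i] i1[of i] ic by simp
    then show ?thesis by linarith
  qed
  have "(LBINT x. gk2 i j \<tau> x * cos (x \<bullet> z) - z $ j * (gk1 i \<tau> x * sin (x \<bullet> z))) = 0"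
  proof (rule integral_directional_derivative_eq_0[where f="\<lambda>x. gk1 i \<tau> x * cos (x \<bullet> z)" and v="axis j 1"])
    show "((\<lambda>t. gk1 i \<tau> (x + t *\<^sub>R axis j 1) * cos ((x + t *\<^sub>R axis j 1) \<bullet> z)) has_real_derivative
          gk2 i j \<tau> x * cos (x \<bullet> z) - z $ j * (gk1 i \<tau> x * sin (x \<bullet> z))) (at 0)" for x
      by (rule DERIV_cong[OF DERIV_mult[OF gk1_deriv[OF t] DERIV_fun_cos[OF lin]]]) (simp add: algebra_simps)
    show "continuous_on UNIV (\<lambda>x. gk2 i j \<tau> x * cos (x \<bullet> z) - z $ j * (gk1 i \<tau> x * sin (x \<bullet> z)))"
      by (intro continuous_intros continuous_on_gk1[OF t] continuous_on_gk2[OF t])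
  qed (use i2 i1 i3 in auto)
  then show "(LBINT x. gk2 i j \<tau> x * cos (x \<bullet> z)) = - (z $ i) * (z $ j) * (LBINT x. gk \<tau> x * cos (x \<bullet> z))"
    using i1[of i] i3 by (simp add: 1 algebra_simps)
qed

text \<open>Along the ray r * z the transform h satisfies the linear equation h' = - \<tau> r |z|^2
  h, by the first identity above, and starts at the mass 1.\<close>

lemma gk_cos_transform:
  fixes z :: "real^'n"
  assumes t: "0 < \<tau>"
  shows "(LBINT x. gk \<tau> x * cos (x \<bullet> z)) = exp (- \<tau> * (norm z)^2 / 2)"
proof -
  define h where "h t = (LBINT x. gk \<tau> x * cos (x \<bullet> (t *\<^sub>R z)))" for t
  have int: "integrable lborel (\<lambda>x. gk \<tau> x * cos (x \<bullet> w))" for w :: "real^'n"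
    by (intro gdom_times_bounded[OF t] gdom_gk t) auto
  have nz: "(\<Sum>i\<in>UNIV. (z $ i)^2) = (norm z)^2" by (simp add: norm_vec_def L2_set_def sum_nonneg)
  have dh: "(h has_real_derivative (- \<tau> * r * (norm z)^2 * h r)) (at r)" for r
  proof -
    define g where "g x = - (gk \<tau> x * (x \<bullet> z) * sin (r * (x \<bullet> z)))" for x
    have gsum: "g x = (\<Sum>i\<in>UNIV. \<tau> * z $ i * (gk1 i \<tau> x * sin (x \<bullet> (r *\<^sub>R z))))" for x
    proof -
      have "(\<Sum>i\<in>UNIV. \<tau> * z $ i * (gk1 i \<tau> x * sin (x \<bullet> (r *\<^sub>R z)))) = - (\<Sum>i\<in>UNIV. x $ i * z $ i) * gk \<tau> x * sin (r * (x \<bullet> z))"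
        unfolding sum_negf[symmetric] sum_distrib_right by (rule sum.cong) (use t in \<open>auto simp: gk1_def\<close>)
      then show ?thesis by (simp add: g_def inner_vec_def)
    qed
    have i1: "integrable lborel (\<lambda>x. gk1 i \<tau> x * sin (x \<bullet> (r *\<^sub>R z)))" for i
      by (intro gdom_times_bounded[OF t] gdom_gk1 t) auto
    have "(LBINT x. g x) = (\<Sum>i\<in>UNIV. \<tau> * z $ i * (LBINT x. gk1 i \<tau> x * sin (x \<bullet> (r *\<^sub>R z))))"
      unfolding gsum using i1 by (subst Bochner_Integration.integral_sum) auto
    also have "\<dots> = (\<Sum>i\<in>UNIV. - \<tau> * r * (z $ i)^2 * h r)"
      unfolding gk_cos_identities(1)[OF t] h_def by (rule sum.cong) (auto simp: power2_eq_square)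
    also have "\<dots> = - \<tau> * r * (norm z)^2 * h r"
      by (simp add: nz[symmetric] sum_distrib_left sum_distrib_right)
    finally have ig: "(LBINT x. g x) = - \<tau> * r * (norm z)^2 * h r" .
    have "((\<lambda>e. (h (r + e) - h r) / e) \<longlongrightarrow> (LBINT x. g x)) (at 0)"
      unfolding tendsto_at_iff_sequentially
    proof (intro allI impI)
      fix X :: "nat \<Rightarrow> real" assume X0: "\<forall>i. X i \<in> UNIV - {0}" and X: "X \<longlonglongrightarrow> 0"
      define s where "s n x = gk \<tau> x * ((cos ((r + X n) * (x \<bullet> z)) - cos (r * (x \<bullet> z))) / X n)" for n x
      have "(\<lambda>n. \<integral>x. s n x \<partial>lborel) \<longlonglongrightarrow> (LBINT x. g x)"
      proof (rule integral_dominated_convergence[where w="\<lambda>x. gk \<tau> x * \<bar>x \<bullet> z\<bar>"])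
        \<comment> \<open>The majorant of the difference quotients is a first moment of the kernel.
          It is finite because x_i times the kernel is a multiple of \<open>gk1 i\<close>, already
          known to be integrable.\<close>
        have "integrable lborel (\<lambda>x. \<tau> * norm z * (\<Sum>i\<in>UNIV. \<bar>gk1 i \<tau> x\<bar>))"
          by (intro integrable_mult_right Bochner_Integration.integrable_sum integrable_abs gdom_integrable[OF t gdom_gk1[OF t]])
        then show "integrable lborel (\<lambda>x. gk \<tau> x * \<bar>x \<bullet> z\<bar>)"
        proof (rule Bochner_Integration.integrable_bound)
          show "AE x in lborel. norm (gk \<tau> x * \<bar>x \<bullet> z\<bar>) \<le> norm (\<tau> * norm z * (\<Sum>i\<in>UNIV. \<bar>gk1 i \<tau> x\<bar>))"
          proof (rule AE_I2)
            fix x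
            have "\<bar>x \<bullet> z\<bar> \<le> norm x * norm z" by (rule Cauchy_Schwarz_ineq2)
            also have "\<dots> \<le> (\<Sum>i\<in>UNIV. \<bar>x $ i\<bar>) * norm z" by (intro mult_right_mono norm_le_l1_cart) auto
            finally have "gk \<tau> x * \<bar>x \<bullet> z\<bar> \<le> gk \<tau> x * ((\<Sum>i\<in>UNIV. \<bar>x $ i\<bar>) * norm z)"
              by (intro mult_left_mono gk_nonneg)
            also have "\<dots> = norm z * (\<Sum>i\<in>UNIV. \<bar>x $ i * gk \<tau> x\<bar>)"
              by (simp add: abs_mult gk_nonneg sum_distrib_right[symmetric])
            also have "\<dots> = \<tau> * norm z * (\<Sum>i\<in>UNIV. \<bar>gk1 i \<tau> x\<bar>)"
              unfolding component_gk[OF t] using t by (simp add: abs_mult sum_distrib_left[symmetric])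
            finally show "norm (gk \<tau> x * \<bar>x \<bullet> z\<bar>) \<le> norm (\<tau> * norm z * (\<Sum>i\<in>UNIV. \<bar>gk1 i \<tau> x\<bar>))"
              using t by (simp add: abs_mult gk_nonneg abs_of_nonneg sum_nonneg)
          qed
        qed measurable
        show "AE x in lborel. (\<lambda>n. s n x) \<longlonglongrightarrow> g x"
        proof (rule AE_I2)
          fix x
          have "((\<lambda>y. cos (y * (x \<bullet> z))) has_real_derivative (- sin (r * (x \<bullet> z)) * (x \<bullet> z))) (at r)"
            by (auto intro!: derivative_eq_intros)
          then have "((\<lambda>e. (cos ((r + e) * (x \<bullet> z)) - cos (r * (x \<bullet> z))) / e) \<longlongrightarrow> - sin (r * (x \<bullet> z)) * (x \<bullet> z)) (at 0)"
            by (simp add: DERIV_def)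
          then have "(\<lambda>n. (cos ((r + X n) * (x \<bullet> z)) - cos (r * (x \<bullet> z))) / X n) \<longlonglongrightarrow> - sin (r * (x \<bullet> z)) * (x \<bullet> z)"
            using X0 X unfolding tendsto_at_iff_sequentially by (auto simp: comp_def)
          then have "(\<lambda>n. gk \<tau> x * ((cos ((r + X n) * (x \<bullet> z)) - cos (r * (x \<bullet> z))) / X n)) \<longlonglongrightarrow> gk \<tau> x * (- sin (r * (x \<bullet> z)) * (x \<bullet> z))"
            by (intro tendsto_mult tendsto_const)
          then show "(\<lambda>n. s n x) \<longlonglongrightarrow> g x" by (simp add: s_def g_def mult_ac)
        qed
        show "AE x in lborel. norm (s n x) \<le> gk \<tau> x * \<bar>x \<bullet> z\<bar>" for n
        proof (rule AE_I2)
          fix x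
          have "X n \<noteq> 0" using X0 by auto
          moreover have "\<bar>cos ((r + X n) * (x \<bullet> z)) - cos (r * (x \<bullet> z))\<bar> \<le> \<bar>X n\<bar> * \<bar>x \<bullet> z\<bar>"
            using abs_cos_diff_le[of "(r + X n) * (x \<bullet> z)" "r * (x \<bullet> z)"] by (simp add: algebra_simps abs_mult[symmetric])
          ultimately have "\<bar>(cos ((r + X n) * (x \<bullet> z)) - cos (r * (x \<bullet> z))) / X n\<bar> \<le> \<bar>x \<bullet> z\<bar>"
            by (simp add: abs_divide divide_le_eq mult.commute)
          then show "norm (s n x) \<le> gk \<tau> x * \<bar>x \<bullet> z\<bar>"
            unfolding s_def real_norm_def abs_mult[of "gk \<tau> x"] abs_of_nonneg[OF gk_nonneg] by (rule mult_left_mono[OF _ gk_nonneg])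
        qed
      qed (auto simp: s_def[abs_def] g_def[abs_def])
      moreover have "(LBINT x. s n x) = (h (r + X n) - h r) / X n" for n
      proof -
        have "(h (r + X n) - h r) / X n = (LBINT x. (gk \<tau> x * cos (x \<bullet> ((r + X n) *\<^sub>R z)) - gk \<tau> x * cos (x \<bullet> (r *\<^sub>R z))) / X n)"
          unfolding h_def using int[of "(r + X n) *\<^sub>R z"] int[of "r *\<^sub>R z"] by simp
        also have "\<dots> = (LBINT x. s n x)"
          by (intro Bochner_Integration.integral_cong) (auto simp: s_def right_diff_distrib diff_divide_distrib)
        finally show ?thesis by simp
      qed
      ultimately show "((\<lambda>e. (h (r + e) - h r) / e) \<circ> X) \<longlonglongrightarrow> (LBINT x. g x)"
        by (simp add: comp_def)
    qed
    then show ?thesis unfolding DERIV_def ig .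
  qed
  have "((\<lambda>r. h r * exp (\<tau> * r^2 * (norm z)^2 / 2)) has_real_derivative 0) (at r)" for r
  proof -
    have "((\<lambda>r. exp (\<tau> * r^2 * (norm z)^2 / 2)) has_real_derivative exp (\<tau> * r^2 * (norm z)^2 / 2) * (\<tau> * r * (norm z)^2)) (at r)"
      by (auto intro!: derivative_eq_intros)
    from DERIV_mult[OF dh[of r] this] show ?thesis by (rule DERIV_cong) simp
  qed
  then have "h 1 * exp (\<tau> * 1^2 * (norm z)^2 / 2) = h 0 * exp (\<tau> * 0^2 * (norm z)^2 / 2)"
    using DERIV_isconst_all[of "\<lambda>r. h r * exp (\<tau> * r^2 * (norm z)^2 / 2)" 1 0] by blast
  moreover have "h 0 = 1" using integral_gk[OF t] by (simp add: h_def)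
  ultimately show ?thesis by (simp add: h_def exp_minus field_simps)
qed

text \<open>A Gaussian is its own transform up to scaling, so reading the transform at time 1 / s
  backwards represents \<open>gk2\<close> as a cosine transform without any inversion theorem. The
  factor x_i x_j is produced by writing x_i x_j * gk as a combination of \<open>gk2 i j\<close> and,
  on the diagonal, \<open>gk\<close>.\<close>

lemma gk2_fourier:
  fixes z :: "real^'n"
  assumes s: "0 < s"
  shows "gk2 i j s z = - ((2 * pi * s) powr (- (real CARD('n) / 2)) * (LBINT x. x $ i * x $ j * gk (1 / s) x * cos (x \<bullet> z)))"
proof -
  define t where "t = 1 / s"
  have t: "t > 0" using s by (simp add: t_def)
  let ?E = "exp (- t * (norm z)^2 / 2)"
  have i2: "integrable lborel (\<lambda>x. gk2 i j t x * cos (x \<bullet> z))" by (intro gdom_times_bounded[OF t] gdom_gk2 t) auto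
  have i0: "integrable lborel (\<lambda>x. gk t x * cos (x \<bullet> z))" by (intro gdom_times_bounded[OF t] gdom_gk t) auto
  have "x $ i * x $ j * gk t x = t^2 * gk2 i j t x + (if i = j then t else 0) * gk t x" for x :: "real^'n"
    using t by (auto simp: gk2_def field_simps power2_eq_square)
  then have "(LBINT x. x $ i * x $ j * gk t x * cos (x \<bullet> z))
     = (LBINT x. t^2 * (gk2 i j t x * cos (x \<bullet> z)) + (if i = j then t else 0) * (gk t x * cos (x \<bullet> z)))"
    by (simp add: distrib_right mult.assoc)
  also have "\<dots> = t^2 * (- (z $ i) * (z $ j) * ?E) + (if i = j then t else 0) * ?E"
    using i2 i0 by (simp add: gk_cos_identities(2)[OF t] gk_cos_transform[OF t])
  also have "\<dots> = - (z $ i * z $ j / s^2 - (if i = j then t else 0)) * ?E"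
    by (simp add: t_def algebra_simps power2_eq_square)
  finally have "(LBINT x. x $ i * x $ j * gk t x * cos (x \<bullet> z)) = - (z $ i * z $ j / s^2 - (if i = j then t else 0)) * ?E" .
  moreover have "gk s z = (2 * pi * s) powr (- (real CARD('n) / 2)) * ?E" using s by (simp add: t_def gk_def)
  ultimately show ?thesis unfolding gk2_def t_def[symmetric] by (simp only: mult_minus_left mult_minus_right minus_minus mult_ac)
qed

text \<open>The addition formula for cos (w \<bullet> (x - y)) decouples x from y, and Fubini's
  theorem turns the double integral into one over w of products of transforms.\<close>

lemma convolution_fourier:
  fixes a b m :: "real^'n \<Rightarrow> real"
  assumes a: "integrable lborel a" and b: "integrable lborel b" and m: "integrable lborel m"
  shows "(LBINT x. a x * (LBINT y. (LBINT w. m w * cos (w \<bullet> (x - y))) * b y))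
    = (LBINT w. m w * ((LBINT x. a x * cos (w \<bullet> x)) * (LBINT x. b x * cos (w \<bullet> x))
              + (LBINT x. a x * sin (w \<bullet> x)) * (LBINT x. b x * sin (w \<bullet> x))))"
proof -
  have [measurable]: "a \<in> borel_measurable borel" "b \<in> borel_measurable borel" "m \<in> borel_measurable borel"
    using a b m by (auto dest: borel_measurable_integrable)
  have tb: "integrable lborel (\<lambda>x. f x * g x)" if "integrable lborel f" "g \<in> borel_measurable borel" "\<And>x. \<bar>g x\<bar> \<le> 1"
    for f g :: "real^'n \<Rightarrow> real"
  proof (rule Bochner_Integration.integrable_bound[OF that(1)])
    show "(\<lambda>x. f x * g x) \<in> borel_measurable lborel" using that by (auto dest: borel_measurable_integrable)
    show "AE x in lborel. norm (f x * g x) \<le> norm (f x)" using that(3) by (auto simp: abs_mult mult_left_le)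
  qed
  have tb2: "integrable (lborel \<Otimes>\<^sub>M lborel) (\<lambda>(x, w). f x * h w * g x w)"
    if f: "integrable lborel f" and h: "integrable lborel h" and g: "case_prod g \<in> borel_measurable (borel \<Otimes>\<^sub>M borel)" "\<And>x w. \<bar>g x w\<bar> \<le> 1"
    for f h :: "real^'n \<Rightarrow> real" and g
  proof (rule Bochner_Integration.integrable_bound[OF integrable_lborel_times[OF f h]])
    have [measurable]: "f \<in> borel_measurable borel" "h \<in> borel_measurable borel"
      using f h by (auto dest: borel_measurable_integrable)
    have [measurable]: "(\<lambda>x. g (fst x) (snd x)) \<in> borel_measurable (lborel \<Otimes>\<^sub>M lborel)"
      using g(1) by (simp add: split_beta')
    show "(\<lambda>(x, w). f x * h w * g x w) \<in> borel_measurable (lborel \<Otimes>\<^sub>M lborel)"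
      unfolding split_beta' by measurable
    show "AE x in lborel \<Otimes>\<^sub>M lborel. norm (case x of (x, w) \<Rightarrow> f x * h w * g x w) \<le> norm (case x of (x, y) \<Rightarrow> f x * h y)"
      using g(2) by (auto simp: abs_mult mult_left_le)
  qed
  define Bc where "Bc w = (LBINT x. b x * cos (w \<bullet> x))" for w
  define Bs where "Bs w = (LBINT x. b x * sin (w \<bullet> x))" for w
  have [measurable]: "Bc \<in> borel_measurable borel" "Bs \<in> borel_measurable borel"
    unfolding Bc_def[abs_def] Bs_def[abs_def] by measurable
  define Kb where "Kb = (LBINT x. \<bar>b x\<bar>)"
  have Bb: "\<bar>Bc w\<bar> \<le> Kb" "\<bar>Bs w\<bar> \<le> Kb" for w
  proof -
    have "\<bar>\<integral>x. b x * g x \<partial>lborel\<bar> \<le> Kb" if "g \<in> borel_measurable borel" "\<And>x. \<bar>g x\<bar> \<le> 1" for g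
    proof -
      have "\<bar>\<integral>x. b x * g x \<partial>lborel\<bar> \<le> (LBINT x. \<bar>b x * g x\<bar>)" by (rule integral_abs_bound)
      also have "\<dots> \<le> Kb" unfolding Kb_def
      proof (rule integral_mono)
        show "integrable lborel (\<lambda>x. \<bar>b x * g x\<bar>)" by (rule integrable_abs[OF tb[OF b that]])
        show "\<bar>b x * g x\<bar> \<le> \<bar>b x\<bar>" for x using that(2)[of x] by (simp add: abs_mult mult_left_le)
      qed (use b in auto)
      finally show ?thesis .
    qed
    then show "\<bar>Bc w\<bar> \<le> Kb" "\<bar>Bs w\<bar> \<le> Kb" unfolding Bc_def Bs_def by auto
  qed
  have mB: "integrable lborel (\<lambda>w. m w * Bc w)" "integrable lborel (\<lambda>w. m w * Bs w)"
    by (rule Bochner_Integration.integrable_bound[of _ "\<lambda>w. Kb * m w"];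
        use m Bb order_trans[OF abs_ge_zero Bb(1)] in \<open>auto simp: abs_mult mult.commute[of Kb] intro!: mult_left_mono\<close>)+
  have inner: "(LBINT y. (LBINT w. m w * cos (w \<bullet> (x - y))) * b y) = (LBINT w. m w * Bc w * cos (w \<bullet> x) + m w * Bs w * sin (w \<bullet> x))" for x
  proof -
    have "(LBINT y. (LBINT w. m w * cos (w \<bullet> (x - y))) * b y) = (LBINT y. (LBINT w. m w * b y * cos (w \<bullet> (x - y))))"
      by (intro Bochner_Integration.integral_cong refl) (simp add: mult_ac flip: Bochner_Integration.integral_mult_left_zero)
    also have "\<dots> = (LBINT w. (LBINT y. m w * b y * cos (w \<bullet> (x - y))))"
      by (rule lborel_pair.Fubini_integral) (intro tb2 m b; auto)
    also have "\<dots> = (LBINT w. m w * Bc w * cos (w \<bullet> x) + m w * Bs w * sin (w \<bullet> x))"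
    proof (intro Bochner_Integration.integral_cong refl)
      fix w
      have "(LBINT y. m w * b y * cos (w \<bullet> (x - y)))
         = (LBINT y. m w * cos (w \<bullet> x) * (b y * cos (w \<bullet> y)) + m w * sin (w \<bullet> x) * (b y * sin (w \<bullet> y)))"
        by (intro Bochner_Integration.integral_cong refl) (simp add: inner_diff_right cos_diff algebra_simps)
      also have "\<dots> = m w * cos (w \<bullet> x) * Bc w + m w * sin (w \<bullet> x) * Bs w"
        unfolding Bc_def Bs_def
        using tb[OF b, of "\<lambda>y. cos (w \<bullet> y)"] tb[OF b, of "\<lambda>y. sin (w \<bullet> y)"] by simp
      finally show "(LBINT y. m w * b y * cos (w \<bullet> (x - y))) = m w * Bc w * cos (w \<bullet> x) + m w * Bs w * sin (w \<bullet> x)"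
        by (simp add: mult_ac)
    qed
    finally show ?thesis .
  qed
  have tba: "integrable lborel (\<lambda>x. a x * cos (w \<bullet> x))" "integrable lborel (\<lambda>x. a x * sin (w \<bullet> x))" for w
    by (intro tb[OF a]; auto)+
  have tbm: "integrable lborel (\<lambda>w. m w * Bc w * cos (w \<bullet> x))" "integrable lborel (\<lambda>w. m w * Bs w * sin (w \<bullet> x))" for x
    by (intro tb mB; auto)+
  have P: "integrable (lborel \<Otimes>\<^sub>M lborel) (\<lambda>(x, w). a x * (m w * Bc w) * cos (w \<bullet> x))"
     "integrable (lborel \<Otimes>\<^sub>M lborel) (\<lambda>(x, w). a x * (m w * Bs w) * sin (w \<bullet> x))"
    by (intro tb2 a mB; auto)+
  have "(LBINT x. a x * (LBINT y. (LBINT w. m w * cos (w \<bullet> (x - y))) * b y))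
     = (LBINT x. (LBINT w. a x * (m w * Bc w) * cos (w \<bullet> x) + a x * (m w * Bs w) * sin (w \<bullet> x)))"
    unfolding inner Bochner_Integration.integral_mult_right_zero[symmetric]
    by (intro Bochner_Integration.integral_cong refl) (simp add: algebra_simps)
  also have "\<dots> = (LBINT w. (LBINT x. a x * (m w * Bc w) * cos (w \<bullet> x) + a x * (m w * Bs w) * sin (w \<bullet> x)))"
    using Bochner_Integration.integrable_add[OF P] by (intro lborel_pair.Fubini_integral[symmetric]) (simp add: split_beta')
  also have "\<dots> = (LBINT w. m w * ((LBINT x. a x * cos (w \<bullet> x)) * Bc w + (LBINT x. a x * sin (w \<bullet> x)) * Bs w))"
  proof (intro Bochner_Integration.integral_cong refl)
    fix w
    have "(LBINT x. a x * (m w * Bc w) * cos (w \<bullet> x) + a x * (m w * Bs w) * sin (w \<bullet> x))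
      = (LBINT x. (m w * Bc w) * (a x * cos (w \<bullet> x)) + (m w * Bs w) * (a x * sin (w \<bullet> x)))"
      by (simp add: mult_ac)
    also have "\<dots> = m w * ((LBINT x. a x * cos (w \<bullet> x)) * Bc w + (LBINT x. a x * sin (w \<bullet> x)) * Bs w)"
    proof -
      have "integrable lborel (\<lambda>x. (m w * Bc w) * (a x * cos (w \<bullet> x)))" "integrable lborel (\<lambda>x. (m w * Bs w) * (a x * sin (w \<bullet> x)))"
        using tba[of w] by auto
      then show ?thesis
        by (simp only: Bochner_Integration.integral_add Bochner_Integration.integral_mult_right_zero) (simp add: algebra_simps)
    qed
    finally show "(LBINT x. a x * (m w * Bc w) * cos (w \<bullet> x) + a x * (m w * Bs w) * sin (w \<bullet> x)) = m w * ((LBINT x. a x * cos (w \<bullet> x)) * Bc w + (LBINT x. a x * sin (w \<bullet> x)) * Bs w)" .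
  qed
  finally show ?thesis unfolding Bc_def Bs_def .
qed

section \<open>Convolution of square integrable functions\<close>

text \<open>At points where the product is not integrable the value is the default 0. For integrable
  k and square integrable g such points form a null set by \<open>conv_AE_integrable\<close>, which
  is why linearity below holds only almost everywhere.\<close>

definition conv :: "(real^'n \<Rightarrow> real) \<Rightarrow> (real^'n \<Rightarrow> real) \<Rightarrow> real^'n \<Rightarrow> real" where
  "conv k g x = (LBINT y. k (x - y) * g y)"

lemma L2_lborel_measurable: "g \<in> L2 lborel \<Longrightarrow> g \<in> borel_measurable borel"
  by (auto simp: L2_def)

lemma integrable_lborel_measurable: "integrable lborel g \<Longrightarrow> g \<in> borel_measurable borel"
  by (auto dest: borel_measurable_integrable)

lemma measurable_conv[measurable (raw)]:
  assumes [measurable]: "k \<in> borel_measurable borel" "g \<in> borel_measurable borel"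
  shows "conv k g \<in> borel_measurable borel"
proof -
  have "(\<lambda>x. \<integral>y. k (x - y) * g y \<partial>lborel) \<in> borel_measurable borel" by measurable
  then show ?thesis by (simp add: conv_def[abs_def])
qed

lemma kernel_sq_integrable_fst:
  fixes k a :: "real^'n \<Rightarrow> real"
  assumes k: "integrable lborel k" and a: "a \<in> L2 lborel"
  shows "integrable (lborel \<Otimes>\<^sub>M lborel) (\<lambda>(x, y). \<bar>k (x - y)\<bar> * (a x)^2)"
proof -
  note [measurable] = integrable_lborel_measurable[OF k] L2_lborel_measurable[OF a]
  show ?thesis
  proof (rule lborel_pair.Fubini_integrable)
    have "(LBINT y. norm (case (x, y) of (x, y) \<Rightarrow> \<bar>k (x - y)\<bar> * (a x)^2)) = (LBINT y. \<bar>k y\<bar>) * (a x)^2" for x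
      using integral_reflect[OF integrable_abs[OF k], of x] by simp
    then have eq: "(\<lambda>x. LBINT y. norm (case (x, y) of (x, y) \<Rightarrow> \<bar>k (x - y)\<bar> * (a x)^2)) = (\<lambda>x. (LBINT y. \<bar>k y\<bar>) * (a x)^2)" by (rule ext)
    show "integrable lborel (\<lambda>x. LBINT y. norm (case (x, y) of (x, y) \<Rightarrow> \<bar>k (x - y)\<bar> * (a x)^2))"
      unfolding eq using L2_int[OF a] by simp
    show "AE x in lborel. integrable lborel (\<lambda>y. case (x, y) of (x, y) \<Rightarrow> \<bar>k (x - y)\<bar> * (a x)^2)"
      using integrable_reflect[OF integrable_abs[OF k]] by simp
  qed measurable
qed

lemma kernel_sq_integrable_snd:
  fixes k b :: "real^'n \<Rightarrow> real"
  assumes k: "integrable lborel k" and b: "b \<in> L2 lborel"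
  shows "integrable (lborel \<Otimes>\<^sub>M lborel) (\<lambda>(x, y). \<bar>k (x - y)\<bar> * (b y)^2)"
proof -
  have "integrable lborel (\<lambda>z. k (- z))" using integrable_reflect[OF k, of 0] by simp
  from lborel_pair.integrable_product_swap[OF kernel_sq_integrable_fst[OF this b]]
  show ?thesis by (simp add: split_beta')
qed

lemma kernel_product_integrable:
  fixes k a b :: "real^'n \<Rightarrow> real"
  assumes k: "integrable lborel k" and a: "a \<in> L2 lborel" and b: "b \<in> L2 lborel"
  shows "integrable (lborel \<Otimes>\<^sub>M lborel) (\<lambda>(x, y). a x * (k (x - y) * b y))"
proof (rule Bochner_Integration.integrable_bound)
  note [measurable] = integrable_lborel_measurable[OF k] L2_lborel_measurable[OF a] L2_lborel_measurable[OF b]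
  show "integrable (lborel \<Otimes>\<^sub>M lborel) (\<lambda>p. (case p of (x, y) \<Rightarrow> \<bar>k (x - y)\<bar> * (a x)^2) + (case p of (x, y) \<Rightarrow> \<bar>k (x - y)\<bar> * (b y)^2))"
    by (intro Bochner_Integration.integrable_add kernel_sq_integrable_fst kernel_sq_integrable_snd assms)
  show "(\<lambda>(x, y). a x * (k (x - y) * b y)) \<in> borel_measurable (lborel \<Otimes>\<^sub>M lborel)" by measurable
  have le: "\<bar>a x * (k (x - y) * b y)\<bar> \<le> \<bar>k (x - y)\<bar> * (a x)^2 + \<bar>k (x - y)\<bar> * (b y)^2" for x y
  proof -
    have "2 * (\<bar>a x\<bar> * \<bar>b y\<bar>) \<le> (a x)^2 + (b y)^2"
      using zero_le_power2[of "\<bar>a x\<bar> - \<bar>b y\<bar>"] by (simp add: power2_diff)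
    moreover have "0 \<le> \<bar>a x\<bar> * \<bar>b y\<bar>" by simp
    ultimately have "\<bar>a x\<bar> * \<bar>b y\<bar> \<le> (a x)^2 + (b y)^2" by linarith
    then have "\<bar>k (x - y)\<bar> * (\<bar>a x\<bar> * \<bar>b y\<bar>) \<le> \<bar>k (x - y)\<bar> * ((a x)^2 + (b y)^2)" by (rule mult_left_mono) simp
    then show ?thesis by (simp add: abs_mult distrib_left mult_ac)
  qed
  show "AE p in lborel \<Otimes>\<^sub>M lborel. norm (case p of (x, y) \<Rightarrow> a x * (k (x - y) * b y))
     \<le> norm ((case p of (x, y) \<Rightarrow> \<bar>k (x - y)\<bar> * (a x)^2) + (case p of (x, y) \<Rightarrow> \<bar>k (x - y)\<bar> * (b y)^2))"
    by (rule AE_I2) (use le in \<open>auto simp: split_beta' intro!: order_trans[OF le] abs_ge_self\<close>)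
qed

lemma conv_AE_integrable_sq:
  fixes k g :: "real^'n \<Rightarrow> real"
  assumes k: "integrable lborel k" and g: "g \<in> L2 lborel"
  shows "AE x in lborel. integrable lborel (\<lambda>y. \<bar>k (x - y)\<bar> * (g y)^2)"
  using lborel_pair.AE_integrable_fst[OF kernel_sq_integrable_snd[OF k g]] by simp

lemma conv_AE_integrable:
  fixes k g :: "real^'n \<Rightarrow> real"
  assumes k: "integrable lborel k" and g: "g \<in> L2 lborel"
  shows "AE x in lborel. integrable lborel (\<lambda>y. k (x - y) * g y)"
  using conv_AE_integrable_sq[OF k g]
proof eventually_elim
  case (elim x)
  note [measurable] = integrable_lborel_measurable[OF k] L2_lborel_measurable[OF g]
  show ?case
  proof (rule Bochner_Integration.integrable_bound)
    show "integrable lborel (\<lambda>y. \<bar>k (x - y)\<bar> + \<bar>k (x - y)\<bar> * (g y)^2)"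
      using elim integrable_reflect[OF integrable_abs[OF k]] by simp
    show "AE y in lborel. norm (k (x - y) * g y) \<le> norm (\<bar>k (x - y)\<bar> + \<bar>k (x - y)\<bar> * (g y)^2)"
    proof (rule AE_I2)
      fix y
      have "2 * \<bar>g y\<bar> \<le> 1 + (g y)^2" using zero_le_power2[of "\<bar>g y\<bar> - 1"] by (simp add: power2_diff)
      then have "\<bar>g y\<bar> \<le> 1 + (g y)^2" using abs_ge_zero[of "g y"] by linarith
      then have "\<bar>k (x - y)\<bar> * \<bar>g y\<bar> \<le> \<bar>k (x - y)\<bar> * (1 + (g y)^2)" by (rule mult_left_mono) simp
      then show "norm (k (x - y) * g y) \<le> norm (\<bar>k (x - y)\<bar> + \<bar>k (x - y)\<bar> * (g y)^2)"
        by (simp add: abs_mult distrib_left)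
    qed
  qed measurable
qed

text \<open>Young's inequality for an L^1 kernel: write |k| as a product of two square roots, apply
  Cauchy-Schwarz in y, and integrate |k (x - y)| * (g y)^2 by Fubini's theorem.\<close>

lemma
  fixes k g :: "real^'n \<Rightarrow> real"
  assumes k: "integrable lborel k" and g: "g \<in> L2 lborel"
  shows conv_L2: "conv k g \<in> L2 lborel"
    and l2n_conv_le: "l2n lborel (conv k g) \<le> (LBINT z. \<bar>k z\<bar>) * l2n lborel g"
proof -
  note [measurable] = integrable_lborel_measurable[OF k] L2_lborel_measurable[OF g]
  define K where "K = (LBINT z. \<bar>k z\<bar>)"
  have K0: "K \<ge> 0" by (simp add: K_def)
  define w where "w x = (LBINT y. \<bar>k (x - y)\<bar> * (g y)^2)" for x
  have w0: "w x \<ge> 0" for x by (simp add: w_def)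
  have wi: "integrable lborel w"
    using lborel_pair.integrable_fst[OF kernel_sq_integrable_snd[OF k g]] by (simp add: w_def[abs_def])
  have "(LBINT x. w x) = (LBINT y. (LBINT x. \<bar>k (x - y)\<bar> * (g y)^2))"
    unfolding w_def by (rule lborel_pair.Fubini_integral[symmetric]) (rule kernel_sq_integrable_snd[OF k g])
  also have "\<dots> = K * (LBINT y. (g y)^2)"
    using integral_shift'[OF integrable_abs[OF k]] by (simp add: K_def)
  finally have wI: "(LBINT x. w x) = K * (l2n lborel g)^2" by (simp add: l2n_sq)
  have le: "AE x in lborel. (conv k g x)^2 \<le> K * w x"
    using conv_AE_integrable_sq[OF k g]
  proof eventually_elim
    case (elim x)
    define f1 where "f1 y = sqrt \<bar>k (x - y)\<bar>" for y
    define f2 where "f2 y = sqrt \<bar>k (x - y)\<bar> * g y" for y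
    have [measurable]: "f1 \<in> borel_measurable borel" "f2 \<in> borel_measurable borel"
      unfolding f1_def[abs_def] f2_def[abs_def] by measurable
    have f1: "f1 \<in> L2 lborel"
      using integrable_reflect[OF integrable_abs[OF k], of x] by (intro L2I) (auto simp: f1_def)
    have f2: "f2 \<in> L2 lborel"
      using elim by (intro L2I) (auto simp: f2_def power_mult_distrib)
    have "\<bar>conv k g x\<bar> \<le> (LBINT y. \<bar>k (x - y) * g y\<bar>)"
      unfolding conv_def by (rule integral_abs_bound)
    also have "\<dots> = (LBINT y. norm (f1 y) * norm (f2 y))"
      by (intro Bochner_Integration.integral_cong refl) (simp add: f1_def f2_def abs_mult mult.assoc[symmetric])
    also have "\<dots> \<le> l2n lborel f1 * l2n lborel f2" by (rule l2n_Cauchy_Schwarz[OF f1 f2])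
    finally have "(conv k g x)^2 \<le> (l2n lborel f1 * l2n lborel f2)^2"
      by (metis abs_ge_zero power2_abs power_mono)
    also have "\<dots> = K * w x"
      unfolding power_mult_distrib l2n_sq w_def K_def using integral_reflect[OF integrable_abs[OF k], of x]
      by (simp add: f1_def f2_def power_mult_distrib)
    finally show ?case .
  qed
  have ci: "integrable lborel (\<lambda>x. (conv k g x)^2)"
  proof (rule Bochner_Integration.integrable_bound)
    show "integrable lborel (\<lambda>x. K * w x)" using wi by simp
    show "AE x in lborel. norm ((conv k g x)^2) \<le> norm (K * w x)"
      using le by eventually_elim (use K0 w0 in auto)
  qed measurable
  then show "conv k g \<in> L2 lborel" by (intro L2I) auto
  have "(l2n lborel (conv k g))^2 \<le> (LBINT x. K * w x)"
    unfolding l2n_sq using ci wi le by (intro integral_mono_AE) auto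
  also have "\<dots> = (K * l2n lborel g)^2" by (simp add: wI power_mult_distrib power2_eq_square)
  finally show "l2n lborel (conv k g) \<le> K * l2n lborel g"
    by (rule power2_le_imp_le) (intro mult_nonneg_nonneg K0 l2n_nonneg)
qed

lemma conv_diff_AE:
  fixes k g h :: "real^'n \<Rightarrow> real"
  assumes k: "integrable lborel k" and g: "g \<in> L2 lborel" and h: "h \<in> L2 lborel"
  shows "AE x in lborel. conv k (\<lambda>y. g y - h y) x = conv k g x - conv k h x"
  using conv_AE_integrable[OF k g] conv_AE_integrable[OF k h]
  by eventually_elim (simp add: conv_def right_diff_distrib)

lemma conv_kernel_diff_AE:
  fixes k k' g :: "real^'n \<Rightarrow> real"
  assumes k: "integrable lborel k" "integrable lborel k'" and g: "g \<in> L2 lborel"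
  shows "AE x in lborel. conv (\<lambda>z. k z - k' z) g x = conv k g x - conv k' g x"
  using conv_AE_integrable[OF k(1) g] conv_AE_integrable[OF k(2) g]
  by eventually_elim (simp add: conv_def left_diff_distrib)

lemma conv_kernel_sum_AE:
  fixes k :: "'i \<Rightarrow> real^'n \<Rightarrow> real"
  assumes k: "\<And>i. i \<in> I \<Longrightarrow> integrable lborel (k i)" and I: "finite I" and g: "g \<in> L2 lborel"
  shows "AE x in lborel. conv (\<lambda>z. \<Sum>i\<in>I. k i z) g x = (\<Sum>i\<in>I. conv (k i) g x)"
proof -
  have "AE x in lborel. \<forall>i\<in>I. integrable lborel (\<lambda>y. k i (x - y) * g y)"
    using conv_AE_integrable[OF k g] I by (intro AE_finite_allI) auto
  then show ?thesis
    by eventually_elim (simp add: conv_def sum_distrib_right)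
qed

section \<open>Bilinear forms of convolutions and their sign\<close>

lemma integral_mult_conv:
  fixes k a b :: "real^'n \<Rightarrow> real"
  assumes k: "integrable lborel k" and a: "a \<in> L2 lborel" and b: "b \<in> L2 lborel"
  shows "(LBINT x. a x * conv k b x) = (LBINT y. b y * (LBINT x. k (x - y) * a x))"
    and "(LBINT x. a x * conv k b x) = (\<integral>p. (case p of (x, y) \<Rightarrow> a x * (k (x - y) * b y)) \<partial>(lborel \<Otimes>\<^sub>M lborel))"
proof -
  note I = kernel_product_integrable[OF k a b]
  have *: "(LBINT x. a x * conv k b x) = (LBINT x. (LBINT y. a x * (k (x - y) * b y)))"
    by (simp add: conv_def)
  also have "\<dots> = (LBINT y. (LBINT x. a x * (k (x - y) * b y)))"
    using lborel_pair.Fubini_integral[OF I] by simp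
  also have "\<dots> = (LBINT y. b y * (LBINT x. k (x - y) * a x))"
    by (intro Bochner_Integration.integral_cong refl) (simp add: mult_ac flip: Bochner_Integration.integral_mult_right_zero)
  finally show "(LBINT x. a x * conv k b x) = (LBINT y. b y * (LBINT x. k (x - y) * a x))" .
  show "(LBINT x. a x * conv k b x) = (\<integral>p. (case p of (x, y) \<Rightarrow> a x * (k (x - y) * b y)) \<partial>(lborel \<Otimes>\<^sub>M lborel))"
    unfolding * using lborel_pair.integral_fst[OF I] by simp
qed

lemma integral_conv_conv:
  fixes k h a b :: "real^'n \<Rightarrow> real"
  assumes k: "integrable lborel k" "k \<in> L2 lborel" and h: "integrable lborel h" and a: "a \<in> L2 lborel" and b: "b \<in> L2 lborel"
  shows "(LBINT x. conv k a x * conv h b x)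
     = (LBINT y. a y * (\<integral>y'. b y' * (LBINT x. k (x - y) * h (x - y')) \<partial>lborel))"
proof -
  have kL: "(\<lambda>x. k (x - y)) \<in> L2 lborel" for y
  proof (rule L2I)
    show "integrable lborel (\<lambda>x. (norm (k (x - y)))^2)" using integrable_shift'[OF L2_int[OF k(2)]] by simp
  qed (use L2_lborel_measurable[OF k(2)] in measurable)
  have "(LBINT x. conv k a x * conv h b x) = (LBINT x. conv h b x * conv k a x)" by (simp add: mult.commute)
  also have "\<dots> = (LBINT y. a y * (LBINT x. k (x - y) * conv h b x))"
    by (rule integral_mult_conv(1)[OF k(1) conv_L2[OF h b] a])
  also have "\<dots> = (LBINT y. a y * (\<integral>y'. b y' * (LBINT x. h (x - y') * k (x - y)) \<partial>lborel))"
    by (simp add: integral_mult_conv(1)[OF h kL b])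
  finally show ?thesis by (simp add: mult.commute)
qed

definition gform :: "'n \<Rightarrow> 'n \<Rightarrow> real \<Rightarrow> (real^'n \<Rightarrow> real) \<Rightarrow> (real^'n \<Rightarrow> real) \<Rightarrow> real" where
  "gform i j s a b = (LBINT x. a x * conv (gk2 i j s) b x)"

lemma trig_integral_bound:
  fixes b :: "real^'n \<Rightarrow> real"
  assumes b: "integrable lborel b" and g: "g \<in> borel_measurable borel" "\<And>x. \<bar>g x\<bar> \<le> 1"
  shows "\<bar>\<integral>x. b x * g x \<partial>lborel\<bar> \<le> (LBINT x. \<bar>b x\<bar>)"
proof -
  have i: "integrable lborel (\<lambda>x. b x * g x)"
  proof (rule Bochner_Integration.integrable_bound[OF b])
    show "(\<lambda>x. b x * g x) \<in> borel_measurable lborel" using b g by (auto dest: borel_measurable_integrable)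
    show "AE x in lborel. norm (b x * g x) \<le> norm (b x)" using g(2) by (auto simp: abs_mult mult_left_le)
  qed
  have "\<bar>\<integral>x. b x * g x \<partial>lborel\<bar> \<le> (LBINT x. \<bar>b x * g x\<bar>)" by (rule integral_abs_bound)
  also have "\<dots> \<le> (LBINT x. \<bar>b x\<bar>)"
  proof (rule integral_mono)
    show "integrable lborel (\<lambda>x. \<bar>b x * g x\<bar>)" by (rule integrable_abs[OF i])
    show "\<bar>b x * g x\<bar> \<le> \<bar>b x\<bar>" for x using g(2)[of x] by (simp add: abs_mult mult_left_le)
  qed (use b in auto)
  finally show ?thesis .
qed

text \<open>The kernel gk2 i j s is minus the cosine transform of a Gaussian times w_i w_j, so the double integral is minus an integral over
  frequencies w of M applied to w and to the cosine and sine transforms of g; no Plancherel theorem is needed.\<close>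

lemma gform_sum_nonpos_L1:
  fixes M :: "'N::finite \<Rightarrow> 'N \<Rightarrow> 'n::finite \<Rightarrow> 'n \<Rightarrow> real" and g :: "'N \<Rightarrow> real^'n \<Rightarrow> real"
  assumes pos: "\<And>\<eta> \<xi>. 0 \<le> (\<Sum>\<alpha>\<in>UNIV. \<Sum>\<beta>\<in>UNIV. \<Sum>i\<in>UNIV. \<Sum>j\<in>UNIV. M \<alpha> \<beta> i j * (\<xi> i * \<xi> j * (\<eta> \<alpha> * \<eta> \<beta>)))"
    and g: "\<And>\<alpha>. integrable lborel (g \<alpha>)" and s: "0 < s"
  shows "(\<Sum>\<alpha>\<in>UNIV. \<Sum>\<beta>\<in>UNIV. \<Sum>i\<in>UNIV. \<Sum>j\<in>UNIV. M \<alpha> \<beta> i j * gform i j s (g \<alpha>) (g \<beta>)) \<le> 0"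
proof -
  define c where "c = (2 * pi * s) powr (- (real CARD('n) / 2))"
  define m where "m i j w = w $ i * w $ j * gk (1 / s) w" for i j and w :: "real^'n"
  define C where "C \<alpha> w = (LBINT x. g \<alpha> x * cos (w \<bullet> x))" for \<alpha> w
  define S where "S \<alpha> w = (LBINT x. g \<alpha> x * sin (w \<bullet> x))" for \<alpha> w
  have t: "1 / s > 0" using s by simp
  note [measurable] = integrable_lborel_measurable[OF g]
  have [measurable]: "C \<alpha> \<in> borel_measurable borel" "S \<alpha> \<in> borel_measurable borel" for \<alpha>
    unfolding C_def[abs_def] S_def[abs_def] by measurable
  have mi: "integrable lborel (m i j)" for i j
  proof -
    have "m i j w = (1 / s)^2 * gk2 i j (1 / s) w + (if i = j then 1 / s else 0) * gk (1 / s) w" for w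
      using s by (auto simp: m_def gk2_def field_simps power2_eq_square)
    then have "m i j = (\<lambda>w. (1 / s)^2 * gk2 i j (1 / s) w + (if i = j then 1 / s else 0) * gk (1 / s) w)" by (rule ext)
    then show ?thesis
      using gdom_integrable[OF t gdom_gk2[OF t]] integrable_gk[OF t]
      by (simp only:) (intro Bochner_Integration.integrable_add integrable_mult_right)
  qed
  note [measurable] = integrable_lborel_measurable[OF mi]
  have CS: "\<bar>C \<alpha> w\<bar> \<le> (LBINT x. \<bar>g \<alpha> x\<bar>)" "\<bar>S \<alpha> w\<bar> \<le> (LBINT x. \<bar>g \<alpha> x\<bar>)" for \<alpha> w
    unfolding C_def S_def by (intro trig_integral_bound g; auto)+
  have ii: "integrable lborel (\<lambda>w. m i j w * (C \<alpha> w * C \<beta> w + S \<alpha> w * S \<beta> w))" for i j \<alpha> \<beta>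
  proof (rule Bochner_Integration.integrable_bound)
    let ?k = "(LBINT x. \<bar>g \<alpha> x\<bar>) * (LBINT x. \<bar>g \<beta> x\<bar>)"
    show "integrable lborel (\<lambda>w. 2 * ?k * m i j w)" using mi by simp
    show "AE w in lborel. norm (m i j w * (C \<alpha> w * C \<beta> w + S \<alpha> w * S \<beta> w)) \<le> norm (2 * ?k * m i j w)"
    proof (rule AE_I2)
      fix w
      have "\<bar>C \<alpha> w * C \<beta> w + S \<alpha> w * S \<beta> w\<bar> \<le> \<bar>C \<alpha> w\<bar> * \<bar>C \<beta> w\<bar> + \<bar>S \<alpha> w\<bar> * \<bar>S \<beta> w\<bar>"
        unfolding abs_mult[symmetric] by (rule abs_triangle_ineq)
      also have "\<dots> \<le> ?k + ?k" by (intro add_mono mult_mono CS) auto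
      finally have "\<bar>C \<alpha> w * C \<beta> w + S \<alpha> w * S \<beta> w\<bar> * \<bar>m i j w\<bar> \<le> (2 * ?k) * \<bar>m i j w\<bar>"
        by (intro mult_right_mono) auto
      also have "(2 * ?k) * \<bar>m i j w\<bar> = norm (2 * ?k * m i j w)" by (simp add: abs_mult)
      finally show "norm (m i j w * (C \<alpha> w * C \<beta> w + S \<alpha> w * S \<beta> w)) \<le> norm (2 * ?k * m i j w)"
        by (simp add: abs_mult mult.commute)
    qed
  qed measurable
  have gf: "gform i j s (g \<alpha>) (g \<beta>) = - c * (LBINT w. m i j w * (C \<alpha> w * C \<beta> w + S \<alpha> w * S \<beta> w))" for i j \<alpha> \<beta>
  proof -
    have "gk2 i j s z = - c * (LBINT w. m i j w * cos (w \<bullet> z))" for z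
      using gk2_fourier[OF s, of i j z] by (simp add: c_def m_def)
    then have "gform i j s (g \<alpha>) (g \<beta>) = (LBINT x. g \<alpha> x * (LBINT y. (- c * (LBINT w. m i j w * cos (w \<bullet> (x - y)))) * g \<beta> y))"
      by (simp add: gform_def conv_def)
    also have "\<dots> = (LBINT x. - c * (g \<alpha> x * (LBINT y. (LBINT w. m i j w * cos (w \<bullet> (x - y))) * g \<beta> y)))"
      by (simp add: mult_ac)
    also have "\<dots> = - c * (LBINT x. g \<alpha> x * (LBINT y. (LBINT w. m i j w * cos (w \<bullet> (x - y))) * g \<beta> y))"
      by (rule Bochner_Integration.integral_mult_right_zero)
    finally show ?thesis unfolding convolution_fourier[OF g g mi] C_def S_def .
  qed
  have "(\<Sum>\<alpha>\<in>UNIV. \<Sum>\<beta>\<in>UNIV. \<Sum>i\<in>UNIV. \<Sum>j\<in>UNIV. M \<alpha> \<beta> i j * gform i j s (g \<alpha>) (g \<beta>))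
     = - c * (LBINT w. (\<Sum>\<alpha>\<in>UNIV. \<Sum>\<beta>\<in>UNIV. \<Sum>i\<in>UNIV. \<Sum>j\<in>UNIV. M \<alpha> \<beta> i j * (m i j w * (C \<alpha> w * C \<beta> w + S \<alpha> w * S \<beta> w))))"
  proof -
    have "(LBINT w. (\<Sum>\<alpha>\<in>UNIV. \<Sum>\<beta>\<in>UNIV. \<Sum>i\<in>UNIV. \<Sum>j\<in>UNIV. M \<alpha> \<beta> i j * (m i j w * (C \<alpha> w * C \<beta> w + S \<alpha> w * S \<beta> w))))
      = (\<Sum>\<alpha>\<in>UNIV. \<Sum>\<beta>\<in>UNIV. \<Sum>i\<in>UNIV. \<Sum>j\<in>UNIV. M \<alpha> \<beta> i j * (LBINT w. m i j w * (C \<alpha> w * C \<beta> w + S \<alpha> w * S \<beta> w)))"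
      using ii by (simp add: Bochner_Integration.integral_sum)
    then show ?thesis unfolding gf sum_distrib_left by (simp only: sum_distrib_left) (intro sum.cong refl, simp)
  qed
  also have "\<dots> \<le> 0"
  proof -
    have "0 \<le> (LBINT w. (\<Sum>\<alpha>\<in>UNIV. \<Sum>\<beta>\<in>UNIV. \<Sum>i\<in>UNIV. \<Sum>j\<in>UNIV. M \<alpha> \<beta> i j * (m i j w * (C \<alpha> w * C \<beta> w + S \<alpha> w * S \<beta> w))))"
    proof (rule Bochner_Integration.integral_nonneg)
      fix w :: "real^'n"
      have "(\<Sum>\<alpha>\<in>UNIV. \<Sum>\<beta>\<in>UNIV. \<Sum>i\<in>UNIV. \<Sum>j\<in>UNIV. M \<alpha> \<beta> i j * (m i j w * (C \<alpha> w * C \<beta> w + S \<alpha> w * S \<beta> w)))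
        = gk (1 / s) w * ((\<Sum>\<alpha>\<in>UNIV. \<Sum>\<beta>\<in>UNIV. \<Sum>i\<in>UNIV. \<Sum>j\<in>UNIV. M \<alpha> \<beta> i j * (w $ i * w $ j * (C \<alpha> w * C \<beta> w)))
         + (\<Sum>\<alpha>\<in>UNIV. \<Sum>\<beta>\<in>UNIV. \<Sum>i\<in>UNIV. \<Sum>j\<in>UNIV. M \<alpha> \<beta> i j * (w $ i * w $ j * (S \<alpha> w * S \<beta> w))))"
        unfolding sum.distrib[symmetric] sum_distrib_left by (intro sum.cong refl) (simp add: m_def algebra_simps)
      also have "\<dots> \<ge> 0"
        using pos[of "\<lambda>i. w $ i" "\<lambda>\<alpha>. C \<alpha> w"] pos[of "\<lambda>i. w $ i" "\<lambda>\<alpha>. S \<alpha> w"]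
        by (intro mult_nonneg_nonneg add_nonneg_nonneg gk_nonneg) auto
      finally show "0 \<le> (\<Sum>\<alpha>\<in>UNIV. \<Sum>\<beta>\<in>UNIV. \<Sum>i\<in>UNIV. \<Sum>j\<in>UNIV. M \<alpha> \<beta> i j * (m i j w * (C \<alpha> w * C \<beta> w + S \<alpha> w * S \<beta> w)))" .
    qed
    then show ?thesis by (simp add: c_def)
  qed
  finally show ?thesis .
qed

lemma L2_truncate_integrable:
  fixes g :: "real^'n \<Rightarrow> real"
  assumes g: "g \<in> L2 lborel"
  shows "integrable lborel (\<lambda>x. indicator (cball 0 R) x * g x)" "(\<lambda>x. indicator (cball 0 R) x * g x) \<in> L2 lborel"
proof -
  note [measurable] = L2_lborel_measurable[OF g]
  show "(\<lambda>x. indicator (cball 0 R) x * g x) \<in> L2 lborel"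
    by (rule L2_dominated[OF g, where C=1]) (auto simp: indicator_def)
  have "(\<lambda>x::real^'n. indicator (cball 0 R) x :: real) \<in> L2 lborel"
  proof (rule L2I)
    have "(\<lambda>x::real^'n. (norm (indicator (cball 0 R) x :: real))^2) = indicator (cball 0 R)"
      by (auto simp: indicator_def fun_eq_iff)
    then show "integrable lborel (\<lambda>x::real^'n. (norm (indicator (cball 0 R) x :: real))^2)"
      using emeasure_compact_finite[OF compact_cball, of "0::real^'n" R]
      by (simp only:) (rule integrable_real_indicator, auto)
  qed (auto intro!: borel_measurable_indicator)
  from L2_mult_integrable(2)[OF this g] show "integrable lborel (\<lambda>x. indicator (cball 0 R) x * g x)" by simp
qed

text \<open>Restriction to balls makes the data integrable, where the frequency representation is
  available. The double integral of the untruncated data is absolutely convergent, so it dominates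
  the passage to the limit.\<close>

theorem gform_sum_nonpos:
  fixes M :: "'N::finite \<Rightarrow> 'N \<Rightarrow> 'n::finite \<Rightarrow> 'n \<Rightarrow> real" and g :: "'N \<Rightarrow> real^'n \<Rightarrow> real"
  assumes pos: "\<And>\<eta> \<xi>. 0 \<le> (\<Sum>\<alpha>\<in>UNIV. \<Sum>\<beta>\<in>UNIV. \<Sum>i\<in>UNIV. \<Sum>j\<in>UNIV. M \<alpha> \<beta> i j * (\<xi> i * \<xi> j * (\<eta> \<alpha> * \<eta> \<beta>)))"
    and g: "\<And>\<alpha>. g \<alpha> \<in> L2 lborel" and s: "0 < s"
  shows "(\<Sum>\<alpha>\<in>UNIV. \<Sum>\<beta>\<in>UNIV. \<Sum>i\<in>UNIV. \<Sum>j\<in>UNIV. M \<alpha> \<beta> i j * gform i j s (g \<alpha>) (g \<beta>)) \<le> 0"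
proof -
  define gR where "gR k \<alpha> x = indicator (cball 0 (real k)) x * g \<alpha> x" for k \<alpha> and x :: "real^'n"
  have k2: "integrable lborel (gk2 i j s :: real^'n \<Rightarrow> real)" for i j by (rule gdom_integrable[OF s gdom_gk2[OF s]])
  note [measurable] = L2_lborel_measurable[OF g]
  have [measurable]: "gR k \<alpha> \<in> borel_measurable borel" for k \<alpha>
    unfolding gR_def[abs_def] by (rule L2_lborel_measurable[OF L2_truncate_integrable(2)[OF g]])
  have "(\<lambda>k. gform i j s (gR k \<alpha>) (gR k \<beta>)) \<longlonglongrightarrow> gform i j s (g \<alpha>) (g \<beta>)" for i j \<alpha> \<beta>
  proof -
    have "(\<lambda>k. \<integral>p. (case p of (x, y) \<Rightarrow> gR k \<alpha> x * (gk2 i j s (x - y) * gR k \<beta> y)) \<partial>(lborel \<Otimes>\<^sub>M lborel))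
      \<longlonglongrightarrow> (\<integral>p. (case p of (x, y) \<Rightarrow> g \<alpha> x * (gk2 i j s (x - y) * g \<beta> y)) \<partial>(lborel \<Otimes>\<^sub>M lborel))"
    proof (rule integral_dominated_convergence[where w="\<lambda>p. norm (case p of (x, y) \<Rightarrow> g \<alpha> x * (gk2 i j s (x - y) * g \<beta> y))"])
      show "integrable (lborel \<Otimes>\<^sub>M lborel) (\<lambda>p. norm (case p of (x, y) \<Rightarrow> g \<alpha> x * (gk2 i j s (x - y) * g \<beta> y)))"
        by (intro integrable_norm kernel_product_integrable k2 g)
      show "AE p in lborel \<Otimes>\<^sub>M lborel. (\<lambda>k. case p of (x, y) \<Rightarrow> gR k \<alpha> x * (gk2 i j s (x - y) * gR k \<beta> y)) \<longlonglongrightarrow> (case p of (x, y) \<Rightarrow> g \<alpha> x * (gk2 i j s (x - y) * g \<beta> y))"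
      proof (rule AE_I2, clarify)
        fix x y :: "real^'n"
        have "\<forall>\<^sub>F k in sequentially. norm x \<le> real k \<and> norm y \<le> real k"
        proof (rule eventually_sequentiallyI[of "nat \<lceil>max (norm x) (norm y)\<rceil>"])
          fix k assume "nat \<lceil>max (norm x) (norm y)\<rceil> \<le> k"
          then have "max (norm x) (norm y) \<le> real k" by (simp only: nat_ceiling_le_eq)
          then show "norm x \<le> real k \<and> norm y \<le> real k" by simp
        qed
        then have "\<forall>\<^sub>F k in sequentially. gR k \<alpha> x * (gk2 i j s (x - y) * gR k \<beta> y) = g \<alpha> x * (gk2 i j s (x - y) * g \<beta> y)"
          by eventually_elim (simp add: gR_def)
        then show "(\<lambda>k. gR k \<alpha> x * (gk2 i j s (x - y) * gR k \<beta> y)) \<longlonglongrightarrow> g \<alpha> x * (gk2 i j s (x - y) * g \<beta> y)"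
          by (rule tendsto_eventually)
      qed
      show "AE p in lborel \<Otimes>\<^sub>M lborel. norm (case p of (x, y) \<Rightarrow> gR k \<alpha> x * (gk2 i j s (x - y) * gR k \<beta> y)) \<le> norm (case p of (x, y) \<Rightarrow> g \<alpha> x * (gk2 i j s (x - y) * g \<beta> y))" for k
        by (rule AE_I2) (auto simp: gR_def indicator_def)
    qed measurable
    then show ?thesis unfolding gform_def
      using L2_truncate_integrable(2)[OF g]
      by (subst (1 2) integral_mult_conv(2)) (auto simp: k2 g gR_def[abs_def])
  qed
  then have lim: "(\<lambda>k. (\<Sum>\<alpha>\<in>UNIV. \<Sum>\<beta>\<in>UNIV. \<Sum>i\<in>UNIV. \<Sum>j\<in>UNIV. M \<alpha> \<beta> i j * gform i j s (gR k \<alpha>) (gR k \<beta>)))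
     \<longlonglongrightarrow> (\<Sum>\<alpha>\<in>UNIV. \<Sum>\<beta>\<in>UNIV. \<Sum>i\<in>UNIV. \<Sum>j\<in>UNIV. M \<alpha> \<beta> i j * gform i j s (g \<alpha>) (g \<beta>))"
    by (intro tendsto_intros)
  show ?thesis
    by (rule LIMSEQ_le_const2[OF lim]) (auto intro!: gform_sum_nonpos_L1 pos s L2_truncate_integrable(1) g simp: gR_def[abs_def])
qed

section \<open>Kernels built from heat kernels\<close>

definition kint :: "(real \<Rightarrow> real) \<Rightarrow> (real \<Rightarrow> real^'n \<Rightarrow> real) \<Rightarrow> real^'n \<Rightarrow> real" where
  "kint \<theta> \<kappa> z = (LBINT s. \<theta> s * \<kappa> s z)"

text \<open>The weight vanishes near time 0, where the kernels are singular, and at large times,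
  where they decay too slowly. Differences of such weights stay in the class, which the Cauchy
  argument for Hessians needs.\<close>

definition adm :: "(real \<Rightarrow> real) \<Rightarrow> bool" where
  "adm \<theta> \<longleftrightarrow> \<theta> \<in> borel_measurable borel \<and> (\<exists>l r c. 0 < l \<and> 0 \<le> c \<and> (\<forall>s. \<bar>\<theta> s\<bar> \<le> c * indicator {l..r} s))"

text \<open>The exponent \<open>b\<close> is half the number of space derivatives: 0, 1/2 and 1 for
  \<open>gk\<close>, \<open>gk1\<close> and \<open>gk2\<close>. In the Riesz potential that
  dominates the kernel it becomes a = 1 - b.\<close>

definition gker :: "real \<Rightarrow> (real \<Rightarrow> real^'n \<Rightarrow> real) \<Rightarrow> bool" where
  "gker b \<kappa> \<longleftrightarrow> 0 \<le> b \<and> (\<lambda>p. \<kappa> (fst p) (snd p)) \<in> borel_measurable (borel \<Otimes>\<^sub>M borel) \<and>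
     (\<exists>C\<ge>0. \<forall>s>0. \<forall>z. \<bar>\<kappa> s z\<bar> \<le> C * s powr (- b) * gk (2 * s) z)"

lemma gker_gk: "gker 0 (gk :: real \<Rightarrow> real^'n \<Rightarrow> real)"
  unfolding gker_def using gk_double_le
  by (auto simp: gk_nonneg intro!: exI[of _ "2 powr (real CARD('n) / 2)"] measurable_gk)

lemma gker_gk1: "gker (1/2) (gk1 i :: real \<Rightarrow> real^'n \<Rightarrow> real)"
  unfolding gker_def using gk1_bound
  by (auto intro!: exI[of _ "2 * 2 powr (real CARD('n) / 2)"] measurable_gk1)

lemma gker_gk2: "gker 1 (gk2 i j :: real \<Rightarrow> real^'n \<Rightarrow> real)"
  unfolding gker_def
proof (intro conjI exI[of _ "5 * 2 powr (real CARD('n) / 2)"] allI impI)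
  fix s :: real and z :: "real^'n" assume "0 < s"
  then show "\<bar>gk2 i j s z\<bar> \<le> 5 * 2 powr (real CARD('n) / 2) * s powr (- 1) * gk (2 * s) z"
  proof -
    have "s powr (- 1) = 1 / s" using \<open>0 < s\<close> by (simp add: powr_minus_divide)
    then show ?thesis using gk2_bound[OF \<open>0 < s\<close>, of i j z] by simp
  qed
qed (auto intro!: measurable_gk2)

lemma gker_measurable[measurable_dest]:
  assumes "gker b \<kappa>" "F \<in> borel_measurable M" "G \<in> borel_measurable M"
  shows "(\<lambda>x. \<kappa> (F x) (G x)) \<in> borel_measurable M"
proof -
  have "(\<lambda>x. (F x, G x)) \<in> M \<rightarrow>\<^sub>M borel \<Otimes>\<^sub>M borel" using assms(2,3) by (rule measurable_Pair)
  moreover have "(\<lambda>p. \<kappa> (fst p) (snd p)) \<in> borel_measurable (borel \<Otimes>\<^sub>M borel)" using assms(1) by (simp add: gker_def)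
  ultimately have "(\<lambda>x. (\<lambda>p. \<kappa> (fst p) (snd p)) (F x, G x)) \<in> borel_measurable M" by (rule measurable_compose)
  then show ?thesis by simp
qed

lemma adm_diff: "adm \<theta> \<Longrightarrow> adm \<theta>' \<Longrightarrow> adm (\<lambda>s. \<theta> s - \<theta>' s)"
proof -
  assume "adm \<theta>" "adm \<theta>'"
  then obtain l r c l' r' c' where a: "\<theta> \<in> borel_measurable borel" "0 < l" "0 \<le> c" "\<And>s. \<bar>\<theta> s\<bar> \<le> c * indicator {l..r} s"
    and a': "\<theta>' \<in> borel_measurable borel" "0 < l'" "0 \<le> c'" "\<And>s. \<bar>\<theta>' s\<bar> \<le> c' * indicator {l'..r'} s"
    unfolding adm_def by blast
  have "\<bar>\<theta> s - \<theta>' s\<bar> \<le> (c + c') * indicator {min l l'..max r r'} s" for s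
  proof -
    have "c * indicator {l..r} s \<le> c * indicator {min l l'..max r r'} s"
      using a by (intro mult_left_mono) (auto simp: indicator_def)
    moreover have "c' * indicator {l'..r'} s \<le> c' * indicator {min l l'..max r r'} s"
      using a' by (intro mult_left_mono) (auto simp: indicator_def)
    ultimately show ?thesis using a(4)[of s] a'(4)[of s] unfolding distrib_right by linarith
  qed
  then show ?thesis unfolding adm_def using a a'
    by (intro conjI exI[of _ "min l l'"] exI[of _ "max r r'"] exI[of _ "c + c'"]) auto
qed

text \<open>On the support of the weight s is at least l, so the singular factor s^-b is replaced by
  the constant l^-b and only Gaussians remain.\<close>

lemma kint_dominated:
  assumes a: "adm \<theta>" and k: "gker b (\<kappa> :: real \<Rightarrow> real^'n \<Rightarrow> real)"
  obtains D l r where "0 \<le> D" "0 < l" "\<And>s z. \<bar>\<theta> s * \<kappa> s z\<bar> \<le> D * indicator {l..r} s * gk (2 * s) z"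
proof -
  obtain l r c where l: "0 < l" and c: "0 \<le> c" and th: "\<And>s. \<bar>\<theta> s\<bar> \<le> c * indicator {l..r} s"
    using a unfolding adm_def by blast
  obtain C where C: "0 \<le> C" "\<And>s z. 0 < s \<Longrightarrow> \<bar>\<kappa> s z\<bar> \<le> C * s powr (- b) * gk (2 * s) z" and b: "0 \<le> b"
    using k unfolding gker_def by blast
  show thesis
  proof (rule that[of "c * (C * l powr (- b))" l r])
    fix s and z :: "real^'n"
    show "\<bar>\<theta> s * \<kappa> s z\<bar> \<le> c * (C * l powr (- b)) * indicator {l..r} s * gk (2 * s) z"
    proof (cases "s \<in> {l..r}")
      case True
      then have s: "0 < s" using l by simp
      have "s powr (- b) \<le> l powr (- b)" using True l b by (intro powr_mono2') auto
      then have "C * s powr (- b) * gk (2 * s) z \<le> C * l powr (- b) * gk (2 * s) z"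
        using C gk_nonneg by (intro mult_right_mono mult_left_mono) auto
      then have "\<bar>\<kappa> s z\<bar> \<le> C * l powr (- b) * gk (2 * s) z" using C(2)[OF s, of z] by linarith
      moreover have "\<bar>\<theta> s\<bar> \<le> c" using th[of s] True by simp
      ultimately have "\<bar>\<theta> s\<bar> * \<bar>\<kappa> s z\<bar> \<le> c * (C * l powr (- b) * gk (2 * s) z)" using c by (intro mult_mono) auto
      then show ?thesis using True by (simp add: abs_mult mult_ac)
    next
      case False
      then have "\<theta> s = 0" using th[of s] by simp
      then show ?thesis using False by simp
    qed
  qed (use c C l in auto)
qed

lemma gk_window_integrable:
  assumes l: "0 < l"
  shows "integrable (lborel \<Otimes>\<^sub>M lborel) (\<lambda>(s, x::real^'n). D * indicator {l..r} s * gk (2 * s) (x - y))"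
proof (rule lborel_pair.Fubini_integrable)
  show "(\<lambda>(s, x::real^'n). D * indicator {l..r} s * gk (2 * s) (x - y)) \<in> borel_measurable (lborel \<Otimes>\<^sub>M lborel)"
    by measurable
  have eq: "(\<lambda>s. LBINT x. norm (case (s, x::real^'n) of (s, x) \<Rightarrow> D * indicator {l..r} s * gk (2 * s) (x - y))) = (\<lambda>s. \<bar>D\<bar> * indicator {l..r} s)"
  proof
    fix s
    show "(LBINT x. norm (case (s, x::real^'n) of (s, x) \<Rightarrow> D * indicator {l..r} s * gk (2 * s) (x - y))) = \<bar>D\<bar> * indicator {l..r} s"
    proof (cases "s \<in> {l..r}")
      case True
      then have "0 < 2 * s" using l by simp
      then have "integral\<^sup>L lborel (gk (2 * s) :: real^'n \<Rightarrow> real) = 1" by (rule integral_gk)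
      with \<open>0 < 2 * s\<close> show ?thesis using True integral_shift'[OF integrable_gk, of "2 * s" y]
        by (simp add: abs_mult gk_nonneg)
    qed simp
  qed
  show "integrable lborel (\<lambda>s. LBINT x. norm (case (s, x::real^'n) of (s, x) \<Rightarrow> D * indicator {l..r} s * gk (2 * s) (x - y)))"
    unfolding eq by (intro integrable_mult_right integrable_real_indicator) (auto simp: emeasure_lborel_Icc_eq)
  show "AE s in lborel. integrable lborel (\<lambda>x. case (s, x::real^'n) of (s, x) \<Rightarrow> D * indicator {l..r} s * gk (2 * s) (x - y))"
  proof (rule AE_I2)
    fix s
    show "integrable lborel (\<lambda>x. case (s, x::real^'n) of (s, x) \<Rightarrow> D * indicator {l..r} s * gk (2 * s) (x - y))"
    proof (cases "s \<in> {l..r}")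
      case True
      then have "0 < 2 * s" using l by simp
      then show ?thesis using integrable_shift'[OF integrable_gk, of "2 * s" y] by simp
    qed simp
  qed
qed

lemma kint_pair_integrable:
  fixes \<kappa> :: "real \<Rightarrow> real^'n \<Rightarrow> real"
  assumes a: "adm \<theta>" and k: "gker b \<kappa>" and f: "f \<in> borel_measurable borel" "\<And>x. \<bar>f x\<bar> \<le> M"
  shows "integrable (lborel \<Otimes>\<^sub>M lborel) (\<lambda>(s, x). \<theta> s * \<kappa> s (x - y) * f x)"
proof -
  obtain D l r where D: "0 \<le> D" "0 < l" "\<And>s z. \<bar>\<theta> s * \<kappa> s z\<bar> \<le> D * indicator {l..r} s * gk (2 * s) z"
    using kint_dominated[OF a k] by metis
  have [measurable]: "\<theta> \<in> borel_measurable borel" using a by (simp add: adm_def)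
  have [measurable]: "f \<in> borel_measurable borel" using f(1) .
  have [measurable]: "(\<lambda>p. \<kappa> (fst p) (snd p - y)) \<in> borel_measurable (lborel \<Otimes>\<^sub>M lborel)"
    by (rule gker_measurable[OF k]) measurable
  show ?thesis
  proof (rule Bochner_Integration.integrable_bound)
    show "integrable (lborel \<Otimes>\<^sub>M lborel) (\<lambda>(s, x::real^'n). (M * D) * indicator {l..r} s * gk (2 * s) (x - y))"
      by (rule gk_window_integrable[OF D(2)])
    show "(\<lambda>(s, x). \<theta> s * \<kappa> s (x - y) * f x) \<in> borel_measurable (lborel \<Otimes>\<^sub>M lborel)"
      unfolding split_beta' by measurable
    show "AE p in lborel \<Otimes>\<^sub>M lborel. norm (case p of (s, x) \<Rightarrow> \<theta> s * \<kappa> s (x - y) * f x) \<le> norm (case p of (s, x) \<Rightarrow> (M * D) * indicator {l..r} s * gk (2 * s) (x - y))"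
    proof (rule AE_I2, clarify)
      fix s x
      have "\<bar>\<theta> s * \<kappa> s (x - y)\<bar> * \<bar>f x\<bar> \<le> (D * indicator {l..r} s * gk (2 * s) (x - y)) * M"
        using D f(2)[of x] by (intro mult_mono) (auto simp: gk_nonneg)
      moreover have "0 \<le> M" using f(2)[of x] by (rule order_trans[OF abs_ge_zero])
      ultimately show "norm (\<theta> s * \<kappa> s (x - y) * f x) \<le> norm ((M * D) * indicator {l..r} s * gk (2 * s) (x - y))"
        using D(1) by (simp add: abs_mult gk_nonneg mult_ac)
    qed
  qed
qed

lemma
  fixes \<kappa> :: "real \<Rightarrow> real^'n \<Rightarrow> real"
  assumes a: "adm \<theta>" and k: "gker b \<kappa>" and f: "f \<in> borel_measurable borel" "\<And>x. \<bar>f x\<bar> \<le> M"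
  shows kint_integral: "(LBINT x. kint \<theta> \<kappa> (x - y) * f x) = (LBINT s. \<theta> s * (LBINT x. \<kappa> s (x - y) * f x))"
    and kint_time_integrable: "integrable lborel (\<lambda>s. \<theta> s * (LBINT x. \<kappa> s (x - y) * f x))"
    and kint_mult_integrable: "integrable lborel (\<lambda>x. kint \<theta> \<kappa> (x - y) * f x)"
proof -
  note I = kint_pair_integrable[OF a k f, of y]
  have e1: "(LBINT x. \<theta> s * \<kappa> s (x - y) * f x) = \<theta> s * (LBINT x. \<kappa> s (x - y) * f x)" for s
    by (simp add: mult.assoc)
  have e2: "(LBINT s. \<theta> s * \<kappa> s (x - y) * f x) = kint \<theta> \<kappa> (x - y) * f x" for x
    by (simp add: kint_def)
  show "(LBINT x. kint \<theta> \<kappa> (x - y) * f x) = (LBINT s. \<theta> s * (LBINT x. \<kappa> s (x - y) * f x))"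
    using lborel_pair.Fubini_integral[OF I] by (simp only: e1 e2)
  show "integrable lborel (\<lambda>s. \<theta> s * (LBINT x. \<kappa> s (x - y) * f x))"
    using lborel_pair.integrable_fst[OF I] by (simp only: e1)
  show "integrable lborel (\<lambda>x. kint \<theta> \<kappa> (x - y) * f x)"
    using lborel_pair.integrable_snd[OF I] by (simp only: e2)
qed

lemma kint_integrable:
  assumes a: "adm \<theta>" and k: "gker b (\<kappa> :: real \<Rightarrow> real^'n \<Rightarrow> real)"
  shows "integrable lborel (kint \<theta> \<kappa>)"
  using kint_mult_integrable[OF a k, of "\<lambda>_. 1" 1 0] by simp

lemma kint_time_slice_integrable:
  assumes a: "adm \<theta>" and k: "gker b (\<kappa> :: real \<Rightarrow> real^'n \<Rightarrow> real)"
  shows "integrable lborel (\<lambda>s. \<theta> s * \<kappa> s z)"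
    and "\<exists>K\<ge>0. \<forall>z. \<bar>kint \<theta> \<kappa> z\<bar> \<le> K"
proof -
  obtain D l r where D: "0 \<le> D" "0 < l" "\<And>s z. \<bar>\<theta> s * \<kappa> s z\<bar> \<le> D * indicator {l..r} s * gk (2 * s) z"
    using kint_dominated[OF a k] by metis
  have [measurable]: "\<theta> \<in> borel_measurable borel" using a by (simp add: adm_def)
  have [measurable]: "(\<lambda>s. \<kappa> s z) \<in> borel_measurable lborel" for z
    by (rule gker_measurable[OF k]) measurable
  define e where "e = (2 * pi * (2 * l)) powr (- (real CARD('n) / 2))"
  have dom: "\<bar>\<theta> s * \<kappa> s z\<bar> \<le> D * e * indicator {l..r} s" for s z
  proof (cases "s \<in> {l..r}")
    case True
    then have "gk (2 * s) z \<le> (2 * pi * (2 * s)) powr (- (real CARD('n) / 2))" using D(2) by (intro gk_le) simp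
    also have "\<dots> \<le> e" unfolding e_def using True D(2) by (intro powr_mono2') auto
    finally have "D * gk (2 * s) z \<le> D * e" using D(1) by (rule mult_left_mono)
    then show ?thesis using D(3)[of s z] True by simp
  next
    case False then show ?thesis using D(3)[of s z] by simp
  qed
  have ind: "integrable lborel (\<lambda>s. D * e * indicator {l..r} s)"
    by (intro integrable_mult_right integrable_real_indicator) (auto simp: emeasure_lborel_Icc_eq)
  show I: "integrable lborel (\<lambda>s. \<theta> s * \<kappa> s z)" for z
    by (rule Bochner_Integration.integrable_bound[OF ind]) (use dom in \<open>auto intro!: AE_I2 order_trans[OF dom] abs_ge_self\<close>)
  show "\<exists>K\<ge>0. \<forall>z. \<bar>kint \<theta> \<kappa> z\<bar> \<le> K"
  proof (intro exI conjI allI)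
    show "0 \<le> (LBINT s. D * e * indicator {l..r} s)" using D(1) by (intro Bochner_Integration.integral_nonneg) (auto simp: e_def)
    fix z
    show "\<bar>kint \<theta> \<kappa> z\<bar> \<le> (LBINT s. D * e * indicator {l..r} s)"
      unfolding kint_def
      by (rule order_trans[OF integral_abs_bound integral_mono]) (use I ind dom in auto)
  qed
qed

lemma kint_L2:
  assumes a: "adm \<theta>" and k: "gker b (\<kappa> :: real \<Rightarrow> real^'n \<Rightarrow> real)"
  shows "kint \<theta> \<kappa> \<in> L2 lborel"
proof -
  note I = kint_integrable[OF a k]
  obtain K where K: "0 \<le> K" "\<And>z. \<bar>kint \<theta> \<kappa> z\<bar> \<le> K" using kint_time_slice_integrable(2)[OF a k] by blast
  have [measurable]: "kint \<theta> \<kappa> \<in> borel_measurable borel" by (rule integrable_lborel_measurable[OF I])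
  show ?thesis
  proof (rule L2I)
    show "integrable lborel (\<lambda>x. (norm (kint \<theta> \<kappa> x))^2)"
    proof (rule Bochner_Integration.integrable_bound)
      show "integrable lborel (\<lambda>x. K * kint \<theta> \<kappa> x)" using I by simp
      show "AE x in lborel. norm ((norm (kint \<theta> \<kappa> x))^2) \<le> norm (K * kint \<theta> \<kappa> x)"
      proof (rule AE_I2)
        fix x
        have "\<bar>kint \<theta> \<kappa> x\<bar> * \<bar>kint \<theta> \<kappa> x\<bar> \<le> K * \<bar>kint \<theta> \<kappa> x\<bar>" by (intro mult_right_mono K) auto
        then show "norm ((norm (kint \<theta> \<kappa> x))^2) \<le> norm (K * kint \<theta> \<kappa> x)"
          using K(1) by (simp add: power2_eq_square abs_mult)
      qed
    qed measurable
  qed measurable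
qed

lemma kint_diff:
  assumes a: "adm \<theta>" "adm \<theta>'" and k: "gker b (\<kappa> :: real \<Rightarrow> real^'n \<Rightarrow> real)"
  shows "kint (\<lambda>s. \<theta> s - \<theta>' s) \<kappa> z = kint \<theta> \<kappa> z - kint \<theta>' \<kappa> z"
  unfolding kint_def using kint_time_slice_integrable(1)[OF a(1) k] kint_time_slice_integrable(1)[OF a(2) k]
  by (simp add: left_diff_distrib)

lemma gker_slice_bounded:
  assumes k: "gker b (\<kappa> :: real \<Rightarrow> real^'n \<Rightarrow> real)" and s: "0 < s"
  obtains K where "0 \<le> K" "\<And>z. \<bar>\<kappa> s z\<bar> \<le> K"
proof -
  obtain C where C: "0 \<le> C" "\<And>z. \<bar>\<kappa> s z\<bar> \<le> C * s powr (- b) * gk (2 * s) z"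
    using k s unfolding gker_def by blast
  have "\<bar>\<kappa> s z\<bar> \<le> C * s powr (- b) * (2 * pi * (2 * s)) powr (- (real CARD('n) / 2))" for z
    using C(2)[of z] mult_left_mono[OF gk_le[of "2 * s" z], of "C * s powr (- b)"] C(1) s by simp
  then show thesis using C(1) by (intro that[of "C * s powr (- b) * (2 * pi * (2 * s)) powr (- (real CARD('n) / 2))"]) auto
qed

lemma adm_zero_nonpos: "adm \<theta> \<Longrightarrow> s \<le> 0 \<Longrightarrow> \<theta> s = 0"
proof -
  assume "adm \<theta>" "s \<le> 0"
  then obtain l r c where l: "0 < l" and th: "\<bar>\<theta> s\<bar> \<le> c * indicator {l..r} s" unfolding adm_def by blast
  from l \<open>s \<le> 0\<close> have "s \<notin> {l..r}" by simp
  with th show "\<theta> s = 0" by simp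
qed

lemma kint_gk2_identity:
  assumes a: "adm \<theta>"
  shows "(LBINT x. kint \<theta> (gk2 i j) (x - y) * kint \<theta> (gk2 i j) (x - y'))
       = (\<integral>x. kint \<theta> (gk2 i i) (x - y) * kint \<theta> (gk2 j j) (x - y') \<partial>(lborel :: (real^'n) measure))"
proof -
  have expand: "(LBINT x. kint \<theta> (gk2 i j) (x - y) * kint \<theta> (gk2 i' j') (x - y'))
     = (LBINT s. \<theta> s * (LBINT t. \<theta> t * (\<integral>x. gk2 i' j' t (x - y') * gk2 i j s (x - y) \<partial>(lborel :: (real^'n) measure))))" for i j i' j' :: 'n
  proof -
    have k1: "gker 1 (gk2 i j :: real \<Rightarrow> real^'n \<Rightarrow> real)" and k2: "gker 1 (gk2 i' j' :: real \<Rightarrow> real^'n \<Rightarrow> real)" by (rule gker_gk2)+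
    obtain K where K: "\<And>z. \<bar>kint \<theta> (gk2 i' j' :: real \<Rightarrow> real^'n \<Rightarrow> real) z\<bar> \<le> K" using kint_time_slice_integrable(2)[OF a k2] by blast
    have m: "(\<lambda>x. kint \<theta> (gk2 i' j' :: real \<Rightarrow> real^'n \<Rightarrow> real) (x - y')) \<in> borel_measurable borel"
      using integrable_lborel_measurable[OF kint_integrable[OF a k2]] by measurable
    have "(LBINT x. kint \<theta> (gk2 i j) (x - y) * kint \<theta> (gk2 i' j') (x - y')) = (LBINT s. \<theta> s * (LBINT x. gk2 i j s (x - y) * kint \<theta> (gk2 i' j') (x - y')))"
      by (rule kint_integral[OF a k1 m K])
    also have "\<dots> = (LBINT s. \<theta> s * (LBINT t. \<theta> t * (LBINT x. gk2 i' j' t (x - y') * gk2 i j s (x - y))))"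
    proof (intro Bochner_Integration.integral_cong refl)
      fix s
      show "\<theta> s * (LBINT x. gk2 i j s (x - y) * kint \<theta> (gk2 i' j') (x - y')) = \<theta> s * (LBINT t. \<theta> t * (LBINT x. gk2 i' j' t (x - y') * gk2 i j s (x - y)))"
      proof (cases "0 < s")
        case True
        obtain K' where K': "\<And>z::real^'n. \<bar>gk2 i j s z\<bar> \<le> K'" using gker_slice_bounded[OF k1 True] by metis
        have "(\<lambda>x::real^'n. gk2 i j s (x - y)) \<in> borel_measurable borel" by measurable
        from kint_integral[OF a k2 this K', of y'] show ?thesis by (simp add: mult.commute)
      qed (simp add: adm_zero_nonpos[OF a])
    qed
    finally show ?thesis .
  qed
  show ?thesis unfolding expand
  proof (intro Bochner_Integration.integral_cong refl)
    fix s
    show "\<theta> s * (LBINT t. \<theta> t * (LBINT x. gk2 i j t (x - y') * gk2 i j s (x - y)))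
       = \<theta> s * (LBINT t. \<theta> t * (\<integral>x. gk2 j j t (x - y') * gk2 i i s (x - y) \<partial>(lborel :: (real^'n) measure)))"
    proof (cases "0 < s")
      case True
      have "\<theta> t * (LBINT x. gk2 i j t (x - y') * gk2 i j s (x - y)) = \<theta> t * (\<integral>x. gk2 j j t (x - y') * gk2 i i s (x - y) \<partial>(lborel :: (real^'n) measure))" for t
      proof (cases "0 < t")
        case t: True
        show ?thesis using gk2_gk2_integral[OF True t, of i j y y'] by (simp add: mult.commute)
      qed (simp add: adm_zero_nonpos[OF a])
      then show ?thesis by (simp only:)
    qed (simp add: adm_zero_nonpos[OF a])
  qed
qed

text \<open>The identity is exact for every admissible weight, before any limit. Applied to a
  difference of two cutoffs it lets the Cauchy property of the Laplacians control all second
  derivatives.\<close>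

theorem hessian_norm_identity:
  fixes g :: "real^'n \<Rightarrow> real"
  assumes a: "adm \<theta>" and g: "g \<in> L2 lborel"
  shows "(\<Sum>i\<in>UNIV. \<Sum>j\<in>UNIV. (l2n lborel (conv (kint \<theta> (gk2 i j)) g))^2)
     = (l2n lborel (\<lambda>x. \<Sum>i\<in>UNIV. conv (kint \<theta> (gk2 i i)) g x))^2"
proof -
  let ?H = "\<lambda>i j. conv (kint \<theta> (gk2 i j)) g"
  note ki = kint_integrable[OF a gker_gk2] and kL = kint_L2[OF a gker_gk2]
  have HL: "?H i j \<in> L2 lborel" for i j by (rule conv_L2[OF ki g])
  have "(l2n lborel (?H i j))^2 = (LBINT x. ?H i i x * ?H j j x)" for i j
  proof -
    have "(l2n lborel (?H i j))^2 = (LBINT x. ?H i j x * ?H i j x)" unfolding l2n_sq by (simp add: power2_eq_square)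
    also have "\<dots> = (LBINT x. ?H i i x * ?H j j x)"
      unfolding integral_conv_conv[OF ki kL ki g g] kint_gk2_identity[OF a, of i j] ..
    finally show ?thesis .
  qed
  moreover have "(l2n lborel (\<lambda>x. \<Sum>i\<in>UNIV. ?H i i x))^2 = (LBINT x. (\<Sum>i\<in>UNIV. \<Sum>j\<in>UNIV. ?H i i x * ?H j j x))"
    unfolding l2n_sq by (simp add: power2_eq_square sum_product)
  moreover have "(LBINT x. (\<Sum>i\<in>UNIV. \<Sum>j\<in>UNIV. ?H i i x * ?H j j x)) = (\<Sum>i\<in>UNIV. \<Sum>j\<in>UNIV. (LBINT x. ?H i i x * ?H j j x))"
    using L2_mult_integrable(2)[OF HL HL] by (simp add: Bochner_Integration.integral_sum)
  ultimately show ?thesis by simp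
qed

text \<open>By the heat equation the trace of \<open>gk2\<close> is twice the time derivative of
  \<open>gk\<close>, so the integral over the window telescopes to its two end values.\<close>

lemma kint_trace:
  fixes z :: "real^'n"
  assumes l: "0 < l" "l \<le> r"
  shows "(\<Sum>i\<in>UNIV. kint (\<lambda>s. c * indicator {l..r} s) (gk2 i i) z) = 2 * c * (gk r z - gk l z)"
proof -
  have a: "adm (\<lambda>s. c * indicator {l..r} s)"
    unfolding adm_def using l by (intro conjI exI[of _ l] exI[of _ r] exI[of _ "\<bar>c\<bar>"]) (auto simp: abs_mult)
  have "(\<Sum>i\<in>UNIV. kint (\<lambda>s. c * indicator {l..r} s) (gk2 i i) z) = (LBINT s. (\<Sum>i\<in>UNIV. c * indicator {l..r} s * gk2 i i s z))"
    unfolding kint_def by (rule Bochner_Integration.integral_sum[symmetric]) (rule kint_time_slice_integrable(1)[OF a gker_gk2])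
  also have "\<dots> = (LBINT s. (2 * c) * ((\<Sum>i\<in>UNIV. gk2 i i s z) / 2 * indicator {l..r} s))"
    by (intro Bochner_Integration.integral_cong refl) (simp add: sum_distrib_left[symmetric] mult_ac)
  also have "\<dots> = (2 * c) * (LBINT s. (\<Sum>i\<in>UNIV. gk2 i i s z) / 2 * indicator {l..r} s)"
    by (rule Bochner_Integration.integral_mult_right_zero)
  also have "(LBINT s. (\<Sum>i\<in>UNIV. gk2 i i s z) / 2 * indicator {l..r} s) = gk r z - gk l z"
  proof (rule integral_FTC_Icc_real[OF l(2)])
    fix s assume "l \<le> s" "s \<le> r"
    then have s: "0 < s" using l by simp
    show "((\<lambda>s. gk s z) has_real_derivative (\<Sum>i\<in>UNIV. gk2 i i s z) / 2) (at s)" by (rule gk_time_deriv[OF s])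
    show "isCont (\<lambda>s. (\<Sum>i\<in>UNIV. gk2 i i s z) / 2) s"
      unfolding gk2_def gk_def using s by (intro continuous_intros) auto
  qed
  finally show ?thesis .
qed

section \<open>Weak derivatives and sign of the truncated potentials\<close>

lemma test_L2:
  assumes "\<phi> \<in> test_functions"
  shows "partial_derivs is \<phi> \<in> L2 lborel"
proof -
  let ?K = "closure {x. \<phi> x \<noteq> 0}"
  obtain M where M: "0 \<le> M" "\<And>x. \<bar>partial_derivs is \<phi> x\<bar> \<le> M * indicator ?K x" using test_bounded[OF assms] by metis
  have K: "compact ?K" by (rule test_compact[OF assms])
  have [measurable]: "partial_derivs is \<phi> \<in> borel_measurable borel" by (rule test_measurable[OF assms])
  have [measurable]: "?K \<in> sets borel" by (rule borel_compact[OF K])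
  show ?thesis
  proof (rule L2I)
    show "integrable lborel (\<lambda>x. (norm (partial_derivs is \<phi> x))^2)"
    proof (rule Bochner_Integration.integrable_bound)
      show "integrable lborel (\<lambda>x. M^2 * indicator ?K x)"
        using emeasure_compact_finite[OF K] by (intro integrable_mult_right integrable_real_indicator) auto
      show "AE x in lborel. norm ((norm (partial_derivs is \<phi> x))^2) \<le> norm (M^2 * indicator ?K x)"
      proof (rule AE_I2)
        fix x
        have "\<bar>partial_derivs is \<phi> x\<bar>^2 \<le> (M * indicator ?K x)^2" by (intro power_mono M) auto
        also have "\<dots> = M^2 * indicator ?K x" by (auto simp: indicator_def)
        finally show "norm ((norm (partial_derivs is \<phi> x))^2) \<le> norm (M^2 * indicator ?K x)" by simp
      qed
    qed measurable
  qed measurable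
qed

lemma test_bdd:
  assumes "\<phi> \<in> test_functions"
  obtains M where "0 \<le> M" "\<And>x. \<bar>partial_derivs is \<phi> x\<bar> \<le> M"
proof -
  obtain M where M: "0 \<le> M" "\<And>x. \<bar>partial_derivs is \<phi> x\<bar> \<le> M * indicator (closure {x. \<phi> x \<noteq> 0}) x" using test_bounded[OF assms] by metis
  have "\<bar>partial_derivs is \<phi> x\<bar> \<le> M" for x
    using M(2)[of x] M(1) by (cases "x \<in> closure {x. \<phi> x \<noteq> 0}") auto
  with M(1) that show thesis by blast
qed

lemma parts_test:
  fixes h h' :: "real^'n \<Rightarrow> real"
  assumes \<phi>: "\<phi> \<in> test_functions" and h: "gdom s h" "gdom s h'" and s: "0 < s"
    and d: "\<And>x. ((\<lambda>t. h (x + t *\<^sub>R axis i 1)) has_real_derivative h' x) (at 0)"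
  shows "(LBINT x. h (x - y) * partial_derivs (i # js) \<phi> x) = - (LBINT x. h' (x - y) * partial_derivs js \<phi> x)"
proof -
  have I: "integrable lborel (\<lambda>x. k (x - y) * partial_derivs js \<phi> x)" if k: "gdom s k" for k :: "real^'n \<Rightarrow> real" and js
  proof -
    obtain M where M: "0 \<le> M" "\<And>x. \<bar>partial_derivs js \<phi> x\<bar> \<le> M" using test_bdd[OF \<phi>] by metis
    have [measurable]: "k \<in> borel_measurable borel" by (rule gdom_measurable[OF k])
    have [measurable]: "partial_derivs js \<phi> \<in> borel_measurable borel" by (rule test_measurable[OF \<phi>])
    show ?thesis
    proof (rule Bochner_Integration.integrable_bound)
      show "integrable lborel (\<lambda>x. M * k (x - y))" using integrable_shift'[OF gdom_integrable[OF s k], of y] by simp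
      show "AE x in lborel. norm (k (x - y) * partial_derivs js \<phi> x) \<le> norm (M * k (x - y))"
        using M by (auto simp: abs_mult mult.commute[of M] intro!: mult_left_mono)
    qed measurable
  qed
  have c: "continuous_on UNIV (\<lambda>x. k (x - y))" if "gdom s k" for k :: "real^'n \<Rightarrow> real"
  proof -
    have "continuous_on UNIV k" using that by (simp add: gdom_def)
    from continuous_on_compose2[OF this continuous_on_diff[OF continuous_on_id continuous_on_const]] show ?thesis by auto
  qed
  have "(LBINT x. h' (x - y) * partial_derivs js \<phi> x + partial_derivs (i # js) \<phi> x * h (x - y)) = 0"
  proof (rule integral_directional_derivative_eq_0[where f="\<lambda>x. h (x - y) * partial_derivs js \<phi> x" and v="axis i 1"])
    fix x
    have "((\<lambda>t. h (x - y + t *\<^sub>R axis i 1) * partial_derivs js \<phi> (x + t *\<^sub>R axis i 1)) has_real_derivative h' (x - y) * partial_derivs js \<phi> x + partial_derivs (i # js) \<phi> x * h (x - y)) (at 0)"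
      using DERIV_mult[OF d[of "x - y"] test_directional[OF \<phi>, of js x i]] by (simp del: partial_derivs.simps)
    moreover have "x - y + t *\<^sub>R axis i 1 = x + t *\<^sub>R axis i 1 - y" for t by simp
    ultimately show "((\<lambda>t. h (x + t *\<^sub>R axis i 1 - y) * partial_derivs js \<phi> (x + t *\<^sub>R axis i 1)) has_real_derivative h' (x - y) * partial_derivs js \<phi> x + partial_derivs (i # js) \<phi> x * h (x - y)) (at 0)" by simp
  next
    show "continuous_on UNIV (\<lambda>x. h' (x - y) * partial_derivs js \<phi> x + partial_derivs (i # js) \<phi> x * h (x - y))"
      by (intro continuous_on_add continuous_on_mult c h test_continuous[OF \<phi>])
  next
    show "integrable lborel (\<lambda>x. h (x - y) * partial_derivs js \<phi> x)" by (rule I[OF h(1)])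
    show "integrable lborel (\<lambda>x. h' (x - y) * partial_derivs js \<phi> x + partial_derivs (i # js) \<phi> x * h (x - y))"
      using I[OF h(2), of js] I[OF h(1), of "i # js"] by (simp add: mult.commute del: partial_derivs.simps)
  qed
  then show ?thesis using I[OF h(2), of js] I[OF h(1), of "i # js"] by (simp add: mult.commute del: partial_derivs.simps)
qed

text \<open>Convolution and time integral are first moved off, leaving a heat kernel of fixed time
  centred at y against \<phi>. Classical integration by parts in x transfers the derivatives there,
  one sign for each.\<close>

lemma conv_kint_weak:
  fixes g :: "real^'n \<Rightarrow> real"
  assumes a: "adm \<theta>" and g: "g \<in> L2 lborel" and \<phi>: "\<phi> \<in> test_functions"
  shows "(LBINT x. partial_derivs [i] \<phi> x * conv (kint \<theta> gk) g x) = - (LBINT x. \<phi> x * conv (kint \<theta> (gk1 i)) g x)"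
    and "(LBINT x. partial_derivs [i, j] \<phi> x * conv (kint \<theta> gk) g x) = (LBINT x. \<phi> x * conv (kint \<theta> (gk2 i j)) g x)"
proof -
  have kk: "(LBINT x. kint \<theta> \<kappa> (x - y) * partial_derivs js \<phi> x) = (LBINT s. \<theta> s * (LBINT x. \<kappa> s (x - y) * partial_derivs js \<phi> x))"
    if "gker b \<kappa>" for \<kappa> :: "real \<Rightarrow> real^'n \<Rightarrow> real" and b js y
  proof -
    obtain M where "\<And>x. \<bar>partial_derivs js \<phi> x\<bar> \<le> M" using test_bdd[OF \<phi>] by metis
    from kint_integral[OF a that test_measurable[OF \<phi>] this] show ?thesis .
  qed
  have w1: "\<theta> s * (LBINT x. gk s (x - y) * partial_derivs (i # js) \<phi> x) = - (\<theta> s * (LBINT x. gk1 i s (x - y) * partial_derivs js \<phi> x))" for s y js i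
  proof (cases "0 < s")
    case True
    show ?thesis using parts_test[OF \<phi> gdom_gk[OF True] gdom_gk1[OF True] True gk_deriv[OF True], where i=i and y=y and js=js] by simp
  qed (simp add: adm_zero_nonpos[OF a])
  have w2: "\<theta> s * (LBINT x. gk1 i s (x - y) * partial_derivs [j] \<phi> x) = - (\<theta> s * (LBINT x. gk2 i j s (x - y) * \<phi> x))" for s y
  proof (cases "0 < s")
    case True
    show ?thesis using parts_test[OF \<phi> gdom_gk1[OF True] gdom_gk2[OF True] True gk1_deriv[OF True], where i=j and y=y and js="[]"] by simp
  qed (simp add: adm_zero_nonpos[OF a])
  have e1: "(LBINT x. kint \<theta> gk (x - y) * partial_derivs [i] \<phi> x) = - (LBINT x. kint \<theta> (gk1 i) (x - y) * \<phi> x)" for y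
    unfolding kk[OF gker_gk] w1 using kk[OF gker_gk1, where js="[]" and y=y] by simp
  have e2: "(LBINT x. kint \<theta> gk (x - y) * partial_derivs [i, j] \<phi> x) = (LBINT x. kint \<theta> (gk2 i j) (x - y) * \<phi> x)" for y
    unfolding kk[OF gker_gk] w1 w2 using kk[OF gker_gk2, where js="[]" and y=y] by simp
  have \<phi>L: "\<phi> \<in> L2 lborel" using test_L2[OF \<phi>, of "[]"] by simp
  note ki = kint_integrable[OF a]
  show "(LBINT x. partial_derivs [i] \<phi> x * conv (kint \<theta> gk) g x) = - (LBINT x. \<phi> x * conv (kint \<theta> (gk1 i)) g x)"
    unfolding integral_mult_conv(1)[OF ki[OF gker_gk] test_L2[OF \<phi>] g] integral_mult_conv(1)[OF ki[OF gker_gk1] \<phi>L g] e1 by simp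
  show "(LBINT x. partial_derivs [i, j] \<phi> x * conv (kint \<theta> gk) g x) = (LBINT x. \<phi> x * conv (kint \<theta> (gk2 i j)) g x)"
    unfolding integral_mult_conv(1)[OF ki[OF gker_gk] test_L2[OF \<phi>] g] integral_mult_conv(1)[OF ki[OF gker_gk2] \<phi>L g] e2 by simp
qed

text \<open>Substituting z = x - y writes the form as the integral of k against the correlation of a
  and b, a bounded function that does not involve k. Thus for a kernel that is itself a time
  integral the two integrations can be exchanged.\<close>

lemma
  fixes k a b :: "real^'n \<Rightarrow> real"
  assumes k: "integrable lborel k" and a: "a \<in> L2 lborel" and b: "b \<in> L2 lborel"
  shows integral_mult_conv_corr: "(LBINT x. a x * conv k b x) = (LBINT z. k z * (LBINT x. a x * b (x - z)))"
    and corr_bounded: "\<bar>\<integral>x. a x * b (x - z) \<partial>lborel\<bar> \<le> l2n lborel a * l2n lborel b"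
    and corr_measurable: "(\<lambda>z. \<integral>x. a x * b (x - z) \<partial>lborel) \<in> borel_measurable borel"
proof -
  note [measurable] = integrable_lborel_measurable[OF k] L2_lborel_measurable[OF a] L2_lborel_measurable[OF b]
  have bz: "(\<lambda>x. b (x - z)) \<in> L2 lborel" for z
    using integrable_shift'[OF L2_int[OF b], of z] by (intro L2I) auto
  have nb: "l2n lborel (\<lambda>x. b (x - z)) = l2n lborel b" for z
    using integral_shift'[OF L2_int[OF b], of z] by (simp add: l2n_def)
  show cb: "\<bar>\<integral>x. a x * b (x - z) \<partial>lborel\<bar> \<le> l2n lborel a * l2n lborel b" for z
    using l2n_inner_le[OF a bz[of z]] by (simp add: nb)
  show "(\<lambda>z. \<integral>x. a x * b (x - z) \<partial>lborel) \<in> borel_measurable borel" by measurable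
  have abi: "integrable lborel (\<lambda>x. \<bar>a x\<bar> * \<bar>b (x - z)\<bar>)" for z
    using L2_mult_integrable(1)[OF a bz[of z]] by simp
  have I: "integrable (lborel \<Otimes>\<^sub>M lborel) (\<lambda>(z, x). a x * (k z * b (x - z)))"
  proof (rule lborel_pair.Fubini_integrable)
    show "(\<lambda>(z, x). a x * (k z * b (x - z))) \<in> borel_measurable (lborel \<Otimes>\<^sub>M lborel)" by measurable
    have e: "(LBINT x. norm (case (z, x) of (z, x) \<Rightarrow> a x * (k z * b (x - z)))) = \<bar>k z\<bar> * (LBINT x. \<bar>a x\<bar> * \<bar>b (x - z)\<bar>)" for z
      by (simp add: abs_mult mult_ac flip: Bochner_Integration.integral_mult_right_zero)
    have le: "(LBINT x. \<bar>a x\<bar> * \<bar>b (x - z)\<bar>) \<le> l2n lborel a * l2n lborel b" for z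
      using l2n_Cauchy_Schwarz[OF a bz[of z]] by (simp add: nb)
    show "integrable lborel (\<lambda>z. LBINT x. norm (case (z, x) of (z, x) \<Rightarrow> a x * (k z * b (x - z))))"
      unfolding e
    proof (rule Bochner_Integration.integrable_bound)
      show "integrable lborel (\<lambda>z. (l2n lborel a * l2n lborel b) * \<bar>k z\<bar>)" using k by simp
      show "AE z in lborel. norm (\<bar>k z\<bar> * (LBINT x. \<bar>a x\<bar> * \<bar>b (x - z)\<bar>)) \<le> norm ((l2n lborel a * l2n lborel b) * \<bar>k z\<bar>)"
      proof (rule AE_I2)
        fix z
        have "0 \<le> (LBINT x. \<bar>a x\<bar> * \<bar>b (x - z)\<bar>)" by simp
        then show "norm (\<bar>k z\<bar> * (LBINT x. \<bar>a x\<bar> * \<bar>b (x - z)\<bar>)) \<le> norm ((l2n lborel a * l2n lborel b) * \<bar>k z\<bar>)"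
          using mult_left_mono[OF le[of z], of "\<bar>k z\<bar>"] by (simp add: abs_mult l2n_nonneg mult.commute)
      qed
    qed measurable
    show "AE z in lborel. integrable lborel (\<lambda>x. case (z, x) of (z, x) \<Rightarrow> a x * (k z * b (x - z)))"
    proof (rule AE_I2)
      fix z
      have "(\<lambda>x. a x * (k z * b (x - z))) = (\<lambda>x. k z * (a x * b (x - z)))" by (simp add: fun_eq_iff)
      then show "integrable lborel (\<lambda>x. case (z, x) of (z, x) \<Rightarrow> a x * (k z * b (x - z)))"
        using L2_mult_integrable(2)[OF a bz[of z]] by simp
    qed
  qed
  have "(LBINT x. a x * conv k b x) = (LBINT x. (LBINT z. a x * (k z * b (x - z))))"
  proof (rule integral_cong_AE)
    show "(\<lambda>x. a x * conv k b x) \<in> borel_measurable lborel" by measurable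
    show "(\<lambda>x. \<integral>z. a x * (k z * b (x - z)) \<partial>lborel) \<in> borel_measurable lborel" by measurable
    show "AE x in lborel. a x * conv k b x = (LBINT z. a x * (k z * b (x - z)))"
      using conv_AE_integrable[OF k b]
    proof eventually_elim
      case (elim x)
      show ?case unfolding conv_def using integral_reflect[OF elim, of x] by simp
    qed
  qed
  also have "\<dots> = (LBINT z. (LBINT x. a x * (k z * b (x - z))))"
    using lborel_pair.Fubini_integral[OF I] by simp
  also have "\<dots> = (LBINT z. k z * (LBINT x. a x * b (x - z)))"
    by (simp add: mult_ac flip: Bochner_Integration.integral_mult_right_zero)
  finally show "(LBINT x. a x * conv k b x) = (LBINT z. k z * (LBINT x. a x * b (x - z)))" .
qed

text \<open>After the exchange with the time integral, at each time a nonpositive weight multiplies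
  the nonpositive form of \<open>gform_sum_nonpos\<close>.\<close>

theorem kint_form_nonneg:
  fixes M :: "'N::finite \<Rightarrow> 'N \<Rightarrow> 'n::finite \<Rightarrow> 'n \<Rightarrow> real" and g :: "'N \<Rightarrow> real^'n \<Rightarrow> real"
  assumes pos: "\<And>\<eta> \<xi>. 0 \<le> (\<Sum>\<alpha>\<in>UNIV. \<Sum>\<beta>\<in>UNIV. \<Sum>i\<in>UNIV. \<Sum>j\<in>UNIV. M \<alpha> \<beta> i j * (\<xi> i * \<xi> j * (\<eta> \<alpha> * \<eta> \<beta>)))"
    and g: "\<And>\<alpha>. g \<alpha> \<in> L2 lborel" and a: "adm \<theta>" and neg: "\<And>s. \<theta> s \<le> 0"
  shows "0 \<le> (\<Sum>\<alpha>\<in>UNIV. \<Sum>\<beta>\<in>UNIV. \<Sum>i\<in>UNIV. \<Sum>j\<in>UNIV. M \<alpha> \<beta> i j * (LBINT x. g \<alpha> x * conv (kint \<theta> (gk2 i j)) (g \<beta>) x))"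
proof -
  have k2: "integrable lborel (gk2 i j s :: real^'n \<Rightarrow> real)" if "0 < s" for i j s by (rule gdom_integrable[OF that gdom_gk2[OF that]])
  have *: "(LBINT x. g \<alpha> x * conv (kint \<theta> (gk2 i j)) (g \<beta>) x) = (LBINT s. \<theta> s * gform i j s (g \<alpha>) (g \<beta>))
     \<and> integrable lborel (\<lambda>s. \<theta> s * gform i j s (g \<alpha>) (g \<beta>))" for \<alpha> \<beta> i j
  proof -
    define c where "c z = (LBINT x. g \<alpha> x * g \<beta> (x - z))" for z
    have k: "gker 1 (gk2 i j :: real \<Rightarrow> real^'n \<Rightarrow> real)" by (rule gker_gk2)
    note ki = kint_integrable[OF a k]
    have cm: "c \<in> borel_measurable borel" unfolding c_def[abs_def] by (rule corr_measurable[OF ki g g])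
    have cb: "\<bar>c z\<bar> \<le> l2n lborel (g \<alpha>) * l2n lborel (g \<beta>)" for z unfolding c_def by (rule corr_bounded[OF ki g g])
    have gf: "\<theta> s * (LBINT x. gk2 i j s (x - 0) * c x) = \<theta> s * gform i j s (g \<alpha>) (g \<beta>)" for s
    proof (cases "0 < s")
      case True
      show ?thesis unfolding gform_def c_def integral_mult_conv_corr[OF k2[OF True] g g] by simp
    qed (simp add: adm_zero_nonpos[OF a])
    have "(LBINT x. g \<alpha> x * conv (kint \<theta> (gk2 i j)) (g \<beta>) x) = (LBINT x. kint \<theta> (gk2 i j) (x - 0) * c x)"
      unfolding integral_mult_conv_corr[OF ki g g] c_def by simp
    then show ?thesis
      using kint_integral[OF a k cm cb, of 0] kint_time_integrable[OF a k cm cb, of 0]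
      unfolding gf by simp
  qed
  have "(\<Sum>\<alpha>\<in>UNIV. \<Sum>\<beta>\<in>UNIV. \<Sum>i\<in>UNIV. \<Sum>j\<in>UNIV. M \<alpha> \<beta> i j * (LBINT x. g \<alpha> x * conv (kint \<theta> (gk2 i j)) (g \<beta>) x))
    = (LBINT s. (\<Sum>\<alpha>\<in>UNIV. \<Sum>\<beta>\<in>UNIV. \<Sum>i\<in>UNIV. \<Sum>j\<in>UNIV. M \<alpha> \<beta> i j * (\<theta> s * gform i j s (g \<alpha>) (g \<beta>))))"
    using * by (simp add: Bochner_Integration.integral_sum)
  also have "\<dots> \<ge> 0"
  proof (rule Bochner_Integration.integral_nonneg)
    fix s
    have "(\<Sum>\<alpha>\<in>UNIV. \<Sum>\<beta>\<in>UNIV. \<Sum>i\<in>UNIV. \<Sum>j\<in>UNIV. M \<alpha> \<beta> i j * (\<theta> s * gform i j s (g \<alpha>) (g \<beta>)))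
      = \<theta> s * (\<Sum>\<alpha>\<in>UNIV. \<Sum>\<beta>\<in>UNIV. \<Sum>i\<in>UNIV. \<Sum>j\<in>UNIV. M \<alpha> \<beta> i j * gform i j s (g \<alpha>) (g \<beta>))"
      by (simp only: sum_distrib_left mult.left_commute)
    also have "\<dots> \<ge> 0"
    proof (cases "0 < s")
      case True
      from gform_sum_nonpos[OF pos g True] neg[of s] show ?thesis by (intro mult_nonpos_nonpos)
    qed (simp add: adm_zero_nonpos[OF a])
    finally show "0 \<le> (\<Sum>\<alpha>\<in>UNIV. \<Sum>\<beta>\<in>UNIV. \<Sum>i\<in>UNIV. \<Sum>j\<in>UNIV. M \<alpha> \<beta> i j * (\<theta> s * gform i j s (g \<alpha>) (g \<beta>)))" .
  qed
  finally show ?thesis .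
qed

section \<open>Second order Riesz transforms\<close>

lemma l2n_tendsto_0:
  assumes "(\<lambda>k. \<integral>x. (norm (f k x))^2 \<partial>M) \<longlonglongrightarrow> 0"
  shows "(\<lambda>k. l2n M (f k)) \<longlonglongrightarrow> 0"
  using tendsto_real_sqrt[OF assms] by (simp add: l2n_def)

text \<open>Truncation in height and to a ball costs little in norm. The truncated function is an
  almost everywhere limit of continuous functions, which dominated convergence turns into a limit in
  mean square.\<close>

lemma L2_dense_continuous:
  fixes g :: "real^'n \<Rightarrow> real"
  assumes g: "g \<in> L2 lborel" and e: "0 < e"
  obtains h R where "continuous_on UNIV h" "\<And>x. R < norm x \<Longrightarrow> h x = 0" "h \<in> L2 lborel" "l2n lborel (\<lambda>x. g x - h x) < e"
proof -
  have [measurable]: "g \<in> borel_measurable borel" by (rule L2_lborel_measurable[OF g])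
  define gR where "gR k x = indicator (cball 0 (real k)) x * max (- real k) (min (real k) (g x))" for k and x :: "real^'n"
  have ball[measurable]: "(indicator (cball 0 r) :: real^'n \<Rightarrow> real) \<in> borel_measurable borel" for r
    by (auto intro!: borel_measurable_indicator)
  have [measurable]: "gR k \<in> borel_measurable borel" for k unfolding gR_def[abs_def] by measurable
  have gRle: "\<bar>gR k x\<bar> \<le> \<bar>g x\<bar>" for k x by (auto simp: gR_def indicator_def)
  have gRk: "\<bar>gR k x\<bar> \<le> real k" for k x by (auto simp: gR_def indicator_def)
  have gRL: "gR k \<in> L2 lborel" for k
    by (rule L2_dominated[OF g, where C=1]) (use gRle in auto)
  have "(\<lambda>k. \<integral>x. (norm (g x - gR k x))^2 \<partial>lborel) \<longlonglongrightarrow> (\<integral>x. 0 \<partial>(lborel :: (real^'n) measure))"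
  proof (rule integral_dominated_convergence[where w="\<lambda>x. 4 * (norm (g x))^2"])
    show "integrable lborel (\<lambda>x. 4 * (norm (g x))^2)" using L2_int[OF g] by simp
    show "AE x in lborel. (\<lambda>k. (norm (g x - gR k x))^2) \<longlonglongrightarrow> 0"
    proof (rule AE_I2)
      fix x
      have "\<forall>\<^sub>F k in sequentially. gR k x = g x"
      proof (rule eventually_sequentiallyI[of "nat \<lceil>max (norm x) \<bar>g x\<bar>\<rceil>"])
        fix k assume "nat \<lceil>max (norm x) \<bar>g x\<bar>\<rceil> \<le> k"
        then have "max (norm x) \<bar>g x\<bar> \<le> real k" by (simp only: nat_ceiling_le_eq)
        then show "gR k x = g x" by (auto simp: gR_def)
      qed
      then have "\<forall>\<^sub>F k in sequentially. (norm (g x - gR k x))^2 = 0" by eventually_elim simp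
      then show "(\<lambda>k. (norm (g x - gR k x))^2) \<longlonglongrightarrow> 0" by (rule tendsto_eventually)
    qed
    show "AE x in lborel. norm ((norm (g x - gR k x))^2) \<le> 4 * (norm (g x))^2" for k
    proof (rule AE_I2)
      fix x
      have "\<bar>g x - gR k x\<bar> \<le> 2 * \<bar>g x\<bar>" using gRle[of k x] by linarith
      then have "\<bar>g x - gR k x\<bar>^2 \<le> (2 * \<bar>g x\<bar>)^2" by (intro power_mono) auto
      then show "norm ((norm (g x - gR k x))^2) \<le> 4 * (norm (g x))^2" by (simp add: power_mult_distrib)
    qed
  qed measurable
  then have "(\<lambda>k. l2n lborel (\<lambda>x. g x - gR k x)) \<longlonglongrightarrow> 0" by (intro l2n_tendsto_0) simp
  then have "\<forall>\<^sub>F k in sequentially. l2n lborel (\<lambda>x. g x - gR k x) < e / 2" using e by (intro order_tendstoD) auto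
  then obtain k where k: "l2n lborel (\<lambda>x. g x - gR k x) < e / 2" by (auto simp: eventually_sequentially)
  define K where "K = real k"
  have K0: "K \<ge> 0" by (simp add: K_def)
  have "gR k measurable_on UNIV"
    by (rule lebesgue_measurable_imp_measurable_on) (auto intro!: borel_imp_lebesgue)
  then obtain N c where N: "negligible N" and c: "\<And>n. continuous_on UNIV (c n)" and cl: "\<And>x. x \<notin> N \<Longrightarrow> (\<lambda>n. c n x) \<longlonglongrightarrow> gR k x"
    unfolding measurable_on_def by auto
  \<comment> \<open>Clamping to the height \<open>K\<close> and a radial cutoff of width 1 provide a
    common integrable majorant. Neither changes the limit, because \<open>gR k\<close> is bounded by
    \<open>K\<close> and vanishes outside the ball of radius \<open>K\<close>.\<close>
  define h where "h n x = max (- K) (min K (c n x)) * max 0 (min 1 (K + 1 - norm x))" for n x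
  have hc: "continuous_on UNIV (h n)" for n unfolding h_def[abs_def] by (intro continuous_intros c)
  have [measurable]: "h n \<in> borel_measurable borel" for n by (rule borel_measurable_continuous_onI[OF hc])
  have h0: "h n x = 0" if "K + 1 < norm x" for n x using that by (simp add: h_def)
  have hb: "\<bar>h n x\<bar> \<le> K" for n x
  proof -
    have "\<bar>h n x\<bar> \<le> K * 1" unfolding h_def abs_mult using K0 by (intro mult_mono) auto
    then show ?thesis by simp
  qed
  have ii: "integrable lborel (\<lambda>x::real^'n. B * indicator (cball 0 (K + 1)) x)" for B K :: real
    using emeasure_compact_finite[OF compact_cball, of "0::real^'n" "K + 1"] by (intro integrable_mult_right integrable_real_indicator) auto
  have hL: "h n \<in> L2 lborel" for n
  proof (rule L2I)
    show "integrable lborel (\<lambda>x. (norm (h n x))^2)"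
    proof (rule Bochner_Integration.integrable_bound[OF ii])
      show "AE x in lborel. norm ((norm (h n x))^2) \<le> norm (K^2 * indicator (cball 0 (K + 1)) x)"
      proof (rule AE_I2)
        fix x
        have "\<bar>h n x\<bar>^2 \<le> K^2" by (intro power_mono hb) auto
        then show "norm ((norm (h n x))^2) \<le> norm (K^2 * indicator (cball 0 (K + 1)) x)"
          using h0[of x n] by (auto simp: indicator_def not_le)
      qed
    qed measurable
  qed measurable
  have "AE x in lebesgue. x \<notin> N" using N by (intro AE_not_in) (simp add: negligible_iff_null_sets)
  then have aeN: "AE x in lborel. x \<notin> N" by (simp add: AE_completion_iff)
  have "(\<lambda>n. \<integral>x. (norm (gR k x - h n x))^2 \<partial>lborel) \<longlonglongrightarrow> (\<integral>x. 0 \<partial>(lborel :: (real^'n) measure))"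
  proof (rule integral_dominated_convergence[where w="\<lambda>x. (2 * K)^2 * indicator (cball 0 (K + 1)) x"])
    show "integrable lborel (\<lambda>x::real^'n. (2 * K)^2 * indicator (cball 0 (K + 1)) x)" by (rule ii)
    show "AE x in lborel. (\<lambda>n. (norm (gR k x - h n x))^2) \<longlonglongrightarrow> 0"
      using aeN
    proof eventually_elim
      case (elim x)
      have "(\<lambda>n. h n x) \<longlonglongrightarrow> max (- K) (min K (gR k x)) * max 0 (min 1 (K + 1 - norm x))"
        unfolding h_def by (intro tendsto_intros cl elim)
      also have "max (- K) (min K (gR k x)) * max 0 (min 1 (K + 1 - norm x)) = gR k x"
      proof (cases "norm x \<le> K")
        case True then show ?thesis using gRk[of k x] by (auto simp: K_def max_def min_def abs_le_iff)
      next
        case False then show ?thesis by (simp add: gR_def K_def)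
      qed
      finally have "(\<lambda>n. (norm (gR k x - h n x))^2) \<longlonglongrightarrow> (norm (gR k x - gR k x))^2" by (intro tendsto_intros)
      then show ?case by simp
    qed
    show "AE x in lborel. norm ((norm (gR k x - h n x))^2) \<le> (2 * K)^2 * indicator (cball 0 (K + 1)) x" for n
    proof (rule AE_I2)
      fix x
      have "\<bar>gR k x - h n x\<bar> \<le> 2 * K" using gRk[of k x] hb[of n x] by (simp add: K_def)
      then have "\<bar>gR k x - h n x\<bar>^2 \<le> (2 * K)^2" by (intro power_mono) auto
      moreover have "gR k x = 0" "h n x = 0" if "K + 1 < norm x" using that h0[OF that] by (auto simp: gR_def K_def)
      ultimately show "norm ((norm (gR k x - h n x))^2) \<le> (2 * K)^2 * indicator (cball 0 (K + 1)) x"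
        by (auto simp: indicator_def not_le)
    qed
  qed measurable
  then have "(\<lambda>n. l2n lborel (\<lambda>x. gR k x - h n x)) \<longlonglongrightarrow> 0" by (intro l2n_tendsto_0) simp
  then have "\<forall>\<^sub>F n in sequentially. l2n lborel (\<lambda>x. gR k x - h n x) < e / 2" using e by (intro order_tendstoD) auto
  then obtain n where n: "l2n lborel (\<lambda>x. gR k x - h n x) < e / 2" by (auto simp: eventually_sequentially)
  show thesis
  proof (rule that[OF hc h0 hL])
    show "l2n lborel (\<lambda>x. g x - h n x) < e"
      using l2n_triangle_diff[OF g gRL hL, of n k] k n by simp
  qed
qed

lemma conv_L1:
  fixes k h :: "real^'n \<Rightarrow> real"
  assumes k: "integrable lborel k" and h: "integrable lborel h"
  shows "integrable lborel (conv k h)" "(LBINT x. \<bar>conv k h x\<bar>) \<le> (LBINT x. \<bar>k x\<bar>) * (LBINT x. \<bar>h x\<bar>)"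
proof -
  note [measurable] = integrable_lborel_measurable[OF k] integrable_lborel_measurable[OF h]
  have e: "(LBINT x. norm (case (y, x) of (y, x) \<Rightarrow> k (x - y) * h y)) = (LBINT x. \<bar>k x\<bar>) * \<bar>h y\<bar>" for y
    using integral_shift'[OF integrable_abs[OF k], of y] by (simp add: abs_mult)
  have I: "integrable (lborel \<Otimes>\<^sub>M lborel) (\<lambda>(y, x). k (x - y) * h y)"
  proof (rule lborel_pair.Fubini_integrable)
    show "integrable lborel (\<lambda>y. LBINT x. norm (case (y, x) of (y, x) \<Rightarrow> k (x - y) * h y))"
      unfolding e using h by simp
    show "AE y in lborel. integrable lborel (\<lambda>x. case (y, x) of (y, x) \<Rightarrow> k (x - y) * h y)"
      using integrable_shift'[OF k] by simp
  qed measurable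
  have I': "integrable (lborel \<Otimes>\<^sub>M lborel) (\<lambda>(y, x). \<bar>k (x - y) * h y\<bar>)"
    using integrable_abs[OF I] by (simp add: split_beta')
  show i1: "integrable lborel (conv k h)"
    using lborel_pair.integrable_snd[OF I] by (simp add: conv_def[abs_def])
  have "(LBINT x. \<bar>conv k h x\<bar>) \<le> (LBINT x. (LBINT y. \<bar>k (x - y) * h y\<bar>))"
  proof (rule integral_mono)
    show "integrable lborel (\<lambda>x. \<bar>conv k h x\<bar>)" using i1 by simp
    show "integrable lborel (\<lambda>x. \<integral>y. \<bar>k (x - y) * h y\<bar> \<partial>lborel)" using lborel_pair.integrable_snd[OF I'] by simp
    show "\<bar>conv k h x\<bar> \<le> (LBINT y. \<bar>k (x - y) * h y\<bar>)" for x unfolding conv_def by (rule integral_abs_bound)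
  qed
  also have "\<dots> = (LBINT y. (LBINT x. \<bar>k (x - y) * h y\<bar>))"
    using lborel_pair.Fubini_integral[OF I'] by simp
  also have "\<dots> = (LBINT x. \<bar>k x\<bar>) * (LBINT x. \<bar>h x\<bar>)"
    using e by simp
  finally show "(LBINT x. \<bar>conv k h x\<bar>) \<le> (LBINT x. \<bar>k x\<bar>) * (LBINT x. \<bar>h x\<bar>)" .
qed

section \<open>The heat semigroup at large and small times\<close>

lemma integral_abs_gk: "0 < s \<Longrightarrow> (LBINT z. \<bar>gk s (z::real^'n)\<bar>) = 1"
  using integral_gk[of s, where 'n='n] by (simp add: gk_nonneg)

text \<open>The square is bounded by supremum times absolute value: the L^1 norm does not grow under
  the semigroup, while the supremum decays like a negative power of time.\<close>

lemma heat_large_continuous: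
  fixes h :: "real^'n \<Rightarrow> real"
  assumes h: "integrable lborel h" and n: "CARD('n) \<ge> 1"
  shows "(\<lambda>k. l2n lborel (conv (gk (real k + 1)) h)) \<longlonglongrightarrow> 0"
proof (rule l2n_tendsto_0)
  define A where "A = (LBINT x. \<bar>h x\<bar>)"
  have A0: "A \<ge> 0" by (simp add: A_def)
  have [measurable]: "h \<in> borel_measurable borel" by (rule integrable_lborel_measurable[OF h])
  have bound: "(LBINT x. (norm (conv (gk (real k + 1)) h x))^2) \<le> (2 * pi * (real k + 1)) powr (- (real CARD('n) / 2)) * A * A" for k
  proof -
    define s where "s = real k + 1"
    define c where "c = (2 * pi * s) powr (- (real CARD('n) / 2))"
    have s: "0 < s" by (simp add: s_def)
    have gi: "integrable lborel (\<lambda>y. gk s (x - y) * h y)" for x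
    proof (rule Bochner_Integration.integrable_bound)
      show "integrable lborel (\<lambda>y. c * h y)" using h by simp
      show "AE y in lborel. norm (gk s (x - y) * h y) \<le> norm (c * h y)"
      proof (rule AE_I2)
        fix y
        have "gk s (x - y) * \<bar>h y\<bar> \<le> c * \<bar>h y\<bar>" unfolding c_def by (intro mult_right_mono gk_le s) auto
        then show "norm (gk s (x - y) * h y) \<le> norm (c * h y)" by (simp add: abs_mult gk_nonneg c_def)
      qed
    qed measurable
    have cb: "\<bar>conv (gk s) h x\<bar> \<le> c * A" for x
    proof -
      have "\<bar>conv (gk s) h x\<bar> \<le> (LBINT y. \<bar>gk s (x - y) * h y\<bar>)" unfolding conv_def by (rule integral_abs_bound)
      also have "\<dots> \<le> (LBINT y. c * \<bar>h y\<bar>)"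
      proof (rule integral_mono)
        show "integrable lborel (\<lambda>y. \<bar>gk s (x - y) * h y\<bar>)" by (rule integrable_abs[OF gi])
        show "\<bar>gk s (x - y) * h y\<bar> \<le> c * \<bar>h y\<bar>" for y
          using gk_le[OF s, of "x - y"] by (auto simp: abs_mult gk_nonneg c_def intro!: mult_right_mono)
      qed (use h in simp)
      finally show ?thesis by (simp add: A_def)
    qed
    note C = conv_L1[OF integrable_gk[OF s] h]
    have "(LBINT x. (norm (conv (gk s) h x))^2) \<le> (LBINT x. (c * A) * \<bar>conv (gk s) h x\<bar>)"
    proof (rule integral_mono')
      show "integrable lborel (\<lambda>x. c * A * \<bar>conv (gk s) h x\<bar>)" using C(1) by simp
      show "(norm (conv (gk s) h x))^2 \<le> c * A * \<bar>conv (gk s) h x\<bar>" for x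
        using mult_right_mono[OF cb[of x], of "\<bar>conv (gk s) h x\<bar>"] by (simp add: power2_eq_square)
      show "0 \<le> c * A * \<bar>conv (gk s) h x\<bar>" for x using A0 by (simp add: c_def)
    qed
    also have "\<dots> = (c * A) * (LBINT x. \<bar>conv (gk s) h x\<bar>)" by simp
    also have "\<dots> \<le> (c * A) * A"
      using C(2) A0 by (intro mult_left_mono) (auto simp: integral_abs_gk[OF s] A_def c_def)
    finally show ?thesis by (simp add: s_def c_def)
  qed
  have "filterlim (\<lambda>k. 2 * pi * (real k + 1)) at_top sequentially" by real_asymp
  then have "(\<lambda>k. (2 * pi * (real k + 1)) powr (- (real CARD('n) / 2))) \<longlonglongrightarrow> 0"
    using n by (intro tendsto_neg_powr) auto
  then have "(\<lambda>k. (2 * pi * (real k + 1)) powr (- (real CARD('n) / 2)) * A * A) \<longlonglongrightarrow> 0 * A * A" by (intro tendsto_intros)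
  then have "(\<lambda>k. (2 * pi * (real k + 1)) powr (- (real CARD('n) / 2)) * A * A) \<longlonglongrightarrow> 0" by simp
  from tendsto_sandwich[OF _ _ tendsto_const this] show "(\<lambda>k. \<integral>x. (norm (conv (gk (real k + 1)) h x))^2 \<partial>lborel) \<longlonglongrightarrow> 0"
    using bound by (auto simp: always_eventually)
qed

text \<open>Near x the difference of values is small by uniform continuity, and far from x the
  kernel is small by the exponential factor in \<open>gk_double\<close>. The resulting uniform bound
  is turned into a mean square bound by multiplying it with the L^1 norms.\<close>

lemma heat_small_continuous:
  fixes h :: "real^'n \<Rightarrow> real"
  assumes hc: "continuous_on UNIV h" and h0: "\<And>x. R < norm x \<Longrightarrow> h x = 0" and h: "integrable lborel h" and hL: "h \<in> L2 lborel"
  shows "(\<lambda>k. l2n lborel (\<lambda>x. conv (gk (1 / (real k + 1))) h x - h x)) \<longlonglongrightarrow> 0"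
proof (rule l2n_tendsto_0)
  have [measurable]: "h \<in> borel_measurable borel" by (rule integrable_lborel_measurable[OF h])
  define A where "A = (LBINT x. \<bar>h x\<bar>)"
  have A0: "A \<ge> 0" by (simp add: A_def)
  have "bounded (h ` cball 0 R)" by (intro compact_imp_bounded compact_continuous_image continuous_on_subset[OF hc]) auto
  then obtain M0 where "\<forall>y\<in>h ` cball 0 R. norm y \<le> M0" unfolding bounded_iff by blast
  then have M0: "\<bar>h x\<bar> \<le> M0" if "x \<in> cball 0 R" for x using that by auto
  define M where "M = max 0 M0"
  have M: "0 \<le> M" "\<And>x. \<bar>h x\<bar> \<le> M"
  proof -
    show "\<bar>h x\<bar> \<le> M" for x using M0[of x] h0[of x] by (cases "R < norm x") (auto simp: M_def)
  qed (simp add: M_def)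
  have uc: "\<exists>d>0. \<forall>x y. norm (x - y) < d \<longrightarrow> \<bar>h y - h x\<bar> \<le> e" if e: "e > 0" for e
  proof -
    have "uniformly_continuous_on (cball 0 (R + 1)) h"
      by (intro compact_uniformly_continuous continuous_on_subset[OF hc]) auto
    then obtain d where d: "d > 0" "\<And>x x'. x \<in> cball 0 (R+1) \<Longrightarrow> x' \<in> cball 0 (R+1) \<Longrightarrow> dist x' x < d \<Longrightarrow> dist (h x') (h x) < e"
      unfolding uniformly_continuous_on_def using e by metis
    show ?thesis
    proof (intro exI[of _ "min d 1"] conjI allI impI)
      fix x y :: "real^'n" assume xy: "norm (x - y) < min d 1"
      show "\<bar>h y - h x\<bar> \<le> e"
      proof (cases "norm x \<le> R \<or> norm y \<le> R")
        case True
        then have "norm x \<le> R + 1" "norm y \<le> R + 1"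
          using xy norm_triangle_sub[of x y] norm_triangle_sub[of y x] by (auto simp: norm_minus_commute)
        then show ?thesis using d(2)[of x y] xy by (simp add: dist_norm norm_minus_commute)
      next
        case False
        then show ?thesis using h0[of x] h0[of y] e by simp
      qed
    qed (use d in auto)
  qed
  define C where "C = 2 powr (real CARD('n) / 2)"
  have C0: "C > 0" by (simp add: C_def)
  have bound: "(LBINT x. (norm (conv (gk s) h x - h x))^2) \<le> (e + 2 * M * C * exp (- d\<^sup>2 / (4 * s))) * (2 * A)"
    if e: "e > 0" and d: "d > 0" and dd: "\<And>x y. norm (x - y) < d \<Longrightarrow> \<bar>h y - h x\<bar> \<le> e" and s: "0 < s" for e d s
  proof -
    define w where "w = e + 2 * M * C * exp (- d\<^sup>2 / (4 * s))"
    have w0: "w \<ge> 0" using e M C0 by (simp add: w_def)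
    have g1: "integrable lborel (\<lambda>y. gk s (x - y))" "(LBINT y. gk s (x - y)) = 1" for x :: "real^'n"
      using integrable_reflect[OF integrable_gk[OF s], of x] integral_reflect[OF integrable_gk[OF s], of x] integral_gk[OF s, where 'n='n] by auto
    have s2: "0 < 2 * s" using s by simp
    have g2: "integrable lborel (\<lambda>y. gk (2 * s) (x - y))" "(LBINT y. gk (2 * s) (x - y)) = 1" for x :: "real^'n"
      using integrable_reflect[OF integrable_gk[OF s2], of x] integral_reflect[OF integrable_gk[OF s2], of x] integral_gk[OF s2, where 'n='n] by auto
    have gi: "integrable lborel (\<lambda>y. gk s (x - y) * h y)" for x
    proof (rule Bochner_Integration.integrable_bound)
      show "integrable lborel (\<lambda>y. M * gk s (x - y))" using g1(1) by simp
      show "AE y in lborel. norm (gk s (x - y) * h y) \<le> norm (M * gk s (x - y))"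
        using M by (auto simp: abs_mult gk_nonneg mult.commute[of M] intro!: mult_left_mono)
    qed measurable
    have pw: "\<bar>conv (gk s) h x - h x\<bar> \<le> w" for x
    proof -
      have "conv (gk s) h x - h x = (LBINT y. gk s (x - y) * h y - gk s (x - y) * h x)"
        unfolding conv_def using gi[of x] g1[of x] by simp
      also have "\<bar>\<dots>\<bar> \<le> (LBINT y. e * gk s (x - y) + 2 * M * C * exp (- d\<^sup>2 / (4 * s)) * gk (2 * s) (x - y))"
      proof (rule order_trans[OF integral_abs_bound integral_mono'])
        show "integrable lborel (\<lambda>y. e * gk s (x - y) + 2 * M * C * exp (- d\<^sup>2 / (4 * s)) * gk (2 * s) (x - y))"
          using g1(1)[of x] g2(1)[of x] by (intro Bochner_Integration.integrable_add integrable_mult_right)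
        fix y
        show "0 \<le> e * gk s (x - y) + 2 * M * C * exp (- d\<^sup>2 / (4 * s)) * gk (2 * s) (x - y)"
          using e M C0 by (intro add_nonneg_nonneg mult_nonneg_nonneg) (auto simp: gk_nonneg)
        have "\<bar>gk s (x - y) * h y - gk s (x - y) * h x\<bar> = gk s (x - y) * \<bar>h y - h x\<bar>"
          by (simp add: right_diff_distrib[symmetric] abs_mult gk_nonneg)
        also have "\<dots> \<le> e * gk s (x - y) + 2 * M * C * exp (- d\<^sup>2 / (4 * s)) * gk (2 * s) (x - y)"
        proof (cases "norm (x - y) < d")
          case True
          have "gk s (x - y) * \<bar>h y - h x\<bar> \<le> gk s (x - y) * e" using dd[OF True] by (intro mult_left_mono gk_nonneg)
          moreover have "0 \<le> 2 * M * C * exp (- d\<^sup>2 / (4 * s)) * gk (2 * s) (x - y)"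
            using M C0 by (intro mult_nonneg_nonneg) (auto simp: gk_nonneg)
          ultimately show ?thesis unfolding mult.commute[of e "gk s (x - y)"] by linarith
        next
          case False
          then have "d^2 \<le> (norm (x - y))^2" using d by (intro power_mono) auto
          then have "exp (- (norm (x - y))\<^sup>2 / (4 * s)) \<le> exp (- d\<^sup>2 / (4 * s))" using s by (simp add: divide_right_mono)
          then have gle: "gk s (x - y) \<le> C * exp (- d\<^sup>2 / (4 * s)) * gk (2 * s) (x - y)"
            unfolding gk_double[OF s] C_def by (intro mult_right_mono mult_left_mono) (auto simp: gk_nonneg)
          have "\<bar>h y - h x\<bar> \<le> 2 * M" using M(2)[of x] M(2)[of y] by linarith
          then have "gk s (x - y) * \<bar>h y - h x\<bar> \<le> (C * exp (- d\<^sup>2 / (4 * s)) * gk (2 * s) (x - y)) * (2 * M)"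
            using gle gk_nonneg[of s "x - y"] by (intro mult_mono) auto
          moreover have "0 \<le> e * gk s (x - y)" using e by (simp add: gk_nonneg)
          ultimately show ?thesis by (simp add: mult_ac)
        qed
        finally show "\<bar>gk s (x - y) * h y - gk s (x - y) * h x\<bar> \<le> e * gk s (x - y) + 2 * M * C * exp (- d\<^sup>2 / (4 * s)) * gk (2 * s) (x - y)" .
      qed
      also have "\<dots> = w" using g1[of x] g2[of x] by (simp add: w_def)
      finally show ?thesis .
    qed
    note Cv = conv_L1[OF integrable_gk[OF s] h]
    have "(LBINT x. (norm (conv (gk s) h x - h x))^2) \<le> (LBINT x. w * (\<bar>conv (gk s) h x\<bar> + \<bar>h x\<bar>))"
    proof (rule integral_mono')
      show "integrable lborel (\<lambda>x. w * (\<bar>conv (gk s) h x\<bar> + \<bar>h x\<bar>))" using Cv(1) h by simp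
      fix x
      have "\<bar>conv (gk s) h x - h x\<bar> * \<bar>conv (gk s) h x - h x\<bar> \<le> w * (\<bar>conv (gk s) h x\<bar> + \<bar>h x\<bar>)"
        using pw[of x] w0 by (intro mult_mono) auto
      then show "(norm (conv (gk s) h x - h x))^2 \<le> w * (\<bar>conv (gk s) h x\<bar> + \<bar>h x\<bar>)" by (simp add: power2_eq_square)
      show "0 \<le> w * (\<bar>conv (gk s) h x\<bar> + \<bar>h x\<bar>)" using w0 by simp
    qed
    also have "\<dots> = w * ((LBINT x. \<bar>conv (gk s) h x\<bar>) + A)" using Cv(1) h by (simp add: A_def)
    also have "\<dots> \<le> w * (A + A)"
      using Cv(2) w0 by (intro mult_left_mono add_right_mono) (auto simp: integral_abs_gk[OF s] A_def)
    finally show ?thesis by (simp add: w_def)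
  qed
  show "(\<lambda>k. \<integral>x. (norm (conv (gk (1 / (real k + 1))) h x - h x))^2 \<partial>lborel) \<longlonglongrightarrow> 0"
  proof (rule LIMSEQ_I)
    fix r :: real assume r: "0 < r"
    \<comment> \<open>The share from nearby points contributes at most e * 2 A < r / 2; the summand
      4 keeps the quotient defined when h has L^1 norm 0.\<close>
    define e where "e = r / (4 * A + 4)"
    have e: "e > 0" "e * (2 * A) < r / 2 + 0"
      using r A0 by (auto simp: e_def field_simps)
    obtain d where d: "d > 0" "\<And>x y. norm (x - y) < d \<Longrightarrow> \<bar>h y - h x\<bar> \<le> e" using uc[OF e(1)] by blast
    have "(\<lambda>k. exp (- d\<^sup>2 / (4 * (1 / (real k + 1))))) \<longlonglongrightarrow> 0" using d(1) by real_asymp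
    then have "(\<lambda>k. (e + 2 * M * C * exp (- d\<^sup>2 / (4 * (1 / (real k + 1))))) * (2 * A)) \<longlonglongrightarrow> (e + 2 * M * C * 0) * (2 * A)"
      by (intro tendsto_intros)
    moreover have "(e + 2 * M * C * 0) * (2 * A) < r" using e r by simp
    ultimately have "\<forall>\<^sub>F k in sequentially. (e + 2 * M * C * exp (- d\<^sup>2 / (4 * (1 / (real k + 1))))) * (2 * A) < r"
      by (rule order_tendstoD)
    then obtain k0 where k0: "\<And>k. k \<ge> k0 \<Longrightarrow> (e + 2 * M * C * exp (- d\<^sup>2 / (4 * (1 / (real k + 1))))) * (2 * A) < r"
      by (auto simp: eventually_sequentially)
    show "\<exists>no. \<forall>k\<ge>no. norm ((LBINT x. (norm (conv (gk (1 / (real k + 1))) h x - h x))^2) - 0) < r"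
    proof (intro exI[of _ k0] allI impI)
      fix k assume "k \<ge> k0"
      have "(LBINT x. (norm (conv (gk (1 / (real k + 1))) h x - h x))^2) < r"
        using bound[OF e(1) d, of "1 / (real k + 1)"] k0[OF \<open>k \<ge> k0\<close>] by simp
      moreover have "0 \<le> (LBINT x. (norm (conv (gk (1 / (real k + 1))) h x - h x))^2)" by simp
      ultimately show "norm ((LBINT x. (norm (conv (gk (1 / (real k + 1))) h x - h x))^2) - 0) < r" by simp
    qed
  qed
qed

text \<open>Convolution with a kernel of mass 1 does not increase the norm, so convergence on a
  dense class extends to all data by three steps of e / 3. The scalar c covers both limits: 1 for
  small times and 0 for large ones.\<close>

lemma heat_extend:
  fixes g :: "real^'n \<Rightarrow> real"
  assumes s: "\<And>k. 0 < s k" and c: "\<bar>c\<bar> \<le> 1"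
    and dense: "\<And>(h :: real^'n \<Rightarrow> real) R. continuous_on UNIV h \<Longrightarrow> (\<And>x. R < norm x \<Longrightarrow> h x = 0) \<Longrightarrow> h \<in> L2 lborel \<Longrightarrow> integrable lborel h \<Longrightarrow>
        (\<lambda>k. l2n lborel (\<lambda>x. conv (gk (s k)) h x - c * h x)) \<longlonglongrightarrow> 0"
    and g: "g \<in> L2 lborel"
  shows "(\<lambda>k. l2n lborel (\<lambda>x. conv (gk (s k)) g x - c * g x)) \<longlonglongrightarrow> 0"
proof (rule LIMSEQ_I)
  fix e :: real assume e: "0 < e"
  then have "0 < e / 3" by simp
  then obtain h R where h: "continuous_on UNIV h" "\<And>x. R < norm x \<Longrightarrow> h x = 0" "h \<in> L2 lborel" "l2n lborel (\<lambda>x. g x - h x) < e / 3"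
    by (rule L2_dense_continuous[OF g]) blast
  have hi: "integrable lborel h"
  proof -
    have "h = (\<lambda>x. indicator (cball 0 R) x * h x)" using h(2) by (auto simp: indicator_def fun_eq_iff not_le)
    then show ?thesis using L2_truncate_integrable(1)[OF h(3), of R] by simp
  qed
  note ki = integrable_gk[OF s]
  have gL: "conv (gk (s k)) g \<in> L2 lborel" for k by (rule conv_L2[OF ki g])
  have hL: "conv (gk (s k)) h \<in> L2 lborel" for k by (rule conv_L2[OF ki h(3)])
  have cL: "(\<lambda>x. c * f x) \<in> L2 lborel" if "f \<in> L2 lborel" for f :: "real^'n \<Rightarrow> real" using L2_scaleR[OF that, of c] by simp
  have 1: "l2n lborel (\<lambda>x. conv (gk (s k)) g x - conv (gk (s k)) h x) < e / 3" for k
  proof -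
    have "l2n lborel (\<lambda>x. conv (gk (s k)) g x - conv (gk (s k)) h x) = l2n lborel (conv (gk (s k)) (\<lambda>x. g x - h x))"
      using conv_diff_AE[OF ki[of k] g h(3)] L2_meas[OF L2_diff[OF gL[of k] hL[of k]]] L2_meas[OF conv_L2[OF ki[of k] L2_diff[OF g h(3)]]]
      by (intro l2n_cong_AE) auto
    also have "\<dots> \<le> l2n lborel (\<lambda>x. g x - h x)"
      using l2n_conv_le[OF ki[of k] L2_diff[OF g h(3)]] by (simp add: integral_abs_gk[OF s])
    finally show ?thesis using h(4) by simp
  qed
  have 3: "l2n lborel (\<lambda>x. c * h x - c * g x) < e / 3"
  proof -
    have "l2n lborel (\<lambda>x. c * h x - c * g x) = \<bar>c\<bar> * l2n lborel (\<lambda>x. h x - g x)"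
      using l2n_scaleR[of lborel c "\<lambda>x. h x - g x"] by (simp add: right_diff_distrib)
    also have "\<dots> \<le> 1 * l2n lborel (\<lambda>x. h x - g x)" using c by (intro mult_right_mono l2n_nonneg)
    finally show ?thesis using h(4) l2n_minus_commute[of lborel g h] by simp
  qed
  have "\<forall>\<^sub>F k in sequentially. l2n lborel (\<lambda>x. conv (gk (s k)) h x - c * h x) < e / 3"
  proof (rule order_tendstoD)
    show "(\<lambda>k. l2n lborel (\<lambda>x. conv (gk (s k)) h x - c * h x)) \<longlonglongrightarrow> 0"
      by (rule dense[of h R]) (use h hi in auto)
  qed (use e in simp)
  then obtain k0 where k0: "\<And>k. k \<ge> k0 \<Longrightarrow> l2n lborel (\<lambda>x. conv (gk (s k)) h x - c * h x) < e / 3"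
    by (auto simp: eventually_sequentially)
  show "\<exists>no. \<forall>k\<ge>no. norm (l2n lborel (\<lambda>x. conv (gk (s k)) g x - c * g x) - 0) < e"
  proof (intro exI[of _ k0] allI impI)
    fix k assume "k \<ge> k0"
    have "l2n lborel (\<lambda>x. conv (gk (s k)) g x - c * g x) < e"
      using l2n_triangle_diff[OF gL[of k] hL[of k] cL[OF g]] l2n_triangle_diff[OF hL[of k] cL[OF h(3)] cL[OF g]] 1[of k] 3 k0[OF \<open>k \<ge> k0\<close>]
      by linarith
    then show "norm (l2n lborel (\<lambda>x. conv (gk (s k)) g x - c * g x) - 0) < e" using l2n_nonneg[of lborel "\<lambda>x. conv (gk (s k)) g x - c * g x"] by simp
  qed
qed

lemma heat_small:
  fixes g :: "real^'n \<Rightarrow> real"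
  assumes g: "g \<in> L2 lborel"
  shows "(\<lambda>k. l2n lborel (\<lambda>x. conv (gk (1 / (real k + 1))) g x - g x)) \<longlonglongrightarrow> 0"
proof -
  have "(\<lambda>k. l2n lborel (\<lambda>x. conv (gk (1 / (real k + 1))) g x - 1 * g x)) \<longlonglongrightarrow> 0"
  proof (rule heat_extend[OF _ _ _ g])
    fix h :: "real^'n \<Rightarrow> real" and R
    assume "continuous_on UNIV h" "\<And>x. R < norm x \<Longrightarrow> h x = 0" "h \<in> L2 lborel" "integrable lborel h"
    then show "(\<lambda>k. l2n lborel (\<lambda>x. conv (gk (1 / (real k + 1))) h x - 1 * h x)) \<longlonglongrightarrow> 0"
      using heat_small_continuous[of h R] by simp
  qed auto
  then show ?thesis by simp
qed

lemma heat_large: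
  fixes g :: "real^'n \<Rightarrow> real"
  assumes g: "g \<in> L2 lborel"
  shows "(\<lambda>k. l2n lborel (conv (gk (real k + 1)) g)) \<longlonglongrightarrow> 0"
proof -
  have "CARD('n) \<ge> 1" using zero_less_card_finite[where 'a='n] by linarith
  then have "(\<lambda>k. l2n lborel (\<lambda>x. conv (gk (real k + 1)) g x - 0 * g x)) \<longlonglongrightarrow> 0"
    by (intro heat_extend[OF _ _ _ g]) (use heat_large_continuous in auto)
  then show ?thesis by simp
qed

text \<open>The factor - 1 / 2 is explained by the scaling of time: - (1/2) * (integral of the heat kernel over all times) is the
  fundamental solution of the Laplace operator. Hence hessk k i j g approximates the i, j entry of the Hessian of the potential of g.\<close>

definition cutoff :: "nat \<Rightarrow> real \<Rightarrow> real" where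
  "cutoff k s = (- 1 / 2) * indicator {1 / (real k + 1)..real k + 1} s"

lemma adm_cutoff: "adm (cutoff k)"
  unfolding adm_def cutoff_def[abs_def]
  by (intro conjI exI[of _ "1 / (real k + 1)"] exI[of _ "real k + 1"] exI[of _ "1/2"]) (auto simp: abs_mult)

lemma cutoff_nonpos: "cutoff k s \<le> 0"
  by (simp add: cutoff_def indicator_def)

definition hessk :: "nat \<Rightarrow> 'n \<Rightarrow> 'n \<Rightarrow> (real^'n \<Rightarrow> real) \<Rightarrow> real^'n \<Rightarrow> real" where
  "hessk k i j g = conv (kint (cutoff k) (gk2 i j)) g"

lemma hessk_L2: "g \<in> L2 lborel \<Longrightarrow> hessk k i j g \<in> L2 lborel"
  unfolding hessk_def by (rule conv_L2[OF kint_integrable[OF adm_cutoff gker_gk2]])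

lemma hessk_trace:
  fixes g :: "real^'n \<Rightarrow> real"
  assumes g: "g \<in> L2 lborel"
  shows "AE x in lborel. (\<Sum>i\<in>UNIV. hessk k i i g x) = conv (gk (1 / (real k + 1))) g x - conv (gk (real k + 1)) g x"
proof -
  have tr: "(\<Sum>i\<in>UNIV. kint (cutoff k) (gk2 i i) z) = gk (1 / (real k + 1)) z - gk (real k + 1) z" for z :: "real^'n"
  proof -
    have "1 / (real k + 1) \<le> real k + 1" by (simp add: divide_le_eq) (simp add: algebra_simps)
    then show ?thesis using kint_trace[of "1 / (real k + 1)" "real k + 1" "- 1 / 2" z] by (simp add: cutoff_def[abs_def])
  qed
  have p: "0 < 1 / (real k + 1)" "0 < real k + 1" by auto
  have "AE x in lborel. conv (\<lambda>z. \<Sum>i\<in>UNIV. kint (cutoff k) (gk2 i i) z) g x = (\<Sum>i\<in>UNIV. hessk k i i g x)"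
    unfolding hessk_def by (rule conv_kernel_sum_AE[OF kint_integrable[OF adm_cutoff gker_gk2] _ g]) simp
  moreover have "AE x in lborel. conv (\<lambda>z. gk (1 / (real k + 1)) z - gk (real k + 1) z) g x = conv (gk (1 / (real k + 1))) g x - conv (gk (real k + 1)) g x"
    by (rule conv_kernel_diff_AE[OF integrable_gk[OF p(1)] integrable_gk[OF p(2)] g])
  ultimately show ?thesis unfolding tr by eventually_elim simp
qed

text \<open>The trace is the difference of the semigroup at the two ends of the time window, of
  which the early end tends to g and the late end to 0.\<close>

lemma hessk_trace_tendsto:
  fixes g :: "real^'n \<Rightarrow> real"
  assumes g: "g \<in> L2 lborel"
  shows "(\<lambda>k. l2n lborel (\<lambda>x. (\<Sum>i\<in>UNIV. hessk k i i g x) - g x)) \<longlonglongrightarrow> 0"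
proof -
  have trL: "(\<lambda>x. \<Sum>i\<in>UNIV. hessk k i i g x) \<in> L2 lborel" for k by (intro L2_sum hessk_L2[OF g]) auto
  have L1: "conv (gk (1 / (real k + 1))) g \<in> L2 lborel" and L2: "conv (gk (real k + 1)) g \<in> L2 lborel" for k
    by (intro conv_L2[OF integrable_gk g]; simp)+
  have le: "l2n lborel (\<lambda>x. (\<Sum>i\<in>UNIV. hessk k i i g x) - g x) \<le> l2n lborel (\<lambda>x. conv (gk (1 / (real k + 1))) g x - g x) + l2n lborel (conv (gk (real k + 1)) g)" for k
  proof -
    have "l2n lborel (\<lambda>x. (\<Sum>i\<in>UNIV. hessk k i i g x) - g x) = l2n lborel (\<lambda>x. (conv (gk (1 / (real k + 1))) g x - g x) + (- conv (gk (real k + 1)) g x))"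
      using hessk_trace[OF g, of k] L2_meas[OF L2_diff[OF trL[of k] g]] L2_meas[OF L2_add[OF L2_diff[OF L1[of k] g] L2_uminus[OF L2[of k]]]]
      by (intro l2n_cong_AE) (auto elim!: eventually_mono)
    also have "\<dots> \<le> l2n lborel (\<lambda>x. conv (gk (1 / (real k + 1))) g x - g x) + l2n lborel (\<lambda>x. - conv (gk (real k + 1)) g x)"
      by (rule l2n_triangle[OF L2_diff[OF L1[of k] g] L2_uminus[OF L2[of k]]])
    finally show ?thesis by (simp add: l2n_def)
  qed
  have "(\<lambda>k. l2n lborel (\<lambda>x. conv (gk (1 / (real k + 1))) g x - g x) + l2n lborel (conv (gk (real k + 1)) g)) \<longlonglongrightarrow> 0 + 0"
    by (intro tendsto_add heat_small heat_large g)
  then have "(\<lambda>k. l2n lborel (\<lambda>x. conv (gk (1 / (real k + 1))) g x - g x) + l2n lborel (conv (gk (real k + 1)) g)) \<longlonglongrightarrow> 0" by simp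
  then show ?thesis
  proof (rule Lim_null_comparison[rotated], intro always_eventually allI)
    fix k
    show "norm (l2n lborel (\<lambda>x. (\<Sum>i\<in>UNIV. hessk k i i g x) - g x)) \<le> l2n lborel (\<lambda>x. conv (gk (1 / (real k + 1))) g x - g x) + l2n lborel (conv (gk (real k + 1)) g)"
      using le[of k] l2n_nonneg[of lborel "\<lambda>x. (\<Sum>i\<in>UNIV. hessk k i i g x) - g x"] by simp
  qed
qed

lemma l2n_tendsto:
  fixes f :: "nat \<Rightarrow> 'a \<Rightarrow> 'b::euclidean_space"
  assumes f: "\<And>k. f k \<in> L2 M" and h: "h \<in> L2 M" and lim: "(\<lambda>k. l2n M (\<lambda>x. f k x - h x)) \<longlonglongrightarrow> 0"
  shows "(\<lambda>k. l2n M (f k)) \<longlonglongrightarrow> l2n M h"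
proof (rule Lim_transform[OF tendsto_const])
  show "(\<lambda>k. l2n M (f k) - l2n M h) \<longlonglongrightarrow> 0"
  proof (rule Lim_null_comparison[OF _ lim], intro always_eventually allI)
    fix k
    have "l2n M (f k) \<le> l2n M (\<lambda>x. f k x - h x) + l2n M h" using l2n_triangle[OF L2_diff[OF f[of k] h] h] by simp
    moreover have "l2n M h \<le> l2n M (\<lambda>x. f k x - h x) + l2n M (f k)"
      using l2n_triangle[OF L2_diff[OF h f[of k]] f[of k]] l2n_minus_commute[of M h "f k"] by simp
    ultimately show "norm (l2n M (f k) - l2n M h) \<le> l2n M (\<lambda>x. f k x - h x)" by simp
  qed
qed

text \<open>Only the traces are known to converge. \<open>hessian_norm_identity\<close> for the
  difference of two truncations transfers their Cauchy property to every entry, and both the trace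
  and the norm identity survive the limit.\<close>

theorem hessian_limit:
  fixes g :: "real^'n \<Rightarrow> real"
  assumes g: "g \<in> L2 lborel"
  obtains H where "\<And>i j. H i j \<in> L2 lborel" "\<And>i j. (\<lambda>k. l2n lborel (\<lambda>x. hessk k i j g x - H i j x)) \<longlonglongrightarrow> 0"
    "AE x in lborel. (\<Sum>i\<in>UNIV. H i i x) = g x" "(\<Sum>i\<in>UNIV. \<Sum>j\<in>UNIV. (l2n lborel (H i j))^2) = (l2n lborel g)^2"
proof -
  note hL = hessk_L2[OF g]
  define T where "T k x = (\<Sum>i\<in>UNIV. hessk k i i g x)" for k x
  have TL: "T k \<in> L2 lborel" for k unfolding T_def[abs_def] by (intro L2_sum hL) auto
  have Tg: "(\<lambda>k. l2n lborel (\<lambda>x. T k x - g x)) \<longlonglongrightarrow> 0" unfolding T_def by (rule hessk_trace_tendsto[OF g])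
  have diff: "l2n lborel (\<lambda>x. hessk m i j g x - hessk n i j g x) \<le> l2n lborel (\<lambda>x. T m x - T n x)" for m n i j
  proof -
    \<comment> \<open>A difference of cutoffs has no sign, but the norm identity does not depend on
      one.\<close>
    define \<theta> where "\<theta> s = cutoff m s - cutoff n s" for s
    have a: "adm \<theta>" unfolding \<theta>_def[abs_def] by (rule adm_diff[OF adm_cutoff adm_cutoff])
    have AEq: "AE x in lborel. conv (kint \<theta> (gk2 i j)) g x = hessk m i j g x - hessk n i j g x" for i j
    proof -
      have "kint \<theta> (gk2 i j) = (\<lambda>z. kint (cutoff m) (gk2 i j) z - kint (cutoff n) (gk2 i j) z :: real)"
        unfolding \<theta>_def[abs_def] by (rule ext) (rule kint_diff[OF adm_cutoff adm_cutoff gker_gk2])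
      then show ?thesis unfolding hessk_def
        using conv_kernel_diff_AE[OF kint_integrable[OF adm_cutoff gker_gk2] kint_integrable[OF adm_cutoff gker_gk2] g] by simp
    qed
    have cL: "conv (kint \<theta> (gk2 i j)) g \<in> L2 lborel" for i j by (rule conv_L2[OF kint_integrable[OF a gker_gk2] g])
    have "(l2n lborel (conv (kint \<theta> (gk2 i j)) g))^2 \<le> (\<Sum>j\<in>UNIV. (l2n lborel (conv (kint \<theta> (gk2 i j)) g))^2)"
      by (rule member_le_sum) auto
    also have "\<dots> \<le> (\<Sum>i\<in>UNIV. \<Sum>j\<in>UNIV. (l2n lborel (conv (kint \<theta> (gk2 i j)) g))^2)"
      by (rule member_le_sum[of i UNIV "\<lambda>i. \<Sum>j\<in>UNIV. (l2n lborel (conv (kint \<theta> (gk2 i j)) g))^2"]) (auto intro: sum_nonneg)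
    also have "\<dots> = (l2n lborel (\<lambda>x. \<Sum>i\<in>UNIV. conv (kint \<theta> (gk2 i i)) g x))^2" by (rule hessian_norm_identity[OF a g])
    finally have "l2n lborel (conv (kint \<theta> (gk2 i j)) g) \<le> l2n lborel (\<lambda>x. \<Sum>i\<in>UNIV. conv (kint \<theta> (gk2 i i)) g x)"
      by (rule power2_le_imp_le) (rule l2n_nonneg)
    moreover have "l2n lborel (conv (kint \<theta> (gk2 i j)) g) = l2n lborel (\<lambda>x. hessk m i j g x - hessk n i j g x)"
    proof (rule l2n_cong_AE)
      show "AE x in lborel. norm (conv (kint \<theta> (gk2 i j)) g x) = norm (hessk m i j g x - hessk n i j g x)"
        using AEq[of i j] by eventually_elim simp
    qed (intro L2_meas cL L2_diff hL)+
    moreover have "l2n lborel (\<lambda>x. \<Sum>i\<in>UNIV. conv (kint \<theta> (gk2 i i)) g x) = l2n lborel (\<lambda>x. T m x - T n x)"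
    proof (rule l2n_cong_AE)
      show "(\<lambda>x. \<Sum>i\<in>UNIV. conv (kint \<theta> (gk2 i i)) g x) \<in> borel_measurable lborel" by (intro L2_meas L2_sum cL) auto
      show "(\<lambda>x. T m x - T n x) \<in> borel_measurable lborel" by (intro L2_meas L2_diff TL)
      have "AE x in lborel. \<forall>i\<in>UNIV. conv (kint \<theta> (gk2 i i)) g x = hessk m i i g x - hessk n i i g x"
        by (intro AE_finite_allI AEq) auto
      then show "AE x in lborel. norm (\<Sum>i\<in>UNIV. conv (kint \<theta> (gk2 i i)) g x) = norm (T m x - T n x)"
        by eventually_elim (simp add: T_def sum_subtractf)
    qed
    ultimately show ?thesis by simp
  qed
  have "\<exists>h. h \<in> L2 lborel \<and> (\<lambda>k. l2n lborel (\<lambda>x. hessk k i j g x - h x)) \<longlonglongrightarrow> 0" for i j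
  proof -
    have cau: "\<exists>N. \<forall>m\<ge>N. \<forall>n\<ge>N. l2n lborel (\<lambda>x. hessk m i j g x - hessk n i j g x) < e" if e: "e > 0" for e
    proof -
      have "\<forall>\<^sub>F k in sequentially. l2n lborel (\<lambda>x. T k x - g x) < e / 2" using Tg e by (intro order_tendstoD) auto
      then obtain N where N: "\<And>k. k \<ge> N \<Longrightarrow> l2n lborel (\<lambda>x. T k x - g x) < e / 2" by (auto simp: eventually_sequentially)
      show ?thesis
      proof (intro exI[of _ N] allI impI)
        fix m n assume mn: "m \<ge> N" "n \<ge> N"
        have "l2n lborel (\<lambda>x. T m x - T n x) < e"
          using l2n_triangle_diff[OF TL[of m] g TL[of n]] N[OF mn(1)] N[OF mn(2)] l2n_minus_commute[of lborel g "T n"] by simp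
        then show "l2n lborel (\<lambda>x. hessk m i j g x - hessk n i j g x) < e" using diff[of m i j n] by linarith
      qed
    qed
    obtain h where "h \<in> L2 lborel" "(\<lambda>k. l2n lborel (\<lambda>x. hessk k i j g x - h x)) \<longlonglongrightarrow> 0"
      using L2_complete[of "\<lambda>k. hessk k i j g" lborel, OF hL cau] by auto
    then show ?thesis by blast
  qed
  note ex = this
  define H where "H i j = (SOME h. h \<in> L2 lborel \<and> (\<lambda>k. l2n lborel (\<lambda>x. hessk k i j g x - h x)) \<longlonglongrightarrow> 0)" for i j
  have H0: "H i j \<in> L2 lborel \<and> (\<lambda>k. l2n lborel (\<lambda>x. hessk k i j g x - H i j x)) \<longlonglongrightarrow> 0" for i j
    unfolding H_def by (rule someI_ex[OF ex])
  have H: "H i j \<in> L2 lborel" "(\<lambda>k. l2n lborel (\<lambda>x. hessk k i j g x - H i j x)) \<longlonglongrightarrow> 0" for i j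
    using H0[of i j] by auto
  have trH: "(\<lambda>x. \<Sum>i\<in>UNIV. H i i x) \<in> L2 lborel" by (intro L2_sum H) auto
  have "l2n lborel (\<lambda>x. (\<Sum>i\<in>UNIV. H i i x) - g x) = 0"
  proof (rule antisym[OF _ l2n_nonneg])
    have sumle: "l2n lborel (\<lambda>x. \<Sum>i\<in>I. H i i x - hessk k i i g x) \<le> (\<Sum>i\<in>I. l2n lborel (\<lambda>x. H i i x - hessk k i i g x))" if "finite I" for I k
      using that
    proof (induction I rule: finite_induct)
      case empty then show ?case by (simp add: l2n_def)
    next
      case (insert i I)
      have "l2n lborel (\<lambda>x. (H i i x - hessk k i i g x) + (\<Sum>i\<in>I. H i i x - hessk k i i g x)) \<le> l2n lborel (\<lambda>x. H i i x - hessk k i i g x) + l2n lborel (\<lambda>x. \<Sum>i\<in>I. H i i x - hessk k i i g x)"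
        by (intro l2n_triangle L2_diff H hL L2_sum insert)
      then show ?case using insert by simp
    qed
    have le: "l2n lborel (\<lambda>x. (\<Sum>i\<in>UNIV. H i i x) - g x) \<le> (\<Sum>i\<in>UNIV. l2n lborel (\<lambda>x. hessk k i i g x - H i i x)) + l2n lborel (\<lambda>x. T k x - g x)" for k
    proof -
      have "l2n lborel (\<lambda>x. (\<Sum>i\<in>UNIV. H i i x) - T k x) \<le> (\<Sum>i\<in>UNIV. l2n lborel (\<lambda>x. hessk k i i g x - H i i x))"
        using sumle[of UNIV k] by (simp add: T_def sum_subtractf l2n_minus_commute[of lborel "H i i" for i])
      then show ?thesis using l2n_triangle_diff[OF trH TL[of k] g] by linarith
    qed
    have "(\<lambda>k. (\<Sum>i\<in>UNIV. l2n lborel (\<lambda>x. hessk k i i g x - H i i x)) + l2n lborel (\<lambda>x. T k x - g x)) \<longlonglongrightarrow> (\<Sum>i\<in>(UNIV::'n set). 0) + 0"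
      by (intro tendsto_add tendsto_sum H Tg)
    then show "l2n lborel (\<lambda>x. (\<Sum>i\<in>UNIV. H i i x) - g x) \<le> 0"
      by (intro LIMSEQ_le_const[where X="\<lambda>k. (\<Sum>i\<in>UNIV. l2n lborel (\<lambda>x. hessk k i i g x - H i i x)) + l2n lborel (\<lambda>x. T k x - g x)"]) (use le in auto)
  qed
  from l2n_eq_0_AE[OF L2_diff[OF trH g] this] have tr: "AE x in lborel. (\<Sum>i\<in>UNIV. H i i x) = g x" by simp
  have "(\<lambda>k. \<Sum>i\<in>UNIV. \<Sum>j\<in>UNIV. (l2n lborel (hessk k i j g))^2) \<longlonglongrightarrow> (\<Sum>i\<in>UNIV. \<Sum>j\<in>UNIV. (l2n lborel (H i j))^2)"
    by (intro tendsto_sum tendsto_power l2n_tendsto hL H)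
  moreover have "(\<Sum>i\<in>UNIV. \<Sum>j\<in>UNIV. (l2n lborel (hessk k i j g))^2) = (l2n lborel (T k))^2" for k
    unfolding hessk_def T_def[abs_def] by (rule hessian_norm_identity[OF adm_cutoff g])
  moreover have "(\<lambda>k. (l2n lborel (T k))^2) \<longlonglongrightarrow> (l2n lborel g)^2"
    by (intro tendsto_power l2n_tendsto TL g Tg)
  ultimately have "(\<Sum>i\<in>UNIV. \<Sum>j\<in>UNIV. (l2n lborel (H i j))^2) = (l2n lborel g)^2"
    using LIMSEQ_unique by simp
  with H tr that show thesis by blast
qed

section \<open>A Liouville theorem\<close>

lemma has_deriv_imp_directional:
  assumes "\<phi> \<in> test_functions" "\<And>x. ((\<lambda>t. partial_derivs is \<phi> (x + t *\<^sub>R axis i 1)) has_real_derivative D x) (at 0)"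
  shows "partial_derivs (i # is) \<phi> = D"
proof
  fix x
  show "partial_derivs (i # is) \<phi> x = D x"
    using DERIV_unique[OF test_directional[OF assms(1)] assms(2)] .
qed

text \<open>The profile is a function of the squared distance, a polynomial, hence smooth also at
  the centre. The index m is kept as a parameter because each differentiation shifts it.\<close>

definition bump :: "nat \<Rightarrow> real \<Rightarrow> real^'n \<Rightarrow> real^'n \<Rightarrow> real" where
  "bump m r y x = psi m (1 - (norm (x - y))^2 / r^2)"

lemma bump_outside: "0 < r \<Longrightarrow> r \<le> norm (x - y) \<Longrightarrow> bump m r y x = 0"
proof -
  assume "0 < r" "r \<le> norm (x - y)"
  then have "r^2 \<le> (norm (x - y))^2" by (intro power_mono) auto
  then have "1 - (norm (x - y))^2 / r^2 \<le> 0" using \<open>0 < r\<close> by simp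
  then show ?thesis unfolding bump_def psi_def by (simp only: not_less[symmetric] if_False)
qed

lemma bump_bound: "\<bar>bump m r y x\<bar> \<le> fact m"
  unfolding bump_def by (rule psi_bounded) simp

lemma bump_nonneg: "0 \<le> bump m r y x" by (simp add: bump_def psi_nonneg)

lemma measurable_bump[measurable (raw)]:
  assumes [measurable]: "f \<in> borel_measurable M" "g \<in> borel_measurable M" "h \<in> borel_measurable M"
  shows "(\<lambda>x. bump m (f x) (g x) (h x)) \<in> borel_measurable M"
  unfolding bump_def by measurable

lemma continuous_on_bump: "0 < r \<Longrightarrow> continuous_on UNIV (bump m r y)"
  unfolding bump_def[abs_def] by (auto intro!: continuous_intros)

lemma bump_nice: "bump m r y \<in> nice"
proof -
  have "bump m r y = (\<lambda>x. psi m (1 + (- 1 / r^2) * (\<Sum>i\<in>UNIV. (x $ i + (- (y $ i))) * (x $ i + (- (y $ i))))))"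
    by (simp add: bump_def fun_eq_iff norm_vec_def L2_set_def sum_nonneg power2_eq_square)
  also have "\<dots> \<in> nice" by (intro nice.intros nice_sum) auto
  finally show ?thesis .
qed

lemma bump_test: "0 < r \<Longrightarrow> bump m r y \<in> test_functions"
proof (rule nice_testI[OF bump_nice, of "cball y r"])
  fix x assume "0 < r" "x \<notin> cball y r"
  then show "bump m r y x = 0" by (intro bump_outside) (auto simp: dist_norm norm_minus_commute)
qed simp

lemma bump_deriv:
  assumes r: "0 < r"
  shows "((\<lambda>t. bump m r y (x + t *\<^sub>R axis i 1)) has_real_derivative
     (bump (m + 2) r y x - real m * bump (m + 1) r y x) * (- 2 * (x $ i - y $ i) / r^2)) (at 0)"
proof -
  have "((\<lambda>t. 1 - ((norm (x - y))^2 + 2 * t * (x - y) $ i + t^2) / r^2) has_real_derivative (- 2 * (x $ i - y $ i) / r^2)) (at 0)"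
    using r by (auto intro!: derivative_eq_intros simp: field_simps)
  moreover have "(\<lambda>t. 1 - ((norm (x - y))^2 + 2 * t * (x - y) $ i + t^2) / r^2) = (\<lambda>t. 1 - (norm (x + t *\<^sub>R axis i 1 - y))^2 / r^2)"
    using norm_shift_axis[of "x - y" _ i] by (simp add: fun_eq_iff algebra_simps)
  ultimately have "((\<lambda>t. 1 - (norm (x + t *\<^sub>R axis i 1 - y))^2 / r^2) has_real_derivative (- 2 * (x $ i - y $ i) / r^2)) (at 0)" by simp
  from DERIV_chain2[OF _ this, of "psi m"] psi_deriv[of m "1 - (norm (x - y))^2 / r^2"]
  show ?thesis by (simp add: bump_def)
qed

lemma bump_laplacian:
  fixes y :: "real^'n"
  assumes r: "0 < r"
  shows "(\<Sum>i\<in>UNIV. partial_derivs [i, i] (bump 0 r y) x)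
    = (4 * (norm (x - y))^2 / r^2 * (bump 4 r y x - 2 * bump 3 r y x) - 2 * real CARD('n) * bump 2 r y x) / r^2"
proof -
  have 1: "partial_derivs [i] (bump 0 r y) = (\<lambda>x. bump 2 r y x * (- 2 * (x $ i - y $ i) / r^2))" for i
    by (rule has_deriv_imp_directional[OF bump_test[OF r]]) (unfold partial_derivs.simps(1), rule DERIV_cong[OF bump_deriv[OF r]], simp add: numeral_2_eq_2)
  have 2: "partial_derivs [i, i] (bump 0 r y) x = (bump 4 r y x - 2 * bump 3 r y x) * (- 2 * (x $ i - y $ i) / r^2) * (- 2 * (x $ i - y $ i) / r^2) - 2 / r^2 * bump 2 r y x" for i x
  proof -
    have "((\<lambda>t. (- 2 * ((x + t *\<^sub>R axis i 1) $ i - y $ i) / r^2)) has_real_derivative (- 2 / r^2)) (at 0)"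
      using r unfolding component_shift by (auto intro!: derivative_eq_intros simp: field_simps)
    moreover have "((\<lambda>t. bump 2 r y (x + t *\<^sub>R axis i 1)) has_real_derivative
        (bump 4 r y x - 2 * bump 3 r y x) * (- 2 * (x $ i - y $ i) / r^2)) (at 0)"
    proof -
      have "(2::nat) + 2 = 4" "(2::nat) + 1 = 3" by simp_all
      then show ?thesis using bump_deriv[OF r, of 2 y x i] by (simp only:) simp
    qed
    ultimately
    have "((\<lambda>t. partial_derivs [i] (bump 0 r y) (x + t *\<^sub>R axis i 1)) has_real_derivative
       (bump 4 r y x - 2 * bump 3 r y x) * (- 2 * (x $ i - y $ i) / r^2) * (- 2 * (x $ i - y $ i) / r^2) - 2 / r^2 * bump 2 r y x) (at 0)"
      unfolding 1 by (intro DERIV_cong[OF DERIV_mult]) (assumption | simp add: algebra_simps)+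
    from DERIV_unique[OF test_directional[of "bump 0 r y" "[i]" x i, OF bump_test[OF r]] this]
    show ?thesis .
  qed
  have S1: "(\<Sum>i\<in>UNIV. (x $ i - y $ i)^2) = (norm (x - y))^2"
    by (simp add: norm_vec_def L2_set_def sum_nonneg)
  have S2: "(\<Sum>i\<in>UNIV. partial_derivs [i, i] (bump 0 r y) x)
     = (\<Sum>i\<in>UNIV. 4 * (bump 4 r y x - 2 * bump 3 r y x) / r^2 / r^2 * (x $ i - y $ i)^2 - 2 / r^2 * bump 2 r y x)"
    unfolding 2 by (intro sum.cong refl) (simp add: power2_eq_square, simp add: algebra_simps)
  have "(\<Sum>i\<in>UNIV. partial_derivs [i, i] (bump 0 r y) x)
     = 4 * (bump 4 r y x - 2 * bump 3 r y x) / r^2 / r^2 * (norm (x - y))^2 - real CARD('n) * (2 / r^2 * bump 2 r y x)"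
    unfolding S2 sum_subtractf sum_distrib_left[symmetric] S1 by simp
  then show ?thesis by (simp only:) (use r in \<open>simp add: field_simps\<close>)
qed

text \<open>For a rescaled profile of fixed mass the derivative in the radius is minus 1 / r times
  the divergence of x - y times the profile. Since psi 2 is the derivative of psi 0, the field (x -
  y) times \<open>bump 2\<close> is - r^2 / 2 times the gradient of \<open>bump 0\<close>, and the
  divergence becomes its Laplacian.\<close>

lemma bump_scale_deriv:
  fixes y :: "real^'n"
  assumes r: "0 < r"
  shows "((\<lambda>r. r powr (- real CARD('n)) * bump 2 r y x) has_real_derivative
     r powr (1 - real CARD('n)) / 2 * (\<Sum>i\<in>UNIV. partial_derivs [i, i] (bump 0 r y) x)) (at r)"
proof -
  have "((\<lambda>r. 1 - (norm (x - y))^2 / r^2) has_real_derivative 2 * (norm (x - y))^2 / r^3) (at r)"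
    using r by (auto intro!: derivative_eq_intros simp: field_simps power2_eq_square power3_eq_cube)
  from DERIV_chain2[OF _ this, of "psi 2"] psi_deriv[of 2 "1 - (norm (x - y))^2 / r^2"]
  have b: "((\<lambda>r. bump 2 r y x) has_real_derivative (bump 4 r y x - 2 * bump 3 r y x) * (2 * (norm (x - y))^2 / r^3)) (at r)"
    by (simp add: bump_def)
  have p: "((\<lambda>r. r powr (- real CARD('n))) has_real_derivative r powr (- real CARD('n)) * (- real CARD('n) / r)) (at r)"
    using DERIV_powr[of "\<lambda>r. r" 1 r "\<lambda>_. - real CARD('n)" 0] r by auto
  have e: "r powr (1 - real CARD('n)) = r * r powr (- real CARD('n))"
    using r by (simp add: powr_diff powr_minus divide_inverse)
  show ?thesis
    by (rule DERIV_cong[OF DERIV_mult[OF p b]])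
       (use r in \<open>simp add: bump_laplacian[OF r] e field_simps power2_eq_square power3_eq_cube del: partial_derivs.simps\<close>)
qed

section \<open>Weighted ball means of weakly harmonic functions\<close>

lemma L1_loc_lborel:
  fixes z :: "real^'n \<Rightarrow> real"
  assumes z: "z \<in> borel_measurable borel" and i: "\<And>K. compact K \<Longrightarrow> integrable lborel (\<lambda>x. indicator K x * z x)"
  shows "z \<in> L1_loc"
  unfolding L1_loc_def set_integrable_def
proof (intro CollectI allI impI)
  fix K :: "(real^'n) set" assume K: "compact K"
  have "(\<lambda>x. indicator K x * z x) \<in> borel_measurable borel"
    using z borel_compact[OF K] by auto
  then show "integrable lebesgue (\<lambda>x. indicator K x *\<^sub>R z x)"
    using i[OF K] by (simp add: integrable_completion)
qed

lemma Lp_imp_L1_loc_lborel: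
  fixes z :: "real^'n \<Rightarrow> real"
  assumes z[measurable]: "z \<in> borel_measurable borel" and p: "1 \<le> p" and i: "integrable lborel (\<lambda>x. \<bar>z x\<bar> powr p)" and K: "compact K"
  shows "integrable lborel (\<lambda>x. indicator K x * z x)"
proof (rule Bochner_Integration.integrable_bound)
  have [measurable]: "K \<in> sets borel" using borel_compact[OF K] .
  have "integrable lborel (indicator K :: real^'n \<Rightarrow> real)"
    using emeasure_compact_finite[OF K] by (intro integrable_real_indicator) auto
  with i show "integrable lborel (\<lambda>x. indicator K x + \<bar>z x\<bar> powr p)" by simp
  show "(\<lambda>x. indicator K x * z x) \<in> borel_measurable lborel" by measurable
  show "AE x in lborel. norm (indicator K x * z x) \<le> norm (indicator K x + \<bar>z x\<bar> powr p)"
  proof (rule AE_I2)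
    fix x
    have "\<bar>z x\<bar> \<le> 1 + \<bar>z x\<bar> powr p"
    proof (cases "\<bar>z x\<bar> \<le> 1")
      case True then show ?thesis by (simp add: add_increasing2)
    next
      case False
      then have "\<bar>z x\<bar> powr 1 \<le> \<bar>z x\<bar> powr p" using p by (intro powr_mono) auto
      then show ?thesis using False by simp
    qed
    then show "norm (indicator K x * z x) \<le> norm (indicator K x + \<bar>z x\<bar> powr p)"
      by (auto simp: indicator_def)
  qed
qed

text \<open>Differentiating the mean with respect to the radius produces the Laplacian of another bump, so weak harmonicity makes it constant in r.\<close>

lemma radial_mean_const:
  fixes z :: "real^'n \<Rightarrow> real"
  assumes z[measurable]: "z \<in> borel_measurable borel" and loc: "\<And>K. compact K \<Longrightarrow> integrable lborel (\<lambda>x. indicator K x * z x)"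
    and harm: "\<And>\<phi>. \<phi> \<in> test_functions \<Longrightarrow> (LBINT x. z x * (\<Sum>i\<in>UNIV. partial_derivs [i, i] \<phi> x)) = 0"
    and r: "0 < r1" "r1 \<le> r2"
  shows "(LBINT x. z x * (r1 powr (- real CARD('n)) * bump 2 r1 y x)) = (LBINT x. z x * (r2 powr (- real CARD('n)) * bump 2 r2 y x))"
proof -
  let ?n = "real CARD('n)"
  \<comment> \<open>The Laplacian is written out so that joint measurability in radius and point,
    and continuity in the radius, can be read off the formula.\<close>
  define L where "L r x = r powr (1 - ?n) / 2 * ((4 * (norm (x - y))^2 / r^2 * (bump 4 r y x - 2 * bump 3 r y x) - 2 * ?n * bump 2 r y x) / r^2)" for r x
  have Lr: "L r x = r powr (1 - ?n) / 2 * (\<Sum>i\<in>UNIV. partial_derivs [i, i] (bump 0 r y) x)" if "0 < r" for r x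
    by (simp add: L_def bump_laplacian[OF that] del: partial_derivs.simps)
  have [measurable]: "(\<lambda>p. L (fst p) (snd p)) \<in> borel_measurable (borel \<Otimes>\<^sub>M borel)"
    unfolding L_def by measurable
  have [measurable]: "(\<lambda>p. L (F p) (G p)) \<in> borel_measurable N" if [measurable]: "F \<in> borel_measurable N" "G \<in> borel_measurable N" for F G and N :: "'z measure"
    unfolding L_def by measurable
  have ftc: "(LBINT r. L r x * indicator {r1..r2} r) = r2 powr (- ?n) * bump 2 r2 y x - r1 powr (- ?n) * bump 2 r1 y x" for x
  proof (rule integral_FTC_Icc_real[OF r(2)])
    fix s assume s: "r1 \<le> s" "s \<le> r2"
    then have s0: "0 < s" using r by simp
    show "((\<lambda>r. r powr (- ?n) * bump 2 r y x) has_real_derivative L s x) (at s)"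
      unfolding Lr[OF s0] by (rule bump_scale_deriv[OF s0])
    have pc: "isCont (psi m) u" for m u by (rule DERIV_isCont[OF psi_deriv])
    have "isCont (\<lambda>r. 1 - (norm (x - y))^2 / r^2) s" using s0 by (intro continuous_intros) auto
    from isCont_o2[OF this pc] have "isCont (\<lambda>r. bump m r y x) s" for m by (simp add: bump_def)
    then show "isCont (\<lambda>r. L r x) s"
      unfolding L_def using s0 by (intro continuous_intros) auto
  qed
  define C where "C = r1 powr (1 - ?n) / 2 * ((4 * (fact 4 + 2 * fact 3) + 2 * ?n * fact 2) / r1^2)"
  have C0: "C \<ge> 0" by (simp add: C_def)
  have Lb: "\<bar>L s x\<bar> \<le> C * indicator (cball y r2) x" if s: "r1 \<le> s" "s \<le> r2" for s x
  proof (cases "norm (x - y) < s")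
    case False
    then have "bump m s y x = 0" for m using s r by (intro bump_outside) auto
    then show ?thesis using C0 by (simp add: L_def)
  next
    case True
    have s0: "0 < s" using s r by simp
    have xin: "x \<in> cball y r2" using True s by (simp add: dist_norm norm_minus_commute)
    have q: "(norm (x - y))^2 / s^2 \<le> 1" using True s0 by (simp add: power_mono)
    have "\<bar>4 * (norm (x - y))^2 / s^2 * (bump 4 s y x - 2 * bump 3 s y x) - 2 * ?n * bump 2 s y x\<bar>
        \<le> \<bar>4 * ((norm (x - y))^2 / s^2) * (bump 4 s y x - 2 * bump 3 s y x)\<bar> + \<bar>2 * ?n * bump 2 s y x\<bar>"
      by (rule order_trans[OF abs_triangle_ineq4]) simp
    also have "\<dots> = 4 * ((norm (x - y))^2 / s^2) * \<bar>bump 4 s y x - 2 * bump 3 s y x\<bar> + 2 * ?n * \<bar>bump 2 s y x\<bar>"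
      by (simp add: abs_mult)
    also have "\<dots> \<le> 4 * 1 * (fact 4 + 2 * fact 3) + 2 * ?n * fact 2"
    proof (intro add_mono mult_mono q bump_bound order_refl)
      show "\<bar>bump 4 s y x - 2 * bump 3 s y x\<bar> \<le> fact 4 + 2 * fact 3"
        using bump_bound[of 4 s y x] bump_bound[of 3 s y x] by linarith
    qed auto
    finally have A: "\<bar>4 * (norm (x - y))^2 / s^2 * (bump 4 s y x - 2 * bump 3 s y x) - 2 * ?n * bump 2 s y x\<bar> \<le> 4 * (fact 4 + 2 * fact 3) + 2 * ?n * fact 2" by simp
    have n1: "1 \<le> ?n" using zero_less_card_finite[where 'a='n] by linarith
    have "\<bar>L s x\<bar> = s powr (1 - ?n) / 2 * (\<bar>4 * (norm (x - y))^2 / s^2 * (bump 4 s y x - 2 * bump 3 s y x) - 2 * ?n * bump 2 s y x\<bar> / s^2)"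
      by (simp add: L_def abs_mult)
    also have "\<dots> \<le> r1 powr (1 - ?n) / 2 * ((4 * (fact 4 + 2 * fact 3) + 2 * ?n * fact 2) / r1^2)"
      using r s s0 n1 by (intro mult_mono divide_right_mono frac_le A power_mono powr_mono2') auto
    finally show ?thesis using xin by (simp add: C_def)
  qed
  have zi: "integrable lborel (\<lambda>x. indicator (cball y r2) x * z x)" by (rule loc) simp
  have I: "integrable (lborel \<Otimes>\<^sub>M lborel) (\<lambda>(x, s). z x * (L s x * indicator {r1..r2} s))"
  proof (rule Bochner_Integration.integrable_bound)
    have ind: "integrable lborel (\<lambda>s::real. C * indicator {r1..r2} s)"
      using r by (intro integrable_mult_right integrable_real_indicator) auto
    show "integrable (lborel \<Otimes>\<^sub>M lborel) (\<lambda>(x, s). (indicator (cball y r2) x * z x) * (C * indicator {r1..r2} s))"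
      by (rule integrable_lborel_times[OF zi ind])
    show "(\<lambda>(x, s). z x * (L s x * indicator {r1..r2} s)) \<in> borel_measurable (lborel \<Otimes>\<^sub>M lborel)"
      unfolding split_beta' by measurable
    show "AE p in lborel \<Otimes>\<^sub>M lborel. norm (case p of (x, s) \<Rightarrow> z x * (L s x * indicator {r1..r2} s)) \<le> norm (case p of (x, s) \<Rightarrow> indicator (cball y r2) x * z x * (C * indicator {r1..r2} s))"
    proof (rule AE_I2, clarify)
      fix x s
      show "norm (z x * (L s x * indicator {r1..r2} s)) \<le> norm (indicator (cball y r2) x * z x * (C * indicator {r1..r2} s))"
      proof (cases "s \<in> {r1..r2}")
        case True
        have "\<bar>z x\<bar> * \<bar>L s x\<bar> \<le> \<bar>z x\<bar> * (C * indicator (cball y r2) x)" using True by (intro mult_left_mono Lb) auto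
        then show ?thesis using True C0 by (simp add: abs_mult mult_ac)
      qed simp
    qed
  qed
  have zb: "integrable lborel (\<lambda>x. z x * (s powr (- ?n) * bump 2 s y x))" if s: "0 < s" "s \<le> r2" for s
  proof (rule Bochner_Integration.integrable_bound)
    show "integrable lborel (\<lambda>x. s powr (- ?n) * fact 2 * (indicator (cball y r2) x * z x))" using zi by simp
    show "AE x in lborel. norm (z x * (s powr (- ?n) * bump 2 s y x)) \<le> norm (s powr (- ?n) * fact 2 * (indicator (cball y r2) x * z x))"
    proof (rule AE_I2)
      fix x
      have "\<bar>bump 2 s y x\<bar> \<le> fact 2 * indicator (cball y r2) x"
        using bump_bound[of 2 s y x] bump_outside[OF s(1), of x y 2] s by (auto simp: indicator_def dist_norm norm_minus_commute)
      then have "s powr (- ?n) * \<bar>z x\<bar> * \<bar>bump 2 s y x\<bar> \<le> s powr (- ?n) * \<bar>z x\<bar> * (fact 2 * indicator (cball y r2) x)" by (intro mult_left_mono) auto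
      then show "norm (z x * (s powr (- ?n) * bump 2 s y x)) \<le> norm (s powr (- ?n) * fact 2 * (indicator (cball y r2) x * z x))"
        by (simp add: abs_mult mult_ac)
    qed
  qed measurable
  have "(LBINT x. z x * (r2 powr (- ?n) * bump 2 r2 y x)) - (LBINT x. z x * (r1 powr (- ?n) * bump 2 r1 y x))
     = (LBINT x. z x * (r2 powr (- ?n) * bump 2 r2 y x) - z x * (r1 powr (- ?n) * bump 2 r1 y x))"
    using zb[of r1] zb[of r2] r by simp
  also have "\<dots> = (LBINT x. (LBINT s. z x * (L s x * indicator {r1..r2} s)))"
    by (simp add: ftc right_diff_distrib)
  also have "\<dots> = (LBINT s. (LBINT x. z x * (L s x * indicator {r1..r2} s)))"
    by (rule lborel_pair.Fubini_integral[symmetric, OF I])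
  also have "\<dots> = (\<integral>s. 0 \<partial>(lborel :: real measure))"
  proof (intro Bochner_Integration.integral_cong refl)
    fix s :: real
    show "(LBINT x. z x * (L s x * indicator {r1..r2} s)) = 0"
    proof (cases "s \<in> {r1..r2}")
      case True
      then have s0: "0 < s" using r by simp
      have "(LBINT x. z x * (L s x * indicator {r1..r2} s)) = (LBINT x. s powr (1 - ?n) / 2 * (z x * (\<Sum>i\<in>UNIV. partial_derivs [i, i] (bump 0 s y) x)))"
        using True by (simp add: Lr[OF s0] mult_ac del: partial_derivs.simps)
      also have "\<dots> = s powr (1 - ?n) / 2 * (LBINT x. z x * (\<Sum>i\<in>UNIV. partial_derivs [i, i] (bump 0 s y) x))"
        by (rule Bochner_Integration.integral_mult_right_zero)
      finally show ?thesis using harm[OF bump_test[OF s0]] by simp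
    qed simp
  qed
  finally show ?thesis by simp
qed

text \<open>The normalized mean is constant in the radius, so it can be estimated at radii tending
  to infinity, where integrability to the power p makes it arbitrarily small.\<close>

lemma radial_mean_zero:
  fixes z :: "real^'n \<Rightarrow> real"
  assumes z[measurable]: "z \<in> borel_measurable borel" and p: "1 < p" and zp: "integrable lborel (\<lambda>x. \<bar>z x\<bar> powr p)"
    and harm: "\<And>\<phi>. \<phi> \<in> test_functions \<Longrightarrow> (LBINT x. z x * (\<Sum>i\<in>UNIV. partial_derivs [i, i] \<phi> x)) = 0"
    and r: "0 < r"
  shows "(LBINT x. z x * bump 2 r y x) = 0"
proof -
  let ?n = "real CARD('n)"
  have loc: "integrable lborel (\<lambda>x. indicator K x * z x)" if "compact K" for K
    by (rule Lp_imp_L1_loc_lborel[OF z _ zp that]) (use p in simp)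
  define I where "I s = (LBINT x. z x * (s powr (- ?n) * bump 2 s y x))" for s
  have const: "I s = I r" if "r \<le> s" for s
    unfolding I_def using radial_mean_const[OF z loc harm r that] by simp
  define V where "V = unit_ball_vol ?n"
  have V0: "V \<ge> 0" by (simp add: V_def)
  have n1: "1 \<le> ?n" using zero_less_card_finite[where 'a='n] by linarith
  define N where "N = (LBINT x. \<bar>z x\<bar> powr p)"
  \<comment> \<open>Splitting |z| at a level d gives |z| \<le> d + d^(1 - p) |z|^p. The
    normalization keeps the first part at the size d V and makes the second decay with s; first s
    tends to infinity, then d to 0. The factor 2 is the bound \<open>fact 2\<close> for
    \<open>bump 2\<close>.\<close>
  have bound: "\<bar>I s\<bar> \<le> 2 * (d * V + s powr (- ?n) * d powr (1 - p) * N)" if s: "0 < s" and d: "0 < d" for s d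
  proof -
    have pw: "\<bar>z x * (s powr (- ?n) * bump 2 s y x)\<bar> \<le> s powr (- ?n) * 2 * (d * indicator (cball y s) x + d powr (1 - p) * \<bar>z x\<bar> powr p)" for x
    proof -
      have "\<bar>bump 2 s y x\<bar> \<le> 2 * indicator (cball y s) x"
        using bump_bound[of 2 s y x] bump_outside[OF s, of x y 2] by (auto simp: indicator_def dist_norm norm_minus_commute numeral_2_eq_2)
      moreover have "\<bar>z x\<bar> \<le> d + d powr (1 - p) * \<bar>z x\<bar> powr p"
      proof (cases "\<bar>z x\<bar> \<le> d")
        case True then show ?thesis by (simp add: add_increasing2)
      next
        case False
        then have "\<bar>z x\<bar> powr (1 - p) \<le> d powr (1 - p)" using d p by (intro powr_mono2') auto
        then have "\<bar>z x\<bar> powr (1 - p) * \<bar>z x\<bar> powr p \<le> d powr (1 - p) * \<bar>z x\<bar> powr p" by (intro mult_right_mono) auto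
        moreover have "\<bar>z x\<bar> powr (1 - p) * \<bar>z x\<bar> powr p = \<bar>z x\<bar>" using False d by (simp add: powr_add[symmetric])
        ultimately show ?thesis using d by linarith
      qed
      ultimately have "\<bar>z x\<bar> * \<bar>bump 2 s y x\<bar> \<le> (d + d powr (1 - p) * \<bar>z x\<bar> powr p) * (2 * indicator (cball y s) x)"
        by (intro mult_mono) auto
      also have "\<dots> \<le> 2 * (d * indicator (cball y s) x + d powr (1 - p) * \<bar>z x\<bar> powr p)"
        by (auto simp: indicator_def algebra_simps)
      finally have "s powr (- ?n) * (\<bar>z x\<bar> * \<bar>bump 2 s y x\<bar>) \<le> s powr (- ?n) * (2 * (d * indicator (cball y s) x + d powr (1 - p) * \<bar>z x\<bar> powr p))"
        by (intro mult_left_mono) auto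
      moreover have "\<bar>z x * (s powr (- ?n) * bump 2 s y x)\<bar> = s powr (- ?n) * (\<bar>z x\<bar> * \<bar>bump 2 s y x\<bar>)" by (simp add: abs_mult)
      ultimately show ?thesis by (simp only: mult.assoc)
    qed
    have ci: "integrable lborel (indicator (cball y s) :: real^'n \<Rightarrow> real)"
      using emeasure_compact_finite[OF compact_cball, of y s] by (intro integrable_real_indicator) auto
    have cV: "(LBINT x. indicator (cball y s) x) = V * s ^ CARD('n)"
      using content_cball[of s y] s by (simp add: V_def)
    have "\<bar>I s\<bar> \<le> (LBINT x. s powr (- ?n) * 2 * (d * indicator (cball y s) x + d powr (1 - p) * \<bar>z x\<bar> powr p))"
      unfolding I_def
    proof (rule order_trans[OF integral_abs_bound integral_mono'])
      show "integrable lborel (\<lambda>x. s powr (- ?n) * 2 * (d * indicator (cball y s) x + d powr (1 - p) * \<bar>z x\<bar> powr p))"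
        using ci zp by simp
      show "\<bar>z x * (s powr (- ?n) * bump 2 s y x)\<bar> \<le> s powr (- ?n) * 2 * (d * indicator (cball y s) x + d powr (1 - p) * \<bar>z x\<bar> powr p)" for x
        by (rule pw)
      show "0 \<le> s powr (- ?n) * 2 * (d * indicator (cball y s) x + d powr (1 - p) * \<bar>z x\<bar> powr p)" for x
        using d by simp
    qed
    also have "\<dots> = s powr (- ?n) * 2 * (d * (V * s ^ CARD('n)) + d powr (1 - p) * N)"
      using ci zp cV by (simp add: N_def)
    also have "\<dots> = 2 * (d * V * (s powr (- ?n) * s ^ CARD('n)) + s powr (- ?n) * d powr (1 - p) * N)"
      by (simp add: algebra_simps)
    also have "s powr (- ?n) * s ^ CARD('n) = 1" using s by (simp add: powr_realpow[symmetric] powr_add[symmetric])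
    finally show ?thesis by simp
  qed
  have "\<bar>I r\<bar> \<le> 2 * (d * V)" if d: "0 < d" for d
  proof (rule tendsto_lowerbound)
    have "((\<lambda>s. s powr (- ?n)) \<longlongrightarrow> 0) at_top" using n1 by (intro tendsto_neg_powr filterlim_ident) auto
    then have "((\<lambda>s. 2 * (d * V + s powr (- ?n) * d powr (1 - p) * N)) \<longlongrightarrow> 2 * (d * V + 0 * d powr (1 - p) * N)) at_top"
      by (intro tendsto_intros)
    then show "((\<lambda>s. 2 * (d * V + s powr (- ?n) * d powr (1 - p) * N)) \<longlongrightarrow> 2 * (d * V)) at_top" by simp
    show "\<forall>\<^sub>F s in at_top. \<bar>I r\<bar> \<le> 2 * (d * V + s powr (- ?n) * d powr (1 - p) * N)"
      using eventually_ge_at_top[of r] by eventually_elim (use bound d const r in \<open>metis order_less_le_trans\<close>)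
  qed simp
  then have "\<bar>I r\<bar> \<le> 0 + e" if "0 < e" for e
  proof -
    have "\<bar>I r\<bar> \<le> 2 * (e / (2 * (V + 1)) * V)" using that V0 by (intro \<open>\<And>d. 0 < d \<Longrightarrow> \<bar>I r\<bar> \<le> 2 * (d * V)\<close>) auto
    also have "\<dots> \<le> e" using that V0 by (simp add: field_simps)
    finally show ?thesis by simp
  qed
  then have "I r = 0" using field_le_epsilon[of "\<bar>I r\<bar>" 0] by simp
  moreover have "I r = r powr (- ?n) * (LBINT x. z x * bump 2 r y x)"
    unfolding I_def by (simp add: mult_ac flip: Bochner_Integration.integral_mult_right_zero)
  ultimately show ?thesis using r by simp
qed

lemma integral_bump_pos:
  assumes r: "0 < r"
  shows "0 < (LBINT y. bump 2 r y (x::real^'n))" "integrable lborel (\<lambda>y. bump 2 r y x)"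
proof -
  have sym: "bump 2 r y x = bump 2 r x y" for y by (simp add: bump_def norm_minus_commute)
  have "integrable lborel (\<lambda>y. indicator (cball x r) y *\<^sub>R bump 2 r x y)"
    using borel_integrable_compact[OF compact_cball continuous_on_subset[OF continuous_on_bump[OF r] subset_UNIV], of x r 2 x] by simp
  moreover have "indicator (cball x r) y *\<^sub>R bump 2 r x y = bump 2 r y x" for y
    using bump_outside[OF r, of y x 2] by (auto simp: indicator_def sym dist_norm norm_minus_commute)
  ultimately show I: "integrable lborel (\<lambda>y. bump 2 r y x)" by simp
  have "0 \<le> (LBINT y. bump 2 r y x)" by (simp add: bump_nonneg)
  moreover have "(LBINT y. bump 2 r y x) \<noteq> 0"
  proof
    assume "(LBINT y. bump 2 r y x) = 0"
    then have "AE y in lborel. bump 2 r y x = 0"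
      using integral_nonneg_eq_0_iff_AE[OF I] by (simp add: bump_nonneg)
    then have "AE y in lborel. y \<notin> ball x r"
    proof eventually_elim
      case (elim y)
      show ?case
      proof
        assume "y \<in> ball x r"
        then have "(norm (x - y))^2 < r^2" by (intro power_strict_mono) (auto simp: dist_norm)
        then have "0 < 1 - (norm (x - y))^2 / r^2" using r by simp
        from psi_pos[OF this, of 2] elim show False by (simp add: bump_def)
      qed
    qed
    then have "emeasure lborel (ball x r) = 0"
      using AE_iff_null_sets[of "ball x r" lborel] by (auto simp: null_sets_def)
    then show False using r content_ball_pos[of r x] by (simp add: measure_def)
  qed
  ultimately show "0 < (LBINT y. bump 2 r y x)" by linarith
qed

text \<open>All bump means of z vanish, so z integrates to 0 against every mollification of a test
  function. Mollifications converge uniformly with supports in a fixed ball, hence z is orthogonal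
  to all test functions and the fundamental lemma applies.\<close>

theorem liouville:
  fixes z :: "real^'n \<Rightarrow> real"
  assumes z[measurable]: "z \<in> borel_measurable borel" and p: "1 < p" and zp: "integrable lborel (\<lambda>x. \<bar>z x\<bar> powr p)"
    and harm: "\<And>\<phi>. \<phi> \<in> test_functions \<Longrightarrow> (LBINT x. z x * (\<Sum>i\<in>UNIV. partial_derivs [i, i] \<phi> x)) = 0"
  shows "AE x in lborel. z x = 0"
proof -
  have loc: "integrable lborel (\<lambda>x. indicator K x * z x)" if "compact K" for K
    by (rule Lp_imp_L1_loc_lborel[OF z _ zp that]) (use p in simp)
  have zL: "z \<in> L1_loc" by (rule L1_loc_lborel[OF z loc])
  have "(\<integral>x. z x * \<phi> x \<partial>lebesgue) = 0" if \<phi>: "\<phi> \<in> test_functions" for \<phi>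
  proof -
    define K where "K = closure {x. \<phi> x \<noteq> 0}"
    have K: "compact K" unfolding K_def by (rule test_compact[OF \<phi>])
    obtain M where M: "0 \<le> M" "\<And>x. \<bar>\<phi> x\<bar> \<le> M * indicator K x"
      using test_bounded[OF \<phi>, of "[]"] by (auto simp: K_def)
    have [measurable]: "\<phi> \<in> borel_measurable borel" using test_measurable[OF \<phi>, of "[]"] by simp
    obtain R where R: "K \<subseteq> cball 0 R" using compact_imp_bounded[OF K] by (auto simp: bounded_iff subset_iff)
    \<comment> \<open>Room of width 1 around the support: the mollification radii stay at most 1, so
      every mollified function lives in this ball, where z is integrable.\<close>
    define K1 where "K1 = cball (0::real^'n) (R + 1)"
    have K1: "compact K1" by (simp add: K1_def)
    have near: "x \<in> K1" if "y \<in> K" "norm (x - y) \<le> 1" for x y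
      using R that norm_triangle_sub[of x y] by (auto simp: K1_def)
    have KK1: "K \<subseteq> K1" using near[of x x for x] by auto
    define Z where "Z = (LBINT x. \<bar>indicator K1 x * z x\<bar>)"
    have Z0: "Z \<ge> 0" by (simp add: Z_def)
    have "uniformly_continuous_on (cball 0 (R + 2)) \<phi>"
      using test_continuous[OF \<phi>, of _ "[]"] by (intro compact_uniformly_continuous) auto
    then have uc: "\<exists>d>0. \<forall>x\<in>cball 0 (R+2). \<forall>x'\<in>cball 0 (R+2). dist x' x < d \<longrightarrow> dist (\<phi> x') (\<phi> x) < e" if "e > 0" for e
      using that unfolding uniformly_continuous_on_def by blast
    have zphi: "integrable lborel (\<lambda>x. z x * \<phi> x)"
    proof (rule Bochner_Integration.integrable_bound)
      show "integrable lborel (\<lambda>x. M * (indicator K x * z x))" using loc[OF K] by simp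
      show "AE x in lborel. norm (z x * \<phi> x) \<le> norm (M * (indicator K x * z x))"
      proof (rule AE_I2)
        fix x
        have "\<bar>z x\<bar> * \<bar>\<phi> x\<bar> \<le> \<bar>z x\<bar> * (M * indicator K x)" by (intro mult_left_mono M) auto
        then show "norm (z x * \<phi> x) \<le> norm (M * (indicator K x * z x))" using M(1) by (simp add: abs_mult mult_ac)
      qed
    qed measurable
    have est: "\<bar>\<integral>x. z x * \<phi> x \<partial>lborel\<bar> \<le> e * Z" if e: "e > 0" for e
    proof -
      obtain d where d: "d > 0" "\<And>x x'. x \<in> cball 0 (R+2) \<Longrightarrow> x' \<in> cball 0 (R+2) \<Longrightarrow> dist x' x < d \<Longrightarrow> dist (\<phi> x') (\<phi> x) < e"
        using uc[OF e] by blast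
      \<comment> \<open>Below the modulus of uniform continuity for e, so that
        \<open>bump 2 r y x\<close> only compares points at which \<phi> differs by less than e; at
        most 1, so that \<open>K1\<close> contains all supports.\<close>
      define r where "r = min (d / 2) 1"
      have r: "0 < r" "r \<le> 1" "r < d" using d(1) by (auto simp: r_def)
      define c where "c = (LBINT y. bump 2 r y (0::real^'n))"
      have c: "c > 0" unfolding c_def by (rule integral_bump_pos[OF r(1)])
      have cx: "(LBINT y. bump 2 r y x) = c" for x :: "real^'n"
      proof -
        have "bump 2 r y x = bump 2 r (y - x) 0" for y by (simp add: bump_def norm_minus_commute)
        then show ?thesis using integral_shift'[OF integral_bump_pos(2)[OF r(1)], of x 0] by (simp add: c_def)
      qed
      have I: "integrable (lborel \<Otimes>\<^sub>M lborel) (\<lambda>(x, y). z x * (\<phi> y * bump 2 r y x))"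
      proof (rule Bochner_Integration.integrable_bound)
        have "integrable lborel (\<lambda>y. 2 * M * indicator K y)"
          using emeasure_compact_finite[OF K] borel_compact[OF K] by (intro integrable_mult_right integrable_real_indicator) auto
        from integrable_lborel_times[OF loc[OF K1] this]
        show "integrable (lborel \<Otimes>\<^sub>M lborel) (\<lambda>(x, y). (indicator K1 x * z x) * (2 * M * indicator K y))" .
        show "AE p in lborel \<Otimes>\<^sub>M lborel. norm (case p of (x, y) \<Rightarrow> z x * (\<phi> y * bump 2 r y x)) \<le> norm (case p of (x, y) \<Rightarrow> (indicator K1 x * z x) * (2 * M * indicator K y))"
        proof (rule AE_I2, clarify)
          fix x y :: "real^'n"
          have "\<bar>\<phi> y * bump 2 r y x\<bar> \<le> 2 * M * indicator K y * indicator K1 x"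
          proof (cases "y \<in> K \<and> norm (x - y) < r")
            case True
            then have "x \<in> K1" using near r by auto
            moreover have "\<bar>\<phi> y\<bar> * \<bar>bump 2 r y x\<bar> \<le> M * 2"
              using M(2)[of y] bump_bound[of 2 r y x] True by (intro mult_mono) (auto simp: M(1))
            ultimately show ?thesis using True by (simp add: abs_mult)
          next
            case False
            then have "\<phi> y * bump 2 r y x = 0" using M(2)[of y] bump_outside[OF r(1), of x y 2] by (auto simp: not_less)
            then show ?thesis by (simp only: abs_zero) (simp add: M(1))
          qed
          then have "\<bar>z x\<bar> * \<bar>\<phi> y * bump 2 r y x\<bar> \<le> \<bar>z x\<bar> * (2 * M * indicator K y * indicator K1 x)" by (rule mult_left_mono) simp
          then show "norm (z x * (\<phi> y * bump 2 r y x)) \<le> norm ((indicator K1 x * z x) * (2 * M * indicator K y))"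
            using M(1) by (simp add: abs_mult mult_ac)
        qed
      qed measurable
      have "(LBINT x. z x * (LBINT y. \<phi> y * bump 2 r y x)) = (LBINT x. (LBINT y. z x * (\<phi> y * bump 2 r y x)))" by simp
      also have "\<dots> = (LBINT y. (LBINT x. z x * (\<phi> y * bump 2 r y x)))"
        using lborel_pair.Fubini_integral[OF I] by simp
      also have "\<dots> = (LBINT y. \<phi> y * (LBINT x. z x * bump 2 r y x))"
        by (intro Bochner_Integration.integral_cong refl) (simp add: mult_ac flip: Bochner_Integration.integral_mult_right_zero)
      also have "\<dots> = 0" using radial_mean_zero[OF z p zp harm r(1)] by simp
      finally have zero: "(LBINT x. z x * (LBINT y. \<phi> y * bump 2 r y x)) = 0" .
      define \<psi> where "\<psi> x = (LBINT y. \<phi> y * bump 2 r y x)" for x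
      have [measurable]: "\<psi> \<in> borel_measurable borel" unfolding \<psi>_def[abs_def] by measurable
      have zpsi: "integrable lborel (\<lambda>x. z x * \<psi> x)"
        using lborel_pair.integrable_fst[OF I] by (simp add: \<psi>_def)
      have close: "\<bar>c * \<phi> x - \<psi> x\<bar> \<le> c * e * indicator K1 x" for x
      proof -
        have pi: "integrable lborel (\<lambda>y. \<phi> y * bump 2 r y x)"
        proof (rule Bochner_Integration.integrable_bound)
          show "integrable lborel (\<lambda>y. M * bump 2 r y x)" using integral_bump_pos(2)[OF r(1), of x] by simp
          have "\<bar>\<phi> y\<bar> \<le> M" for y using M(2)[of y] M(1) by (cases "y \<in> K") auto
          then show "AE y in lborel. norm (\<phi> y * bump 2 r y x) \<le> norm (M * bump 2 r y x)"
            using M(1) by (auto simp: abs_mult intro!: mult_right_mono)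
        qed measurable
        have "c * \<phi> x - \<psi> x = (LBINT y. (\<phi> x - \<phi> y) * bump 2 r y x)"
          unfolding \<psi>_def cx[symmetric, of x] using pi integral_bump_pos(2)[OF r(1), of x]
          by (simp add: left_diff_distrib mult.commute)
        also have "\<bar>\<dots>\<bar> \<le> (LBINT y. e * indicator K1 x * bump 2 r y x)"
        proof (rule order_trans[OF integral_abs_bound integral_mono'])
          show "integrable lborel (\<lambda>y. e * indicator K1 x * bump 2 r y x)" using integral_bump_pos(2)[OF r(1), of x] by simp
          fix y :: "real^'n"
          show "\<bar>(\<phi> x - \<phi> y) * bump 2 r y x\<bar> \<le> e * indicator K1 x * bump 2 r y x"
          proof (cases "norm (x - y) < r")
            case False
            then have "bump 2 r y x = 0" by (intro bump_outside r) auto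
            then show ?thesis by simp
          next
            case True
            have "\<bar>\<phi> x - \<phi> y\<bar> \<le> e * indicator K1 x"
            proof (cases "x \<in> K1")
              case x: True
              then have "norm x \<le> R + 1" by (simp add: K1_def)
              moreover have "norm y \<le> norm x + norm (x - y)" using norm_triangle_sub[of y x] by (simp add: norm_minus_commute)
              ultimately have "x \<in> cball 0 (R + 2)" "y \<in> cball 0 (R + 2)" using True r by auto
              moreover have "dist y x < d" using True r by (simp add: dist_norm norm_minus_commute)
              ultimately have "dist (\<phi> y) (\<phi> x) < e" by (intro d)
              then show ?thesis using x by (simp add: dist_real_def abs_minus_commute)
            next
              case x: False
              then have "x \<notin> K" using KK1 by blast
              moreover have "y \<notin> K" using near[of y x] True r x by auto
              ultimately show ?thesis using M(2)[of x] M(2)[of y] x by simp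
            qed
            then have "\<bar>\<phi> x - \<phi> y\<bar> * bump 2 r y x \<le> e * indicator K1 x * bump 2 r y x" by (rule mult_right_mono) (rule bump_nonneg)
            then show ?thesis by (simp add: abs_mult bump_nonneg)
          qed
          show "0 \<le> e * indicator K1 x * bump 2 r y x" using e by (simp add: bump_nonneg)
        qed
        also have "\<dots> = c * e * indicator K1 x" using cx[of x] by simp
        finally show ?thesis .
      qed
      have "c * (LBINT x. z x * \<phi> x) = (LBINT x. z x * (c * \<phi> x - \<psi> x))"
        using zphi zpsi zero by (simp add: right_diff_distrib \<psi>_def mult.left_commute)
      also have "\<bar>\<dots>\<bar> \<le> (LBINT x. c * e * \<bar>indicator K1 x * z x\<bar>)"
      proof (rule order_trans[OF integral_abs_bound integral_mono'])
        show "integrable lborel (\<lambda>x. c * e * \<bar>indicator K1 x * z x\<bar>)" using loc[OF K1] by simp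
        fix x
        have "\<bar>z x\<bar> * \<bar>c * \<phi> x - \<psi> x\<bar> \<le> \<bar>z x\<bar> * (c * e * indicator K1 x)" by (intro mult_left_mono close) auto
        then show "\<bar>z x * (c * \<phi> x - \<psi> x)\<bar> \<le> c * e * \<bar>indicator K1 x * z x\<bar>" by (simp add: abs_mult mult_ac)
        show "0 \<le> c * e * \<bar>indicator K1 x * z x\<bar>" using c e by simp
      qed
      also have "\<dots> = c * (e * Z)" by (simp add: Z_def)
      finally show ?thesis using c by (simp add: abs_mult)
    qed
    have "\<bar>\<integral>x. z x * \<phi> x \<partial>lborel\<bar> \<le> 0 + e" if "0 < e" for e
    proof -
      have "\<bar>\<integral>x. z x * \<phi> x \<partial>lborel\<bar> \<le> e / (Z + 1) * Z" using that Z0 by (intro est) auto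
      also have "\<dots> \<le> e" using that Z0 by (simp add: field_simps)
      finally show ?thesis by simp
    qed
    then have "(LBINT x. z x * \<phi> x) = 0" using field_le_epsilon[of "\<bar>\<integral>x. z x * \<phi> x \<partial>lborel\<bar>" 0] by simp
    then show ?thesis by (simp add: integral_completion)
  qed
  from fundamental_lemma[OF zL this] have "AE x in lebesgue. z x = 0" .
  then show ?thesis by (simp add: AE_completion_iff)
qed

section \<open>The Newtonian potential\<close>

text \<open>Finiteness of the Riesz potential of |g| at x means that the space-time integrand is
  absolutely integrable there. It dominates all truncations at once, while the cutoffs tend to -1/2
  at every positive time; this yields both the limit and a bound that is uniform in k.\<close>

lemma potential_pointwise:
  fixes \<kappa> :: "real \<Rightarrow> real^'n \<Rightarrow> real" and g :: "real^'n \<Rightarrow> real"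
  assumes k: "gker (1 - a) \<kappa>" and C: "0 \<le> C" "\<And>s z. 0 < s \<Longrightarrow> \<bar>\<kappa> s z\<bar> \<le> C * s powr (a - 1) * gk (2 * s) z"
    and g[measurable]: "g \<in> borel_measurable borel" and fin: "riesz a (\<lambda>y. \<bar>g y\<bar>) x < \<infinity>"
  shows "convergent (\<lambda>k. conv (kint (cutoff k) \<kappa>) g x)"
    and "\<bar>conv (kint (cutoff k) \<kappa>) g x\<bar> \<le> C * enn2real (riesz a (\<lambda>y. \<bar>g y\<bar>) x)"
proof -
  define F where "F p = indicator {0<..} (fst p) * \<kappa> (fst p) (x - snd p) * g (snd p)" for p :: "real \<times> (real^'n)"
  define w where "w p = indicator {0<..} (fst p) * fst p powr (a - 1) * gk (2 * fst p) (x - snd p) * \<bar>g (snd p)\<bar>" for p :: "real \<times> (real^'n)"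
  have km[measurable]: "(\<lambda>p. \<kappa> (fst p) (x - snd p)) \<in> borel_measurable (lborel \<Otimes>\<^sub>M lborel)"
    by (rule gker_measurable[OF k]) measurable
  have ks[measurable]: "(\<lambda>s. \<kappa> s z) \<in> borel_measurable borel" for z
    by (rule gker_measurable[OF k]) measurable
  have [measurable]: "F \<in> borel_measurable (lborel \<Otimes>\<^sub>M lborel)" unfolding F_def[abs_def] by measurable
  have [measurable]: "w \<in> borel_measurable (lborel \<Otimes>\<^sub>M lborel)" unfolding w_def[abs_def] by measurable
  have w0: "0 \<le> w p" for p by (simp add: w_def gk_nonneg)
  have wr: "(\<integral>\<^sup>+p. ennreal (w p) \<partial>(lborel \<Otimes>\<^sub>M lborel)) = riesz a (\<lambda>y. \<bar>g y\<bar>) x"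
  proof -
    have "(\<integral>\<^sup>+p. ennreal (w p) \<partial>(lborel \<Otimes>\<^sub>M lborel)) = (\<integral>\<^sup>+s. (\<integral>\<^sup>+y. ennreal (w (s, y)) \<partial>lborel) \<partial>lborel)"
      by (rule lborel.nn_integral_fst[symmetric]) measurable
    also have "\<dots> = riesz a (\<lambda>y. \<bar>g y\<bar>) x"
      unfolding riesz_def heat_def
    proof (intro nn_integral_cong)
      fix s
      have "(\<integral>\<^sup>+y. ennreal (w (s, y)) \<partial>lborel) = (\<integral>\<^sup>+y. ennreal (indicator {0<..} s * s powr (a - 1)) * (ennreal (gk (2 * s) (x - y)) * ennreal \<bar>g y\<bar>) \<partial>lborel)"
        by (intro nn_integral_cong) (simp add: w_def gk_nonneg ennreal_mult'[symmetric] mult.assoc)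
      also have "\<dots> = ennreal (indicator {0<..} s * s powr (a - 1)) * (\<integral>\<^sup>+y. ennreal (gk (2 * s) (x - y)) * ennreal \<bar>g y\<bar> \<partial>lborel)"
        by (rule nn_integral_cmult) measurable
      finally show "(\<integral>\<^sup>+y. ennreal (w (s, y)) \<partial>lborel) = ennreal (indicator {0<..} s * s powr (a - 1)) * (\<integral>\<^sup>+y. ennreal (gk (2 * s) (x - y)) * ennreal \<bar>g y\<bar> \<partial>lborel)" .
    qed
    finally show ?thesis .
  qed
  have wi: "integrable (lborel \<Otimes>\<^sub>M lborel) w"
    by (rule integrableI_nonneg) (use wr fin w0 in auto)
  have wI: "(\<integral>p. w p \<partial>(lborel \<Otimes>\<^sub>M lborel)) = enn2real (riesz a (\<lambda>y. \<bar>g y\<bar>) x)"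
    using integral_eq_nn_integral[of w "lborel \<Otimes>\<^sub>M lborel"] w0 wr by simp
  have Fw: "\<bar>F p\<bar> \<le> C * w p" for p
  proof (cases "0 < fst p")
    case True
    have "\<bar>\<kappa> (fst p) (x - snd p)\<bar> * \<bar>g (snd p)\<bar> \<le> (C * fst p powr (a - 1) * gk (2 * fst p) (x - snd p)) * \<bar>g (snd p)\<bar>"
      by (intro mult_right_mono C True) auto
    then show ?thesis using True by (simp add: F_def w_def abs_mult mult.assoc)
  qed (simp add: F_def w_def)
  have Fi: "integrable (lborel \<Otimes>\<^sub>M lborel) F"
    by (rule Bochner_Integration.integrable_bound[of _ "\<lambda>p. C * w p"]) (use wi Fw in \<open>auto intro!: AE_I2 order_trans[OF Fw] abs_ge_self\<close>)
  have cut: "\<bar>cutoff k s\<bar> \<le> 1 / 2 * indicator {0<..} s" for k s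
  proof (cases "s \<in> {1 / (real k + 1)..real k + 1}")
    case True
    have "0 < 1 / (real k + 1)" by simp
    with True have "0 < s" by (metis atLeastAtMost_iff less_le_trans)
    then show ?thesis by (simp add: cutoff_def indicator_def)
  qed (simp add: cutoff_def)
  have [measurable]: "cutoff k \<in> borel_measurable borel" for k using adm_cutoff[of k] by (simp add: adm_def)
  have cF: "cutoff k (fst p) * \<kappa> (fst p) (x - snd p) * g (snd p) = cutoff k (fst p) * F p" for k p
    using cut[of k "fst p"] by (cases "0 < fst p") (auto simp: F_def)
  have cFle: "\<bar>cutoff k (fst p) * F p\<bar> \<le> C * w p" for k p
  proof -
    have "\<bar>cutoff k (fst p)\<bar> \<le> 1" using cut[of k "fst p"] by (cases "0 < fst p") auto
    then have "\<bar>cutoff k (fst p)\<bar> * \<bar>F p\<bar> \<le> 1 * (C * w p)" by (intro mult_mono Fw) auto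
    then show ?thesis by (simp add: abs_mult)
  qed
  have cFi: "integrable (lborel \<Otimes>\<^sub>M lborel) (\<lambda>p. cutoff k (fst p) * F p)" for k
    by (rule Bochner_Integration.integrable_bound[of _ "\<lambda>p. C * w p"]) (use wi in \<open>auto intro!: AE_I2 order_trans[OF cFle] abs_ge_self\<close>)
  have eq: "conv (kint (cutoff k) \<kappa>) g x = (\<integral>p. cutoff k (fst p) * F p \<partial>(lborel \<Otimes>\<^sub>M lborel))" for k
  proof -
    have "conv (kint (cutoff k) \<kappa>) g x = (LBINT y. (LBINT s. cutoff k s * F (s, y)))"
      unfolding conv_def kint_def
    proof (intro Bochner_Integration.integral_cong refl)
      fix y
      have "(LBINT s. cutoff k s * F (s, y)) = (LBINT s. cutoff k s * \<kappa> s (x - y) * g y)"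
        using cF[of k "(s, y)" for s] unfolding fst_conv snd_conv by (simp only:)
      then show "(LBINT s. cutoff k s * \<kappa> s (x - y)) * g y = (LBINT s. cutoff k s * F (s, y))"
        by simp
    qed
    also have "\<dots> = (\<integral>p. cutoff k (fst p) * F p \<partial>(lborel \<Otimes>\<^sub>M lborel))"
      using lborel_pair.integral_snd[of "\<lambda>s y. cutoff k s * F (s, y)"] cFi[of k] by (simp add: split_beta')
    finally show ?thesis .
  qed
  show "\<bar>conv (kint (cutoff k) \<kappa>) g x\<bar> \<le> C * enn2real (riesz a (\<lambda>y. \<bar>g y\<bar>) x)"
  proof -
    have "\<bar>conv (kint (cutoff k) \<kappa>) g x\<bar> \<le> (\<integral>p. C * w p \<partial>(lborel \<Otimes>\<^sub>M lborel))"
      unfolding eq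
    proof (rule order_trans[OF integral_abs_bound integral_mono'])
      show "integrable (lborel \<Otimes>\<^sub>M lborel) (\<lambda>p. C * w p)" using wi by simp
      show "\<bar>cutoff k (fst p) * F p\<bar> \<le> C * w p" for p by (rule cFle)
      show "0 \<le> C * w p" for p using C(1) w0[of p] by simp
    qed
    then show ?thesis by (simp add: wI)
  qed
  have "(\<lambda>k. \<integral>p. cutoff k (fst p) * F p \<partial>(lborel \<Otimes>\<^sub>M lborel)) \<longlonglongrightarrow> (\<integral>p. - 1 / 2 * F p \<partial>(lborel \<Otimes>\<^sub>M lborel))"
  proof (rule integral_dominated_convergence[where w="\<lambda>p. C * w p"])
    show "AE p in lborel \<Otimes>\<^sub>M lborel. (\<lambda>k. cutoff k (fst p) * F p) \<longlonglongrightarrow> - 1 / 2 * F p"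
    proof (rule AE_I2)
      fix p :: "real \<times> (real^'n)"
      show "(\<lambda>k. cutoff k (fst p) * F p) \<longlonglongrightarrow> - 1 / 2 * F p"
      proof (cases "0 < fst p")
        case True
        have "\<forall>\<^sub>F k in sequentially. cutoff k (fst p) * F p = - 1 / 2 * F p"
        proof (rule eventually_sequentiallyI[of "nat \<lceil>max (fst p) (1 / fst p)\<rceil>"])
          fix k assume "nat \<lceil>max (fst p) (1 / fst p)\<rceil> \<le> k"
          then have m: "max (fst p) (1 / fst p) \<le> real k" by (simp only: nat_ceiling_le_eq)
          then have "1 / fst p \<le> real k + 1" by simp
          then have "1 / (real k + 1) \<le> fst p" using True by (simp add: field_simps)
          then show "cutoff k (fst p) * F p = - 1 / 2 * F p" using m by (simp add: cutoff_def)
        qed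
        then show ?thesis by (rule tendsto_eventually)
      qed (simp add: F_def)
    qed
    show "AE p in lborel \<Otimes>\<^sub>M lborel. norm (cutoff k (fst p) * F p) \<le> C * w p" for k
      using cFle by auto
    show "integrable (lborel \<Otimes>\<^sub>M lborel) (\<lambda>p. C * w p)" using wi by simp
  qed measurable
  then show "convergent (\<lambda>k. conv (kint (cutoff k) \<kappa>) g x)" unfolding eq by (rule convergentI)
qed

text \<open>Restates the Riesz bound homogeneously, in terms of the norm of g itself instead of a
  positive upper bound for its square.\<close>

lemma riesz_L2_bound:
  assumes a: "0 < a" "4 * a < real CARD('n)"
  defines "q \<equiv> 2 * real CARD('n) / (real CARD('n) - 4 * a)"
  obtains C where "0 \<le> C" "\<And>g :: real^'n \<Rightarrow> real. g \<in> L2 lborel \<Longrightarrow>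
     (AE x in lborel. riesz a (\<lambda>y. \<bar>g y\<bar>) x < \<infinity>) \<and>
     integrable lborel (\<lambda>x. enn2real (riesz a (\<lambda>y. \<bar>g y\<bar>) x) powr q) \<and>
     (LBINT x. enn2real (riesz a (\<lambda>y. \<bar>g y\<bar>) x) powr q) \<le> C * (l2n lborel g) powr q"
proof -
  define d where "d = real CARD('n) / 2"
  define c where "c = (4 * pi) powr (- (real CARD('n) / 2))"
  define K where "K = 1 / a + (c + 1) / 2 / (d / 2 - a)"
  define C where "C = 2 * (2 * K) powr q"
  have C0: "C \<ge> 0" by (simp add: C_def)
  have q0: "q > 0" using a by (simp add: q_def)
  show thesis
  proof (rule that[OF C0])
    fix g :: "real^'n \<Rightarrow> real" assume g: "g \<in> L2 lborel"
    have [measurable]: "g \<in> borel_measurable borel" by (rule L2_lborel_measurable[OF g])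
    have m: "(\<lambda>y. \<bar>g y\<bar>) \<in> borel_measurable borel" by measurable
    define f where "f y = \<bar>g y\<bar>" for y
    have fm[measurable]: "f \<in> borel_measurable borel" unfolding f_def[abs_def] by measurable
    have f0: "\<And>y. 0 \<le> f y" by (simp add: f_def)
    have sq: "(\<integral>\<^sup>+y. ennreal ((f y)^2) \<partial>lborel) = ennreal ((l2n lborel g)^2)"
      using nn_integral_eq_integral[OF L2_int[OF g]] by (simp add: f_def l2n_sq)
    define v where "v x = enn2real (riesz a f x)" for x
    have [measurable]: "v \<in> borel_measurable borel" unfolding v_def[abs_def] by measurable
    have bound: "(\<integral>\<^sup>+x. ennreal (v x powr q) \<partial>lborel) \<le> ennreal (C * B powr (q / 2))" and fin: "AE x in lborel. riesz a f x < \<infinity>"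
      if "0 < B" "(l2n lborel g)^2 \<le> B" for B
      using riesz_Lq_bound[OF fm f0 a that(1)] that unfolding sq
      by (simp_all add: ennreal_leI v_def C_def K_def d_def c_def q_def)
    have fin1: "AE x in lborel. riesz a f x < \<infinity>" by (rule fin[of "(l2n lborel g)^2 + 1"]) (auto intro: add_nonneg_pos)
    have le: "(\<integral>\<^sup>+x. ennreal (v x powr q) \<partial>lborel) \<le> ennreal (C * (l2n lborel g) powr q)"
    proof (cases "l2n lborel g = 0")
      case False
      then have pos: "0 < l2n lborel g" using l2n_nonneg[of lborel g] by linarith
      have "((l2n lborel g)^2) powr (q / 2) = (l2n lborel g) powr q"
        using pos by (simp add: powr_powr powr_numeral[symmetric] del: powr_numeral)
      then show ?thesis using bound[of "(l2n lborel g)^2"] pos by simp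
    next
      case True
      \<comment> \<open>The earlier bound takes a positive B, so norm 0 is reached as the limit of B
        = 1 / (n + 1).\<close>
      have "(\<lambda>n. C * (1 / real (Suc n)) powr (q / 2)) \<longlonglongrightarrow> C * 0"
      proof (intro tendsto_intros)
        show "(\<lambda>n. (1 / real (Suc n)) powr (q / 2)) \<longlonglongrightarrow> 0"
          using q0 by real_asymp
      qed
      then have lim: "(\<lambda>n. ennreal (C * (1 / real (Suc n)) powr (q / 2))) \<longlonglongrightarrow> ennreal 0" by (intro tendsto_ennrealI) simp
      have "(\<integral>\<^sup>+x. ennreal (v x powr q) \<partial>lborel) \<le> ennreal 0"
      proof (rule LIMSEQ_le_const[OF lim], intro exI[of _ 0] allI impI)
        fix n :: nat
        show "(\<integral>\<^sup>+x. ennreal (v x powr q) \<partial>lborel) \<le> ennreal (C * (1 / real (Suc n)) powr (q / 2))"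
          by (rule bound) (auto simp: True)
      qed
      then show ?thesis using True by simp
    qed
    have i: "integrable lborel (\<lambda>x. v x powr q)"
      by (rule integrableI_nonneg) (use le in \<open>auto intro: order_le_less_trans[OF le]\<close>)
    have "ennreal (LBINT x. v x powr q) \<le> ennreal (C * (l2n lborel g) powr q)"
      using le nn_integral_eq_integral[OF i] by simp
    then have "(LBINT x. v x powr q) \<le> C * (l2n lborel g) powr q" using C0 by simp
    with fin1 i show "(AE x in lborel. riesz a (\<lambda>y. \<bar>g y\<bar>) x < \<infinity>) \<and>
     integrable lborel (\<lambda>x. enn2real (riesz a (\<lambda>y. \<bar>g y\<bar>) x) powr q) \<and>
     (LBINT x. enn2real (riesz a (\<lambda>y. \<bar>g y\<bar>) x) powr q) \<le> C * (l2n lborel g) powr q"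
      by (simp add: v_def f_def[abs_def])
  qed
qed

text \<open>The majorant v is independent of k. It carries the integrability, and it is what permits
  the limit under the integral in the weak formulation.\<close>

definition dom_potential :: "(real \<Rightarrow> real^'n \<Rightarrow> real) \<Rightarrow> real \<Rightarrow> real \<Rightarrow> (real^'n \<Rightarrow> real) \<Rightarrow> (real^'n \<Rightarrow> real) \<Rightarrow> (real^'n \<Rightarrow> real) \<Rightarrow> bool" where
  "dom_potential \<kappa> q C g u v \<longleftrightarrow> u \<in> borel_measurable borel \<and> v \<in> borel_measurable borel \<and>
     (AE x in lborel. (\<lambda>k. conv (kint (cutoff k) \<kappa>) g x) \<longlonglongrightarrow> u x) \<and>
     (\<forall>k. AE x in lborel. \<bar>conv (kint (cutoff k) \<kappa>) g x\<bar> \<le> v x) \<and> (\<forall>x. 0 \<le> v x) \<and> (AE x in lborel. \<bar>u x\<bar> \<le> v x) \<and>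
     integrable lborel (\<lambda>x. v x powr q) \<and> (LBINT x. v x powr q) \<le> C * (l2n lborel g) powr q"

lemma potential_exists:
  fixes \<kappa> :: "real \<Rightarrow> real^'n \<Rightarrow> real"
  assumes a: "0 < a" "4 * a < real CARD('n)" and k: "gker (1 - a) \<kappa>"
  defines "q \<equiv> 2 * real CARD('n) / (real CARD('n) - 4 * a)"
  obtains C where "0 \<le> C" "\<And>g. g \<in> L2 lborel \<Longrightarrow> \<exists>u v. dom_potential \<kappa> q C g u v"
proof -
  obtain C1 where C1: "0 \<le> C1" "\<And>s z. 0 < s \<Longrightarrow> \<bar>\<kappa> s z\<bar> \<le> C1 * s powr (a - 1) * gk (2 * s) z"
    using k unfolding gker_def by auto
  obtain C2 where C2: "0 \<le> C2" "\<And>g :: real^'n \<Rightarrow> real. g \<in> L2 lborel \<Longrightarrow>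
     (AE x in lborel. riesz a (\<lambda>y. \<bar>g y\<bar>) x < \<infinity>) \<and>
     integrable lborel (\<lambda>x. enn2real (riesz a (\<lambda>y. \<bar>g y\<bar>) x) powr q) \<and>
     (LBINT x. enn2real (riesz a (\<lambda>y. \<bar>g y\<bar>) x) powr q) \<le> C2 * (l2n lborel g) powr q"
    using riesz_L2_bound[OF a] unfolding q_def by blast
  show thesis
  proof (rule that[of "C1 powr q * C2"])
    show "0 \<le> C1 powr q * C2" using C2(1) by simp
    fix g :: "real^'n \<Rightarrow> real" assume g: "g \<in> L2 lborel"
    have [measurable]: "g \<in> borel_measurable borel" by (rule L2_lborel_measurable[OF g])
    have [measurable]: "kint (cutoff k) \<kappa> \<in> borel_measurable borel" for k
      by (rule integrable_lborel_measurable[OF kint_integrable[OF adm_cutoff k]])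
    have [measurable]: "riesz a (\<lambda>y. \<bar>g y\<bar>) \<in> borel_measurable borel" by measurable
    \<comment> \<open>Where the sequence diverges, \<open>lim\<close> is an arbitrary value; this
      happens only where the Riesz potential is infinite, on a null set.\<close>
    define u where "u x = lim (\<lambda>k. conv (kint (cutoff k) \<kappa>) g x)" for x
    define v where "v x = C1 * enn2real (riesz a (\<lambda>y. \<bar>g y\<bar>) x)" for x
    have um: "u \<in> borel_measurable borel" unfolding u_def[abs_def] by measurable
    have vm: "v \<in> borel_measurable borel" unfolding v_def[abs_def] by measurable
    have v0: "\<forall>x. 0 \<le> v x" using C1(1) by (simp add: v_def)
    note fin = C2(2)[OF g]
    have lim: "AE x in lborel. (\<lambda>k. conv (kint (cutoff k) \<kappa>) g x) \<longlonglongrightarrow> u x"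
      using fin[THEN conjunct1]
    proof eventually_elim
      case (elim x)
      then show ?case using potential_pointwise(1)[OF k C1] unfolding u_def by (simp add: convergent_LIMSEQ_iff)
    qed
    have bd: "AE x in lborel. \<bar>conv (kint (cutoff k) \<kappa>) g x\<bar> \<le> v x" for k
      using fin[THEN conjunct1]
    proof eventually_elim
      case (elim x)
      then show ?case using potential_pointwise(2)[OF k C1] unfolding v_def by simp
    qed
    have ub: "AE x in lborel. \<bar>u x\<bar> \<le> v x"
    proof -
      have "AE x in lborel. \<forall>k. \<bar>conv (kint (cutoff k) \<kappa>) g x\<bar> \<le> v x" using bd by (simp add: AE_all_countable)
      with lim show ?thesis
      proof eventually_elim
        case (elim x)
        from elim(1) have "(\<lambda>k. \<bar>conv (kint (cutoff k) \<kappa>) g x\<bar>) \<longlonglongrightarrow> \<bar>u x\<bar>" by (rule tendsto_rabs)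
        then show ?case by (rule LIMSEQ_le_const2) (use elim(2) in auto)
      qed
    qed
    have vq: "v x powr q = C1 powr q * enn2real (riesz a (\<lambda>y. \<bar>g y\<bar>) x) powr q" for x
      unfolding v_def by (rule powr_mult)
    have i: "integrable lborel (\<lambda>x. v x powr q)" unfolding vq using fin by simp
    have "(LBINT x. v x powr q) = C1 powr q * (LBINT x. enn2real (riesz a (\<lambda>y. \<bar>g y\<bar>) x) powr q)"
      unfolding vq by simp
    also have "\<dots> \<le> C1 powr q * (C2 * (l2n lborel g) powr q)" using fin by (intro mult_left_mono) auto
    finally have le: "(LBINT x. v x powr q) \<le> C1 powr q * C2 * (l2n lborel g) powr q" by simp
    show "\<exists>u v. dom_potential \<kappa> q (C1 powr q * C2) g u v"
      unfolding dom_potential_def using um vm lim bd v0 ub i le by blast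
  qed
qed

section \<open>Passage to the limit in potentials and their weak derivatives\<close>

lemma Lq_times_test_integrable:
  fixes v :: "real^'n \<Rightarrow> real"
  assumes v[measurable]: "v \<in> borel_measurable borel" and q: "1 \<le> q" and i: "integrable lborel (\<lambda>x. \<bar>v x\<bar> powr q)" and \<phi>: "\<phi> \<in> test_functions"
  shows "integrable lborel (\<lambda>x. v x * partial_derivs js \<phi> x)"
proof -
  have "v \<in> L1_loc" by (rule L1_loc_lborel[OF v Lp_imp_L1_loc_lborel[OF v q i]])
  from L1_loc_test_integrable[OF this \<phi>] have "integrable lebesgue (\<lambda>x. v x * partial_derivs js \<phi> x)" .
  moreover have "(\<lambda>x. v x * partial_derivs js \<phi> x) \<in> borel_measurable lborel" using test_measurable[OF \<phi>, of js] v by simp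
  ultimately show ?thesis by (simp add: integrable_completion)
qed

lemma potential_weak_limit:
  fixes u v :: "real^'n \<Rightarrow> real" and f :: "nat \<Rightarrow> real^'n \<Rightarrow> real"
  assumes u: "u \<in> borel_measurable borel" and v: "v \<in> borel_measurable borel" and f: "\<And>k. f k \<in> borel_measurable borel"
    and lim: "AE x in lborel. (\<lambda>k. f k x) \<longlonglongrightarrow> u x" and bd: "\<And>k. AE x in lborel. \<bar>f k x\<bar> \<le> v x"
    and v0: "\<And>x. 0 \<le> v x" and q: "1 \<le> q" and i: "integrable lborel (\<lambda>x. v x powr q)" and \<phi>: "\<phi> \<in> test_functions"
  shows "(\<lambda>k. \<integral>x. partial_derivs js \<phi> x * f k x \<partial>lborel) \<longlonglongrightarrow> (LBINT x. u x * partial_derivs js \<phi> x)"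
proof -
  note [measurable] = u v f test_measurable[OF \<phi>, of js]
  have vi: "integrable lborel (\<lambda>x. v x * partial_derivs js \<phi> x)"
    by (rule Lq_times_test_integrable[OF v q _ \<phi>]) (use i v0 in \<open>simp add: abs_of_nonneg\<close>)
  show ?thesis
  proof (rule integral_dominated_convergence[where w="\<lambda>x. \<bar>v x * partial_derivs js \<phi> x\<bar>"])
    show "integrable lborel (\<lambda>x. \<bar>v x * partial_derivs js \<phi> x\<bar>)" using vi by (rule integrable_abs)
    show "AE x in lborel. (\<lambda>k. partial_derivs js \<phi> x * f k x) \<longlonglongrightarrow> u x * partial_derivs js \<phi> x"
      using lim
    proof eventually_elim
      case (elim x)
      then have "(\<lambda>k. partial_derivs js \<phi> x * f k x) \<longlonglongrightarrow> partial_derivs js \<phi> x * u x" by (intro tendsto_intros)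
      then show ?case by (simp add: mult.commute)
    qed
    show "AE x in lborel. norm (partial_derivs js \<phi> x * f k x) \<le> \<bar>v x * partial_derivs js \<phi> x\<bar>" for k
      using bd[of k]
    proof eventually_elim
      case (elim x)
      then have "\<bar>partial_derivs js \<phi> x\<bar> * \<bar>f k x\<bar> \<le> \<bar>partial_derivs js \<phi> x\<bar> * v x" by (rule mult_left_mono) simp
      then show ?case using v0[of x] by (simp add: abs_mult mult.commute)
    qed
  qed measurable
qed

lemma Lq_dominated:
  fixes u v :: "real^'n \<Rightarrow> real"
  assumes u: "u \<in> borel_measurable borel" and le: "AE x in lborel. \<bar>u x\<bar> \<le> v x" and q: "0 \<le> q"
    and i: "integrable lborel (\<lambda>x. v x powr q)"
  shows "integrable lborel (\<lambda>x. \<bar>u x\<bar> powr q)" "(LBINT x. \<bar>u x\<bar> powr q) \<le> (LBINT x. v x powr q)"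
proof -
  note [measurable] = u
  have le': "AE x in lborel. \<bar>u x\<bar> powr q \<le> v x powr q"
    using le by eventually_elim (auto intro: powr_mono2 q)
  show "integrable lborel (\<lambda>x. \<bar>u x\<bar> powr q)"
  proof (rule Bochner_Integration.integrable_bound[OF i])
    show "AE x in lborel. norm (\<bar>u x\<bar> powr q) \<le> norm (v x powr q)" using le' by eventually_elim simp
  qed measurable
  then show "(LBINT x. \<bar>u x\<bar> powr q) \<le> (LBINT x. v x powr q)"
    using i le' by (rule integral_mono_AE)
qed

lemma tendsto_integral_mult_L2:
  fixes f H :: "'a \<Rightarrow> real"
  assumes f: "f \<in> L2 M" and h: "\<And>k. h k \<in> L2 M" and H: "H \<in> L2 M"
    and lim: "(\<lambda>k. l2n M (\<lambda>x. h k x - H x)) \<longlonglongrightarrow> 0"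
  shows "(\<lambda>k. \<integral>x. f x * h k x \<partial>M) \<longlonglongrightarrow> (\<integral>x. f x * H x \<partial>M)"
proof (rule LIM_zero_cancel, rule Lim_null_comparison)
  show "\<forall>\<^sub>F k in sequentially. norm ((\<integral>x. f x * h k x \<partial>M) - (\<integral>x. f x * H x \<partial>M)) \<le> l2n M f * l2n M (\<lambda>x. h k x - H x)"
  proof (intro always_eventually allI)
    fix k
    have "(\<integral>x. f x * h k x \<partial>M) - (\<integral>x. f x * H x \<partial>M) = (\<integral>x. f x \<bullet> (h k x - H x) \<partial>M)"
      using L2_mult_integrable(2)[OF f h[of k]] L2_mult_integrable(2)[OF f H] by (simp add: right_diff_distrib)
    then show "norm ((\<integral>x. f x * h k x \<partial>M) - (\<integral>x. f x * H x \<partial>M)) \<le> l2n M f * l2n M (\<lambda>x. h k x - H x)"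
      using l2n_inner_le[OF f L2_diff[OF h[of k] H]] by simp
  qed
  show "(\<lambda>k. l2n M f * l2n M (\<lambda>x. h k x - H x)) \<longlonglongrightarrow> 0" using tendsto_mult_left[OF lim, of "l2n M f"] by simp
qed

text \<open>Convergence of the truncated Hessians is kept as a clause because symmetry and
  coercivity are verified on the truncations and then passed to the limit.\<close>

definition newtonian :: "real \<Rightarrow> (real^'n \<Rightarrow> real) \<Rightarrow> (real^'n \<Rightarrow> real) \<Rightarrow> ('n \<Rightarrow> real^'n \<Rightarrow> real) \<Rightarrow> ('n \<Rightarrow> 'n \<Rightarrow> real^'n \<Rightarrow> real) \<Rightarrow> bool" where
  "newtonian C g u G H \<longleftrightarrow> u \<in> borel_measurable borel \<and> (\<forall>i. G i \<in> borel_measurable borel) \<and> (\<forall>i j. H i j \<in> L2 lborel) \<and>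
     integrable lborel (\<lambda>x. \<bar>u x\<bar> powr crit_exp2 CARD('n)) \<and> (LBINT x. \<bar>u x\<bar> powr crit_exp2 CARD('n)) \<le> C * (l2n lborel g) powr crit_exp2 CARD('n) \<and>
     (\<forall>i. integrable lborel (\<lambda>x. \<bar>G i x\<bar> powr crit_exp1 CARD('n)) \<and> (LBINT x. \<bar>G i x\<bar> powr crit_exp1 CARD('n)) \<le> C * (l2n lborel g) powr crit_exp1 CARD('n)) \<and>
     (\<forall>i j. (\<lambda>k. l2n lborel (\<lambda>x. hessk k i j g x - H i j x)) \<longlonglongrightarrow> 0) \<and>
     (AE x in lborel. (\<Sum>i\<in>UNIV. H i i x) = g x) \<and> (\<Sum>i\<in>UNIV. \<Sum>j\<in>UNIV. (l2n lborel (H i j))^2) = (l2n lborel g)^2 \<and>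
     (\<forall>\<phi>\<in>test_functions. \<forall>i. (LBINT x. u x * partial_derivs [i] \<phi> x) = - (LBINT x. G i x * \<phi> x)) \<and>
     (\<forall>\<phi>\<in>test_functions. \<forall>i j. (LBINT x. u x * partial_derivs [i, j] \<phi> x) = (LBINT x. H i j x * \<phi> x))"

lemma dom_potential_Lq:
  assumes "dom_potential \<kappa> q C0 g u v" "0 \<le> q" "C0 \<le> C"
  shows "integrable lborel (\<lambda>x. \<bar>u x\<bar> powr q)" "(LBINT x. \<bar>u x\<bar> powr q) \<le> C * (l2n lborel g) powr q"
proof -
  note u = assms(1)[unfolded dom_potential_def]
  have u': "u \<in> borel_measurable borel" "AE x in lborel. \<bar>u x\<bar> \<le> v x" "integrable lborel (\<lambda>x. v x powr q)" using u by auto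
  show "integrable lborel (\<lambda>x. \<bar>u x\<bar> powr q)" by (rule Lq_dominated(1)[OF u'(1,2) assms(2) u'(3)])
  have "(LBINT x. \<bar>u x\<bar> powr q) \<le> C0 * (l2n lborel g) powr q"
    using Lq_dominated(2)[OF u'(1,2) assms(2) u'(3)] u by linarith
  also have "\<dots> \<le> C * (l2n lborel g) powr q" using assms(3) by (intro mult_right_mono) auto
  finally show "(LBINT x. \<bar>u x\<bar> powr q) \<le> C * (l2n lborel g) powr q" .
qed

lemma dom_potential_weak_limit:
  assumes u: "dom_potential \<kappa> q C g u v" and k: "gker b \<kappa>" and g: "g \<in> L2 lborel" and q: "1 \<le> q" and \<phi>: "\<phi> \<in> test_functions"
  shows "(\<lambda>k. \<integral>x. partial_derivs js \<phi> x * conv (kint (cutoff k) \<kappa>) g x \<partial>lborel) \<longlonglongrightarrow> (LBINT x. u x * partial_derivs js \<phi> x)"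
  by (rule potential_weak_limit[where v=v, OF _ _ L2_lborel_measurable[OF conv_L2[OF kint_integrable[OF adm_cutoff k] g]] _ _ _ q _ \<phi>])
     (use u in \<open>auto simp: dom_potential_def\<close>)

text \<open>The Riesz exponent 2 n / (n - 4 a) is \<open>crit_exp2\<close> for a = 1, used for u
  with kernel \<open>gk\<close>, and \<open>crit_exp1\<close> for a = 1/2, used for the gradient
  with kernels \<open>gk1 i\<close>. The Hessian lies beyond this scale and comes from
  \<open>hessian_limit\<close>. The three limits are tied together by the weak identities of the
  truncations.\<close>

theorem newton_potential:
  assumes n: "5 \<le> CARD('n)"
  obtains C where "0 \<le> C" "\<And>g :: real^'n \<Rightarrow> real. g \<in> L2 lborel \<Longrightarrow> \<exists>u G H. newtonian C g u G H"
proof -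
  let ?n = "real CARD('n)"
  have n5: "?n \<ge> 5" using n by simp
  have q2: "2 * ?n / (?n - 4 * 1) = crit_exp2 CARD('n)" by (simp add: crit_exp2_def)
  have q1: "2 * ?n / (?n - 4 * (1/2)) = crit_exp1 CARD('n)" by (simp add: crit_exp1_def)
  have q2_ge: "1 \<le> crit_exp2 CARD('n)" using n5 by (simp add: crit_exp2_def field_simps)
  have q1_ge: "1 \<le> crit_exp1 CARD('n)" using n5 by (simp add: crit_exp1_def field_simps)
  have k0: "gker (1 - 1) (gk :: real \<Rightarrow> real^'n \<Rightarrow> real)" using gker_gk by simp
  have k1: "gker (1 - 1/2) (gk1 i :: real \<Rightarrow> real^'n \<Rightarrow> real)" for i using gker_gk1 by simp
  have a0: "(0::real) < 1" "4 * 1 < ?n" and a1: "(0::real) < 1/2" "4 * (1/2) < ?n" using n5 by auto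
  obtain C0 where C0: "0 \<le> C0" "\<And>g :: real^'n \<Rightarrow> real. g \<in> L2 lborel \<Longrightarrow> \<exists>u v. dom_potential gk (crit_exp2 CARD('n)) C0 g u v"
    by (rule potential_exists[OF a0 k0, unfolded q2, OF that])
  have "\<forall>i::'n. \<exists>C\<ge>0. \<forall>g :: real^'n \<Rightarrow> real. g \<in> L2 lborel \<longrightarrow> (\<exists>u v. dom_potential (gk1 i) (crit_exp1 CARD('n)) C g u v)"
    by (intro allI, rule potential_exists[OF a1 k1, unfolded q1]) blast
  from choice[OF this] obtain C1 where C1: "\<And>i. 0 \<le> C1 i"
    "\<And>i (g :: real^'n \<Rightarrow> real). g \<in> L2 lborel \<Longrightarrow> \<exists>u v. dom_potential (gk1 i) (crit_exp1 CARD('n)) (C1 i) g u v"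
    by blast
  define C where "C = C0 + (\<Sum>i\<in>UNIV. C1 i)"
  have C: "C0 \<le> C" "C1 i \<le> C" "0 \<le> C" for i
  proof -
    have "C1 i \<le> (\<Sum>i\<in>UNIV. C1 i)" using C1(1) by (intro member_le_sum) auto
    then show "C1 i \<le> C" "C0 \<le> C" "0 \<le> C" using C0(1) C1(1)[of i] by (auto simp: C_def)
  qed
  show thesis
  proof (rule that[OF C(3)])
    fix g :: "real^'n \<Rightarrow> real" assume g: "g \<in> L2 lborel"
    obtain u v where u: "dom_potential gk (crit_exp2 CARD('n)) C0 g u v" using C0(2)[OF g] by blast
    have "\<forall>i. \<exists>p. dom_potential (gk1 i) (crit_exp1 CARD('n)) (C1 i) g (fst p) (snd p)" using C1(2)[OF g] by auto
    from choice[OF this] obtain P where P: "\<And>i. dom_potential (gk1 i) (crit_exp1 CARD('n)) (C1 i) g (fst (P i)) (snd (P i))" by blast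
    define G where "G i = fst (P i)" for i
    have G: "dom_potential (gk1 i) (crit_exp1 CARD('n)) (C1 i) g (G i) (snd (P i))" for i using P by (simp add: G_def)
    obtain H where H: "\<And>i j. H i j \<in> L2 lborel" "\<And>i j. (\<lambda>k. l2n lborel (\<lambda>x. hessk k i j g x - H i j x)) \<longlonglongrightarrow> 0"
      "AE x in lborel. (\<Sum>i\<in>UNIV. H i i x) = g x" "(\<Sum>i\<in>UNIV. \<Sum>j\<in>UNIV. (l2n lborel (H i j))^2) = (l2n lborel g)^2"
      using hessian_limit[OF g] by blast
    have w1: "(LBINT x. u x * partial_derivs [i] \<phi> x) = - (LBINT x. G i x * \<phi> x)" if \<phi>: "\<phi> \<in> test_functions" for \<phi> i
      using LIMSEQ_unique[OF dom_potential_weak_limit[OF u gker_gk g q2_ge \<phi>, of "[i]", unfolded conv_kint_weak(1)[OF adm_cutoff g \<phi>]]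
        tendsto_minus[OF dom_potential_weak_limit[OF G gker_gk1 g q1_ge \<phi>, of "[]", unfolded partial_derivs.simps]]] .
    have w2: "(LBINT x. u x * partial_derivs [i, j] \<phi> x) = (LBINT x. H i j x * \<phi> x)" if \<phi>: "\<phi> \<in> test_functions" for \<phi> i j
    proof -
      have \<phi>L: "\<phi> \<in> L2 lborel" using test_L2[OF \<phi>, of "[]"] by simp
      show ?thesis
        using LIMSEQ_unique[OF dom_potential_weak_limit[OF u gker_gk g q2_ge \<phi>, of "[i, j]", unfolded conv_kint_weak(2)[OF adm_cutoff g \<phi>] hessk_def[symmetric]]
          tendsto_integral_mult_L2[OF \<phi>L hessk_L2[OF g] H(1) H(2)]] by (simp add: mult.commute)
    qed
    have "u \<in> borel_measurable borel" "G i \<in> borel_measurable borel" for i using u G[of i] by (auto simp: dom_potential_def)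
    moreover have "0 \<le> crit_exp2 CARD('n)" "0 \<le> crit_exp1 CARD('n)" using q1_ge q2_ge by auto
    ultimately show "\<exists>u G H. newtonian C g u G H"
      unfolding newtonian_def using H w1 w2 dom_potential_Lq[OF u _ C(1)] dom_potential_Lq[OF G _ C(2)] by (intro exI[of _ u] exI[of _ G] exI[of _ H]) (simp del: partial_derivs.simps)
  qed
qed

section \<open>Weak derivatives\<close>

lemma AE_lebesgue_iff: "(AE x in lebesgue. P x) \<longleftrightarrow> (AE x in lborel. P x)"
  by (rule AE_completion_iff)

lemma borel_measurable_lebesgue_cong_AE:
  fixes f g :: "'a::euclidean_space \<Rightarrow> 'b::topological_space"
  assumes f: "f \<in> borel_measurable lebesgue" and ae: "AE x in lebesgue. f x = g x"
  shows "g \<in> borel_measurable lebesgue"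
proof (rule measurableI)
  fix A :: "'b set" assume A: "A \<in> sets borel"
  have "g -` A \<in> sets lebesgue"
  proof (rule completion.in_sets_AE)
    show "AE x in lebesgue. x \<in> f -` A \<longleftrightarrow> x \<in> g -` A" using ae by eventually_elim auto
    show "f -` A \<in> sets lebesgue" using measurable_sets[OF f A] by simp
  qed simp
  then show "g -` A \<inter> space lebesgue \<in> sets lebesgue" by simp
qed simp

lemma borel_version:
  fixes f :: "real^'n \<Rightarrow> real"
  assumes f: "f \<in> borel_measurable lebesgue"
  obtains g where "g \<in> borel_measurable borel" "AE x in lebesgue. f x = g x"
proof -
  obtain g where "g \<in> borel_measurable lborel" "AE x in lborel. f x = g x"
    using completion_ex_borel_measurable_real[OF f] by auto
  then show thesis by (intro that[of g]) (auto intro: AE_completion)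
qed

lemma integral_lebesgue_borel:
  fixes f :: "real^'n \<Rightarrow> real"
  assumes "f \<in> borel_measurable borel"
  shows "(\<integral>x. f x \<partial>lebesgue) = (LBINT x. f x)" "integrable lebesgue f \<longleftrightarrow> integrable lborel f"
  using assms by (simp_all add: integral_completion integrable_completion)

lemma L2_lebesgue_borel:
  fixes f :: "real^'n \<Rightarrow> real"
  assumes "f \<in> borel_measurable borel"
  shows "l2n lebesgue f = l2n lborel f" "f \<in> L2 lebesgue \<longleftrightarrow> f \<in> L2 lborel"
proof -
  have [measurable]: "(\<lambda>x. (norm (f x))^2) \<in> borel_measurable borel" using assms by measurable
  show "l2n lebesgue f = l2n lborel f"
    unfolding l2n_def by (rule arg_cong[where f=sqrt], rule integral_lebesgue_borel) measurable
  have "integrable lebesgue (\<lambda>x. (norm (f x))^2) \<longleftrightarrow> integrable lborel (\<lambda>x. (norm (f x))^2)"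
    by (rule integral_lebesgue_borel) measurable
  then show "f \<in> L2 lebesgue \<longleftrightarrow> f \<in> L2 lborel"
    using assms borel_imp_lebesgue[OF assms] by (simp add: L2_def)
qed

lemma L1_loc_measurable:
  assumes "z \<in> L1_loc"
  shows "z \<in> borel_measurable lebesgue"
proof (rule borel_measurable_LIMSEQ_real)
  fix i :: nat
  show "(\<lambda>x. indicator (cball 0 (real i)) x * z x) \<in> borel_measurable lebesgue"
    using assms by (auto simp: L1_loc_def set_integrable_def dest!: spec[of _ "cball 0 (real i)"] borel_measurable_integrable)
next
  fix x
  show "(\<lambda>i. indicator (cball 0 (real i)) x * z x) \<longlonglongrightarrow> z x"
  proof (rule tendsto_eventually, rule eventually_sequentiallyI[of "nat \<lceil>norm x\<rceil>"])
    fix i assume "nat \<lceil>norm x\<rceil> \<le> i"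
    then show "indicator (cball 0 (real i)) x * z x = z x" by (simp add: nat_ceiling_le_eq)
  qed
qed

lemma L1_loc_diff: "f \<in> L1_loc \<Longrightarrow> g \<in> L1_loc \<Longrightarrow> (\<lambda>x. f x - g x) \<in> L1_loc"
  unfolding L1_loc_def by (auto intro: set_integral_diff)

lemma L1_loc_cong_AE:
  fixes f g :: "real^'n \<Rightarrow> real"
  assumes f: "f \<in> L1_loc" and ae: "AE x in lebesgue. f x = g x"
  shows "g \<in> L1_loc"
  unfolding L1_loc_def set_integrable_def
proof (intro CollectI allI impI)
  fix K :: "(real^'n) set" assume K: "compact K"
  then have i: "integrable lebesgue (\<lambda>x. indicator K x *\<^sub>R f x)" using f by (auto simp: L1_loc_def set_integrable_def)
  have ae': "AE x in lebesgue. indicator K x *\<^sub>R f x = indicator K x *\<^sub>R g x" using ae by eventually_elim simp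
  show "integrable lebesgue (\<lambda>x. indicator K x *\<^sub>R g x)"
    by (rule integrable_cong_AE_imp[OF i borel_measurable_lebesgue_cong_AE[OF _ ae']])
       (use i ae' in \<open>auto elim: eventually_mono\<close>)
qed

lemma has_weak_deriv_unique:
  fixes u :: "real^'n \<Rightarrow> real"
  assumes g: "has_weak_deriv js u g" and h: "has_weak_deriv js u h"
  shows "AE x in lebesgue. g x = h x"
proof -
  have L: "g \<in> L1_loc" "h \<in> L1_loc" using g h by (auto simp: has_weak_deriv_def)
  have "AE x in lebesgue. g x - h x = 0"
  proof (rule fundamental_lemma[OF L1_loc_diff[OF L]])
    fix \<phi> :: "real^'n \<Rightarrow> real" assume \<phi>: "\<phi> \<in> test_functions"
    have i: "integrable lebesgue (\<lambda>x. g x * \<phi> x)" "integrable lebesgue (\<lambda>x. h x * \<phi> x)"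
      using L1_loc_test_integrable[OF L(1) \<phi>, of "[]"] L1_loc_test_integrable[OF L(2) \<phi>, of "[]"] by simp_all
    have "(\<integral>x. g x * \<phi> x \<partial>lebesgue) = (\<integral>x. h x * \<phi> x \<partial>lebesgue)"
      using g h \<phi> unfolding has_weak_deriv_def by auto
    then show "(\<integral>x. (g x - h x) * \<phi> x \<partial>lebesgue) = 0"
      using i by (simp add: left_diff_distrib)
  qed
  then show ?thesis by simp
qed

lemma has_weak_deriv_diff:
  fixes u v :: "real^'n \<Rightarrow> real"
  assumes u: "has_weak_deriv js u g" and v: "has_weak_deriv js v h"
  shows "has_weak_deriv js (\<lambda>x. u x - v x) (\<lambda>x. g x - h x)"
  unfolding has_weak_deriv_def
proof (intro conjI ballI)
  have L: "u \<in> L1_loc" "g \<in> L1_loc" "v \<in> L1_loc" "h \<in> L1_loc" using u v by (auto simp: has_weak_deriv_def)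
  then show "(\<lambda>x. u x - v x) \<in> L1_loc" "(\<lambda>x. g x - h x) \<in> L1_loc" by (auto intro: L1_loc_diff)
  fix \<phi> :: "real^'n \<Rightarrow> real" assume \<phi>: "\<phi> \<in> test_functions"
  note i = L1_loc_test_integrable[OF L(1) \<phi>, of js] L1_loc_test_integrable[OF L(3) \<phi>, of js]
    L1_loc_test_integrable[OF L(2) \<phi>, of "[]", simplified] L1_loc_test_integrable[OF L(4) \<phi>, of "[]", simplified]
  show "(\<integral>x. (u x - v x) * partial_derivs js \<phi> x \<partial>lebesgue) = (- 1) ^ length js * (\<integral>x. (g x - h x) * \<phi> x \<partial>lebesgue)"
    using u v \<phi> i unfolding has_weak_deriv_def by (simp add: left_diff_distrib right_diff_distrib)
qed

lemma has_weak_deriv_cong_AE: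
  fixes u v :: "real^'n \<Rightarrow> real"
  assumes u: "has_weak_deriv js u g" and v: "AE x in lebesgue. u x = v x" and h: "AE x in lebesgue. g x = h x"
  shows "has_weak_deriv js v h"
  unfolding has_weak_deriv_def
proof (intro conjI ballI)
  have L: "u \<in> L1_loc" "g \<in> L1_loc" using u by (auto simp: has_weak_deriv_def)
  then show L': "v \<in> L1_loc" "h \<in> L1_loc" using L1_loc_cong_AE v h by blast+
  fix \<phi> :: "real^'n \<Rightarrow> real" assume \<phi>: "\<phi> \<in> test_functions"
  note i = L1_loc_test_integrable[OF L(1) \<phi>, of js] L1_loc_test_integrable[OF L'(1) \<phi>, of js]
    L1_loc_test_integrable[OF L(2) \<phi>, of "[]", simplified] L1_loc_test_integrable[OF L'(2) \<phi>, of "[]", simplified]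
  have "(\<integral>x. v x * partial_derivs js \<phi> x \<partial>lebesgue) = (\<integral>x. u x * partial_derivs js \<phi> x \<partial>lebesgue)"
    using v by (intro integral_cong_AE borel_measurable_integrable i) (auto elim: eventually_mono)
  moreover have "(\<integral>x. h x * \<phi> x \<partial>lebesgue) = (\<integral>x. g x * \<phi> x \<partial>lebesgue)"
    using h by (intro integral_cong_AE borel_measurable_integrable i) (auto elim: eventually_mono)
  ultimately show "(\<integral>x. v x * partial_derivs js \<phi> x \<partial>lebesgue) = (- 1) ^ length js * (\<integral>x. h x * \<phi> x \<partial>lebesgue)"
    using u \<phi> by (simp add: has_weak_deriv_def)
qed

text \<open>Weak derivatives are unique up to null sets, so the representative picked by
  \<open>SOME\<close> can be exchanged for any explicit one.\<close>

lemma weak_gradient_eq_AE: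
  fixes u :: "real^'n \<Rightarrow> real^'N"
  assumes G: "has_weak_gradient u G"
  shows "has_weak_gradient u (weak_gradient u)" "AE x in lebesgue. weak_gradient u x = G x"
proof -
  show *: "has_weak_gradient u (weak_gradient u)"
    unfolding weak_gradient_def by (rule someI[of "has_weak_gradient u", OF G])
  have "AE x in lebesgue. \<forall>\<alpha> i. weak_gradient u x $ \<alpha> $ i = G x $ \<alpha> $ i"
    using has_weak_deriv_unique * G unfolding has_weak_gradient_def AE_all_countable[symmetric]
    by (simp add: AE_all_countable) blast
  then show "AE x in lebesgue. weak_gradient u x = G x" by eventually_elim (simp add: vec_eq_iff)
qed

lemma weak_hessian_eq_AE:
  fixes u :: "real^'n \<Rightarrow> real^'N"
  assumes H: "has_weak_hessian u H"
  shows "has_weak_hessian u (weak_hessian u)" "AE x in lebesgue. weak_hessian u x = H x"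
proof -
  show *: "has_weak_hessian u (weak_hessian u)"
    unfolding weak_hessian_def by (rule someI[of "has_weak_hessian u", OF H])
  have "AE x in lebesgue. \<forall>\<alpha> i j. weak_hessian u x $ \<alpha> $ i $ j = H x $ \<alpha> $ i $ j"
    using has_weak_deriv_unique * H unfolding has_weak_hessian_def
    by (simp add: AE_all_countable) blast
  then show "AE x in lebesgue. weak_hessian u x = H x" by eventually_elim (simp add: vec_eq_iff)
qed

lemma has_weak_gradient_diff:
  "has_weak_gradient u G \<Longrightarrow> has_weak_gradient v G' \<Longrightarrow> has_weak_gradient (\<lambda>x. u x - v x) (\<lambda>x. G x - G' x)"
  unfolding has_weak_gradient_def by (simp add: has_weak_deriv_diff)

lemma has_weak_hessian_diff:
  "has_weak_hessian u H \<Longrightarrow> has_weak_hessian v H' \<Longrightarrow> has_weak_hessian (\<lambda>x. u x - v x) (\<lambda>x. H x - H' x)"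
  unfolding has_weak_hessian_def by (simp add: has_weak_deriv_diff)

section \<open>Lebesgue norms and the function space under changes on null sets\<close>

lemma Lp_2_eq_L2: "Lp 2 = L2 lebesgue"
  by (simp add: Lp_def L2_def powr_numeral)

lemma Lp_norm_2_eq_l2n: "Lp_norm 2 g = l2n lebesgue g"
  by (simp add: Lp_norm_def l2n_def powr_numeral powr_half_sqrt)

lemma Lp_cong_AE:
  fixes f :: "real^'n \<Rightarrow> 'b::euclidean_space"
  assumes f: "f \<in> Lp p" and ae: "AE x in lebesgue. f x = g x"
  shows "g \<in> Lp p" "Lp_norm p g = Lp_norm p f"
proof -
  have m[measurable]: "f \<in> borel_measurable lebesgue" "g \<in> borel_measurable lebesgue"
    using f borel_measurable_lebesgue_cong_AE[OF _ ae] by (auto simp: Lp_def)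
  have ae': "AE x in lebesgue. norm (f x) powr p = norm (g x) powr p" using ae by eventually_elim simp
  have "integrable lebesgue (\<lambda>x. norm (g x) powr p)"
    by (rule integrable_cong_AE_imp[of lebesgue "\<lambda>x. norm (f x) powr p"]) (use f ae' in \<open>auto simp: Lp_def elim: eventually_mono\<close>)
  then show "g \<in> Lp p" by (simp add: Lp_def)
  show "Lp_norm p g = Lp_norm p f"
    unfolding Lp_norm_def using ae' by (intro arg_cong[where f="\<lambda>t. t powr (1 / p)"] integral_cong_AE) (auto elim: eventually_mono)
qed

lemma norm_diff_powr_le:
  fixes a b :: "'b::real_normed_vector"
  assumes "0 \<le> p"
  shows "norm (a - b) powr p \<le> 2 powr p * (norm a powr p + norm b powr p)"
proof -
  have "norm (a - b) powr p \<le> (2 * max (norm a) (norm b)) powr p"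
    using norm_triangle_ineq4[of a b] assms by (intro powr_mono2) auto
  also have "\<dots> = 2 powr p * max (norm a) (norm b) powr p" by (rule powr_mult)
  also have "\<dots> \<le> 2 powr p * (norm a powr p + norm b powr p)" by (intro mult_left_mono) (auto simp: max_def)
  finally show ?thesis .
qed

lemma Lp_diff:
  fixes f g :: "real^'n \<Rightarrow> 'b::euclidean_space"
  assumes p: "0 \<le> p" and f: "f \<in> Lp p" and g: "g \<in> Lp p"
  shows "(\<lambda>x. f x - g x) \<in> Lp p"
proof -
  have [measurable]: "f \<in> borel_measurable lebesgue" "g \<in> borel_measurable lebesgue" using f g by (auto simp: Lp_def)
  have "integrable lebesgue (\<lambda>x. norm (f x - g x) powr p)"
  proof (rule Bochner_Integration.integrable_bound)
    show "integrable lebesgue (\<lambda>x. 2 powr p * (norm (f x) powr p + norm (g x) powr p))"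
      using f g by (simp add: Lp_def)
    show "AE x in lebesgue. norm (norm (f x - g x) powr p) \<le> norm (2 powr p * (norm (f x) powr p + norm (g x) powr p))"
      using norm_diff_powr_le[OF p] by (intro AE_I2) (simp add: abs_mult)
  qed measurable
  then show ?thesis by (simp add: Lp_def)
qed

lemma Lp_component_L1_loc:
  fixes z :: "real^'n \<Rightarrow> real"
  assumes p: "1 \<le> p" and z: "z \<in> borel_measurable borel" "integrable lborel (\<lambda>x. \<bar>z x\<bar> powr p)"
  shows "z \<in> L1_loc"
  by (rule L1_loc_lborel[OF z(1) Lp_imp_L1_loc_lborel[OF z(1) p z(2)]])

lemma W22_starI:
  fixes u :: "real^'n \<Rightarrow> real^'N"
  assumes "u \<in> Lp (crit_exp2 CARD('n))" "has_weak_gradient u G" "G \<in> Lp (crit_exp1 CARD('n))"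
    "has_weak_hessian u H" "H \<in> Lp 2"
  shows "u \<in> W22_star"
proof -
  have "AE x in lebesgue. G x = weak_gradient u x" "AE x in lebesgue. H x = weak_hessian u x"
    using weak_gradient_eq_AE(2)[OF assms(2)] weak_hessian_eq_AE(2)[OF assms(4)] by (auto elim: eventually_mono)
  from Lp_cong_AE(1)[OF assms(3) this(1)] Lp_cong_AE(1)[OF assms(5) this(2)] show ?thesis
    unfolding W22_star_def using assms by auto
qed

lemma W22_starD:
  fixes u :: "real^'n \<Rightarrow> real^'N"
  assumes "u \<in> W22_star"
  shows "u \<in> Lp (crit_exp2 CARD('n))" "has_weak_gradient u (weak_gradient u)" "weak_gradient u \<in> Lp (crit_exp1 CARD('n))"
    "has_weak_hessian u (weak_hessian u)" "weak_hessian u \<in> L2 lebesgue"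
  using assms weak_gradient_eq_AE(1) weak_hessian_eq_AE(1) unfolding W22_star_def Lp_2_eq_L2[symmetric] by auto

lemma W22_star_diff:
  fixes w v :: "real^'n \<Rightarrow> real^'N"
  assumes n: "5 \<le> CARD('n)" and w: "w \<in> W22_star" and v: "v \<in> W22_star"
  shows "(\<lambda>x. w x - v x) \<in> W22_star"
    and "AE x in lebesgue. weak_hessian (\<lambda>x. w x - v x) x = weak_hessian w x - weak_hessian v x"
proof -
  note d = W22_starD[OF w] W22_starD[OF v]
  note G = has_weak_gradient_diff[OF d(2) d(7)] and H = has_weak_hessian_diff[OF d(4) d(9)]
  show "(\<lambda>x. w x - v x) \<in> W22_star"
    by (rule W22_starI[OF Lp_diff[OF _ d(1) d(6)] G Lp_diff[OF _ d(3) d(8)] H])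
      (use n d in \<open>auto simp: crit_exp1_def crit_exp2_def Lp_2_eq_L2 intro: L2_diff\<close>)
  show "AE x in lebesgue. weak_hessian (\<lambda>x. w x - v x) x = weak_hessian w x - weak_hessian v x"
    by (rule weak_hessian_eq_AE(2)[OF H])
qed

section \<open>The structure of the function space\<close>

lemma L2_limit_unique:
  fixes f :: "nat \<Rightarrow> 'a \<Rightarrow> 'b::euclidean_space"
  assumes f: "\<And>k. f k \<in> L2 M" and g: "g \<in> L2 M" and h: "h \<in> L2 M"
    and lim: "(\<lambda>k. l2n M (\<lambda>x. f k x - g x)) \<longlonglongrightarrow> 0" "(\<lambda>k. l2n M (\<lambda>x. f k x - h x)) \<longlonglongrightarrow> 0"
  shows "AE x in M. g x = h x"
proof -
  have "l2n M (\<lambda>x. g x - h x) \<le> 0 + 0"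
  proof (rule LIMSEQ_le_const[OF tendsto_add[OF lim]], intro exI allI impI)
    show "l2n M (\<lambda>x. g x - h x) \<le> l2n M (\<lambda>x. f k x - g x) + l2n M (\<lambda>x. f k x - h x)" for k
      using l2n_triangle_diff[OF g f[of k] h] l2n_minus_commute[of M g "f k"] by simp
  qed
  then have "l2n M (\<lambda>x. g x - h x) = 0" using l2n_nonneg[of M "\<lambda>x. g x - h x"] by simp
  from l2n_eq_0_AE[OF L2_diff[OF g h] this] show ?thesis by simp
qed

lemma hessk_commute: "hessk k i j g = hessk k j i g"
proof -
  have "gk2 i j = (gk2 j i :: real \<Rightarrow> real^'a \<Rightarrow> real)" for i j :: 'a by (auto simp: gk2_def fun_eq_iff)
  then show ?thesis unfolding hessk_def by simp
qed

lemma rank_one_form_scaleR: "rank_one_form A (s *\<^sub>R \<eta>) (t *\<^sub>R a) = s^2 * t^2 * rank_one_form A \<eta> a"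
  unfolding rank_one_form_def sum_distrib_left by (intro sum.cong refl) (simp add: power2_eq_square mult_ac)

lemma rank_one_form_ge: "ellipticity A * ((norm \<eta>)^2 * (norm a)^2) \<le> rank_one_form A \<eta> a"
proof (cases "\<eta> = 0 \<or> a = 0")
  case True
  then show ?thesis by (auto simp: rank_one_form_def)
next
  case False
  have "ellipticity A \<le> rank_one_form A (sgn \<eta>) (sgn a)"
    by (rule ellipticity_attained[of A]) (use False in \<open>simp add: norm_sgn\<close>)
  then have "((norm \<eta>)^2 * (norm a)^2) * ellipticity A \<le> ((norm \<eta>)^2 * (norm a)^2) * rank_one_form A (sgn \<eta>) (sgn a)"
    by (intro mult_left_mono) auto
  also have "\<dots> = rank_one_form A (norm \<eta> *\<^sub>R sgn \<eta>) (norm a *\<^sub>R sgn a)" by (simp only: rank_one_form_scaleR)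
  finally show ?thesis using False by (simp add: sgn_div_norm mult.commute)
qed

text \<open>Subtracting the ellipticity constant times the product of two Kronecker deltas from A
  leaves a tensor that is nonnegative on rank-one arguments, so its form is nonnegative by
  \<open>kint_form_nonneg\<close>. The subtracted part contracts the Hessian to its trace, which is
  g, and so contributes exactly the squared norm of g.\<close>

lemma potential_coercive:
  fixes g :: "'N::finite \<Rightarrow> real^'n \<Rightarrow> real" and A :: "real^'n^'n^'N^'N"
  assumes g: "\<And>\<alpha>. g \<alpha> \<in> L2 lborel" and H: "\<And>\<alpha> i j. H \<alpha> i j \<in> L2 lborel"
    and lim: "\<And>\<alpha> i j. (\<lambda>k. l2n lborel (\<lambda>x. hessk k i j (g \<alpha>) x - H \<alpha> i j x)) \<longlonglongrightarrow> 0"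
    and tr: "\<And>\<alpha>. AE x in lborel. (\<Sum>i\<in>UNIV. H \<alpha> i i x) = g \<alpha> x"
  shows "ellipticity A * (\<Sum>\<alpha>\<in>UNIV. (l2n lborel (g \<alpha>))^2) \<le>
    (\<Sum>\<alpha>\<in>UNIV. \<Sum>\<beta>\<in>UNIV. \<Sum>i\<in>UNIV. \<Sum>j\<in>UNIV. A $ \<alpha> $ \<beta> $ i $ j * (LBINT x. g \<alpha> x * H \<beta> i j x))"
proof -
  \<comment> \<open>On a rank-one argument this tensor takes the value \<nu>(A) |\<eta>|^2
    |\<xi>|^2, the lower bound for the form of A.\<close>
  define D where "D \<alpha> \<beta> i j = (if \<alpha> = \<beta> \<and> i = j then ellipticity A else 0)" for \<alpha> \<beta> :: 'N and i j :: 'n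
  define M where "M \<alpha> \<beta> i j = A $ \<alpha> $ \<beta> $ i $ j - D \<alpha> \<beta> i j" for \<alpha> \<beta> i j
  have D: "(\<Sum>\<alpha>\<in>UNIV. \<Sum>\<beta>\<in>UNIV. \<Sum>i\<in>UNIV. \<Sum>j\<in>UNIV. D \<alpha> \<beta> i j * c \<alpha> \<beta> i j) = ellipticity A * (\<Sum>\<alpha>\<in>UNIV. \<Sum>i\<in>UNIV. c \<alpha> \<alpha> i i)" for c
  proof -
    have "(\<Sum>i\<in>UNIV. \<Sum>j\<in>UNIV. D \<alpha> \<beta> i j * c \<alpha> \<beta> i j) = (if \<alpha> = \<beta> then ellipticity A * (\<Sum>i\<in>UNIV. c \<alpha> \<alpha> i i) else 0)" for \<alpha> \<beta>
      by (auto simp: D_def if_distrib[of "\<lambda>t. t * _"] sum_distrib_left cong: if_cong)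
    then show ?thesis by (simp add: sum_distrib_left)
  qed
  have nn: "0 \<le> (\<Sum>\<alpha>\<in>UNIV. \<Sum>\<beta>\<in>UNIV. \<Sum>i\<in>UNIV. \<Sum>j\<in>UNIV. M \<alpha> \<beta> i j * (\<xi> i * \<xi> j * (\<eta> \<alpha> * \<eta> \<beta>)))" for \<eta> \<xi>
  proof -
    have "(\<Sum>\<alpha>\<in>UNIV. \<Sum>i\<in>UNIV. \<xi> i * \<xi> i * (\<eta> \<alpha> * \<eta> \<alpha>)) = (norm (vec_lambda \<eta>))^2 * (norm (vec_lambda \<xi>))^2"
      by (simp add: norm_vec_def L2_set_def sum_product sum_nonneg power2_eq_square mult_ac)
    moreover have "(\<Sum>\<alpha>\<in>UNIV. \<Sum>\<beta>\<in>UNIV. \<Sum>i\<in>UNIV. \<Sum>j\<in>UNIV. A $ \<alpha> $ \<beta> $ i $ j * (\<xi> i * \<xi> j * (\<eta> \<alpha> * \<eta> \<beta>))) = rank_one_form A (vec_lambda \<eta>) (vec_lambda \<xi>)"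
      by (simp add: rank_one_form_def mult_ac)
    ultimately show ?thesis
      using rank_one_form_ge[of A "vec_lambda \<eta>" "vec_lambda \<xi>"] D[of "\<lambda>\<alpha> \<beta> i j. \<xi> i * \<xi> j * (\<eta> \<alpha> * \<eta> \<beta>)"]
      by (simp add: M_def left_diff_distrib sum_subtractf)
  qed
  have "(\<lambda>k. \<Sum>\<alpha>\<in>UNIV. \<Sum>\<beta>\<in>UNIV. \<Sum>i\<in>UNIV. \<Sum>j\<in>UNIV. M \<alpha> \<beta> i j * (LBINT x. g \<alpha> x * hessk k i j (g \<beta>) x)) \<longlonglongrightarrow>
     (\<Sum>\<alpha>\<in>UNIV. \<Sum>\<beta>\<in>UNIV. \<Sum>i\<in>UNIV. \<Sum>j\<in>UNIV. M \<alpha> \<beta> i j * (LBINT x. g \<alpha> x * H \<beta> i j x))"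
    by (intro tendsto_sum tendsto_mult_left tendsto_integral_mult_L2 g H lim hessk_L2)
  then have "0 \<le> (\<Sum>\<alpha>\<in>UNIV. \<Sum>\<beta>\<in>UNIV. \<Sum>i\<in>UNIV. \<Sum>j\<in>UNIV. M \<alpha> \<beta> i j * (LBINT x. g \<alpha> x * H \<beta> i j x))"
    by (rule LIMSEQ_le_const)
       (use kint_form_nonneg[of M, OF nn g adm_cutoff cutoff_nonpos] in \<open>auto simp: hessk_def\<close>)
  moreover have "(\<Sum>i\<in>UNIV. (LBINT x. g \<alpha> x * H \<alpha> i i x)) = (l2n lborel (g \<alpha>))^2" for \<alpha>
  proof -
    have i: "integrable lborel (\<lambda>x. g \<alpha> x * H \<alpha> i i x)" for i using L2_mult_integrable(2)[OF g H, of \<alpha>] by simp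
    have "(\<Sum>i\<in>UNIV. (LBINT x. g \<alpha> x * H \<alpha> i i x)) = (LBINT x. g \<alpha> x * (\<Sum>i\<in>UNIV. H \<alpha> i i x))"
      by (simp add: sum_distrib_left Bochner_Integration.integral_sum i)
    also have "\<dots> = (l2n lborel (g \<alpha>))^2"
      unfolding l2n_sq
    proof (rule integral_cong_AE)
      show "AE x in lborel. g \<alpha> x * (\<Sum>i\<in>UNIV. H \<alpha> i i x) = (norm (g \<alpha> x))^2"
        using tr[of \<alpha>] by eventually_elim (simp add: power2_eq_square)
    qed (use L2_meas[OF g] L2_meas[OF H] in measurable)
    finally show ?thesis .
  qed
  ultimately show ?thesis
    using D[of "\<lambda>\<alpha> \<beta> i j. \<integral>x. g \<alpha> x * H \<beta> i j x \<partial>lborel"] by (simp add: M_def left_diff_distrib sum_subtractf)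
qed

section \<open>From scalar to vector-valued potentials\<close>

lemma borel_measurable_vec_lambda:
  fixes f :: "'k::finite \<Rightarrow> 'a \<Rightarrow> 'b::euclidean_space"
  assumes [measurable]: "\<And>i. f i \<in> borel_measurable M"
  shows "(\<lambda>x. \<chi> i. f i x) \<in> borel_measurable M"
  unfolding borel_measurable_euclidean_space[of "\<lambda>x. \<chi> i. f i x"] Basis_vec_def
  by (auto simp: inner_axis)

lemma powr_sum_le:
  fixes a :: "'k::finite \<Rightarrow> real"
  assumes a: "\<And>i. 0 \<le> a i" and q: "0 \<le> q"
  shows "(\<Sum>i\<in>UNIV. a i) powr q \<le> real CARD('k) powr q * (\<Sum>i\<in>UNIV. a i powr q)"
proof -
  have "Max (range a) \<in> range a" by (intro Max_in) auto
  then obtain m where "Max (range a) = a m" by blast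
  then have m: "a i \<le> a m" for i using Max_ge[of "range a" "a i"] by simp
  have "(\<Sum>i\<in>UNIV. a i) \<le> real CARD('k) * a m" using sum_bounded_above[of UNIV a "a m"] m by simp
  then have "(\<Sum>i\<in>UNIV. a i) powr q \<le> (real CARD('k) * a m) powr q" using a q by (intro powr_mono2 sum_nonneg) auto
  also have "\<dots> = real CARD('k) powr q * a m powr q" by (rule powr_mult)
  also have "\<dots> \<le> real CARD('k) powr q * (\<Sum>i\<in>UNIV. a i powr q)"
    by (intro mult_left_mono member_le_sum) auto
  finally show ?thesis .
qed

lemma Lp_norm_components:
  fixes f :: "'k::finite \<Rightarrow> real^'n \<Rightarrow> real" and u :: "real^'n \<Rightarrow> 'b::euclidean_space"
  assumes u: "u \<in> borel_measurable lebesgue" and le: "\<And>x. norm (u x) \<le> (\<Sum>i\<in>UNIV. \<bar>f i x\<bar>)"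
    and f: "\<And>i. integrable lebesgue (\<lambda>x. \<bar>f i x\<bar> powr q)" "\<And>i. (\<integral>x. \<bar>f i x\<bar> powr q \<partial>lebesgue) \<le> C * B powr q"
    and q: "0 < q" and C: "0 \<le> C" and B: "0 \<le> B"
  shows "u \<in> Lp q" "Lp_norm q u \<le> (real CARD('k) powr q * real CARD('k) * C) powr (1 / q) * B"
proof -
  note [measurable] = u
  define w where "w x = real CARD('k) powr q * (\<Sum>i\<in>UNIV. \<bar>f i x\<bar> powr q)" for x
  have w: "norm (u x) powr q \<le> w x" for x
  proof -
    have "norm (u x) powr q \<le> (\<Sum>i\<in>UNIV. \<bar>f i x\<bar>) powr q" using le q by (intro powr_mono2) auto
    also have "\<dots> \<le> w x" unfolding w_def using q by (intro powr_sum_le) auto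
    finally show ?thesis .
  qed
  have wi: "integrable lebesgue w" unfolding w_def using f(1) by auto
  have ui: "integrable lebesgue (\<lambda>x. norm (u x) powr q)"
    by (rule Bochner_Integration.integrable_bound[OF wi]) (use w in \<open>auto intro!: AE_I2 intro: order_trans abs_ge_self\<close>)
  then show "u \<in> Lp q" using u by (simp add: Lp_def)
  have "(\<integral>x. norm (u x) powr q \<partial>lebesgue) \<le> (\<integral>x. w x \<partial>lebesgue)" by (rule integral_mono[OF ui wi w])
  also have "\<dots> = real CARD('k) powr q * (\<Sum>i\<in>UNIV. \<integral>x. \<bar>f i x\<bar> powr q \<partial>lebesgue)"
    unfolding w_def using f(1) by (simp add: Bochner_Integration.integral_sum)
  also have "\<dots> \<le> real CARD('k) powr q * (\<Sum>i\<in>(UNIV::'k set). C * B powr q)"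
    by (intro mult_left_mono sum_mono f) auto
  finally have "Lp_norm q u \<le> ((real CARD('k) powr q * real CARD('k) * C) * B powr q) powr (1 / q)"
    unfolding Lp_norm_def using q by (intro powr_mono2) (auto simp: mult.assoc)
  also have "\<dots> = (real CARD('k) powr q * real CARD('k) * C) powr (1 / q) * B"
    using q B by (simp only: powr_mult powr_powr) simp
  finally show "Lp_norm q u \<le> (real CARD('k) powr q * real CARD('k) * C) powr (1 / q) * B" .
qed

lemma l2n_sq_vec:
  fixes f :: "'a \<Rightarrow> 'b::euclidean_space^'k"
  assumes "\<And>i. (\<lambda>x. f x $ i) \<in> L2 M"
  shows "f \<in> L2 M" "(l2n M f)^2 = (\<Sum>i\<in>UNIV. (l2n M (\<lambda>x. f x $ i))^2)"
proof -
  have eq: "(norm (f x))^2 = (\<Sum>i\<in>UNIV. (norm (f x $ i))^2)" for x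
    by (simp add: norm_vec_def L2_set_def sum_nonneg)
  have "(\<lambda>x. \<chi> i. f x $ i) \<in> borel_measurable M" by (rule borel_measurable_vec_lambda) (rule L2_meas[OF assms])
  moreover have "integrable M (\<lambda>x. (norm (f x))^2)" unfolding eq using L2_int[OF assms] by simp
  ultimately show "f \<in> L2 M" by (intro L2I) simp_all
  show "(l2n M f)^2 = (\<Sum>i\<in>UNIV. (l2n M (\<lambda>x. f x $ i))^2)"
    unfolding l2n_sq eq using L2_int[OF assms] by (simp add: Bochner_Integration.integral_sum)
qed

text \<open>On a Hessian this is the Laplacian, taken component by component.\<close>

definition hess_trace :: "real^'n^'n^'N \<Rightarrow> real^'N" where
  "hess_trace X = (\<chi> \<alpha>. \<Sum>i\<in>UNIV. X $ \<alpha> $ i $ i)"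

text \<open>Coercivity is quantified over all A at once: the potential is that of the Laplacian and
  does not involve A. The lower bound couples the components of g, so it belongs to the vector
  level.\<close>

definition vector_newtonian :: "real \<Rightarrow> (real^'n \<Rightarrow> real^'N) \<Rightarrow> (real^'n \<Rightarrow> real^'N) \<Rightarrow> (real^'n \<Rightarrow> real^'n^'N) \<Rightarrow> (real^'n \<Rightarrow> real^'n^'n^'N) \<Rightarrow> bool" where
  "vector_newtonian C g u G H \<longleftrightarrow> u \<in> Lp (crit_exp2 CARD('n)) \<and> has_weak_gradient u G \<and> G \<in> Lp (crit_exp1 CARD('n)) \<and>
     has_weak_hessian u H \<and> H \<in> L2 lebesgue \<and>
     Lp_norm (crit_exp2 CARD('n)) u \<le> C * l2n lebesgue g \<and> Lp_norm (crit_exp1 CARD('n)) G \<le> C * l2n lebesgue g \<and>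
     l2n lebesgue H = l2n lebesgue g \<and> (AE x in lebesgue. H x \<in> sym_tensors) \<and>
     (AE x in lebesgue. hess_trace (H x) = g x) \<and>
     (\<forall>A. ellipticity A * (l2n lebesgue g)^2 \<le> (\<integral>x. contract A (H x) \<bullet> g x \<partial>lebesgue))"

text \<open>The Laplacian acts on each component separately, so scalar potentials are stacked. Only
  the norm bounds and the coercive form mix components.\<close>

theorem vector_potential:
  assumes n: "5 \<le> CARD('n)"
  obtains C where "0 \<le> C" "\<And>g :: real^'n \<Rightarrow> real^'N. g \<in> L2 lebesgue \<Longrightarrow> \<exists>u G H. vector_newtonian C g u G H"
proof -
  let ?q2 = "crit_exp2 CARD('n)" and ?q1 = "crit_exp1 CARD('n)"
  have q2: "1 \<le> ?q2" and q1: "1 \<le> ?q1" using n by (simp_all add: crit_exp1_def crit_exp2_def field_simps)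
  obtain C where C: "0 \<le> C" and pot: "\<And>g :: real^'n \<Rightarrow> real. g \<in> L2 lborel \<Longrightarrow> \<exists>u G H. newtonian C g u G H"
    by (rule newton_potential[OF n, where thesis=thesis]) (rule that)
  \<comment> \<open>From \<open>Lp_norm_components\<close>: the power of the number of components
    comes from the power of a sum, and the further factor from adding up equal bounds. For the
    gradient the components are indexed by pairs.\<close>
  define c2 where "c2 = (real CARD('N) powr ?q2 * real CARD('N) * C) powr (1 / ?q2)"
  define c1 where "c1 = (real CARD('N \<times> 'n) powr ?q1 * real CARD('N \<times> 'n) * C) powr (1 / ?q1)"
  show thesis
  proof (rule that[of "max c1 c2"])
    show "0 \<le> max c1 c2" by (simp add: c1_def le_max_iff_disj)
    fix g0 :: "real^'n \<Rightarrow> real^'N" assume g0: "g0 \<in> L2 lebesgue"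
    have g0m: "(\<lambda>x. g0 x $ \<alpha>) \<in> borel_measurable lebesgue" for \<alpha>
      using L2_meas[OF g0] by measurable
    \<comment> \<open>The scalar theory works with Borel functions on \<open>lborel\<close>; each
      component is replaced by a Borel function that agrees with it off a null set.\<close>
    have "\<forall>\<alpha>. \<exists>g. g \<in> borel_measurable borel \<and> (AE x in lebesgue. g0 x $ \<alpha> = g x)"
      using borel_version[OF g0m] by metis
    from choice[OF this] obtain g where gm: "\<And>\<alpha>. g \<alpha> \<in> borel_measurable borel" and gg: "\<And>\<alpha>. AE x in lebesgue. g0 x $ \<alpha> = g \<alpha> x" by blast
    have gleb: "g \<alpha> \<in> L2 lebesgue" for \<alpha>
    proof (rule L2_dominated[OF g0 borel_imp_lebesgue[OF gm], where C=1])
      show "AE x in lebesgue. norm (g \<alpha> x) \<le> 1 * norm (g0 x)"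
        using gg[of \<alpha>] by eventually_elim (metis component_le_norm_cart mult_1 real_norm_def)
    qed
    then have gL: "g \<alpha> \<in> L2 lborel" for \<alpha> using L2_lebesgue_borel(2)[OF gm] by simp
    have gvec: "(\<lambda>x. \<chi> \<alpha>. g \<alpha> x) \<in> L2 lebesgue" by (rule l2n_sq_vec) (simp add: gleb)
    have g0g: "AE x in lebesgue. g0 x = (\<chi> \<alpha>. g \<alpha> x)"
    proof -
      have "AE x in lebesgue. \<forall>\<alpha>. g0 x $ \<alpha> = g \<alpha> x" using gg by (simp add: AE_all_countable)
      then show ?thesis by eventually_elim (simp add: vec_eq_iff)
    qed
    have gn: "(l2n lebesgue g0)^2 = (\<Sum>\<alpha>\<in>UNIV. (l2n lborel (g \<alpha>))^2)"
    proof -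
      have "l2n lebesgue g0 = l2n lebesgue (\<lambda>x. \<chi> \<alpha>. g \<alpha> x)"
        by (rule l2n_cong_AE[OF L2_meas[OF g0] L2_meas[OF gvec]]) (use g0g in \<open>auto elim: eventually_mono\<close>)
      then show ?thesis using l2n_sq_vec(2)[of "\<lambda>x. \<chi> \<alpha>. g \<alpha> x" lebesgue] gleb L2_lebesgue_borel(1)[OF gm] by simp
    qed
    have gle: "l2n lborel (g \<alpha>) \<le> l2n lebesgue g0" for \<alpha>
    proof (rule power2_le_imp_le[OF _ l2n_nonneg])
      show "(l2n lborel (g \<alpha>))^2 \<le> (l2n lebesgue g0)^2" unfolding gn by (rule member_le_sum) auto
    qed
    have gpow: "C * l2n lborel (g \<alpha>) powr q \<le> C * l2n lebesgue g0 powr q" if "1 \<le> q" for \<alpha> q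
      using that C gle l2n_nonneg by (intro mult_left_mono powr_mono2) auto
    have "\<forall>\<alpha>. \<exists>p. newtonian C (g \<alpha>) (fst p) (fst (snd p)) (snd (snd p))" using pot[OF gL] by auto
    from choice[OF this] obtain P where P: "\<And>\<alpha>. newtonian C (g \<alpha>) (fst (P \<alpha>)) (fst (snd (P \<alpha>))) (snd (snd (P \<alpha>)))" by blast
    define u G H where "u \<alpha> = fst (P \<alpha>)" and "G \<alpha> = fst (snd (P \<alpha>))" and "H \<alpha> = snd (snd (P \<alpha>))" for \<alpha>
    have um: "u \<alpha> \<in> borel_measurable borel" and Gm: "G \<alpha> i \<in> borel_measurable borel" and HL: "H \<alpha> i j \<in> L2 lborel"
      and ui: "integrable lborel (\<lambda>x. \<bar>u \<alpha> x\<bar> powr ?q2)" "(LBINT x. \<bar>u \<alpha> x\<bar> powr ?q2) \<le> C * (l2n lborel (g \<alpha>)) powr ?q2"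
      and Gi: "integrable lborel (\<lambda>x. \<bar>G \<alpha> i x\<bar> powr ?q1)" "(LBINT x. \<bar>G \<alpha> i x\<bar> powr ?q1) \<le> C * (l2n lborel (g \<alpha>)) powr ?q1"
      and lim: "(\<lambda>k. l2n lborel (\<lambda>x. hessk k i j (g \<alpha>) x - H \<alpha> i j x)) \<longlonglongrightarrow> 0"
      and tr: "AE x in lborel. (\<Sum>i\<in>UNIV. H \<alpha> i i x) = g \<alpha> x" and Hn: "(\<Sum>i\<in>UNIV. \<Sum>j\<in>UNIV. (l2n lborel (H \<alpha> i j))^2) = (l2n lborel (g \<alpha>))^2"
      and w1: "\<phi> \<in> test_functions \<Longrightarrow> (LBINT x. u \<alpha> x * partial_derivs [i] \<phi> x) = - (LBINT x. G \<alpha> i x * \<phi> x)"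
      and w2: "\<phi> \<in> test_functions \<Longrightarrow> (LBINT x. u \<alpha> x * partial_derivs [i, j] \<phi> x) = (LBINT x. H \<alpha> i j x * \<phi> x)" for \<alpha> i j \<phi>
      using P[of \<alpha>] unfolding u_def G_def H_def newtonian_def by blast+
    have Hm: "H \<alpha> i j \<in> borel_measurable borel" for \<alpha> i j using L2_meas[OF HL] by simp
    define uu where "uu x = (\<chi> \<alpha>. u \<alpha> x)" for x
    define GG where "GG x = (\<chi> \<alpha> i. G \<alpha> i x)" for x
    define HH where "HH x = (\<chi> \<alpha> i j. H \<alpha> i j x)" for x
    have uloc: "u \<alpha> \<in> L1_loc" for \<alpha> by (rule Lp_component_L1_loc[OF q2 um ui(1)])
    have Gloc: "G \<alpha> i \<in> L1_loc" for \<alpha> i by (rule Lp_component_L1_loc[OF q1 Gm Gi(1)])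
    have Hloc: "H \<alpha> i j \<in> L1_loc" for \<alpha> i j
      by (rule Lp_component_L1_loc[where p=2]) (use Hm[of \<alpha> i j] L2_int[OF HL[of \<alpha> i j]] in \<open>simp_all add: powr_numeral\<close>)
    have leb: "(\<integral>x. f x * partial_derivs js \<phi> x \<partial>lebesgue) = (LBINT x. f x * partial_derivs js \<phi> x)"
      if "f \<in> borel_measurable borel" "\<phi> \<in> test_functions" for f \<phi> js
      using that test_measurable[OF that(2), of js] by (intro integral_lebesgue_borel) measurable
    have wG: "has_weak_gradient uu GG"
      unfolding has_weak_gradient_def has_weak_deriv_def
      using uloc Gloc w1 leb[OF um] leb[OF Gm, of _ _ _ "[]"] by (simp add: uu_def GG_def del: partial_derivs.simps(2))
    have wH: "has_weak_hessian uu HH"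
      unfolding has_weak_hessian_def has_weak_deriv_def
      using uloc Hloc w2 leb[OF um] leb[OF Hm, of _ _ _ _ "[]"] by (simp add: uu_def HH_def del: partial_derivs.simps(2))
    have um': "uu \<in> borel_measurable lebesgue" unfolding uu_def[abs_def]
      by (intro borel_measurable_vec_lambda borel_imp_lebesgue um)
    have Gm': "GG \<in> borel_measurable lebesgue" unfolding GG_def[abs_def]
      by (intro borel_measurable_vec_lambda borel_imp_lebesgue Gm)
    have l1: "norm (X :: 'c::real_normed_vector^'k) \<le> (\<Sum>i\<in>UNIV. norm (X $ i))" for X
      unfolding norm_vec_def by (rule L2_set_le_sum) simp
    have lebq: "integrable lebesgue (\<lambda>x. \<bar>f x\<bar> powr q)" "(\<integral>x. \<bar>f x\<bar> powr q \<partial>lebesgue) \<le> C * l2n lebesgue g0 powr q"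
      if "f \<in> borel_measurable borel" "integrable lborel (\<lambda>x. \<bar>f x\<bar> powr q)" "(LBINT x. \<bar>f x\<bar> powr q) \<le> C * l2n lborel (g \<alpha>) powr q" "1 \<le> q"
      for f :: "real^'n \<Rightarrow> real" and q \<alpha>
    proof -
      have [measurable]: "(\<lambda>x. \<bar>f x\<bar> powr q) \<in> borel_measurable borel" using that(1) by measurable
      show "integrable lebesgue (\<lambda>x. \<bar>f x\<bar> powr q)" using that(2) by (subst integral_lebesgue_borel(2)) measurable
      have "(\<integral>x. \<bar>f x\<bar> powr q \<partial>lebesgue) = (LBINT x. \<bar>f x\<bar> powr q)" by (rule integral_lebesgue_borel) measurable
      then show "(\<integral>x. \<bar>f x\<bar> powr q \<partial>lebesgue) \<le> C * l2n lebesgue g0 powr q" using that(3) gpow[OF that(4), of \<alpha>] by linarith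
    qed
    have "norm (uu x) \<le> (\<Sum>\<alpha>\<in>UNIV. \<bar>u \<alpha> x\<bar>)" for x using l1[of "uu x"] by (simp add: uu_def)
    from Lp_norm_components[OF um' this lebq[OF um ui q2] _ C l2n_nonneg]
    have uLp: "uu \<in> Lp ?q2" "Lp_norm ?q2 uu \<le> c2 * l2n lebesgue g0"
      using q2 by (simp_all add: c2_def)
    have "norm (GG x) \<le> (\<Sum>p\<in>UNIV. \<bar>G (fst p) (snd p) x\<bar>)" for x
    proof -
      have "norm (GG x) \<le> (\<Sum>\<alpha>\<in>UNIV. \<Sum>i\<in>UNIV. \<bar>G \<alpha> i x\<bar>)"
        using l1[of "GG x"] sum_mono[of UNIV "\<lambda>\<alpha>. norm (GG x $ \<alpha>)" "\<lambda>\<alpha>. \<Sum>i\<in>UNIV. \<bar>G \<alpha> i x\<bar>"] l1[of "GG x $ \<alpha>" for \<alpha>]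
        by (simp add: GG_def)
      then show ?thesis by (simp add: sum.cartesian_product UNIV_Times_UNIV split_beta)
    qed
    from Lp_norm_components[OF Gm' this lebq[OF Gm Gi q1] _ C l2n_nonneg]
    have GLp: "GG \<in> Lp ?q1" "Lp_norm ?q1 GG \<le> c1 * l2n lebesgue g0"
      using q1 by (simp_all add: c1_def)
    have Hleb: "H \<alpha> i j \<in> L2 lebesgue" "l2n lebesgue (H \<alpha> i j) = l2n lborel (H \<alpha> i j)" for \<alpha> i j
      using L2_lebesgue_borel[OF Hm] HL by auto
    have H1: "(\<lambda>x. HH x $ \<alpha> $ i) \<in> L2 lebesgue" "(l2n lebesgue (\<lambda>x. HH x $ \<alpha> $ i))^2 = (\<Sum>j\<in>UNIV. (l2n lborel (H \<alpha> i j))^2)" for \<alpha> i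
      using l2n_sq_vec[of "\<lambda>x. HH x $ \<alpha> $ i" lebesgue] Hleb by (simp_all add: HH_def)
    have H2: "(\<lambda>x. HH x $ \<alpha>) \<in> L2 lebesgue" "(l2n lebesgue (\<lambda>x. HH x $ \<alpha>))^2 = (\<Sum>i\<in>UNIV. \<Sum>j\<in>UNIV. (l2n lborel (H \<alpha> i j))^2)" for \<alpha>
      using l2n_sq_vec[of "\<lambda>x. HH x $ \<alpha>" lebesgue] H1 by simp_all
    have H3: "HH \<in> L2 lebesgue" "(l2n lebesgue HH)^2 = (l2n lebesgue g0)^2"
      using l2n_sq_vec[of HH lebesgue] H2 Hn gn by simp_all
    have H4: "l2n lebesgue HH = l2n lebesgue g0" by (rule power2_eq_imp_eq[OF H3(2) l2n_nonneg l2n_nonneg])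
    \<comment> \<open>The kernels \<open>gk2 i j\<close> and \<open>gk2 j i\<close> coincide, so the
      two entries are mean square limits of one and the same sequence.\<close>
    have sym: "AE x in lebesgue. HH x \<in> sym_tensors"
    proof -
      have "AE x in lborel. H \<alpha> i j x = H \<alpha> j i x" for \<alpha> i j
        by (rule L2_limit_unique[OF hessk_L2[OF gL] HL HL lim[of i j \<alpha>]]) (use lim[of j i \<alpha>] hessk_commute[of _ j i] in simp)
      then have "AE x in lborel. \<forall>\<alpha> i j. H \<alpha> i j x = H \<alpha> j i x" by (simp add: AE_all_countable)
      then show ?thesis unfolding AE_lebesgue_iff by eventually_elim (simp add: sym_tensors_def HH_def)
    qed
    have trace: "AE x in lebesgue. hess_trace (HH x) = g0 x"
    proof -
      have "AE x in lebesgue. \<forall>\<alpha>. (\<Sum>i\<in>UNIV. H \<alpha> i i x) = g \<alpha> x" using tr by (simp add: AE_all_countable AE_lebesgue_iff)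
      with g0g show ?thesis by eventually_elim (simp add: hess_trace_def HH_def)
    qed
    have coer: "ellipticity A * (l2n lebesgue g0)^2 \<le> (\<integral>x. contract A (HH x) \<bullet> g0 x \<partial>lebesgue)" for A
    proof -
      have i: "integrable lborel (\<lambda>x. g \<alpha> x * H \<beta> i j x)" for \<alpha> \<beta> i j
        using L2_mult_integrable(2)[OF gL HL] by simp
      define f where "f x = (\<Sum>\<alpha>\<in>UNIV. \<Sum>\<beta>\<in>UNIV. \<Sum>i\<in>UNIV. \<Sum>j\<in>UNIV. A $ \<alpha> $ \<beta> $ i $ j * (g \<alpha> x * H \<beta> i j x))" for x
      have fi: "integrable lborel f" unfolding f_def using i by auto
      have fe: "f x = contract A (HH x) \<bullet> (\<chi> \<alpha>. g \<alpha> x)" for x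
        by (simp add: f_def inner_vec_def contract_def HH_def sum_distrib_left sum_distrib_right mult_ac)
      have "(\<integral>x. contract A (HH x) \<bullet> g0 x \<partial>lebesgue) = (\<integral>x. f x \<partial>lebesgue)"
      proof (rule integral_cong_AE)
        show "AE x in lebesgue. contract A (HH x) \<bullet> g0 x = f x" using g0g by eventually_elim (simp add: fe)
        show "f \<in> borel_measurable lebesgue" using fi by (intro borel_imp_lebesgue) auto
        then show "(\<lambda>x. contract A (HH x) \<bullet> g0 x) \<in> borel_measurable lebesgue"
          by (rule borel_measurable_lebesgue_cong_AE) (use g0g in \<open>auto elim!: eventually_mono simp: fe\<close>)
      qed
      also have "\<dots> = (LBINT x. f x)" using fi by (intro integral_lebesgue_borel) auto
      also have "\<dots> = (\<Sum>\<alpha>\<in>UNIV. \<Sum>\<beta>\<in>UNIV. \<Sum>i\<in>UNIV. \<Sum>j\<in>UNIV. A $ \<alpha> $ \<beta> $ i $ j * (LBINT x. g \<alpha> x * H \<beta> i j x))"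
        unfolding f_def using i by (simp add: Bochner_Integration.integral_sum)
      finally show ?thesis using potential_coercive[of g H A, OF gL HL lim tr] gn by simp
    qed
    have mono: "c * l2n lebesgue g0 \<le> max c1 c2 * l2n lebesgue g0" if "c \<le> max c1 c2" for c
      using that l2n_nonneg by (rule mult_right_mono)
    show "\<exists>u G H. vector_newtonian (max c1 c2) g0 u G H"
      unfolding vector_newtonian_def
      using uLp(1) wG GLp(1) wH H3(1) order_trans[OF uLp(2) mono[of c2]] order_trans[OF GLp(2) mono[of c1]] H4 sym trace coer
      by (intro exI[of _ uu] exI[of _ GG] exI[of _ HH]) simp
  qed
qed

section \<open>Elements of the function space as potentials of their Laplacians\<close>

lemma hess_trace_bounded_linear: "bounded_linear hess_trace"
  unfolding hess_trace_def linear_conv_bounded_linear[symmetric]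
  by (rule linearI) (simp_all add: vec_eq_iff sum.distrib sum_distrib_left)

lemma contract_bounded_linear: "bounded_linear (contract A)"
  unfolding contract_def linear_conv_bounded_linear[symmetric]
  by (rule linearI) (simp_all add: vec_eq_iff sum.distrib sum_distrib_left distrib_left mult_ac)

lemma L2_bounded_linear:
  fixes f :: "'b::euclidean_space \<Rightarrow> 'c::euclidean_space"
  assumes f: "bounded_linear f" and g: "g \<in> L2 M"
  shows "(\<lambda>x. f (g x)) \<in> L2 M"
proof -
  obtain K where "\<And>x. norm (f x) \<le> norm x * K" using bounded_linear.bounded[OF f] by auto
  moreover have "(\<lambda>x. f (g x)) \<in> borel_measurable M"
    by (rule borel_measurable_continuous_on[OF linear_continuous_on[OF f] L2_meas[OF g]])
  ultimately show ?thesis by (intro L2_dominated[OF g, where C=K]) (auto simp: mult.commute)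
qed

lemma l2n_bounded_linear_le:
  fixes f :: "'b::euclidean_space \<Rightarrow> 'c::euclidean_space"
  assumes f: "bounded_linear f" and g: "g \<in> L2 M" and K: "\<And>x. norm (f x) \<le> K * norm x" "0 \<le> K"
  shows "l2n M (\<lambda>x. f (g x)) \<le> K * l2n M g"
proof -
  have "l2n M (\<lambda>x. f (g x)) \<le> l2n M (\<lambda>x. K *\<^sub>R g x)"
    by (rule l2n_mono_AE[OF L2_bounded_linear[OF f g] L2_scaleR[OF g]]) (simp add: K)
  then show ?thesis using K(2) by (simp add: l2n_scaleR)
qed

lemma integral_mult_Laplacian:
  fixes u :: "real^'n \<Rightarrow> real^'N"
  assumes H: "has_weak_hessian u H" and tr: "AE x in lebesgue. hess_trace (H x) = g x" and \<phi>: "\<phi> \<in> test_functions"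
  shows "(\<integral>x. u x $ \<alpha> * (\<Sum>i\<in>UNIV. partial_derivs [i, i] \<phi> x) \<partial>lebesgue) = (\<integral>x. g x $ \<alpha> * \<phi> x \<partial>lebesgue)"
proof -
  have L: "(\<lambda>x. u x $ \<alpha>) \<in> L1_loc" "(\<lambda>x. H x $ \<alpha> $ i $ i) \<in> L1_loc" for i
    using H by (auto simp: has_weak_hessian_def has_weak_deriv_def)
  have i: "integrable lebesgue (\<lambda>x. u x $ \<alpha> * partial_derivs [i, i] \<phi> x)" "integrable lebesgue (\<lambda>x. H x $ \<alpha> $ i $ i * \<phi> x)" for i
    using L1_loc_test_integrable[OF L(1) \<phi>, of "[i, i]"] L1_loc_test_integrable[OF L(2) \<phi>, of _ "[]"] by simp_all
  have "(\<integral>x. u x $ \<alpha> * (\<Sum>i\<in>UNIV. partial_derivs [i, i] \<phi> x) \<partial>lebesgue) = (\<Sum>i\<in>UNIV. \<integral>x. u x $ \<alpha> * partial_derivs [i, i] \<phi> x \<partial>lebesgue)"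
    using i(1) by (simp add: sum_distrib_left Bochner_Integration.integral_sum del: partial_derivs.simps)
  also have "\<dots> = (\<Sum>i\<in>UNIV. \<integral>x. H x $ \<alpha> $ i $ i * \<phi> x \<partial>lebesgue)"
    using H \<phi> by (simp add: has_weak_hessian_def has_weak_deriv_def del: partial_derivs.simps)
  also have "\<dots> = (\<integral>x. (\<Sum>i\<in>UNIV. H x $ \<alpha> $ i $ i) * \<phi> x \<partial>lebesgue)"
    using i(2) by (simp add: sum_distrib_right Bochner_Integration.integral_sum)
  also have "\<dots> = (\<integral>x. g x $ \<alpha> * \<phi> x \<partial>lebesgue)"
  proof (rule integral_cong_AE)
    have "(\<lambda>x. \<Sum>i\<in>UNIV. H x $ \<alpha> $ i $ i * \<phi> x) \<in> borel_measurable lebesgue"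
      using i(2) by (intro borel_measurable_sum borel_measurable_integrable)
    then show m: "(\<lambda>x. (\<Sum>i\<in>UNIV. H x $ \<alpha> $ i $ i) * \<phi> x) \<in> borel_measurable lebesgue"
      by (simp add: sum_distrib_right)
    show ae: "AE x in lebesgue. (\<Sum>i\<in>UNIV. H x $ \<alpha> $ i $ i) * \<phi> x = g x $ \<alpha> * \<phi> x"
      using tr by eventually_elim (auto simp: hess_trace_def vec_eq_iff)
    show "(\<lambda>x. g x $ \<alpha> * \<phi> x) \<in> borel_measurable lebesgue"
      by (rule borel_measurable_lebesgue_cong_AE[OF m ae])
  qed
  finally show ?thesis .
qed

text \<open>Each component of the difference is weakly harmonic and integrable to the power
  \<open>crit_exp2\<close>, which exceeds 1. A Borel version of it therefore vanishes by Liouville's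
  theorem.\<close>

lemma Laplacian_unique:
  fixes u v :: "real^'n \<Rightarrow> real^'N"
  assumes n: "5 \<le> CARD('n)" and u: "u \<in> Lp (crit_exp2 CARD('n))" "has_weak_hessian u H" "AE x in lebesgue. hess_trace (H x) = g x"
    and v: "v \<in> Lp (crit_exp2 CARD('n))" "has_weak_hessian v H'" "AE x in lebesgue. hess_trace (H' x) = g x"
    and g: "g \<in> L2 lebesgue"
  shows "AE x in lebesgue. u x = v x"
proof -
  let ?q = "crit_exp2 CARD('n)"
  have q: "1 < ?q" using n by (simp add: crit_exp2_def field_simps)
  have "AE x in lebesgue. u x $ \<alpha> = v x $ \<alpha>" for \<alpha>
  proof -
    define z where "z x = u x $ \<alpha> - v x $ \<alpha>" for x
    have L: "(\<lambda>x. u x $ \<alpha>) \<in> L1_loc" "(\<lambda>x. v x $ \<alpha>) \<in> L1_loc"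
      using u(2) v(2) by (auto simp: has_weak_hessian_def has_weak_deriv_def)
    have zL: "z \<in> L1_loc" unfolding z_def[abs_def] by (rule L1_loc_diff[OF L])
    obtain z' where z'[measurable]: "z' \<in> borel_measurable borel" and zz': "AE x in lebesgue. z x = z' x"
      using borel_version[OF L1_loc_measurable[OF zL]] by blast
    have "AE x in lborel. z' x = 0"
    proof (rule liouville[OF z' q])
      have d: "(\<lambda>x. u x - v x) \<in> Lp ?q" using q by (intro Lp_diff u v) simp
      have "integrable lebesgue (\<lambda>x. \<bar>z' x\<bar> powr ?q)"
      proof (rule Bochner_Integration.integrable_bound)
        show "integrable lebesgue (\<lambda>x. norm (u x - v x) powr ?q)" using d by (simp add: Lp_def)
        show "AE x in lebesgue. norm (\<bar>z' x\<bar> powr ?q) \<le> norm (norm (u x - v x) powr ?q)"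
          using zz'
        proof eventually_elim
          case (elim x)
          have "\<bar>z' x\<bar> \<le> norm (u x - v x)" using component_le_norm_cart[of "u x - v x" \<alpha>] elim by (simp add: z_def)
          then show ?case using q by (simp add: powr_mono2)
        qed
        have "(\<lambda>x. \<bar>z' x\<bar> powr ?q) \<in> borel_measurable borel" by measurable
        then show "(\<lambda>x. \<bar>z' x\<bar> powr ?q) \<in> borel_measurable lebesgue" by (rule borel_imp_lebesgue)
      qed
      then show "integrable lborel (\<lambda>x. \<bar>z' x\<bar> powr ?q)" by (subst (asm) integral_lebesgue_borel) measurable
    next
      fix \<phi> :: "real^'n \<Rightarrow> real" assume \<phi>: "\<phi> \<in> test_functions"
      let ?L = "\<lambda>x. \<Sum>i\<in>UNIV. partial_derivs [i, i] \<phi> x"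
      have Lm: "?L \<in> borel_measurable borel" by (intro borel_measurable_sum test_measurable[OF \<phi>])
      have i: "integrable lebesgue (\<lambda>x. w x * ?L x)" if "w \<in> L1_loc" for w
        using L1_loc_test_integrable[OF that \<phi>] by (simp add: sum_distrib_left del: partial_derivs.simps)
      have "(LBINT x. z' x * ?L x) = (\<integral>x. z' x * ?L x \<partial>lebesgue)"
        using Lm z' by (intro integral_lebesgue_borel(1)[symmetric] borel_measurable_times)
      also have "\<dots> = (\<integral>x. z x * ?L x \<partial>lebesgue)"
      proof (rule integral_cong_AE)
        show "(\<lambda>x. z' x * ?L x) \<in> borel_measurable lebesgue"
          by (intro borel_imp_lebesgue borel_measurable_times Lm z')
        show "(\<lambda>x. z x * ?L x) \<in> borel_measurable lebesgue" using i[OF zL] by (rule borel_measurable_integrable)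
        show "AE x in lebesgue. z' x * ?L x = z x * ?L x" using zz' by eventually_elim simp
      qed
      also have "\<dots> = (\<integral>x. u x $ \<alpha> * ?L x \<partial>lebesgue) - (\<integral>x. v x $ \<alpha> * ?L x \<partial>lebesgue)"
        using i[OF L(1)] i[OF L(2)] by (simp add: z_def left_diff_distrib del: partial_derivs.simps)
      also have "\<dots> = 0" using integral_mult_Laplacian[OF u(2,3) \<phi>] integral_mult_Laplacian[OF v(2,3) \<phi>] by simp
      finally show "(LBINT x. z' x * ?L x) = 0" .
    qed
    then have "AE x in lebesgue. z' x = 0" by (simp add: AE_lebesgue_iff)
    with zz' show ?thesis by eventually_elim (simp add: z_def)
  qed
  then have "AE x in lebesgue. \<forall>\<alpha>. u x $ \<alpha> = v x $ \<alpha>" by (simp add: AE_all_countable)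
  then show ?thesis by eventually_elim (simp add: vec_eq_iff)
qed

text \<open>Given u, form the potential of its own Laplacian. By uniqueness it equals u almost
  everywhere, so the bounds, the symmetry and the coercivity of the potential become properties of
  every element of the space.\<close>

theorem W22_star_structure:
  assumes n: "5 \<le> CARD('n)"
  obtains C where "0 \<le> C"
    "\<And>u :: real^'n \<Rightarrow> real^'N. u \<in> W22_star \<Longrightarrow> W22_star_norm u \<le> C * l2n lebesgue (weak_hessian u) \<and> (AE x in lebesgue. weak_hessian u x \<in> sym_tensors) \<and>
      l2n lebesgue (\<lambda>x. hess_trace (weak_hessian u x)) = l2n lebesgue (weak_hessian u) \<and>
      (\<forall>A. ellipticity A * (l2n lebesgue (weak_hessian u))^2 \<le>
       (\<integral>x. contract A (weak_hessian u x) \<bullet> hess_trace (weak_hessian u x) \<partial>lebesgue))"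
    "\<And>g :: real^'n \<Rightarrow> real^'N. g \<in> L2 lebesgue \<Longrightarrow> \<exists>u\<in>W22_star. AE x in lebesgue. hess_trace (weak_hessian u x) = g x"
proof -
  let ?q2 = "crit_exp2 CARD('n)" and ?q1 = "crit_exp1 CARD('n)"
  obtain C where C: "0 \<le> C" and pot: "\<And>g :: real^'n \<Rightarrow> real^'N. g \<in> L2 lebesgue \<Longrightarrow> \<exists>u G H. vector_newtonian C g u G H"
    by (rule vector_potential[OF n, where thesis=thesis]) (rule that)
  show thesis
  \<comment> \<open>Two Lebesgue norms bounded by C each, and the Hessian norm itself with factor
    1.\<close>
  proof (rule that[of "2 * C + 1"])
    show "0 \<le> 2 * C + 1" using C by simp
    show "W22_star_norm u \<le> (2 * C + 1) * l2n lebesgue (weak_hessian u) \<and> (AE x in lebesgue. weak_hessian u x \<in> sym_tensors) \<and>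
        l2n lebesgue (\<lambda>x. hess_trace (weak_hessian u x)) = l2n lebesgue (weak_hessian u) \<and>
        (\<forall>A. ellipticity A * (l2n lebesgue (weak_hessian u))^2 \<le>
         (\<integral>x. contract A (weak_hessian u x) \<bullet> hess_trace (weak_hessian u x) \<partial>lebesgue))"
      if u: "u \<in> W22_star" for u :: "real^'n \<Rightarrow> real^'N"
    proof -
      note d = W22_starD[OF u]
      define g where "g x = hess_trace (weak_hessian u x)" for x
      have g: "g \<in> L2 lebesgue" unfolding g_def by (rule L2_bounded_linear[OF hess_trace_bounded_linear d(5)])
      obtain v G H where v: "v \<in> Lp ?q2" "has_weak_gradient v G" "G \<in> Lp ?q1" "has_weak_hessian v H" "H \<in> L2 lebesgue"
       "Lp_norm ?q2 v \<le> C * l2n lebesgue g" "Lp_norm ?q1 G \<le> C * l2n lebesgue g"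
       "l2n lebesgue H = l2n lebesgue g" "AE x in lebesgue. H x \<in> sym_tensors" "AE x in lebesgue. hess_trace (H x) = g x"
       "\<And>A. ellipticity A * (l2n lebesgue g)^2 \<le> (\<integral>x. contract A (H x) \<bullet> g x \<partial>lebesgue)"
        using pot[OF g] unfolding vector_newtonian_def by blast
      have uv: "AE x in lebesgue. u x = v x"
        by (rule Laplacian_unique[OF n d(1,4) _ v(1,4,10) g]) (simp add: g_def)
      then have vu: "AE x in lebesgue. v x = u x" by eventually_elim simp
      have c: "AE x in lebesgue. v x $ \<alpha> = u x $ \<alpha>" for \<alpha> using vu by eventually_elim simp
      have "has_weak_deriv js (\<lambda>x. u x $ \<alpha>) h" if "has_weak_deriv js (\<lambda>x. v x $ \<alpha>) h" for js \<alpha> h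
        by (rule has_weak_deriv_cong_AE[OF that c]) simp
      with v(2,4) have "has_weak_gradient u G" "has_weak_hessian u H"
        unfolding has_weak_gradient_def has_weak_hessian_def by blast+
      then have G: "AE x in lebesgue. weak_gradient u x = G x" and H: "AE x in lebesgue. weak_hessian u x = H x"
        by (auto intro: weak_gradient_eq_AE(2) weak_hessian_eq_AE(2))
      have "AE x in lebesgue. norm (weak_hessian u x) = norm (H x)" using H by eventually_elim simp
      from l2n_cong_AE[OF L2_meas[OF d(5)] L2_meas[OF v(5)] this]
      have Hn: "l2n lebesgue (weak_hessian u) = l2n lebesgue g" by (simp add: v(8))
      have "Lp_norm ?q2 u = Lp_norm ?q2 v" using Lp_cong_AE(2)[OF v(1) vu] .
      moreover have "Lp_norm ?q1 G = Lp_norm ?q1 (weak_gradient u)" using Lp_cong_AE(2)[OF d(3) G] .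
      ultimately have 1: "W22_star_norm u \<le> (2 * C + 1) * l2n lebesgue (weak_hessian u)"
        using v(6,7) Hn by (simp add: W22_star_norm_def Lp_norm_2_eq_l2n algebra_simps)
      have 2: "AE x in lebesgue. weak_hessian u x \<in> sym_tensors" using H v(9) by eventually_elim simp
      have 3: "(\<integral>x. contract A (weak_hessian u x) \<bullet> g x \<partial>lebesgue) = (\<integral>x. contract A (H x) \<bullet> g x \<partial>lebesgue)" for A
      proof (rule integral_cong_AE)
        show "(\<lambda>x. contract A (weak_hessian u x) \<bullet> g x) \<in> borel_measurable lebesgue" "(\<lambda>x. contract A (H x) \<bullet> g x) \<in> borel_measurable lebesgue"
          using L2_meas[OF g] L2_meas[OF L2_bounded_linear[OF contract_bounded_linear d(5)]] L2_meas[OF L2_bounded_linear[OF contract_bounded_linear v(5)]]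
          by (auto intro: borel_measurable_inner)
        show "AE x in lebesgue. contract A (weak_hessian u x) \<bullet> g x = contract A (H x) \<bullet> g x" using H by eventually_elim simp
      qed
      show ?thesis using 1 2 3 Hn v(11) by (simp flip: g_def)
    qed
    show "\<exists>u\<in>W22_star. AE x in lebesgue. hess_trace (weak_hessian u x) = g x" if g: "g \<in> L2 lebesgue" for g :: "real^'n \<Rightarrow> real^'N"
    proof -
      obtain v G H where v: "v \<in> Lp ?q2" "has_weak_gradient v G" "G \<in> Lp ?q1" "has_weak_hessian v H" "H \<in> L2 lebesgue"
        "AE x in lebesgue. hess_trace (H x) = g x"
        using pot[OF g] unfolding vector_newtonian_def by blast
      have "v \<in> W22_star" using W22_starI[OF v(1-4)] v(5) by (simp add: Lp_2_eq_L2)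
      moreover have "AE x in lebesgue. hess_trace (weak_hessian v x) = g x"
        using weak_hessian_eq_AE(2)[OF v(4)] v(6) by eventually_elim simp
      ultimately show ?thesis by blast
    qed
  qed
qed

lemma W22_star_hessian:
  fixes u :: "real^'n \<Rightarrow> real^'N"
  assumes n: "5 \<le> CARD('n)" and u: "u \<in> W22_star"
  shows "AE x in lebesgue. weak_hessian u x \<in> sym_tensors"
    and "l2n lebesgue (\<lambda>x. hess_trace (weak_hessian u x)) = l2n lebesgue (weak_hessian u)"
    and "ellipticity A * (l2n lebesgue (weak_hessian u))^2 \<le>
       (\<integral>x. contract A (weak_hessian u x) \<bullet> hess_trace (weak_hessian u x) \<partial>lebesgue)"
  by (rule W22_star_structure[OF n, where 'N='N]; use u in blast)+

section \<open>Linear and nonlinear systems\<close>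

text \<open>Cauchy-Schwarz in the coercive form, where the test function is the Laplacian and has
  the same norm as the Hessian; one factor of this norm is then cancelled.\<close>

lemma W22_star_coercive:
  fixes u :: "real^'n \<Rightarrow> real^'N"
  assumes n: "5 \<le> CARD('n)" and u: "u \<in> W22_star"
  shows "ellipticity A * l2n lebesgue (weak_hessian u) \<le> l2n lebesgue (\<lambda>x. contract A (weak_hessian u x))"
proof (cases "l2n lebesgue (weak_hessian u) = 0")
  case False
  then have pos: "0 < l2n lebesgue (weak_hessian u)" using l2n_nonneg[of lebesgue "weak_hessian u"] by linarith
  have "(ellipticity A * l2n lebesgue (weak_hessian u)) * l2n lebesgue (weak_hessian u) \<le> l2n lebesgue (\<lambda>x. contract A (weak_hessian u x)) * l2n lebesgue (weak_hessian u)"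
    using W22_star_hessian(2)[OF n u] W22_star_hessian(3)[OF n u, of A]
      l2n_inner_le[OF L2_bounded_linear[OF contract_bounded_linear[of A] W22_starD(5)[OF u]] L2_bounded_linear[OF hess_trace_bounded_linear W22_starD(5)[OF u]]]
    by (simp add: power2_eq_square mult.assoc)
  then show ?thesis using pos by simp
qed (simp add: l2n_nonneg)

text \<open>With g the Laplacian of u, the operator T from g to A : D^2 u is strongly monotone with
  constant \<nu> and Lipschitz with constant M. Hence g \<mapsto> g - \<tau> (T g - f) contracts
  squared norms by the factor 1 - 2 \<tau> \<nu> + \<tau>^2 M^2, which is below 1 for small positive
  \<tau>.\<close>

lemma linear_system_solvable:
  fixes A :: "real^'n^'n^'N^'N" and f :: "real^'n \<Rightarrow> real^'N"
  assumes n: "5 \<le> CARD('n)" and A: "rank_one_positive A" and f: "f \<in> L2 lebesgue"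
  obtains u where "u \<in> W22_star" "AE x in lebesgue. contract A (weak_hessian u x) = f x"
proof -
  define \<nu> where "\<nu> = ellipticity A"
  have \<nu>: "0 < \<nu>" using A by (simp add: rank_one_positive_def \<nu>_def)
  obtain M0 where M0: "\<And>X. norm (contract A X) \<le> norm X * M0"
    using bounded_linear.bounded[OF contract_bounded_linear[of A]] by blast
  \<comment> \<open>Enlarging the operator bound to at least \<nu> makes M positive and keeps the
    number under the root in \<kappa> nonnegative.\<close>
  define M where "M = max M0 \<nu>"
  have M: "norm (contract A X) \<le> M * norm X" for X
    using M0[of X] mult_left_mono[of M0 M "norm X"] by (simp add: M_def mult.commute)
  have M\<nu>: "\<nu> \<le> M" "0 < M" using \<nu> by (auto simp: M_def)
  \<comment> \<open>The minimizer of 1 - 2 \<tau> \<nu> + \<tau>^2 M^2; the minimum is 1 - \<nu>^2 /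
    M^2, the square of \<kappa>.\<close>
  define \<tau> where "\<tau> = \<nu> / M^2"
  define \<kappa> where "\<kappa> = sqrt (1 - \<nu>^2 / M^2)"
  have "0 < \<nu>^2 / M^2" "\<nu>^2 / M^2 \<le> 1" using \<nu> M\<nu> by (auto simp: power_mono)
  then have \<kappa>: "0 \<le> \<kappa>" "\<kappa> < 1" "\<kappa>^2 = 1 - \<nu>^2 / M^2" by (auto simp: \<kappa>_def)
  \<comment> \<open>The solution map is chosen function by function and is not known to be linear.
    Differences of its values are handled inside the space instead, by
    \<open>W22_star_diff\<close>.\<close>
  have "\<forall>g. \<exists>u. g \<in> L2 lebesgue \<longrightarrow> u \<in> W22_star \<and> (AE x in lebesgue. hess_trace (weak_hessian (u :: real^'n \<Rightarrow> real^'N) x) = g x)"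
    by (rule W22_star_structure[OF n, where 'N='N]) blast
  from choice[OF this] obtain U :: "(real^'n \<Rightarrow> real^'N) \<Rightarrow> real^'n \<Rightarrow> real^'N"
    where U: "\<And>g. g \<in> L2 lebesgue \<Longrightarrow> U g \<in> W22_star" "\<And>g. g \<in> L2 lebesgue \<Longrightarrow> AE x in lebesgue. hess_trace (weak_hessian (U g) x) = g x"
    by blast
  define T where "T g x = contract A (weak_hessian (U g) x)" for g x
  have T: "T g \<in> L2 lebesgue" if "g \<in> L2 lebesgue" for g
    unfolding T_def[abs_def] by (rule L2_bounded_linear[OF contract_bounded_linear W22_starD(5)[OF U(1)[OF that]]])
  define \<Phi> where "\<Phi> g x = g x - \<tau> *\<^sub>R (T g x - f x)" for g x
  have \<Phi>: "\<Phi> g \<in> L2 lebesgue" if "g \<in> L2 lebesgue" for g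
    unfolding \<Phi>_def[abs_def] by (intro L2_diff L2_scaleR T f that)
  have con: "l2n lebesgue (\<lambda>x. \<Phi> g x - \<Phi> h x) \<le> \<kappa> * l2n lebesgue (\<lambda>x. g x - h x)"
    if g: "g \<in> L2 lebesgue" and h: "h \<in> L2 lebesgue" for g h
  proof -
    define w where "w x = U g x - U h x" for x
    have w: "w \<in> W22_star" "AE x in lebesgue. weak_hessian w x = weak_hessian (U g) x - weak_hessian (U h) x"
      using W22_star_diff[OF n U(1)[OF g] U(1)[OF h]] by (simp_all add: w_def[abs_def])
    define D where "D = weak_hessian w"
    have D: "D \<in> L2 lebesgue" unfolding D_def by (rule W22_starD(5)[OF w(1)])
    note AD = L2_bounded_linear[OF contract_bounded_linear D, of A] and trD = L2_bounded_linear[OF hess_trace_bounded_linear D]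
    have Dx: "AE x in lebesgue. hess_trace (D x) = g x - h x \<and> contract A (D x) = T g x - T h x"
      using w(2) U(2)[OF g] U(2)[OF h]
      by eventually_elim (auto simp: D_def T_def linear_diff[OF bounded_linear.linear[OF hess_trace_bounded_linear]] linear_diff[OF bounded_linear.linear[OF contract_bounded_linear]])
    have "AE x in lebesgue. norm (g x - h x) = norm (hess_trace (D x))" using Dx by eventually_elim simp
    from l2n_cong_AE[OF L2_meas[OF L2_diff[OF g h]] L2_meas[OF trD] this]
    have n1: "l2n lebesgue (\<lambda>x. g x - h x) = l2n lebesgue D" using W22_star_hessian(2)[OF n w(1)] by (simp add: D_def)
    have n2: "l2n lebesgue (\<lambda>x. \<Phi> g x - \<Phi> h x) = l2n lebesgue (\<lambda>x. hess_trace (D x) - \<tau> *\<^sub>R contract A (D x))"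
    proof (rule l2n_cong_AE[OF L2_meas[OF L2_diff[OF \<Phi>[OF g] \<Phi>[OF h]]] L2_meas[OF L2_diff[OF trD L2_scaleR[OF AD]]]])
      show "AE x in lebesgue. norm (\<Phi> g x - \<Phi> h x) = norm (hess_trace (D x) - \<tau> *\<^sub>R contract A (D x))"
        using Dx
      proof eventually_elim
        case (elim x)
        have "\<Phi> g x - \<Phi> h x = (g x - h x) - \<tau> *\<^sub>R (T g x - T h x)" by (simp add: \<Phi>_def scaleR_diff_right)
        then show ?case by (simp only: elim)
      qed
    qed
    have sq: "(norm (hess_trace (D x) - \<tau> *\<^sub>R contract A (D x)))^2 =
        (norm (hess_trace (D x)))^2 - 2 * \<tau> * (contract A (D x) \<bullet> hess_trace (D x)) + \<tau>^2 * (norm (contract A (D x)))^2" for x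
      unfolding power2_norm_eq_inner by (simp add: inner_diff inner_commute power2_eq_square algebra_simps)
    have "(l2n lebesgue (\<lambda>x. hess_trace (D x) - \<tau> *\<^sub>R contract A (D x)))^2 =
        (l2n lebesgue (\<lambda>x. hess_trace (D x)))^2 - 2 * \<tau> * (\<integral>x. contract A (D x) \<bullet> hess_trace (D x) \<partial>lebesgue) + \<tau>^2 * (l2n lebesgue (\<lambda>x. contract A (D x)))^2"
      unfolding l2n_sq sq using L2_int[OF trD] L2_int[OF AD] L2_mult_integrable(2)[OF AD trD] by simp
    also have "\<dots> \<le> (l2n lebesgue D)^2 - 2 * \<tau> * (\<nu> * (l2n lebesgue D)^2) + \<tau>^2 * (M * l2n lebesgue D)^2"
    proof (intro add_mono diff_mono mult_left_mono power_mono)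
      show "l2n lebesgue (\<lambda>x. hess_trace (D x)) \<le> l2n lebesgue D" using W22_star_hessian(2)[OF n w(1)] by (simp add: D_def)
      show "\<nu> * (l2n lebesgue D)^2 \<le> (\<integral>x. contract A (D x) \<bullet> hess_trace (D x) \<partial>lebesgue)"
        using W22_star_hessian(3)[OF n w(1), of A] by (simp add: D_def \<nu>_def)
      show "l2n lebesgue (\<lambda>x. contract A (D x)) \<le> M * l2n lebesgue D"
        using M\<nu> by (intro l2n_bounded_linear_le[OF contract_bounded_linear D M]) simp
    qed (use \<nu> M\<nu> l2n_nonneg in \<open>auto simp: \<tau>_def\<close>)
    also have "\<dots> = (\<kappa> * l2n lebesgue D)^2"
      using M\<nu>(2) by (simp add: \<kappa>(3) power_mult_distrib \<tau>_def field_simps) (simp add: power2_eq_square algebra_simps)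
    finally have "l2n lebesgue (\<lambda>x. hess_trace (D x) - \<tau> *\<^sub>R contract A (D x)) \<le> \<kappa> * l2n lebesgue D"
      by (rule power2_le_imp_le) (simp add: \<kappa> l2n_nonneg)
    then show ?thesis using n1 n2 by simp
  qed
  obtain g where g: "g \<in> L2 lebesgue" "AE x in lebesgue. \<Phi> g x = g x"
    using L2_fixed_point[of lebesgue \<Phi>, OF \<Phi> con \<kappa>(1,2)] by blast
  have "AE x in lebesgue. contract A (weak_hessian (U g) x) = f x"
    using g(2) by eventually_elim (use \<nu> M\<nu> in \<open>auto simp: \<Phi>_def \<tau>_def T_def\<close>)
  with U(1)[OF g(1)] show thesis by (rule that)
qed

section \<open>Carath\<eacute>odory maps and the nonlinear system\<close>

definition symmetrize :: "real^'n^'n^'N \<Rightarrow> real^'n^'n^'N" where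
  "symmetrize X = (\<chi> \<alpha> i j. (X $ \<alpha> $ i $ j + X $ \<alpha> $ j $ i) / 2)"

lemma symmetrize_sym_tensors: "symmetrize X \<in> sym_tensors" "X \<in> sym_tensors \<Longrightarrow> symmetrize X = X"
  by (auto simp: sym_tensors_def symmetrize_def vec_eq_iff)

lemma continuous_symmetrize: "continuous_on S symmetrize"
  unfolding symmetrize_def by (intro continuous_on_vec_lambda continuous_intros) auto

text \<open>For a simple function in the second argument the composition is a finite sum of
  measurable pieces, and continuity in X passes this to limits. F is constrained only at symmetric
  tensors, so the approximating values are symmetrized before being inserted; this is continuous and
  leaves the limit unchanged where V is symmetric.\<close>

lemma caratheodory_measurable:
  fixes F :: "real^'n \<Rightarrow> real^'n^'n^'N \<Rightarrow> real^'N"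
  assumes F: "caratheodory F" and V: "V \<in> borel_measurable lebesgue" "AE x in lebesgue. V x \<in> sym_tensors"
  shows "(\<lambda>x. F x (V x)) \<in> borel_measurable lebesgue"
proof -
  obtain s where s: "\<And>i. simple_function lebesgue (s i)" "\<And>x. (\<lambda>i. s i x) \<longlonglongrightarrow> V x"
    using borel_measurable_implies_sequence_metric[OF V(1), of 0] by auto
  have simple: "(\<lambda>x. F x (symmetrize (s i x))) \<in> borel_measurable lebesgue" for i
  proof -
    have fin: "finite (range (s i))" using simple_functionD(1)[OF s(1)[of i]] by simp
    have m: "(\<lambda>x. F x (symmetrize c)) \<in> borel_measurable lebesgue" for c
      using F symmetrize_sym_tensors(1) by (auto simp: caratheodory_def)
    have "s i -` {c} \<in> sets lebesgue" for c using simple_functionD(2)[OF s(1)[of i], of "{c}"] by simp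
    then have "(\<lambda>x. \<Sum>c\<in>range (s i). indicator (s i -` {c}) x *\<^sub>R F x (symmetrize c)) \<in> borel_measurable lebesgue"
      by (intro borel_measurable_sum borel_measurable_scaleR m borel_measurable_indicator)
    moreover have "(\<Sum>c\<in>range (s i). indicator (s i -` {c}) x *\<^sub>R F x (symmetrize c)) = F x (symmetrize (s i x))" for x
      using fin by (subst sum.remove[of _ "s i x"]) (auto intro!: sum.neutral simp: indicator_def)
    ultimately show ?thesis by simp
  qed
  have "AE x in lebesgue. (\<lambda>i. F x (symmetrize (s i x))) \<longlonglongrightarrow> F x (V x)"
    using V(2) F[unfolded caratheodory_def, THEN conjunct2]
  proof eventually_elim
    case (elim x)
    have "(\<lambda>i. symmetrize (s i x)) \<longlonglongrightarrow> symmetrize (V x)"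
      by (rule continuous_on_tendsto_compose[OF continuous_symmetrize[of UNIV] s(2)]) auto
    then have "(\<lambda>i. symmetrize (s i x)) \<longlonglongrightarrow> V x" using elim(1) by (simp add: symmetrize_sym_tensors)
    then show ?case
      using elim by (intro continuous_on_tendsto_compose[OF elim(2)]) (auto simp: symmetrize_sym_tensors)
  qed
  \<comment> \<open>Convergence holds off a null set only. Cutting this set out makes it hold
    everywhere, and completeness of Lebesgue measure restores the original function.\<close>
  then obtain N where N: "N \<in> null_sets lebesgue" "{x. \<not> (\<lambda>i. F x (symmetrize (s i x))) \<longlonglongrightarrow> F x (V x)} \<subseteq> N"
    by (auto simp: eventually_ae_filter)
  have "(\<lambda>x. indicator (- N) x *\<^sub>R F x (V x)) \<in> borel_measurable lebesgue"
  proof (rule borel_measurable_LIMSEQ_metric)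
    show "(\<lambda>x. indicator (- N) x *\<^sub>R F x (symmetrize (s i x))) \<in> borel_measurable lebesgue" for i
      using null_setsD2[OF N(1)] by (intro borel_measurable_scaleR simple borel_measurable_indicator) (simp add: Compl_in_sets_lebesgue)
    show "(\<lambda>i. indicator (- N) x *\<^sub>R F x (symmetrize (s i x))) \<longlonglongrightarrow> indicator (- N) x *\<^sub>R F x (V x)" for x
      using N(2) by (cases "x \<in> N") auto
  qed
  then show ?thesis
    by (rule borel_measurable_lebesgue_cong_AE) (use AE_not_in[OF N(1)] in \<open>auto elim: eventually_mono\<close>)
qed

text \<open>A countable dense set of symmetric tensors leaves only countably many exceptional sets.
  At the remaining points both sides are continuous in X and Z, so the inequality extends to all
  symmetric tensors simultaneously.\<close>

lemma K_condition_uniform: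
  fixes F :: "real^'n \<Rightarrow> real^'n^'n^'N \<Rightarrow> real^'N"
  assumes F: "caratheodory F"
    and K: "\<And>X Z. X \<in> sym_tensors \<Longrightarrow> Z \<in> sym_tensors \<Longrightarrow> AE x in lebesgue.
      (norm (contract A Z - \<alpha> x *\<^sub>R (F x (X + Z) - F x X)))^2 \<le> b * (norm Z)^2 + c * (norm (contract A Z))^2"
  shows "AE x in lebesgue. \<forall>X\<in>sym_tensors. \<forall>Z\<in>sym_tensors.
      (norm (contract A Z - \<alpha> x *\<^sub>R (F x (X + Z) - F x X)))^2 \<le> b * (norm Z)^2 + c * (norm (contract A Z))^2"
proof -
  obtain S :: "(real^'n^'n^'N) set" where S: "countable S" "S \<subseteq> sym_tensors" "sym_tensors \<subseteq> closure S"
    using separable[of "sym_tensors :: (real^'n^'n^'N) set"] by metis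
  have "AE x in lebesgue. \<forall>X\<in>S. \<forall>Z\<in>S. (norm (contract A Z - \<alpha> x *\<^sub>R (F x (X + Z) - F x X)))^2 \<le> b * (norm Z)^2 + c * (norm (contract A Z))^2"
    using S K by (simp add: AE_ball_countable subset_iff)
  moreover have "AE x in lebesgue. continuous_on sym_tensors (F x)" using F by (simp add: caratheodory_def)
  ultimately show ?thesis
  proof eventually_elim
    case (elim x)
    show ?case
    proof (intro ballI)
      fix X Z :: "real^'n^'n^'N" assume XZ: "X \<in> sym_tensors" "Z \<in> sym_tensors"
      have "X \<in> closure S" "Z \<in> closure S" using XZ S(3) by auto
      then obtain Y W where Y: "\<And>k. Y k \<in> S" "Y \<longlonglongrightarrow> X" and W: "\<And>k. W k \<in> S" "W \<longlonglongrightarrow> Z"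
        unfolding closure_sequential by blast
      have add: "X \<in> sym_tensors \<Longrightarrow> Z \<in> sym_tensors \<Longrightarrow> X + Z \<in> sym_tensors" for X Z :: "real^'n^'n^'N"
        by (simp add: sym_tensors_def)
      have F1: "(\<lambda>k. F x (Y k)) \<longlonglongrightarrow> F x X"
        by (rule continuous_on_tendsto_compose[OF elim(2) Y(2) XZ(1)]) (use Y(1) S(2) in \<open>auto intro!: always_eventually\<close>)
      have F2: "(\<lambda>k. F x (Y k + W k)) \<longlonglongrightarrow> F x (X + Z)"
        by (rule continuous_on_tendsto_compose[OF elim(2) tendsto_add[OF Y(2) W(2)] add[OF XZ]])
           (use Y(1) W(1) S(2) add in \<open>auto simp: subset_iff intro!: always_eventually\<close>)
      have AW: "(\<lambda>k. contract A (W k)) \<longlonglongrightarrow> contract A Z"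
        by (rule bounded_linear.tendsto[OF contract_bounded_linear W(2)])
      show "(norm (contract A Z - \<alpha> x *\<^sub>R (F x (X + Z) - F x X)))^2 \<le> b * (norm Z)^2 + c * (norm (contract A Z))^2"
      proof (rule LIMSEQ_le)
        show "(\<lambda>k. (norm (contract A (W k) - \<alpha> x *\<^sub>R (F x (Y k + W k) - F x (Y k))))^2) \<longlonglongrightarrow> (norm (contract A Z - \<alpha> x *\<^sub>R (F x (X + Z) - F x X)))^2"
          by (intro tendsto_intros AW F1 F2)
        show "(\<lambda>k. b * (norm (W k))^2 + c * (norm (contract A (W k)))^2) \<longlonglongrightarrow> b * (norm Z)^2 + c * (norm (contract A Z))^2"
          by (intro tendsto_intros AW W(2))
      qed (use elim(1) Y(1) W(1) in auto)
    qed
  qed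
qed

theorem theorem15:
  fixes F :: "real^'n \<Rightarrow> real^'n^'n^'N \<Rightarrow> real^'N"
  assumes "CARD('n) \<ge> 5" and "CARD('N) \<ge> 2"
    and "caratheodory F"
    and "K_condition UNIV F"
    and "AE x in lebesgue. F x 0 = 0"
  shows "\<exists>C>0.
    (\<forall>f\<in>Lp 2.
       \<exists>u\<in>W22_star. strong_solution F f u \<and>
         (\<forall>v\<in>W22_star. strong_solution F f v \<longrightarrow> (AE x in lebesgue. v x = u x)) \<and>
         Lp_norm (crit_exp2 CARD('n)) u + Lp_norm (crit_exp1 CARD('n)) (weak_gradient u)
           + Lp_norm 2 (weak_hessian u) \<le> C * Lp_norm 2 f) \<and>
    (\<forall>w\<in>W22_star. \<forall>v\<in>W22_star.
       W22_star_norm (\<lambda>x. w x - v x)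
         \<le> C * Lp_norm 2 (\<lambda>x. F x (weak_hessian w x) - F x (weak_hessian v x)))"
proof -
  note n = assms(1) and F = assms(3)
  obtain A :: "real^'n^'n^'N^'N" and a b c where A: "rank_one_positive A" and aL: "a \<in> Linf_on UNIV" "AE x in lebesgue. 0 < a x" "(\<lambda>x. 1 / a x) \<in> Linf_on UNIV"
    and bc: "0 < b" "0 < c" "b + c < 1"
    and K0: "\<And>X Z. X \<in> sym_tensors \<Longrightarrow> Z \<in> sym_tensors \<Longrightarrow> AE x in lebesgue.
      (norm (contract A Z - a x *\<^sub>R (F x (X + Z) - F x X)))^2 \<le> b * (ellipticity A)^2 * (norm Z)^2 + c * (norm (contract A Z))^2"
    using assms(4) unfolding K_condition_def lebesgue_on_UNIV_eq by blast
  have K: "AE x in lebesgue. \<forall>X\<in>sym_tensors. \<forall>Z\<in>sym_tensors.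
      (norm (contract A Z - a x *\<^sub>R (F x (X + Z) - F x X)))^2 \<le> b * (ellipticity A)^2 * (norm Z)^2 + c * (norm (contract A Z))^2"
    by (rule K_condition_uniform[OF F K0])
  define \<nu> where "\<nu> = ellipticity A"
  have \<nu>: "0 < \<nu>" using A by (simp add: rank_one_positive_def \<nu>_def)
  obtain Ma Mi where am: "a \<in> borel_measurable lebesgue" "(\<lambda>x. 1 / a x) \<in> borel_measurable lebesgue"
    and Ma0: "AE x in lebesgue. \<bar>a x\<bar> \<le> Ma" and Mi0: "AE x in lebesgue. \<bar>1 / a x\<bar> \<le> Mi"
    using aL unfolding Linf_on_def lebesgue_on_UNIV_eq by blast
  obtain C where C: "0 \<le> C" "\<And>u :: real^'n \<Rightarrow> real^'N. u \<in> W22_star \<Longrightarrow> W22_star_norm u \<le> C * l2n lebesgue (weak_hessian u)"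
    by (rule W22_star_structure[OF n, where 'N='N]) (rule that, auto)
  note sym = W22_star_hessian(1)[OF n] and coer = W22_star_coercive[OF n, of _ A, folded \<nu>_def]
  define \<kappa> where "\<kappa> = sqrt (b + c)"
  have \<kappa>: "0 \<le> \<kappa>" "\<kappa> < 1" "\<kappa>^2 = b + c" using bc by (auto simp: \<kappa>_def)
  define FH where "FH w x = F x (weak_hessian w x)" for w :: "real^'n \<Rightarrow> real^'N" and x
  define AH where "AH w x = contract A (weak_hessian w x)" for w :: "real^'n \<Rightarrow> real^'N" and x
  \<comment> \<open>The residual of nearness: how far the weighted nonlinear operator departs from
    the linear one on the pair w, v. The K-Condition with X = D^2 v and Z = D^2 w - D^2 v is a bound
    on it.\<close>
  define R where "R w v x = AH w x - AH v x - a x *\<^sub>R (FH w x - FH v x)" for w v x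
  have FHm: "FH w \<in> borel_measurable lebesgue" if "w \<in> W22_star" for w
    unfolding FH_def[abs_def] by (rule caratheodory_measurable[OF F L2_meas[OF W22_starD(5)[OF that]] sym[OF that]])
  have AHL: "AH w \<in> L2 lebesgue" if "w \<in> W22_star" for w
    unfolding AH_def[abs_def] by (rule L2_bounded_linear[OF contract_bounded_linear W22_starD(5)[OF that]])
  have nearness: "R w v \<in> L2 lebesgue" "l2n lebesgue (R w v) \<le> \<kappa> * l2n lebesgue (\<lambda>x. AH w x - AH v x)"
    "W22_star_norm (\<lambda>x. w x - v x) \<le> C / \<nu> * l2n lebesgue (\<lambda>x. AH w x - AH v x)"
    if w: "w \<in> W22_star" and v: "v \<in> W22_star" for w v
  proof -
    note d = W22_star_diff[OF n w v]
    define D where "D = weak_hessian (\<lambda>x. w x - v x)"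
    have D: "D \<in> L2 lebesgue" unfolding D_def by (rule W22_starD(5)[OF d(1)])
    note AD = L2_bounded_linear[OF contract_bounded_linear D, of A]
    have Dx: "AE x in lebesgue. contract A (D x) = AH w x - AH v x"
      using d(2) by eventually_elim (simp add: D_def AH_def linear_diff[OF bounded_linear.linear[OF contract_bounded_linear]])
    then have "AE x in lebesgue. norm (contract A (D x)) = norm (AH w x - AH v x)" by eventually_elim simp
    from l2n_cong_AE[OF L2_meas[OF AD] L2_meas[OF L2_diff[OF AHL[OF w] AHL[OF v]]] this]
    have AHn: "l2n lebesgue (\<lambda>x. contract A (D x)) = l2n lebesgue (\<lambda>x. AH w x - AH v x)" .
    have le: "AE x in lebesgue. (norm (R w v x))^2 \<le> b * \<nu>^2 * (norm (D x))^2 + c * (norm (contract A (D x)))^2"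
      using K d(2) Dx sym[OF v] sym[OF d(1)]
    proof eventually_elim
      case (elim x)
      have "weak_hessian v x + D x = weak_hessian w x" using elim(2) by (simp add: D_def)
      then show ?case using elim(1)[rule_format, OF elim(4), of "D x"] elim(3,5) by (simp add: R_def FH_def D_def \<nu>_def)
    qed
    have Rm: "R w v \<in> borel_measurable lebesgue"
      unfolding R_def[abs_def] by (intro borel_measurable_diff borel_measurable_scaleR am FHm w v L2_meas[OF AHL])
    have bi: "integrable lebesgue (\<lambda>x. b * \<nu>^2 * (norm (D x))^2 + c * (norm (contract A (D x)))^2)"
      using L2_int[OF D] L2_int[OF AD] by simp
    have Ri: "integrable lebesgue (\<lambda>x. (norm (R w v x))^2)"
    proof (rule Bochner_Integration.integrable_bound[OF bi])
      show "AE x in lebesgue. norm ((norm (R w v x))^2) \<le> norm (b * \<nu>^2 * (norm (D x))^2 + c * (norm (contract A (D x)))^2)"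
        using le by eventually_elim auto
    qed (use Rm in measurable)
    show "R w v \<in> L2 lebesgue" by (rule L2I[OF Rm Ri])
    have "(l2n lebesgue (R w v))^2 \<le> b * (\<nu> * l2n lebesgue D)^2 + c * (l2n lebesgue (\<lambda>x. contract A (D x)))^2"
      using integral_mono_AE[OF Ri bi le] L2_int[OF D] L2_int[OF AD] by (simp add: l2n_sq power_mult_distrib mult.assoc)
    \<comment> \<open>The coercive estimate enters here, at the level of norms: the term with the
      full Hessian has no pointwise bound by A : D^2, but its integral does.\<close>
    also have "\<dots> \<le> b * (l2n lebesgue (\<lambda>x. contract A (D x)))^2 + c * (l2n lebesgue (\<lambda>x. contract A (D x)))^2"
      using coer[OF d(1)] \<nu> bc by (intro add_right_mono mult_left_mono power_mono mult_nonneg_nonneg l2n_nonneg) (auto simp: D_def)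
    also have "\<dots> = (\<kappa> * l2n lebesgue (\<lambda>x. contract A (D x)))^2" by (simp add: power_mult_distrib \<kappa>(3) distrib_right)
    finally show "l2n lebesgue (R w v) \<le> \<kappa> * l2n lebesgue (\<lambda>x. AH w x - AH v x)"
      unfolding AHn by (rule power2_le_imp_le) (simp add: \<kappa> l2n_nonneg)
    have "W22_star_norm (\<lambda>x. w x - v x) \<le> C * l2n lebesgue D" using C(2)[OF d(1)] by (simp add: D_def)
    also have "\<dots> \<le> C * (l2n lebesgue (\<lambda>x. contract A (D x)) / \<nu>)"
      using coer[OF d(1)] \<nu> C(1) by (intro mult_left_mono) (simp_all add: field_simps D_def)
    finally show "W22_star_norm (\<lambda>x. w x - v x) \<le> C / \<nu> * l2n lebesgue (\<lambda>x. AH w x - AH v x)" by (simp add: AHn)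
  qed
  \<comment> \<open>Removing the residual from the linear difference leaves the weight times the
    difference of the F values, and the bound on the reciprocal of the weight recovers the
    latter.\<close>
  have FL: "(\<lambda>x. FH w x - FH v x) \<in> L2 lebesgue" if w: "w \<in> W22_star" and v: "v \<in> W22_star" for w v
  proof (rule L2_dominated[where C=Mi])
    show "(\<lambda>x. AH w x - AH v x - R w v x) \<in> L2 lebesgue" by (intro L2_diff AHL w v nearness)
    show "(\<lambda>x. FH w x - FH v x) \<in> borel_measurable lebesgue" by (intro borel_measurable_diff FHm w v)
    show "AE x in lebesgue. norm (FH w x - FH v x) \<le> Mi * norm (AH w x - AH v x - R w v x)"
      using aL(2) Mi0
    proof eventually_elim
      case (elim x)
      then have "norm (FH w x - FH v x) = \<bar>1 / a x\<bar> * norm (a x *\<^sub>R (FH w x - FH v x))" by simp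
      also have "\<dots> \<le> Mi * norm (a x *\<^sub>R (FH w x - FH v x))" using elim by (intro mult_right_mono) auto
      finally show ?case by (simp add: R_def)
    qed
  qed
  define M where "M = max Ma 0"
  have M: "0 \<le> M" "AE x in lebesgue. \<bar>a x\<bar> \<le> M" using Ma0 by (auto simp: M_def elim: eventually_mono)
  have aL2: "(\<lambda>x. a x *\<^sub>R g x) \<in> L2 lebesgue" "l2n lebesgue (\<lambda>x. a x *\<^sub>R g x) \<le> M * l2n lebesgue g" if g: "g \<in> L2 lebesgue" for g :: "real^'n \<Rightarrow> real^'N"
  proof -
    have le: "AE x in lebesgue. norm (a x *\<^sub>R g x) \<le> M * norm (g x)"
      using M(2) by eventually_elim (auto intro: mult_right_mono)
    show L: "(\<lambda>x. a x *\<^sub>R g x) \<in> L2 lebesgue"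
      by (rule L2_dominated[OF g _ le]) (intro borel_measurable_scaleR am L2_meas[OF g])
    have "l2n lebesgue (\<lambda>x. a x *\<^sub>R g x) \<le> l2n lebesgue (\<lambda>x. M *\<^sub>R g x)"
      by (rule l2n_mono_AE[OF L L2_scaleR[OF g]]) (use le M(1) in simp)
    then show "l2n lebesgue (\<lambda>x. a x *\<^sub>R g x) \<le> M * l2n lebesgue g" using M(1) by (simp add: l2n_scaleR)
  qed
  \<comment> \<open>The a priori constant C / \<nu> times the factor M / (1 - \<kappa>) from
    absorbing the residual; the summand 1 makes the result positive even if C or M is 0.\<close>
  define CC where "CC = C / \<nu> * (M / (1 - \<kappa>)) + 1"
  have CC: "0 < CC" using C(1) \<nu> M(1) \<kappa> by (simp add: CC_def add_nonneg_pos)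
  have est: "W22_star_norm (\<lambda>x. w x - v x) \<le> CC * l2n lebesgue (\<lambda>x. FH w x - FH v x)"
    if w: "w \<in> W22_star" and v: "v \<in> W22_star" for w v
  proof -
    let ?h = "l2n lebesgue (\<lambda>x. AH w x - AH v x)" and ?f = "l2n lebesgue (\<lambda>x. FH w x - FH v x)"
    have "?h = l2n lebesgue (\<lambda>x. R w v x + a x *\<^sub>R (FH w x - FH v x))" by (simp add: R_def)
    also have "\<dots> \<le> l2n lebesgue (R w v) + l2n lebesgue (\<lambda>x. a x *\<^sub>R (FH w x - FH v x))"
      by (intro l2n_triangle nearness aL2 FL w v)
    also have "\<dots> \<le> \<kappa> * ?h + M * ?f"
      by (intro add_mono nearness aL2 FL w v)
    \<comment> \<open>The residual contributes \<kappa> times the left-hand side and is absorbed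
      because \<kappa> < 1.\<close>
    finally have "?h \<le> M / (1 - \<kappa>) * ?f" using \<kappa>(2) by (simp add: field_simps)
    then have "C / \<nu> * ?h \<le> C / \<nu> * (M / (1 - \<kappa>) * ?f)" using C(1) \<nu> by (intro mult_left_mono) auto
    also have "\<dots> \<le> CC * ?f" using l2n_nonneg[of lebesgue "\<lambda>x. FH w x - FH v x"] by (simp add: CC_def distrib_right)
    finally show ?thesis using nearness(3)[OF w v] by linarith
  qed
  \<comment> \<open>The estimates control differences only. Comparison with the zero function, where
    F vanishes, turns them into statements about single elements: square integrability of F(x, D^2
    w) and the a priori bound.\<close>
  have zero: "(\<lambda>x. 0) \<in> (W22_star :: (real^'n \<Rightarrow> real^'N) set)" "AE x in lebesgue. weak_hessian (\<lambda>x :: real^'n. 0 :: real^'N) x = 0"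
  proof -
    have "has_weak_deriv js (\<lambda>x :: real^'n. 0) (\<lambda>x. 0)" for js
      by (simp add: has_weak_deriv_def L1_loc_def set_integrable_def)
    then have h: "has_weak_gradient (\<lambda>x :: real^'n. 0 :: real^'N) (\<lambda>x. 0)" "has_weak_hessian (\<lambda>x :: real^'n. 0 :: real^'N) (\<lambda>x. 0)"
      by (simp_all add: has_weak_gradient_def has_weak_hessian_def)
    show "(\<lambda>x. 0) \<in> (W22_star :: (real^'n \<Rightarrow> real^'N) set)"
      by (rule W22_starI[OF _ h(1) _ h(2)]) (simp_all add: Lp_def)
    show "AE x in lebesgue. weak_hessian (\<lambda>x :: real^'n. 0 :: real^'N) x = 0" by (rule weak_hessian_eq_AE(2)[OF h(2)])
  qed
  have F0: "AE x in lebesgue. FH (\<lambda>x. 0) x = 0" using zero(2) assms(5) by eventually_elim (simp add: FH_def)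
  have existence: "\<exists>u\<in>W22_star. AE x in lebesgue. FH u x = f x" if f: "f \<in> L2 lebesgue" for f
  proof -
    have "\<forall>h. \<exists>u. h \<in> L2 lebesgue \<longrightarrow> u \<in> W22_star \<and> (AE x in lebesgue. AH u x = h x)"
      using linear_system_solvable[OF n A] unfolding AH_def by metis
    from choice[OF this] obtain S where S: "\<And>h. h \<in> L2 lebesgue \<Longrightarrow> S h \<in> W22_star" "\<And>h. h \<in> L2 lebesgue \<Longrightarrow> AE x in lebesgue. AH (S h) x = h x" by blast
    \<comment> \<open>As A : D^2 (S h) = h, a difference of two values of this map is the residual
      \<open>R (S h) (S k)\<close>, so nearness is its contraction estimate. At a fixed point the
      weighted defect vanishes, and positivity of the weight gives the equation.\<close>
    define \<Phi> where "\<Phi> h x = h x - a x *\<^sub>R (FH (S h) x - f x)" for h x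
    have FHL: "FH w \<in> L2 lebesgue" if w: "w \<in> W22_star" for w
      by (rule L2_dominated[OF FL[OF w zero(1)] FHm[OF w], where C=1]) (use F0 in \<open>auto elim: eventually_mono\<close>)
    have \<Phi>: "\<Phi> h \<in> L2 lebesgue" if "h \<in> L2 lebesgue" for h
      unfolding \<Phi>_def[abs_def] by (intro L2_diff aL2 FHL S f that)
    have con: "l2n lebesgue (\<lambda>x. \<Phi> h x - \<Phi> k x) \<le> \<kappa> * l2n lebesgue (\<lambda>x. h x - k x)" if h: "h \<in> L2 lebesgue" and k: "k \<in> L2 lebesgue" for h k
    proof -
      have "AE x in lebesgue. norm (\<Phi> h x - \<Phi> k x) = norm (R (S h) (S k) x)"
        using S(2)[OF h] S(2)[OF k] by eventually_elim (simp add: \<Phi>_def R_def algebra_simps)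
      from l2n_cong_AE[OF L2_meas[OF L2_diff[OF \<Phi>[OF h] \<Phi>[OF k]]] L2_meas[OF nearness(1)[OF S(1)[OF h] S(1)[OF k]]] this]
      have 1: "l2n lebesgue (\<lambda>x. \<Phi> h x - \<Phi> k x) = l2n lebesgue (R (S h) (S k))" .
      have "AE x in lebesgue. norm (AH (S h) x - AH (S k) x) = norm (h x - k x)"
        using S(2)[OF h] S(2)[OF k] by eventually_elim simp
      from l2n_cong_AE[OF L2_meas[OF L2_diff[OF AHL[OF S(1)[OF h]] AHL[OF S(1)[OF k]]]] L2_meas[OF L2_diff[OF h k]] this]
      show ?thesis using 1 nearness(2)[OF S(1)[OF h] S(1)[OF k]] by simp
    qed
    obtain h where h: "h \<in> L2 lebesgue" "AE x in lebesgue. \<Phi> h x = h x"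
      using L2_fixed_point[of lebesgue \<Phi>, OF \<Phi> con \<kappa>(1,2)] by blast
    have "AE x in lebesgue. FH (S h) x = f x" using h(2) aL(2) by eventually_elim (simp add: \<Phi>_def)
    with S(1)[OF h(1)] show ?thesis by blast
  qed
  \<comment> \<open>Equal F values make the norm of the difference vanish; its summand with exponent
    \<open>crit_exp2\<close> alone already gives equality almost everywhere.\<close>
  have uniq: "AE x in lebesgue. v x = u x" if u: "u \<in> W22_star" and v: "v \<in> W22_star" and eq: "AE x in lebesgue. FH v x = FH u x" for u v
  proof -
    have "l2n lebesgue (\<lambda>x. FH v x - FH u x) = l2n lebesgue (\<lambda>x :: real^'n. 0 :: real^'N)"
      by (rule l2n_cong_AE[OF L2_meas[OF FL[OF v u]]]) (use eq in \<open>auto elim: eventually_mono\<close>)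
    then have "W22_star_norm (\<lambda>x. v x - u x) \<le> 0" using est[OF v u] by (simp add: l2n_def)
    moreover have "0 \<le> Lp_norm (crit_exp2 CARD('n)) (\<lambda>x. v x - u x)"
      "0 \<le> Lp_norm (crit_exp1 CARD('n)) (weak_gradient (\<lambda>x. v x - u x))" "0 \<le> Lp_norm 2 (weak_hessian (\<lambda>x. v x - u x))"
      by (simp_all add: Lp_norm_def)
    ultimately have "Lp_norm (crit_exp2 CARD('n)) (\<lambda>x. v x - u x) = 0"
      unfolding W22_star_norm_def by linarith
    then have "(\<integral>x. norm (v x - u x) powr crit_exp2 CARD('n) \<partial>lebesgue) = 0"
      using n by (simp add: Lp_norm_def crit_exp2_def)
    then have "AE x in lebesgue. norm (v x - u x) powr crit_exp2 CARD('n) = 0"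
      using integral_nonneg_eq_0_iff_AE[of lebesgue "\<lambda>x. norm (v x - u x) powr crit_exp2 CARD('n)"] W22_starD(1)[OF W22_star_diff(1)[OF n v u]]
      by (simp add: Lp_def)
    then show ?thesis by eventually_elim simp
  qed
  have sol: "strong_solution F f u \<longleftrightarrow> (AE x in lebesgue. FH u x = f x)" for f u
    by (simp add: strong_solution_def FH_def)
  have bound: "W22_star_norm u \<le> CC * l2n lebesgue f" if u: "u \<in> W22_star" and f: "f \<in> L2 lebesgue" "AE x in lebesgue. FH u x = f x" for u f
  proof -
    have "AE x in lebesgue. norm (FH u x - FH (\<lambda>x. 0) x) = norm (f x)" using f(2) F0 by eventually_elim simp
    from l2n_cong_AE[OF L2_meas[OF FL[OF u zero(1)]] L2_meas[OF f(1)] this] show ?thesis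
      using est[OF u zero(1)] by simp
  qed
  show ?thesis
    unfolding Lp_2_eq_L2 Lp_norm_2_eq_l2n sol W22_star_norm_def[symmetric] FH_def[symmetric]
  proof (intro exI[of _ CC] conjI ballI CC)
    fix f :: "real^'n \<Rightarrow> real^'N" assume f: "f \<in> L2 lebesgue"
    from existence[OF f] obtain u where u: "u \<in> W22_star" "AE x in lebesgue. FH u x = f x" by blast
    show "\<exists>u\<in>W22_star. (AE x in lebesgue. FH u x = f x) \<and> (\<forall>v\<in>W22_star. (AE x in lebesgue. FH v x = f x) \<longrightarrow> (AE x in lebesgue. v x = u x)) \<and>
        Lp_norm (crit_exp2 CARD('n)) u + Lp_norm (crit_exp1 CARD('n)) (weak_gradient u) + l2n lebesgue (weak_hessian u) \<le> CC * l2n lebesgue f"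
    proof (intro bexI[OF _ u(1)] conjI ballI impI u(2))
      fix v assume v: "v \<in> W22_star" "AE x in lebesgue. FH v x = f x"
      have "AE x in lebesgue. FH v x = FH u x" using v(2) u(2) by eventually_elim simp
      then show "AE x in lebesgue. v x = u x" by (rule uniq[OF u(1) v(1)])
    qed (use bound[OF u(1) f u(2)] in \<open>simp add: W22_star_norm_def Lp_norm_2_eq_l2n\<close>)
  qed (rule est)
qed

end
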